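(* Let $\Omega\subset\mathbb{R}$ be a compact interval of length at least $1$, let $T>0$ and $\rho_0\in K$. For every $N\in\mathbb{N}$, let $\varepsilon_N=1/N$ and let $\mu_N(0)\in\mathcal{P}_N(\mathbb{R})$ be such that, for some constant $C$ independent of $N$, $$\frac1{\varepsilon_N} W_2^2(\rho_0, \mu_N(0)) \leq C .$$ Let $X^N=(x_1^N,\dots,x_N^N)\in C^1([0,T];\mathbb{R}^{N})$ be a solution of $$\frac1N \dot X^N(t) = -\nabla E_{\varepsilon_N}\bigl(X^N(t)\bigr),\qquad X^N(0)=X^N_0,\quad \mu_{X^N_0}=\mu_N(0),$$ or, equivalently, of $$\dot x_i^N(t) = -V'\bigl(x_i^N(t)\bigr) + \frac1{\varepsilon_N}\bigl[\beta_i\bigl(X^N(t)\bigr)-x_i^N(t)\bigr]\quad (1\le i\le N),\qquad X^N(0)=X_0^N ,$$ and let $\mu_N:[0,T]\to\mathcal{P}_N(\mathbb{R})$, $\mu_N(t)=\mu_{X^N(t)}$, be the corresponding curve of measures. Then, as $N\to\infty$ and up to subsequences, $\mu_N\to\rho$ in $C^0\bigl([0,T];W_2(\mathbb{R})\bigr)$, where $\rho$ is a weak solution, with initial datum $\rho_0$, of $$\begin{cases}\partial_t\rho+\partial_x(\rho v)=0,\quad \rho\in K,\\ v=-\partial_x V-\partial_x p,\\ p\ge 0,\ p(1-\rho)=0.\end{cases}$$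
   Context: $V\in C^1(\mathbb{R})$ is bounded from below. $\mathcal{P}_{\rm ac}(\Omega)$ denotes the absolutely continuous probability measures on $\Omega$ (identified with their densities), and $K=\{\rho\in\mathcal{P}_{\rm ac}(\Omega):\rho\le 1\}$. $W_2$ is the quadratic Wasserstein distance, and $W_2(\mathbb{R})$ also denotes the space of probability measures on $\mathbb{R}$ with finite second moment, endowed with this distance. For $X=(x_1,\dots,x_N)\in\mathbb{R}^{N}$ let $\mu_X=\frac1N\sum_{i=1}^N\delta_{x_i}$, and let $\mathcal{P}_N(\mathbb{R})=\{\mu_X: X\in\mathbb{R}^{N}\}$. For $\varepsilon>0$ set $$E_\varepsilon(X)=\frac1N\sum_{i=1}^N V(x_i)+\frac1{2\varepsilon}\min_{\sigma\in K}W_2^2(\mu_X,\sigma).$$ The minimizer $\sigma\in K$ exists and is unique; it is called the projection of $\mu_X$ onto $K$. Let $T_X:\Omega\to\mathbb{R}$ be the ($\sigma$-a.e. unique) optimal transport map for the quadratic cost from $\sigma$ to $\mu_X$, let $L_i=T_X^{-1}(\{x_i\})$, and let $\beta_i(X)=\frac{\int_{L_i}x\,d\sigma(x)}{\sigma(L_i)}$ be the barycenter of $L_i$. The gradient of $E_\varepsilon$ is the Euclidean gradient on $\mathbb{R}^{N}$. Weak solution (with no-flux boundary conditions) with initial datum $\rho_0$: a curve $\rho\in C^0([0,T];W_2(\mathbb{R}))$ with $\rho(t)\in K$ for all $t$ and $\rho(0)=\rho_0$, for which there is $p\in L^2([0,T];H^1(\Omega))$ with $p\ge0$ and $p(1-\rho)=0$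 a.e. on $[0,T]\times\Omega$, such that for every $\zeta\in C^1_c([0,T)\times\mathbb{R})$, $$\int_0^T\int_\Omega\bigl(\partial_t\zeta-\partial_x\zeta\,(\partial_xV+\partial_x p)\bigr)\rho\,dx\,dt+\int_\Omega\zeta(0,x)\rho_0(x)\,dx=0.$$ *)

theory Defs
  imports "HOL-Probability.Probability"
begin

text \<open>
  Measures on \<open>\<real>\<close> are Borel measures of type \<^typ>\<open>real measure\<close>.
  The set \<open>W2_space\<close> is the underlying set of $W_2(\mathbb{R})$.
\<close>

definition W2_space :: "real measure set" where
  "W2_space = {\<mu>. prob_space \<mu> \<and> sets \<mu> = sets borel \<and> integrable \<mu> (\<lambda>x. x\<^sup>2)}"

definition couplings :: "real measure \<Rightarrow> real measure \<Rightarrow> (real \<times> real) measure set" where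
  "couplings \<mu> \<nu> = {\<pi>. sets \<pi> = sets borel \<and> distr \<pi> borel fst = \<mu> \<and> distr \<pi> borel snd = \<nu>}"

definition transport_cost :: "real measure \<Rightarrow> real measure \<Rightarrow> ennreal" where
  "transport_cost \<mu> \<nu> = (INF \<pi>\<in>couplings \<mu> \<nu>. \<integral>\<^sup>+ z. ennreal ((fst z - snd z)\<^sup>2) \<partial>\<pi>)"

text \<open>
  The cost is finite on \<open>W2_space\<close>, so the truncation in \<^const>\<open>enn2real\<close> is harmless there.
\<close>

definition W2 :: "real measure \<Rightarrow> real measure \<Rightarrow> real" where
  "W2 \<mu> \<nu> = sqrt (enn2real (transport_cost \<mu> \<nu>))"

definition C0_W2 :: "real \<Rightarrow> (real \<Rightarrow> real measure) \<Rightarrow> bool" where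
  "C0_W2 T \<rho> \<longleftrightarrow> (\<forall>t\<in>{0..T}. \<rho> t \<in> W2_space \<and>
     ((\<lambda>s. W2 (\<rho> s) (\<rho> t)) \<longlongrightarrow> 0) (at t within {0..T}))"

definition converges_C0_W2 :: "real \<Rightarrow> (nat \<Rightarrow> real \<Rightarrow> real measure) \<Rightarrow> (real \<Rightarrow> real measure) \<Rightarrow> bool" where
  "converges_C0_W2 T \<mu> \<rho> \<longleftrightarrow>
     (\<forall>e>0. \<forall>\<^sub>F n in sequentially. \<forall>t\<in>{0..T}. W2 (\<mu> n t) (\<rho> t) < e)"

definition P_ac :: "real set \<Rightarrow> real measure set" where
  "P_ac \<Omega> = {\<mu>. prob_space \<mu> \<and> sets \<mu> = sets borel \<and> emeasure \<mu> (- \<Omega>) = 0 \<and>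
     absolutely_continuous lborel \<mu>}"

definition K_set :: "real set \<Rightarrow> real measure set" where
  "K_set \<Omega> = {\<mu> \<in> P_ac \<Omega>. AE x in lborel. RN_deriv lborel \<mu> x \<le> 1}"

text \<open>
  Points of $\mathbb{R}^N$ are functions \<open>nat \<Rightarrow> real\<close> of which only the values at indices
  \<open>i < N\<close> matter, since \<open>N\<close> varies inside the statement. The uniform measure on the indices
  makes coinciding points count with multiplicity in \<open>empirical\<close>.
\<close>

definition empirical :: "nat \<Rightarrow> (nat \<Rightarrow> real) \<Rightarrow> real measure" where
  "empirical N X = distr (uniform_count_measure {..<N}) borel X"

definition P_emp :: "nat \<Rightarrow> real measure set" where
  "P_emp N = range (empirical N)"

text \<open>The infimum over \<open>K_set \<Omega>\<close> is attained.\<close>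

definition energy :: "real set \<Rightarrow> (real \<Rightarrow> real) \<Rightarrow> real \<Rightarrow> nat \<Rightarrow> (nat \<Rightarrow> real) \<Rightarrow> real" where
  "energy \<Omega> V \<epsilon> N X = (1 / real N) * (\<Sum>i<N. V (X i)) +
     (1 / (2 * \<epsilon>)) * (INF \<sigma>\<in>K_set \<Omega>. (W2 (empirical N X) \<sigma>)\<^sup>2)"

text \<open>Frechet differentiability on Euclidean $\mathbb{R}^N$ at \<open>X\<close>, with gradient \<open>g\<close>.\<close>

definition has_gradient :: "nat \<Rightarrow> ((nat \<Rightarrow> real) \<Rightarrow> real) \<Rightarrow> (nat \<Rightarrow> real) \<Rightarrow> (nat \<Rightarrow> real) \<Rightarrow> bool" where
  "has_gradient N F g X \<longleftrightarrow> (\<forall>e>0. \<exists>d>0. \<forall>Y.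
     L2_set (\<lambda>i. Y i - X i) {..<N} < d \<longrightarrow>
     \<bar>F Y - F X - (\<Sum>i<N. g i * (Y i - X i))\<bar> \<le> e * L2_set (\<lambda>i. Y i - X i) {..<N})"

definition is_projection :: "real set \<Rightarrow> real measure \<Rightarrow> real measure \<Rightarrow> bool" where
  "is_projection \<Omega> \<mu> \<sigma> \<longleftrightarrow> \<sigma> \<in> K_set \<Omega> \<and> (\<forall>\<tau>\<in>K_set \<Omega>. (W2 \<mu> \<sigma>)\<^sup>2 \<le> (W2 \<mu> \<tau>)\<^sup>2)"

definition is_optimal_map :: "real measure \<Rightarrow> real measure \<Rightarrow> (real \<Rightarrow> real) \<Rightarrow> bool" where
  "is_optimal_map \<sigma> \<mu> S \<longleftrightarrow> S \<in> borel_measurable borel \<and> distr \<sigma> borel S = \<mu> \<and>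
     (\<integral>\<^sup>+ x. ennreal ((x - S x)\<^sup>2) \<partial>\<sigma>) = transport_cost \<sigma> \<mu>"

text \<open>
  \<open>is_barycenters \<Omega> N X \<beta>\<close>: \<open>\<beta> i\<close> is the barycenter of the cell \<open>S -` {X i}\<close>. Since the
  projection \<open>\<sigma>\<close> exists and is unique and the optimal map \<open>S\<close> exists and is \<open>\<sigma>\<close>-a.e. unique,
  this determines \<open>\<beta> i\<close> for \<open>i < N\<close>. If \<open>X i = X j\<close>, both indices have the same cell.
\<close>

definition is_barycenters :: "real set \<Rightarrow> nat \<Rightarrow> (nat \<Rightarrow> real) \<Rightarrow> (nat \<Rightarrow> real) \<Rightarrow> bool" where
  "is_barycenters \<Omega> N X \<beta> \<longleftrightarrow> (\<exists>\<sigma> S.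
     is_projection \<Omega> (empirical N X) \<sigma> \<and> is_optimal_map \<sigma> (empirical N X) S \<and>
     (\<forall>i<N. \<beta> i = (LINT x:(S -` {X i} \<inter> \<Omega>)|\<sigma>. x) / measure \<sigma> (S -` {X i} \<inter> \<Omega>)))"

definition C1_curve :: "real \<Rightarrow> nat \<Rightarrow> (real \<Rightarrow> nat \<Rightarrow> real) \<Rightarrow> (real \<Rightarrow> nat \<Rightarrow> real) \<Rightarrow> bool" where
  "C1_curve T N X X' \<longleftrightarrow> (\<forall>i<N.
     (\<forall>t\<in>{0..T}. ((\<lambda>s. X s i) has_real_derivative X' t i) (at t within {0..T})) \<and>
     continuous_on {0..T} (\<lambda>t. X' t i))"

definition solves_gradient_flow ::
  "real set \<Rightarrow> (real \<Rightarrow> real) \<Rightarrow> real \<Rightarrow> real \<Rightarrow> nat \<Rightarrow> (real \<Rightarrow> nat \<Rightarrow> real) \<Rightarrow> (real \<Rightarrow> nat \<Rightarrow> real) \<Rightarrow> bool" where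
  "solves_gradient_flow \<Omega> V \<epsilon> T N X X' \<longleftrightarrow> (\<forall>t\<in>{0..T}. \<exists>g.
     has_gradient N (energy \<Omega> V \<epsilon> N) g (X t) \<and> (\<forall>i<N. (1 / real N) * X' t i = - g i))"

definition solves_barycenter_ode ::
  "real set \<Rightarrow> (real \<Rightarrow> real) \<Rightarrow> real \<Rightarrow> real \<Rightarrow> nat \<Rightarrow> (real \<Rightarrow> nat \<Rightarrow> real) \<Rightarrow> (real \<Rightarrow> nat \<Rightarrow> real) \<Rightarrow> bool" where
  "solves_barycenter_ode \<Omega> V \<epsilon> T N X X' \<longleftrightarrow> (\<forall>t\<in>{0..T}. \<exists>\<beta>.
     is_barycenters \<Omega> N (X t) \<beta> \<and>
     (\<forall>i<N. X' t i = - deriv V (X t i) + (1 / \<epsilon>) * (\<beta> i - X t i)))"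

text \<open>
  \<open>in_H1 \<Omega> u u'\<close>: \<open>u\<close> belongs to $H^1$ of the interior of the interval \<open>\<Omega>\<close>, with weak
  derivative \<open>u'\<close>. As usual in dimension one, the test functions are $C^1_c$.
\<close>

definition in_H1 :: "real set \<Rightarrow> (real \<Rightarrow> real) \<Rightarrow> (real \<Rightarrow> real) \<Rightarrow> bool" where
  "in_H1 \<Omega> u u' \<longleftrightarrow>
     set_borel_measurable lborel \<Omega> u \<and> set_integrable lborel \<Omega> (\<lambda>x. (u x)\<^sup>2) \<and>
     set_borel_measurable lborel \<Omega> u' \<and> set_integrable lborel \<Omega> (\<lambda>x. (u' x)\<^sup>2) \<and>
     (\<forall>\<phi>. \<phi> C1_differentiable_on UNIV \<longrightarrow>
        (\<exists>C. compact C \<and> C \<subseteq> interior \<Omega> \<and> (\<forall>x. x \<notin> C \<longrightarrow> \<phi> x = 0)) \<longrightarrow>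
        (LINT x:\<Omega>|lborel. u x * deriv \<phi> x) = - (LINT x:\<Omega>|lborel. u' x * \<phi> x))"

text \<open>
  \<open>in_L2_H1 T \<Omega> p q\<close>: \<open>p\<close> belongs to $L^2([0,T];H^1(\Omega))$, with weak space derivative \<open>q\<close>.
  As $H^1(\Omega)$ is separable, its elements are described by jointly measurable
  representatives \<open>p\<close>, \<open>q\<close> of the function and its derivative.
\<close>

definition in_L2_H1 :: "real \<Rightarrow> real set \<Rightarrow> (real \<times> real \<Rightarrow> real) \<Rightarrow> (real \<times> real \<Rightarrow> real) \<Rightarrow> bool" where
  "in_L2_H1 T \<Omega> p q \<longleftrightarrow>
     p \<in> borel_measurable borel \<and> q \<in> borel_measurable borel \<and>
     (AE t in lborel. t \<in> {0..T} \<longrightarrow> in_H1 \<Omega> (\<lambda>x. p (t, x)) (\<lambda>x. q (t, x))) \<and>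
     set_integrable lborel ({0..T} \<times> \<Omega>) (\<lambda>z. (p z)\<^sup>2 + (q z)\<^sup>2)"

text \<open>
  \<open>\<zeta> \<in>\<close> $C^1_c([0,T)\times\mathbb{R})$ with partial derivatives \<open>\<zeta>t\<close> and \<open>\<zeta>x\<close>; \<open>\<zeta>\<close> need not vanish
  at time \<open>0\<close>, where the time derivative is one-sided.
\<close>

definition C1c_test ::
  "real \<Rightarrow> (real \<times> real \<Rightarrow> real) \<Rightarrow> (real \<times> real \<Rightarrow> real) \<Rightarrow> (real \<times> real \<Rightarrow> real) \<Rightarrow> bool" where
  "C1c_test T \<zeta> \<zeta>t \<zeta>x \<longleftrightarrow>
     (\<forall>z\<in>{0..<T} \<times> UNIV. (\<zeta> has_derivative (\<lambda>h. \<zeta>t z * fst h + \<zeta>x z * snd h))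
        (at z within {0..<T} \<times> UNIV)) \<and>
     continuous_on ({0..<T} \<times> UNIV) \<zeta>t \<and> continuous_on ({0..<T} \<times> UNIV) \<zeta>x \<and>
     (\<exists>C. compact C \<and> C \<subseteq> {0..<T} \<times> UNIV \<and> (\<forall>z\<in>{0..<T} \<times> UNIV - C. \<zeta> z = 0))"

text \<open>
  \<open>r\<close> is a jointly measurable representative of the densities \<open>\<rho>(t,x)\<close>, so that
  \<open>p (1 - \<rho>) = 0\<close> can be required a.e. for two-dimensional Lebesgue measure: an arbitrary choice
  of the density of \<open>\<rho> t\<close> for each \<open>t\<close> need not be jointly measurable.
\<close>

definition weak_solution ::
  "real set \<Rightarrow> (real \<Rightarrow> real) \<Rightarrow> real \<Rightarrow> real measure \<Rightarrow> (real \<Rightarrow> real measure) \<Rightarrow> bool" where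
  "weak_solution \<Omega> V T \<rho>0 \<rho> \<longleftrightarrow>
     C0_W2 T \<rho> \<and> (\<forall>t\<in>{0..T}. \<rho> t \<in> K_set \<Omega>) \<and> \<rho> 0 = \<rho>0 \<and>
     (\<exists>r p q.
        r \<in> borel_measurable borel \<and> (\<forall>z. 0 \<le> r z) \<and>
        (AE t in lborel. t \<in> {0..T} \<longrightarrow> \<rho> t = density lborel (\<lambda>x. ennreal (r (t, x)))) \<and>
        in_L2_H1 T \<Omega> p q \<and>
        (AE z in lborel. z \<in> {0..T} \<times> \<Omega> \<longrightarrow> 0 \<le> p z \<and> p z * (1 - r z) = 0) \<and>
        (\<forall>\<zeta> \<zeta>t \<zeta>x. C1c_test T \<zeta> \<zeta>t \<zeta>x \<longrightarrow>
           (LINT t:{0..<T}|lborel. LINT x:\<Omega>|lborel.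
              (\<zeta>t (t, x) - \<zeta>x (t, x) * (deriv V x + q (t, x))) * r (t, x))
           + (LINT x:\<Omega>|\<rho>0. \<zeta> (0, x)) = 0))"

end

theory Submission
  imports Defs "HOL-Complex_Analysis.Great_Picard" "HOL-Real_Asymp.Real_Asymp"
begin

text \<open>
  The particle system is the gradient flow of $E_\varepsilon$, so its energy decreases. With
  $\varepsilon = 1/N$ and well prepared data this bounds, uniformly in $N$, both
  $N W_2^2(\mu_N(t),\sigma_N(t))$, where $\sigma_N(t) \in K$ is the projection of $\mu_N(t)$, and the action
  $\int_0^T \frac1N \sum_i |\dot x_i|^2 dt$ (lemma \<open>dissipation\<close>). Hence $\mu_N$ and $\sigma_N$ have the same
  limits, and the pressure gradient $N (x_i - \beta_i) = -\dot x_i - V'(x_i)$ is bounded in $L^2$.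
  
  On the line everything can be made explicit. The projection onto $K$ is a packing of disjoint blocks of
  density one, one block of length $m_i$ for every position $x_i$ of mass $m_i$, in the order of the
  positions. Its block positions are the nearest point to $x$ in a convex polyhedron, which is
  described by a variational inequality (locale \<open>packing\<close>). Out of the inequality one reads off an explicit
  \<open>pressure\<close>: it has slope $x_i - \beta_i$ on the block of $x_i$, is nonnegative, and vanishes in the gaps
  between blocks. This function is also the Kantorovich potential that certifies optimality of the
  packing (\<open>coupling_duality\<close>), and strict complementary slackness gives uniqueness of the projection and of the optimal map
  (\<open>optimal_coupling\<close>). So the barycenters are the centers of the blocks, and the gradient of the energy,
  where it exists, is the one of the barycenter equation (\<open>velocity_eq\<close>): the two forms of the system
  agree. Along the flow particles keep their order and their ties (\<open>flow_order\<close>), so that the number of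
  blocks and their masses are constant in time.
  
  The distribution functions of $\sigma_N$ are equicontinuous in time and 1-Lipschitz in space
  (\<open>Fc_time\<close>), so Arzela-Ascoli gives a uniformly convergent subsequence; the limit is again
  1-Lipschitz in space, i.e. the distribution function of some $\rho(t) \in K$, and uniform
  convergence of distribution functions on a bounded interval controls $W_2$ (\<open>transport_cost_cdf_le\<close>).
  
  The discrete pressure gradients, functions on $[0,T] \times [a-1,b]$ with $N$ times the pressure as their
  primitive, converge weakly in $L^2$ along the sequence to some $q$, in the one-sided sense of
  \<open>weak_L2_limit\<close>, which avoids a second extraction of a subsequence. The primitive $p$ of $q$ is the limit
  pressure. Nonnegativity is a weak limit of nonnegativity. The condition $p (1 - \rho) = 0$ survives because
  $\int p_N (1 - \sigma_N)$, after integration by parts, pairs the weakly convergent gradients with the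
  uniformly convergent distribution functions (\<open>f_slack_tendsto\<close>). Since $p$ has vanishing derivative
  almost everywhere on its zero set, $q \rho = q$; therefore the linear limit of the discrete equations, in
  which $q$ occurs without the factor $\rho$, is the weak equation.
\<close>

section \<open>Packing unit-density blocks into the interval\<close>

text \<open>
  The mass to the left of \<open>y\<close> of a block of unit density on \<open>[l, l + m]\<close>.
\<close>

definition ramp :: "real \<Rightarrow> real \<Rightarrow> real \<Rightarrow> real" where
  "ramp l m y = max 0 (min m (y - l))"

definition mass_left :: "nat set \<Rightarrow> (nat \<Rightarrow> real) \<Rightarrow> (nat \<Rightarrow> real) \<Rightarrow> nat \<Rightarrow> real" where
  "mass_left I m x i = (\<Sum>j\<in>{j\<in>I. x j < x i}. m j)"

text \<open>
  With \<open>l i\<close> the left end of the block of \<open>i\<close>, the quantity \<open>l i - mass_left I m x i\<close> is the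
  total length of the gaps to the left of that block, up to \<open>a\<close>. Blocks are disjoint, ordered like the \<open>x i\<close> and
  contained in \<open>[a, b]\<close> (for total mass one) exactly if, for distinct positions, this quantity is nondecreasing with values in
  \<open>[a, b - 1]\<close>.
\<close>

definition feasible :: "nat set \<Rightarrow> (nat \<Rightarrow> real) \<Rightarrow> (nat \<Rightarrow> real) \<Rightarrow> real \<Rightarrow> real \<Rightarrow> (nat \<Rightarrow> real) \<Rightarrow> bool" where
  "feasible I m x a b l \<longleftrightarrow>
     (\<forall>i\<in>I. a \<le> l i - mass_left I m x i \<and> l i - mass_left I m x i \<le> b - 1) \<and>
     (\<forall>i\<in>I. \<forall>j\<in>I. x i < x j \<longrightarrow> l i - mass_left I m x i \<le> l j - mass_left I m x j)"

text \<open>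
  \<open>VI\<close> is the variational inequality of the nearest point problem: among all feasible block positions, the
  centers \<open>l i + m i / 2\<close> are nearest to \<open>x\<close> in the Euclidean norm weighted by \<open>m\<close>.
\<close>

locale packing =
  fixes I :: "nat set" and m x :: "nat \<Rightarrow> real" and a b :: real and l :: "nat \<Rightarrow> real"
  assumes fin: "finite I" and inj: "inj_on x I" and mpos: "\<And>i. i \<in> I \<Longrightarrow> 0 < m i"
    and msum: "sum m I = 1" and feas: "feasible I m x a b l"
    and VI: "\<And>k. feasible I m x a b k \<Longrightarrow>
      (\<Sum>i\<in>I. m i * (x i - (l i + m i / 2)) * (k i - l i)) \<le> 0"

lemma continuous_on_proj: "continuous_on S (\<lambda>l::nat\<Rightarrow>real. l i)"
  by (intro continuous_on_product_coordinates[THEN continuous_on_subset]) auto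

text \<open>
  The feasible positions form a compact convex set; the inequality is the first order condition of a
  minimizer of the squared distance on it.
\<close>

lemma packing_exists:
  assumes fin: "finite I" and inj: "inj_on x I" and mpos: "\<And>i. i \<in> I \<Longrightarrow> 0 < m i"
    and msum: "sum m I = (1::real)" and ab: "b - a \<ge> 1"
  shows "\<exists>l. packing I m x a b l"
proof -
  let ?L = "mass_left I m x"
  define R where "R = (\<lambda>i. if i \<in> I then {a + ?L i .. b - 1 + ?L i} else {0::real})"
  define S where "S = {l\<in>PiE UNIV R. \<forall>i\<in>I. \<forall>j\<in>I. x i < x j \<longrightarrow> l i - ?L i \<le> l j - ?L j}"
  have "compactin (product_topology (\<lambda>i. euclidean) UNIV) (PiE UNIV R)"
    by (auto simp: compactin_PiE R_def)
  then have cPi: "compact (PiE UNIV R)"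
    by (simp add: euclidean_product_topology)
  have "S = PiE UNIV R \<inter> (\<Inter>i\<in>I. \<Inter>j\<in>I. {l. x i < x j \<longrightarrow> l i - ?L i \<le> l j - ?L j})"
    by (auto simp: S_def)
  moreover have "closed {l. x i < x j \<longrightarrow> l i - ?L i \<le> l j - ?L j}" for i j
    by (cases "x i < x j")
       (auto intro!: closed_Collect_le continuous_intros continuous_on_proj)
  ultimately have cS: "compact S"
    by (auto intro!: compact_Int_closed cPi closed_INT)
  have "(\<lambda>i. if i \<in> I then a + ?L i else 0) \<in> S"
    using ab by (auto simp: S_def R_def PiE_def)
  then have neS: "S \<noteq> {}" by auto
  have "continuous_on S (\<lambda>l. \<Sum>i\<in>I. m i * (x i - (l i + m i / 2))\<^sup>2)"
    by (intro continuous_intros continuous_on_proj)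
  then obtain l where l: "l \<in> S"
    and lmin: "\<And>k. k \<in> S \<Longrightarrow> (\<Sum>i\<in>I. m i * (x i - (l i + m i / 2))\<^sup>2) \<le> (\<Sum>i\<in>I. m i * (x i - (k i + m i / 2))\<^sup>2)"
    using continuous_attains_inf[OF cS neS] by blast
  have feas: "feasible I m x a b l"
  proof -
    have "l i \<in> R i" for i using l by (auto simp: S_def PiE_def Pi_def)
    then have "a + ?L i \<le> l i \<and> l i \<le> b - 1 + ?L i" if "i \<in> I" for i
      using that by (metis R_def atLeastAtMost_iff)
    moreover have "\<forall>i\<in>I. \<forall>j\<in>I. x i < x j \<longrightarrow> l i - ?L i \<le> l j - ?L j"
      using l by (auto simp: S_def)
    ultimately show ?thesis unfolding feasible_def by (auto simp: algebra_simps)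
  qed
  have "(\<Sum>i\<in>I. m i * (x i - (l i + m i / 2)) * (k i - l i)) \<le> 0" (is "?A \<le> 0")
    if k: "feasible I m x a b k" for k
  proof -
    define Q where "Q = (\<Sum>i\<in>I. m i * (k i - l i)\<^sup>2)"
    have key: "2 * ?A \<le> s * Q" if s: "0 < s" "s < 1" for s
    proof -
      define k' where "k' = (\<lambda>i. if i \<in> I then (1 - s) * l i + s * k i else 0)"
      have cv: "u \<le> (1 - s) * y + s * z" if "u \<le> y" "u \<le> z" for u y z :: real
        using convex_bound_le[of "-y" "-u" "-z" "1-s" s] that s by auto
      have cv2: "(1 - s) * y + s * z \<le> u" if "y \<le> u" "z \<le> u" for u y z :: real
        using convex_bound_le[of "y" "u" "z" "1-s" s] that s by auto
      have "k' \<in> S"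
        unfolding S_def
      proof (intro CollectI conjI ballI impI)
        show "k' \<in> PiE UNIV R"
        proof -
          have "a + ?L i \<le> (1 - s) * l i + s * k i" "(1 - s) * l i + s * k i \<le> b - 1 + ?L i" if "i \<in> I" for i
            using that k feas by (intro cv cv2; force simp: feasible_def)+
          then show ?thesis
            by (auto simp: PiE_def Pi_def R_def k'_def algebra_simps)
        qed
        fix i j assume ij: "i \<in> I" "j \<in> I" "x i < x j"
        have "(1 - s) * (l i - ?L i) + s * (k i - ?L i) \<le> (1 - s) * (l j - ?L j) + s * (k j - ?L j)"
          using ij k feas s by (intro add_mono mult_left_mono) (auto simp: feasible_def)
        then show "k' i - ?L i \<le> k' j - ?L j"
          using ij by (simp add: k'_def algebra_simps)
      qed
      from lmin[OF this] have "(\<Sum>i\<in>I. m i * (x i - (l i + m i / 2))\<^sup>2) \<le>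
          (\<Sum>i\<in>I. m i * (x i - ((1 - s) * l i + s * k i + m i / 2))\<^sup>2)"
        by (simp add: k'_def cong: sum.cong)
      also have "\<dots> = (\<Sum>i\<in>I. m i * (x i - (l i + m i / 2))\<^sup>2 - 2 * s * (m i * (x i - (l i + m i / 2)) * (k i - l i))
           + s\<^sup>2 * (m i * (k i - l i)\<^sup>2))"
        by (intro sum.cong refl) (simp add: power2_eq_square field_simps)
      also have "\<dots> = (\<Sum>i\<in>I. m i * (x i - (l i + m i / 2))\<^sup>2) - 2 * s * ?A + s\<^sup>2 * Q"
        by (simp add: sum.distrib sum_subtractf sum_distrib_left Q_def)
      finally have "s * (2 * ?A) \<le> s * (s * Q)"
        by (simp add: power2_eq_square algebra_simps)
      then show ?thesis using s by simp
    qed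
    have "((\<lambda>s. s * Q) \<longlongrightarrow> 0 * Q) (at_right 0)"
      by (intro tendsto_intros)
    moreover have "\<forall>\<^sub>F s in at_right 0. 2 * ?A \<le> s * Q"
      using eventually_at_right_real[of 0 1] by (rule eventually_mono) (use key in auto)
    ultimately have "2 * ?A \<le> 0 * Q"
      by (intro tendsto_lowerbound) auto
    then show ?thesis by simp
  qed
  then have "packing I m x a b l"
    by unfold_locales (use assms feas in auto)
  then show ?thesis by blast
qed

lemma nondecreasing_off_finite:
  fixes f f' :: "real \<Rightarrow> real"
  assumes E: "finite E" and uv: "u \<le> v" and cont: "continuous_on {u..v} f"
    and der: "\<And>y. u < y \<Longrightarrow> y < v \<Longrightarrow> y \<notin> E \<Longrightarrow> (f has_real_derivative f' y) (at y)"
    and nonneg: "\<And>y. u < y \<Longrightarrow> y < v \<Longrightarrow> y \<notin> E \<Longrightarrow> 0 \<le> f' y"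
  shows "f u \<le> f v"
proof -
  define g where "g = (\<lambda>y. if u < y \<and> y < v \<and> y \<notin> E then f' y else 0)"
  have "(g has_integral (f v - f u)) {u..v}"
    by (rule fundamental_theorem_of_calculus_interior_strong[OF E uv _ cont])
       (use der in \<open>auto simp: g_def has_real_derivative_iff_has_vector_derivative\<close>)
  then have "0 \<le> f v - f u"
    by (rule has_integral_nonneg) (use nonneg in \<open>auto simp: g_def\<close>)
  then show ?thesis by simp
qed

context packing
begin

abbreviation "L \<equiv> mass_left I m x"
abbreviation "\<beta> i \<equiv> l i + m i / 2"
abbreviation "d i \<equiv> x i - \<beta> i"

text \<open>
  Let \<open>U J\<close> be the integral of the slope \<open>d\<close> over the blocks of an initial segment \<open>J\<close>. The constant \<open>c\<close> is the
  smallest one that makes the piecewise linear function \<open>pressure\<close> nonnegative at all block ends. That it then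
  vanishes in every gap is a consequence of the variational inequality.
\<close>

definition initseg :: "nat set \<Rightarrow> bool" where
  "initseg J \<longleftrightarrow> J \<subseteq> I \<and> (\<forall>j\<in>J. \<forall>k\<in>I. x k \<le> x j \<longrightarrow> k \<in> J)"

definition U :: "nat set \<Rightarrow> real" where "U J = (\<Sum>j\<in>J. m j * d j)"

definition c :: real where "c = Max ((\<lambda>J. - U J) ` {J. initseg J})"

definition pressure :: "real \<Rightarrow> real" where
  "pressure y = c + (\<Sum>i\<in>I. d i * ramp (l i) (m i) y)"

text \<open>
  A parabola over the block of \<open>j\<close> that vanishes at its ends. Added to twice the pressure it changes the slope
  \<open>2 * (x j - \<beta> j)\<close> on the block to \<open>2 * (x j - y)\<close>, which is the slope a Kantorovich potential for
  \<open>(x j - y)\<^sup>2\<close> must have there; and it makes the potential strictly positive inside the blocks.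
\<close>

definition bump :: "nat \<Rightarrow> real \<Rightarrow> real" where
  "bump j y = max 0 ((y - l j) * (l j + m j - y))"

text \<open>
  The function whose minimum over \<open>y\<close> is the dual variable of the atom \<open>x i\<close>. On the block of \<open>j\<close> it has
  slope \<open>2 * (x j - x i)\<close>, in a gap \<open>2 * (y - x i)\<close>; so it is constant on the block of \<open>i\<close> and grows away from it.
\<close>

definition cert :: "nat \<Rightarrow> real \<Rightarrow> real" where
  "cert i y = (x i - y)\<^sup>2 + (2 * pressure y + (\<Sum>j\<in>I. bump j y))"

definition E :: "real set" where "E = l ` I \<union> (\<lambda>i. l i + m i) ` I"

lemma finE: "finite E" by (simp add: E_def fin)

lemma finite_initsegs: "finite {J. initseg J}"
  by (rule finite_subset[of _ "Pow I"]) (auto simp: initseg_def fin)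

lemma initseg_finite: "initseg J \<Longrightarrow> finite J"
  unfolding initseg_def using fin finite_subset by blast

lemma c_ge: "initseg J \<Longrightarrow> 0 \<le> c + U J"
proof -
  assume "initseg J"
  then have "- U J \<le> c" unfolding c_def by (intro Max_ge) (auto simp: finite_initsegs)
  then show ?thesis by simp
qed

lemma initseg_empty: "initseg {}" by (simp add: initseg_def)

lemma c_witness: "\<exists>J. initseg J \<and> c = - U J"
proof -
  have "c \<in> (\<lambda>J. - U J) ` {J. initseg J}"
    unfolding c_def by (intro Max_in) (use finite_initsegs initseg_empty in auto)
  then show ?thesis by auto
qed

lemma mass_left_nonneg: "0 \<le> L i"
  unfolding mass_left_def by (intro sum_nonneg) (auto intro: less_imp_le mpos)

lemma mass_left_step: assumes "i \<in> I" "j \<in> I" "x i < x j" shows "L i + m i \<le> L j"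
proof -
  have "L i + m i = (\<Sum>k\<in>insert i {k\<in>I. x k < x i}. m k)"
    by (simp add: mass_left_def fin)
  also have "\<dots> \<le> L j" unfolding mass_left_def
    using assms by (intro sum_mono2) (auto simp: fin intro: less_imp_le mpos)
  finally show ?thesis .
qed

lemma mass_left_le: assumes "i \<in> I" shows "L i + m i \<le> 1"
proof -
  have "L i + m i = (\<Sum>k\<in>insert i {k\<in>I. x k < x i}. m k)"
    by (simp add: mass_left_def fin)
  also have "\<dots> \<le> sum m I"
    using assms by (intro sum_mono2) (auto simp: fin intro: less_imp_le mpos)
  finally show ?thesis by (simp add: msum)
qed

lemma gamma_bounds: "i \<in> I \<Longrightarrow> a \<le> l i - L i \<and> l i - L i \<le> b - 1"
  using feas by (auto simp: feasible_def)

lemma gamma_mono: "i \<in> I \<Longrightarrow> j \<in> I \<Longrightarrow> x i \<le> x j \<Longrightarrow> l i - L i \<le> l j - L j"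
  using feas inj by (cases "x i = x j") (auto simp: feasible_def inj_on_def)

lemma cell_order: assumes "i \<in> I" "j \<in> I" "x i < x j" shows "l i + m i \<le> l j"
  using mass_left_step[OF assms] gamma_mono[of i j] assms by auto

lemma cell_bounds: assumes "i \<in> I" shows "a \<le> l i" "l i + m i \<le> b"
  using gamma_bounds[OF assms] mass_left_nonneg[of i] mass_left_le[OF assms] by auto

lemma cells_disjoint:
  assumes "i \<in> I" "j \<in> I" "l i < y" "y < l i + m i" "l j < y" "y < l j + m j" shows "i = j"
  using cell_order[of i j] cell_order[of j i] assms inj
  by (cases "x i" "x j" rule: linorder_cases) (auto simp: inj_on_def)

lemma initseg_nested: "initseg J \<Longrightarrow> initseg B \<Longrightarrow> J \<subseteq> B \<or> B \<subseteq> J"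
  unfolding initseg_def by (meson linear subsetD subsetI)

text \<open>
  The variational inequality in terms of admissible shifts \<open>\<delta>\<close> of the blocks.
\<close>

lemma feasible_shift:
  assumes "\<And>i. i \<in> I \<Longrightarrow> a \<le> l i - L i + \<delta> i \<and> l i - L i + \<delta> i \<le> b - 1"
    and "\<And>i j. i \<in> I \<Longrightarrow> j \<in> I \<Longrightarrow> x i < x j \<Longrightarrow> l i - L i + \<delta> i \<le> l j - L j + \<delta> j"
  shows "(\<Sum>i\<in>I. m i * d i * \<delta> i) \<le> 0"
proof -
  have "feasible I m x a b (\<lambda>i. l i + \<delta> i)"
    using assms unfolding feasible_def by (simp add: algebra_simps)
  from VI[OF this] show ?thesis by simp
qed

text \<open>
  If the blocks of \<open>B\<close> are separated from the others by a gap, all blocks of \<open>B - J\<close> can be moved a little to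
  the right, or those of \<open>J - B\<close> a little to the left, without violating feasibility. The
  variational inequality for this shift compares \<open>U B\<close> with \<open>U J\<close>.
\<close>

lemma U_minimal_at_gap:
  assumes B: "initseg B" and J: "initseg J"
    and lt: "\<And>k. k \<in> B \<Longrightarrow> l k - L k < g" and gt: "\<And>k. k \<in> I - B \<Longrightarrow> g < l k - L k"
    and g: "a \<le> g" "g \<le> b - 1"
  shows "U B \<le> U J"
proof -
  \<comment> \<open>The shift must not exceed the distance to the other blocks; the element 1 keeps the set nonempty.\<close>
  define D where "D = (\<lambda>k. \<bar>l k - L k - g\<bar>) ` I \<union> {1}"
  define \<tau> where "\<tau> = Min D"
  have finD: "finite D" and neD: "D \<noteq> {}" by (auto simp: D_def fin)
  have \<tau>pos: "0 < \<tau>"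
    unfolding \<tau>_def using finD neD lt gt
    by (subst Min_gr_iff) (force simp: D_def)+
  have \<tau>le: "\<tau> \<le> \<bar>l k - L k - g\<bar>" if "k \<in> I" for k
    unfolding \<tau>_def using that finD by (intro Min_le) (auto simp: D_def)
  have BI: "B \<subseteq> I" and JI: "J \<subseteq> I" using B J by (auto simp: initseg_def)
  have \<tau>lt: "l k - L k + \<tau> \<le> g" if "k \<in> B" for k using \<tau>le[of k] lt[OF that] that BI by auto
  have \<tau>gt: "g \<le> l k - L k - \<tau>" if "k \<in> I - B" for k using \<tau>le[of k] gt[OF that] that by auto
  consider "J \<subseteq> B" | "B \<subseteq> J" using initseg_nested[OF J B] by auto
  then show ?thesis
  proof cases
    case 1
    define \<delta> where "\<delta> = (\<lambda>i. if i \<in> B - J then \<tau> else 0)"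
    have "(\<Sum>i\<in>I. m i * d i * \<delta> i) \<le> 0"
    proof (rule feasible_shift)
      fix i assume i: "i \<in> I"
      show "a \<le> l i - L i + \<delta> i \<and> l i - L i + \<delta> i \<le> b - 1"
        using gamma_bounds[OF i] \<tau>lt[of i] \<tau>pos g by (auto simp: \<delta>_def)
    next
      fix i j assume ij: "i \<in> I" "j \<in> I" "x i < x j"
      have "i \<in> B" if "j \<in> B" using that ij B by (auto simp: initseg_def)
      moreover have "i \<in> J" if "j \<in> J" using that ij J by (auto simp: initseg_def)
      ultimately show "l i - L i + \<delta> i \<le> l j - L j + \<delta> j"
        using gamma_mono[of i j] ij \<tau>lt[of i] gt[of j] \<tau>pos by (auto simp: \<delta>_def)
    qed
    also have "(\<Sum>i\<in>I. m i * d i * \<delta> i) = \<tau> * (\<Sum>i\<in>B - J. m i * d i)"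
    proof -
      have "(\<Sum>i\<in>I. m i * d i * \<delta> i) = (\<Sum>i\<in>I. if i \<in> B - J then \<tau> * (m i * d i) else 0)"
        by (intro sum.cong) (auto simp: \<delta>_def)
      also have "\<dots> = (\<Sum>i\<in>B - J. \<tau> * (m i * d i))"
        using BI fin by (subst sum.inter_restrict[symmetric]) (auto intro!: sum.cong)
      finally show ?thesis by (simp add: sum_distrib_left)
    qed
    finally have "(\<Sum>i\<in>B - J. m i * d i) \<le> 0" using \<tau>pos by (simp add: mult_le_0_iff)
    then show ?thesis
      using 1 initseg_finite[OF B] by (simp add: U_def sum_diff)
  next
    case 2
    define \<delta> where "\<delta> = (\<lambda>i. if i \<in> J - B then - \<tau> else 0)"
    have "(\<Sum>i\<in>I. m i * d i * \<delta> i) \<le> 0"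
    proof (rule feasible_shift)
      fix i assume i: "i \<in> I"
      show "a \<le> l i - L i + \<delta> i \<and> l i - L i + \<delta> i \<le> b - 1"
        using gamma_bounds[OF i] \<tau>gt[of i] i \<tau>pos g by (auto simp: \<delta>_def)
    next
      fix i j assume ij: "i \<in> I" "j \<in> I" "x i < x j"
      have "i \<in> B" if "j \<in> B" using that ij B by (auto simp: initseg_def)
      moreover have "i \<in> J" if "j \<in> J" using that ij J by (auto simp: initseg_def)
      ultimately show "l i - L i + \<delta> i \<le> l j - L j + \<delta> j"
        using gamma_mono[of i j] ij \<tau>gt[of j] lt[of i] \<tau>pos by (auto simp: \<delta>_def)
    qed
    also have "(\<Sum>i\<in>I. m i * d i * \<delta> i) = - \<tau> * (\<Sum>i\<in>J - B. m i * d i)"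
    proof -
      have "(\<Sum>i\<in>I. m i * d i * \<delta> i) = (\<Sum>i\<in>I. if i \<in> J - B then - \<tau> * (m i * d i) else 0)"
        by (intro sum.cong) (auto simp: \<delta>_def)
      also have "\<dots> = (\<Sum>i\<in>J - B. - \<tau> * (m i * d i))"
        using JI fin by (subst sum.inter_restrict[symmetric]) (auto intro!: sum.cong)
      finally show ?thesis by (simp add: sum_distrib_left)
    qed
    finally have "0 \<le> (\<Sum>i\<in>J - B. m i * d i)" using \<tau>pos by (simp add: zero_le_mult_iff)
    then show ?thesis
      using 2 initseg_finite[OF J] by (simp add: U_def sum_diff)
  qed
qed

definition gap :: "real \<Rightarrow> bool" where
  "gap y \<longleftrightarrow> a \<le> y \<and> y \<le> b \<and> (\<forall>i\<in>I. y < l i \<or> l i + m i < y)"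

text \<open>
  The separating value for \<open>U_minimal_at_gap\<close> is the gap point \<open>y\<close> minus the mass to its left.
\<close>

lemma gap_U_minimal:
  assumes y: "gap y" and J: "initseg J"
  shows "initseg {i\<in>I. l i + m i < y}" and "U {i\<in>I. l i + m i < y} \<le> U J"
proof -
  define B where "B = {i\<in>I. l i + m i < y}"
  have y': "i \<in> I - B \<Longrightarrow> y < l i" for i using y by (auto simp: gap_def B_def)
  have ineB: "initseg B"
    unfolding initseg_def
  proof (intro conjI ballI impI)
    fix j k assume "j \<in> B" "k \<in> I" "x k \<le> x j"
    then show "k \<in> B"
      using cell_order[of k j] inj mpos[of j] by (cases "x k = x j") (auto simp: B_def inj_on_def)
  qed (auto simp: B_def)
  have finB: "finite B" by (simp add: B_def fin)
  define g where "g = y - sum m B"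
  have lt: "l k - L k < g" if k: "k \<in> B" for k
  proof -
    have "Max (x ` B) \<in> x ` B" using finB k by (intro Max_in) auto
    then obtain k0 where k0: "k0 \<in> B" and k0max: "x k0 = Max (x ` B)" by auto
    have le: "x j \<le> x k0" if "j \<in> B" for j using that finB unfolding k0max by simp
    have "B = insert k0 {j\<in>I. x j < x k0}"
    proof (intro equalityI subsetI)
      fix j assume "j \<in> B"
      then show "j \<in> insert k0 {j\<in>I. x j < x k0}"
        using le[of j] k0 inj_onD[OF inj, of j k0] by (auto simp: B_def)
    next
      fix j assume "j \<in> insert k0 {j\<in>I. x j < x k0}"
      then have "j \<in> I" "x j \<le> x k0" using k0 by (auto simp: B_def)
      then show "j \<in> B" using ineB k0 unfolding initseg_def by blast
    qed
    then have "sum m B = m k0 + L k0"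
      by (metis (no_types, lifting) finB finite_insert less_irrefl mass_left_def mem_Collect_eq sum.insert)
    then show ?thesis
      using gamma_mono[of k k0] le[OF k] k k0 by (auto simp: g_def B_def)
  qed
  have gt: "g < l k - L k" if k: "k \<in> I - B" for k
  proof -
    have finC: "finite (I - B)" using fin by simp
    have "Min (x ` (I - B)) \<in> x ` (I - B)" using finC k by (intro Min_in) auto
    then obtain k0 where k0: "k0 \<in> I - B" and k0min: "x k0 = Min (x ` (I - B))" by auto
    have le: "x k0 \<le> x j" if "j \<in> I - B" for j using that finC unfolding k0min by simp
    have "B = {j\<in>I. x j < x k0}"
    proof (intro equalityI subsetI)
      fix j assume j: "j \<in> B"
      show "j \<in> {j\<in>I. x j < x k0}"
      proof -
        have "j \<in> I" "\<not> x k0 \<le> x j" using j ineB k0 unfolding initseg_def by blast+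
        then show ?thesis by simp
      qed
    next
      fix j assume "j \<in> {j\<in>I. x j < x k0}"
      then show "j \<in> B" using le[of j] by force
    qed
    then have "sum m B = L k0"
      by (simp add: mass_left_def)
    then show ?thesis
      using gamma_mono[of k0 k] le[OF k] k k0 y'[of k0] by (auto simp: g_def)
  qed
  have ga: "a \<le> g"
  proof (cases "B = {}")
    case True then show ?thesis using y by (simp add: g_def gap_def)
  next
    case False
    then obtain k where "k \<in> B" by auto
    then show ?thesis using lt[of k] gamma_bounds[of k] by (auto simp: B_def)
  qed
  have gb: "g \<le> b - 1"
  proof (cases "I - B = {}")
    case True
    then have "B = I" by (auto simp: B_def)
    then show ?thesis using y by (simp add: g_def gap_def msum)
  next
    case False
    then obtain k where "k \<in> I - B" by auto
    then show ?thesis using gt[of k] gamma_bounds[of k] by auto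
  qed
  show "initseg {i\<in>I. l i + m i < y}" using ineB by (simp add: B_def)
  show "U {i\<in>I. l i + m i < y} \<le> U J"
    using U_minimal_at_gap[OF ineB J lt gt ga gb] by (simp add: B_def)
qed

text \<open>
  Otherwise \<open>x i\<close> would pull its block to the right, into the gap: \<open>U\<close> of the blocks left of \<open>x i\<close> would be
  smaller than \<open>U\<close> of the blocks left of the gap, contrary to \<open>gap_U_minimal\<close>.
\<close>

lemma gap_right:
  assumes y: "gap y" and i: "i \<in> I" "l i + m i < y"
  shows "x i \<le> y"
proof (rule ccontr)
  assume n: "\<not> x i \<le> y"
  let ?B = "{i\<in>I. l i + m i < y}"
  let ?J = "{j\<in>I. x j < x i}"
  have J: "initseg ?J" by (auto simp: initseg_def)
  have JB: "?J \<subseteq> ?B"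
  proof
    fix j assume "j \<in> ?J"
    then show "j \<in> ?B" using cell_order[of j i] i mpos[of i] by auto
  qed
  have e: "U ?B - U ?J = (\<Sum>j\<in>?B - ?J. m j * d j)"
    unfolding U_def using JB fin by (subst sum_diff) auto
  have p: "0 < (\<Sum>j\<in>?B - ?J. m j * d j)"
  proof (rule sum_pos)
    fix j assume j: "j \<in> ?B - ?J"
    then have "0 < m j" "d j > 0" using n mpos[of j] by auto
    then show "0 < m j * d j" by simp
  next
    show "finite (?B - ?J)" using fin by simp
    have "i \<in> ?B - ?J" using i by simp
    then show "?B - ?J \<noteq> {}" by blast
  qed
  have q: "U ?B \<le> U ?J" by (rule gap_U_minimal(2)[OF y J])
  have False if "u - v = (w::real)" "0 < w" "u \<le> v" for u v w using that by simp
  from this[OF e p q] show False .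
qed

lemma gap_left:
  assumes y: "gap y" and i: "i \<in> I" "y < l i"
  shows "y \<le> x i"
proof (rule ccontr)
  assume n: "\<not> y \<le> x i"
  let ?B = "{i\<in>I. l i + m i < y}"
  let ?J = "{j\<in>I. x j \<le> x i}"
  have J: "initseg ?J" by (auto simp: initseg_def)
  have BJ: "?B \<subseteq> ?J"
  proof
    fix j assume j: "j \<in> ?B"
    then have "\<not> x i < x j" using cell_order[of i j] i mpos[of j] mpos[of i] by auto
    then show "j \<in> ?J" using j by auto
  qed
  have e: "U ?J - U ?B = (\<Sum>j\<in>?J - ?B. m j * d j)"
    unfolding U_def using BJ fin by (subst sum_diff) auto
  have p: "(\<Sum>j\<in>?J - ?B. m j * d j) < (\<Sum>j\<in>?J - ?B. 0)"
  proof (rule sum_strict_mono)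
    fix j assume j: "j \<in> ?J - ?B"
    then have "0 < m j" "d j < 0" using n mpos[of j] y by (auto simp: gap_def)
    then show "m j * d j < 0" by (simp add: mult_pos_neg)
  next
    show "finite (?J - ?B)" using fin by simp
    have "i \<in> ?J - ?B" using i mpos[of i] by simp
    then show "?J - ?B \<noteq> {}" by blast
  qed
  have q: "U ?B \<le> U ?J" by (rule gap_U_minimal(2)[OF y J])
  have False if "v - u = (w::real)" "w < z" "z = 0" "u \<le> v" for u v w z using that by simp
  from this[OF e p sum.neutral_const q] show False .
qed

lemma ramp_sum_gap:
  assumes y: "gap y"
  shows "(\<Sum>i\<in>I. d i * ramp (l i) (m i) y) = U {i\<in>I. l i + m i < y}"
proof -
  have "(\<Sum>i\<in>I. d i * ramp (l i) (m i) y) = (\<Sum>i\<in>I. if l i + m i < y then m i * d i else 0)"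
  proof (intro sum.cong refl)
    fix i assume i: "i \<in> I"
    have "0 < m i" "y < l i \<or> l i + m i < y" using i y mpos by (auto simp: gap_def)
    then show "d i * ramp (l i) (m i) y = (if l i + m i < y then m i * d i else 0)"
      by (auto simp: ramp_def)
  qed
  also have "\<dots> = U {i\<in>I. l i + m i < y}" unfolding U_def by (rule sum.inter_filter[symmetric, OF fin])
  finally show ?thesis .
qed

text \<open>
  In a gap the pressure is \<open>c + U B\<close> for the blocks \<open>B\<close> to the left, and \<open>U B\<close> is the minimum of \<open>U\<close>.
\<close>

lemma pressure_gap: "gap y \<Longrightarrow> pressure y = 0"
proof -
  assume y: "gap y"
  let ?B = "{i\<in>I. l i + m i < y}"
  obtain J where J: "initseg J" "c = - U J" using c_witness by auto
  have "pressure y = c + U ?B" by (simp add: pressure_def ramp_sum_gap[OF y])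
  moreover have "0 \<le> c + U ?B" using c_ge gap_U_minimal(1)[OF y J(1)] by blast
  moreover have "c + U ?B \<le> 0" using J(2) gap_U_minimal(2)[OF y J(1)] by linarith
  ultimately show ?thesis by linarith
qed

text \<open>
  Outside the blocks the pressure is \<open>c + U B\<close> for an initial segment \<open>B\<close>, nonnegative by the choice of \<open>c\<close>;
  inside a block it is a convex combination of its values at the two ends.
\<close>

lemma pressure_nonneg: "0 \<le> pressure y"
proof -
  define B where "B = {i\<in>I. l i + m i \<le> y}"
  have ineB: "initseg B"
    unfolding initseg_def
  proof (intro conjI ballI impI)
    fix j k assume "j \<in> B" "k \<in> I" "x k \<le> x j"
    then show "k \<in> B"
      using cell_order[of k j] inj mpos[of j] by (cases "x k = x j") (auto simp: B_def inj_on_def)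
  qed (auto simp: B_def)
  show ?thesis
  proof (cases "\<exists>i\<in>I. l i < y \<and> y < l i + m i")
    case False
    have "(\<Sum>i\<in>I. d i * ramp (l i) (m i) y) = (\<Sum>i\<in>I. if l i + m i \<le> y then m i * d i else 0)"
    proof (intro sum.cong refl)
      fix i assume i: "i \<in> I"
      have "0 < m i" "y \<le> l i \<or> l i + m i \<le> y" using i False mpos by auto
      then show "d i * ramp (l i) (m i) y = (if l i + m i \<le> y then m i * d i else 0)"
        by (auto simp: ramp_def)
    qed
    also have "\<dots> = U B" unfolding U_def B_def by (rule sum.inter_filter[symmetric, OF fin])
    finally have "pressure y = c + U B" by (simp add: pressure_def)
    then show ?thesis using c_ge[OF ineB] by simp
  next
    case True
    then obtain i where i: "i \<in> I" "l i < y" "y < l i + m i" by auto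
    have "(\<Sum>j\<in>I. d j * ramp (l j) (m j) y) =
        (\<Sum>j\<in>I. (if l j + m j \<le> y then m j * d j else 0) + (if j = i then d i * (y - l i) else 0))"
    proof (intro sum.cong refl)
      fix j assume j: "j \<in> I"
      show "d j * ramp (l j) (m j) y = (if l j + m j \<le> y then m j * d j else 0) + (if j = i then d i * (y - l i) else 0)"
      proof (cases "j = i")
        case True then show ?thesis using i by (auto simp: ramp_def)
      next
        case False
        then have "\<not> (l j < y \<and> y < l j + m j)" using cells_disjoint i j by blast
        then have "y \<le> l j \<or> l j + m j \<le> y" by auto
        then show ?thesis using False mpos[OF j] by (auto simp: ramp_def)
      qed
    qed
    also have "\<dots> = U B + d i * (y - l i)"
      unfolding sum.distrib U_def B_def sum.inter_filter[OF fin] using i fin by simp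
    finally have *: "pressure y = (c + U B) + d i * (y - l i)" by (simp add: pressure_def)
    have Bi: "initseg (insert i B)"
      unfolding initseg_def
    proof (intro conjI ballI impI)
      fix j k assume jk: "j \<in> insert i B" "k \<in> I" "x k \<le> x j"
      show "k \<in> insert i B"
      proof (cases "j \<in> B")
        case True then show ?thesis using ineB jk by (auto simp: initseg_def)
      next
        case False
        then show ?thesis using jk i cell_order[of k i] inj
          by (cases "x k = x i") (auto simp: B_def inj_on_def)
      qed
    qed (use i in \<open>auto simp: B_def\<close>)
    have "i \<notin> B" using i by (auto simp: B_def)
    then have "U (insert i B) = U B + m i * d i" by (simp add: U_def B_def fin)
    then have 2: "0 \<le> (c + U B) + m i * d i" using c_ge[OF Bi] by simp
    have 1: "0 \<le> c + U B" using c_ge[OF ineB] .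
    define \<theta> where "\<theta> = (y - l i) / m i"
    have \<theta>: "0 \<le> \<theta>" "\<theta> \<le> 1" "y - l i = \<theta> * m i" using i mpos[OF i(1)] by (auto simp: \<theta>_def field_simps)
    have "pressure y = (1 - \<theta>) * (c + U B) + \<theta> * ((c + U B) + m i * d i)"
      unfolding * \<theta>(3) by (simp add: algebra_simps)
    moreover have "0 \<le> (1 - \<theta>) * (c + U B) + \<theta> * ((c + U B) + m i * d i)"
      using mult_nonneg_nonneg[of "1 - \<theta>" "c + U B"] mult_nonneg_nonneg[OF \<theta>(1) 2] \<theta> 1 by linarith
    ultimately show ?thesis by linarith
  qed
qed

text \<open>
  The constant is \<open>- U J\<close> for some initial segment \<open>J\<close>.
\<close>

lemma abs_c_le: "\<bar>c\<bar> \<le> (\<Sum>i\<in>I. m i * \<bar>d i\<bar>)"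
proof -
  obtain J where J: "initseg J" "c = - U J" using c_witness by auto
  then have JI: "J \<subseteq> I" by (auto simp: initseg_def)
  have "\<bar>c\<bar> = \<bar>U J\<bar>" by (simp add: J)
  also have "\<dots> \<le> (\<Sum>i\<in>J. \<bar>m i * d i\<bar>)" unfolding U_def by (rule sum_abs)
  also have "\<dots> = (\<Sum>i\<in>J. m i * \<bar>d i\<bar>)"
  proof (intro sum.cong refl)
    fix i assume "i \<in> J"
    then have "0 < m i" using JI mpos by blast
    then show "\<bar>m i * d i\<bar> = m i * \<bar>d i\<bar>" by (simp add: abs_mult)
  qed
  also have "\<dots> \<le> (\<Sum>i\<in>I. m i * \<bar>d i\<bar>)" 
  proof (intro sum_mono2)
    show "0 \<le> m i * \<bar>d i\<bar>" if "i \<in> I - J" for i using mpos[of i] that by auto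
  qed (use JI fin in auto)
  finally show ?thesis .
qed

lemma cont_ramp: "continuous_on S (ramp u v)"
  unfolding ramp_def[abs_def] by (intro continuous_intros)

lemma cont_cert: "continuous_on S (cert i)"
  unfolding cert_def[abs_def] pressure_def[abs_def] bump_def[abs_def] ramp_def[abs_def]
  by (intro continuous_intros)

lemma deriv_ramp:
  assumes "0 < v" "y \<noteq> u" "y \<noteq> u + v"
  shows "(ramp u v has_real_derivative (if u < y \<and> y < u + v then 1 else 0)) (at y)"
proof -
  consider "y < u" | "u < y" "y < u + v" | "u + v < y" using assms by linarith
  then show ?thesis
  proof cases
    case 1
    have "((\<lambda>_. 0) has_real_derivative 0) (at y)" by simp
    then have "(ramp u v has_real_derivative 0) (at y)"
      by (rule has_field_derivative_transform_within_open[of _ _ _ "{..<u}"])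
         (use 1 assms in \<open>auto simp: ramp_def\<close>)
    then show ?thesis using 1 by simp
  next
    case 2
    have "((\<lambda>z. z - u) has_real_derivative 1) (at y)" by (auto intro!: derivative_eq_intros)
    then have "(ramp u v has_real_derivative 1) (at y)"
      by (rule has_field_derivative_transform_within_open[of _ _ _ "{u<..<u+v}"])
         (use 2 assms in \<open>auto simp: ramp_def\<close>)
    then show ?thesis using 2 by simp
  next
    case 3
    have "((\<lambda>_. v) has_real_derivative 0) (at y)" by simp
    then have "(ramp u v has_real_derivative 0) (at y)"
      by (rule has_field_derivative_transform_within_open[of _ _ _ "{u+v<..}"])
         (use 3 assms in \<open>auto simp: ramp_def\<close>)
    then show ?thesis using 3 by simp
  qed
qed

lemma bump_pos: "j \<in> I \<Longrightarrow> l j < y \<Longrightarrow> y < l j + m j \<Longrightarrow> 0 < bump j y"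
  by (simp add: bump_def)

lemma bump_outside: "j \<in> I \<Longrightarrow> \<not> (l j < y \<and> y < l j + m j) \<Longrightarrow> bump j y = 0"
proof -
  assume j: "j \<in> I" and n: "\<not> (l j < y \<and> y < l j + m j)"
  then have "0 < m j" "y \<le> l j \<or> l j + m j \<le> y" using mpos by auto
  then have "(y - l j) * (l j + m j - y) \<le> 0" by (auto simp: mult_le_0_iff)
  then show ?thesis by (simp add: bump_def)
qed

lemma deriv_bump:
  assumes j: "j \<in> I" "y \<noteq> l j" "y \<noteq> l j + m j"
  shows "(bump j has_real_derivative (if l j < y \<and> y < l j + m j then 2 * (\<beta> j - y) else 0)) (at y)"
proof (cases "l j < y \<and> y < l j + m j")
  case True
  have "((\<lambda>y. (y - l j) * (l j + m j - y)) has_real_derivative 2 * (\<beta> j - y)) (at y)"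
    by (auto intro!: derivative_eq_intros simp: algebra_simps)
  then have "(bump j has_real_derivative 2 * (\<beta> j - y)) (at y)"
    by (rule has_field_derivative_transform_within_open[of _ _ _ "{l j<..<l j + m j}"])
       (use True in \<open>auto simp: bump_def\<close>)
  then show ?thesis using True by simp
next
  case False
  have "((\<lambda>_. 0) has_real_derivative 0) (at y)" by simp
  then have "(bump j has_real_derivative 0) (at y)"
    by (rule has_field_derivative_transform_within_open[of _ _ _ "- {l j..l j + m j}"])
       (use False j in \<open>auto simp: bump_outside\<close>)
  then show ?thesis using False by (simp only: if_False)
qed

lemma deriv_cert:
  assumes y: "y \<notin> E"
  shows "(cert i has_real_derivative (2 * (y - x i) + 2 * (\<Sum>j\<in>I. if l j < y \<and> y < l j + m j then x j - y else 0))) (at y)"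
proof -
  have 1: "((\<lambda>y. d j * ramp (l j) (m j) y) has_real_derivative d j * (if l j < y \<and> y < l j + m j then 1 else 0)) (at y)"
    if "j \<in> I" for j
    using y that by (intro DERIV_cmult deriv_ramp) (auto simp: mpos E_def)
  have 2: "(bump j has_real_derivative (if l j < y \<and> y < l j + m j then 2 * (\<beta> j - y) else 0)) (at y)"
    if "j \<in> I" for j
    using y that by (intro deriv_bump) (auto simp: E_def)
  have 0: "((\<lambda>y. (x i - y)\<^sup>2) has_real_derivative 2 * (y - x i)) (at y)"
    by (auto intro!: derivative_eq_intros)
  have p: "(pressure has_real_derivative 0 + (\<Sum>j\<in>I. d j * (if l j < y \<and> y < l j + m j then 1 else 0))) (at y)"
    unfolding pressure_def[abs_def] by (intro DERIV_add DERIV_const DERIV_sum 1)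
  have q: "((\<lambda>y. \<Sum>j\<in>I. bump j y) has_real_derivative (\<Sum>j\<in>I. if l j < y \<and> y < l j + m j then 2 * (\<beta> j - y) else 0)) (at y)"
    by (intro DERIV_sum 2)
  have "(cert i has_real_derivative (2 * (y - x i) + (2 * (0 + (\<Sum>j\<in>I. d j * (if l j < y \<and> y < l j + m j then 1 else 0)))
     + (\<Sum>j\<in>I. if l j < y \<and> y < l j + m j then 2 * (\<beta> j - y) else 0)))) (at y)"
    unfolding cert_def[abs_def] by (intro DERIV_add DERIV_cmult 0 p q)
  moreover have "2 * (\<Sum>j\<in>I. d j * (if l j < y \<and> y < l j + m j then 1 else 0))
     + (\<Sum>j\<in>I. if l j < y \<and> y < l j + m j then 2 * (\<beta> j - y) else 0) = 2 * (\<Sum>j\<in>I. if l j < y \<and> y < l j + m j then x j - y else 0)"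
    unfolding sum_distrib_left sum.distrib[symmetric] by (intro sum.cong) auto
  ultimately show ?thesis by simp
qed

lemma deriv_cert_cell:
  assumes y: "y \<notin> E" and j: "j \<in> I" "l j < y" "y < l j + m j"
  shows "(cert i has_real_derivative (2 * (x j - x i))) (at y)"
proof -
  have "(\<Sum>k\<in>I. if l k < y \<and> y < l k + m k then x k - y else 0) = (\<Sum>k\<in>I. if k = j then x j - y else 0)"
    using cells_disjoint j by (intro sum.cong) auto
  then have "(\<Sum>k\<in>I. if l k < y \<and> y < l k + m k then x k - y else 0) = x j - y"
    using j fin by simp
  then have eq: "2 * (y - x i) + 2 * (\<Sum>k\<in>I. if l k < y \<and> y < l k + m k then x k - y else 0) = 2 * (x j - x i)"
    by simp
  show ?thesis using deriv_cert[OF y, of i] unfolding eq .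
qed

lemma deriv_cert_gap:
  assumes y: "y \<notin> E" "a \<le> y" "y \<le> b" and n: "\<And>j. j \<in> I \<Longrightarrow> \<not> (l j < y \<and> y < l j + m j)"
  shows "gap y" "(cert i has_real_derivative (2 * (y - x i))) (at y)"
proof -
  show "gap y" using y n by (force simp: gap_def E_def)
  have "(\<Sum>k\<in>I. if l k < y \<and> y < l k + m k then x k - y else 0) = 0"
    using n by (intro sum.neutral) auto
  then show "(cert i has_real_derivative (2 * (y - x i))) (at y)"
    using deriv_cert[OF y(1), of i] by simp
qed

lemma cert_mono_right:
  assumes i: "i \<in> I" and uv: "l i \<le> u" "u \<le> v" "v \<le> b"
  shows "cert i u \<le> cert i v"
proof (rule nondecreasing_off_finite[OF finE uv(2) cont_cert deriv_cert])
  fix y assume y: "u < y" "y < v" "y \<notin> E"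
  have ay: "a \<le> y" using cell_bounds[OF i] uv y by auto
  show "0 \<le> 2 * (y - x i) + 2 * (\<Sum>j\<in>I. if l j < y \<and> y < l j + m j then x j - y else 0)" (is "0 \<le> ?D")
  proof (cases "\<exists>j\<in>I. l j < y \<and> y < l j + m j")
    case True
    then obtain j where j: "j \<in> I" "l j < y" "y < l j + m j" by auto
    have "?D = 2 * (x j - x i)"
      using deriv_cert[OF y(3), of i] deriv_cert_cell[OF y(3) j, of i] DERIV_unique by blast
    moreover have "x i \<le> x j" using cell_order[of j i] i j y uv by force
    ultimately show ?thesis by simp
  next
    case False
    then have g: "gap y" "(cert i has_real_derivative (2 * (y - x i))) (at y)"
      using deriv_cert_gap(1)[of y] deriv_cert_gap(2)[of y i] y ay uv by auto
    have "?D = 2 * (y - x i)"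
      using deriv_cert[OF y(3), of i] g(2) DERIV_unique by blast
    moreover have "x i \<le> y" using gap_right[OF g(1) i] g(1) i uv y by (auto simp: gap_def)
    ultimately show ?thesis by simp
  qed
qed

lemma cert_mono_left:
  assumes i: "i \<in> I" and uv: "a \<le> u" "u \<le> v" "v \<le> l i + m i"
  shows "cert i v \<le> cert i u"
proof -
  have "- cert i u \<le> - cert i v"
  proof (rule nondecreasing_off_finite[OF finE uv(2) _ DERIV_minus[OF deriv_cert]])
    show "continuous_on {u..v} (\<lambda>y. - cert i y)" by (intro continuous_intros cont_cert)
    fix y assume y: "u < y" "y < v" "y \<notin> E"
    have yb: "y \<le> b" using cell_bounds[OF i] uv y by auto
    show "0 \<le> - (2 * (y - x i) + 2 * (\<Sum>j\<in>I. if l j < y \<and> y < l j + m j then x j - y else 0))" (is "0 \<le> - ?D")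
    proof (cases "\<exists>j\<in>I. l j < y \<and> y < l j + m j")
      case True
      then obtain j where j: "j \<in> I" "l j < y" "y < l j + m j" by auto
      have "?D = 2 * (x j - x i)"
        using deriv_cert[OF y(3), of i] deriv_cert_cell[OF y(3) j, of i] DERIV_unique by blast
      moreover have "x j \<le> x i" using cell_order[of i j] i j y uv by force
      ultimately show ?thesis by simp
    next
      case False
      then have g: "gap y" "(cert i has_real_derivative (2 * (y - x i))) (at y)"
        using deriv_cert_gap(1)[of y] deriv_cert_gap(2)[of y i] y yb uv by auto
      have "?D = 2 * (y - x i)"
        using deriv_cert[OF y(3), of i] g(2) DERIV_unique by blast
      moreover have "y \<le> x i" using gap_left[OF g(1) i] g(1) i uv y by (auto simp: gap_def)
      ultimately show ?thesis by simp
    qed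
  qed
  then show ?thesis by simp
qed

text \<open>
  The certificate of \<open>i\<close> decreases up to the block of \<open>i\<close> and increases from there on, by its slopes on blocks and in gaps.
\<close>

lemma cert_ge:
  assumes i: "i \<in> I" and y: "a \<le> y" "y \<le> b"
  shows "cert i (\<beta> i) \<le> cert i y"
proof (cases "\<beta> i \<le> y")
  case True
  show ?thesis by (rule cert_mono_right[OF i _ True y(2)]) (use mpos[OF i] in simp)
next
  case False
  show ?thesis by (rule cert_mono_left[OF i y(1)]) (use False mpos[OF i] in auto)
qed

lemma cert_eq_cell:
  assumes i: "i \<in> I" and y: "l i \<le> y" "y \<le> l i + m i"
  shows "cert i y = cert i (\<beta> i)"
proof -
  have "a \<le> y" "y \<le> b" using cell_bounds[OF i] y by auto
  moreover have "a \<le> \<beta> i" "\<beta> i \<le> b" using cell_bounds[OF i] mpos[OF i] by auto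
  moreover have "0 < m i" using mpos[OF i] .
  ultimately have le: "cert i (\<beta> i) \<le> cert i y" "a \<le> y" "y \<le> b" "a \<le> \<beta> i" "\<beta> i \<le> b" "0 < m i"
    using cert_ge[OF i] by blast+
  have "cert i y \<le> cert i (\<beta> i)"
  proof (cases "y \<le> \<beta> i")
    case True
    show ?thesis by (rule cert_mono_right[OF i y(1) True le(5)])
  next
    case False
    then show ?thesis by (intro cert_mono_left[OF i le(4) _ y(2)]) simp
  qed
  with le(1) show ?thesis by (rule antisym[rotated])
qed

text \<open>
  The slope of the certificate on a block other than that of \<open>i\<close> is nonzero. This strictness forces an optimal map to send
  each block to its own atom.
\<close>

lemma cert_gt_other_cell:
  assumes i: "i \<in> I" and j: "j \<in> I" "l j < y" "y < l j + m j" and ne: "i \<noteq> j"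
  shows "cert i (\<beta> i) < cert i y"
proof -
  have "x i \<noteq> x j" using inj i j ne by (auto simp: inj_on_def)
  then consider "x i < x j" | "x j < x i" by linarith
  then show ?thesis
  proof cases
    case 1
    have "cert i (l j) - 2 * (x j - x i) * l j \<le> cert i y - 2 * (x j - x i) * y"
    proof (rule nondecreasing_off_finite[OF finE, where f' = "\<lambda>_. 0" and u = "l j" and v = y and f = "\<lambda>y. cert i y - 2 * (x j - x i) * y"])
      show "continuous_on {l j..y} (\<lambda>y. cert i y - 2 * (x j - x i) * y)" by (intro continuous_intros cont_cert)
      fix z assume "l j < z" "z < y" "z \<notin> E"
      then have "(cert i has_real_derivative 2 * (x j - x i)) (at z)" using deriv_cert_cell[of z j i] j by auto
      then show "((\<lambda>y. cert i y - 2 * (x j - x i) * y) has_real_derivative 0) (at z)"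
        by (auto intro!: derivative_eq_intros)
    qed (use j in auto)
    moreover have "0 < 2 * (x j - x i) * (y - l j)" using 1 j by simp
    moreover have "cert i (\<beta> i) \<le> cert i (l j)" using cert_ge[OF i] cell_bounds[of j] j by auto
    ultimately show ?thesis by (simp add: algebra_simps)
  next
    case 2
    have "- (cert i y - 2 * (x j - x i) * y) \<le> - (cert i (l j + m j) - 2 * (x j - x i) * (l j + m j))"
    proof (rule nondecreasing_off_finite[OF finE, where f' = "\<lambda>_. 0" and u = y and v = "l j + m j" and f = "\<lambda>y. - (cert i y - 2 * (x j - x i) * y)"])
      show "continuous_on {y..l j + m j} (\<lambda>y. - (cert i y - 2 * (x j - x i) * y))" by (intro continuous_intros cont_cert)
      fix z assume "y < z" "z < l j + m j" "z \<notin> E"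
      then have "(cert i has_real_derivative 2 * (x j - x i)) (at z)" using deriv_cert_cell[of z j i] j by auto
      then show "((\<lambda>y. - (cert i y - 2 * (x j - x i) * y)) has_real_derivative 0) (at z)"
        by (auto intro!: derivative_eq_intros)
    qed (use j in auto)
    moreover have "0 < 2 * (x i - x j) * (l j + m j - y)" using 2 j by simp
    moreover have "cert i (\<beta> i) \<le> cert i (l j + m j)" using cert_ge[OF i] cell_bounds[of j] j mpos[of j] by auto
    ultimately show ?thesis by (simp add: algebra_simps)
  qed
qed

end

section \<open>Atomic measures and empirical measures\<close>

definition atomic :: "nat set \<Rightarrow> (nat \<Rightarrow> real) \<Rightarrow> (nat \<Rightarrow> real) \<Rightarrow> real measure" where
  "atomic I m x = distr (point_measure I (\<lambda>i. ennreal (m i))) borel x"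

lemma sets_atomic [simp, measurable_cong]: "sets (atomic I m x) = sets borel"
  and space_atomic [simp]: "space (atomic I m x) = UNIV"
  by (auto simp: atomic_def)

lemma nn_integral_atomic:
  assumes "finite I" "f \<in> borel_measurable borel"
  shows "(\<integral>\<^sup>+y. f y \<partial>atomic I m x) = (\<Sum>i\<in>I. ennreal (m i) * f (x i))"
  unfolding atomic_def using assms
  by (subst nn_integral_distr) (auto simp: nn_integral_point_measure_finite mult.commute)

lemma emeasure_atomic:
  assumes "finite I" "A \<in> sets borel"
  shows "emeasure (atomic I m x) A = (\<Sum>i\<in>I. ennreal (m i) * indicator A (x i))"
  using nn_integral_atomic[of I "indicator A" m x] assms by simp

lemma prob_space_atomic:
  assumes "finite I" "\<And>i. i \<in> I \<Longrightarrow> 0 \<le> m i" "sum m I = 1"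
  shows "prob_space (atomic I m x)"
proof (rule prob_spaceI)
  show "emeasure (atomic I m x) (space (atomic I m x)) = 1"
    using assms by (simp add: emeasure_atomic sum_ennreal)
qed

lemma AE_atomic: "finite I \<Longrightarrow> AE y in atomic I m x. y \<in> x ` I"
proof (rule AE_I[where N = "- x ` I"])
  assume "finite I"
  moreover from this have "- x ` I \<in> sets borel" by (intro borel_comp borel_closed finite_imp_closed) auto
  ultimately show "emeasure (atomic I m x) (- x ` I) = 0" by (simp add: emeasure_atomic)
  show "- x ` I \<in> sets (atomic I m x)" using \<open>- x ` I \<in> sets borel\<close> by simp
qed auto

lemma integral_atomic:
  fixes f :: "real \<Rightarrow> real"
  assumes "finite I" "\<And>i. i \<in> I \<Longrightarrow> 0 \<le> m i" "f \<in> borel_measurable borel"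
  shows "integral\<^sup>L (atomic I m x) f = (\<Sum>i\<in>I. m i * f (x i))"
    and "integrable (atomic I m x) f"
proof -
  have i: "integrable (point_measure I (\<lambda>i. ennreal (m i))) (\<lambda>i. f (x i))"
    using assms by (intro integrable_point_measure_finite) auto
  show "integral\<^sup>L (atomic I m x) f = (\<Sum>i\<in>I. m i * f (x i))"
    unfolding atomic_def using assms
    by (subst integral_distr) (auto simp: lebesgue_integral_point_measure_finite)
  show "integrable (atomic I m x) f"
    unfolding atomic_def using assms i by (subst integrable_distr_eq) auto
qed

lemma empirical_eq_atomic: "0 < N \<Longrightarrow> empirical N X = atomic {..<N} (\<lambda>_. 1 / real N) X"
  unfolding empirical_def atomic_def uniform_count_measure_def
  by (simp add: divide_ennreal ennreal_of_nat_eq_real_of_nat)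

text \<open>
  Coinciding particles share one block, so the indices are reduced to the least one at each position, with
  the multiplicity as mass.
\<close>

definition reps :: "nat \<Rightarrow> (nat \<Rightarrow> real) \<Rightarrow> nat set" where
  "reps N X = {i. i < N \<and> (\<forall>j<i. X j \<noteq> X i)}"

definition mult :: "nat \<Rightarrow> (nat \<Rightarrow> real) \<Rightarrow> nat \<Rightarrow> real" where
  "mult N X i = real (card {j. j < N \<and> X j = X i}) / real N"

lemma reps_sub: "reps N X \<subseteq> {..<N}" by (auto simp: reps_def)
lemma finite_reps: "finite (reps N X)" by (rule finite_subset[OF reps_sub]) simp

lemma inj_reps: "inj_on X (reps N X)"
  by (auto simp: inj_on_def reps_def) (metis linorder_neqE_nat)

lemma rep_exists: assumes "i < N" shows "\<exists>r\<in>reps N X. X r = X i"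
proof -
  define r where "r = (LEAST j. X j = X i)"
  have "X r = X i" unfolding r_def by (rule LeastI) simp
  moreover have "r \<le> i" unfolding r_def by (rule Least_le) simp
  moreover have "X j \<noteq> X r" if "j < r" for j
    using not_less_Least[of j "\<lambda>j. X j = X i"] that \<open>X r = X i\<close> unfolding r_def by auto
  ultimately show ?thesis using assms by (intro bexI[of _ r]) (auto simp: reps_def)
qed

lemma mult_ge: "i < N \<Longrightarrow> 1 / real N \<le> mult N X i"
proof -
  assume "i < N"
  then have "0 < card {j. j < N \<and> X j = X i}" by (auto simp: card_gt_0_iff)
  then show ?thesis unfolding mult_def by (intro divide_right_mono) auto
qed

lemma mult_pos: "i < N \<Longrightarrow> 0 < mult N X i"
  using mult_ge[of i N X] by (rule less_le_trans[rotated]) auto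

lemma sum_reps:
  fixes h :: "nat \<Rightarrow> real"
  assumes h: "\<And>i j. i < N \<Longrightarrow> j < N \<Longrightarrow> X i = X j \<Longrightarrow> h i = h j"
  shows "(\<Sum>i<N. 1 / real N * h i) = (\<Sum>i\<in>reps N X. mult N X i * h i)"
proof -
  have "(\<Sum>i<N. 1 / real N * h i) = (\<Sum>v\<in>X ` {..<N}. \<Sum>i\<in>{i\<in>{..<N}. X i = v}. 1 / real N * h i)"
    by (rule sum.image_gen) simp
  also have "\<dots> = (\<Sum>v\<in>X ` reps N X. \<Sum>i\<in>{i\<in>{..<N}. X i = v}. 1 / real N * h i)"
  proof (rule sum.cong[OF _ refl])
    show "X ` {..<N} = X ` reps N X"
      using rep_exists[of _ N X] reps_sub[of N X] by (auto simp: image_iff) metis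
  qed
  also have "\<dots> = (\<Sum>r\<in>reps N X. \<Sum>i\<in>{i\<in>{..<N}. X i = X r}. 1 / real N * h i)"
    by (subst sum.reindex[OF inj_reps]) simp
  also have "\<dots> = (\<Sum>r\<in>reps N X. \<Sum>i\<in>{i\<in>{..<N}. X i = X r}. 1 / real N * h r)"
    using reps_sub[of N X] h by (intro sum.cong) auto
  also have "\<dots> = (\<Sum>i\<in>reps N X. mult N X i * h i)"
    by (simp add: mult_def field_simps)
  finally show ?thesis .
qed

lemma mult_sum: "0 < N \<Longrightarrow> sum (mult N X) (reps N X) = 1"
  using sum_reps[of N X "\<lambda>_. 1"] by simp

lemma empirical_eq_reps:
  assumes "0 < N" and Y: "\<And>i j. i < N \<Longrightarrow> j < N \<Longrightarrow> X i = X j \<Longrightarrow> Y i = Y j"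
  shows "empirical N Y = atomic (reps N X) (mult N X) Y"
proof (rule measure_eqI)
  fix A assume "A \<in> sets (empirical N Y)"
  then have A: "A \<in> sets borel" by (simp add: empirical_def)
  have m0: "0 \<le> mult N X i" for i by (simp add: mult_def)
  have "emeasure (empirical N Y) A = (\<Sum>i<N. ennreal (1 / real N * indicator A (Y i)))"
    unfolding empirical_eq_atomic[OF assms(1)] emeasure_atomic[OF finite_lessThan A]
    by (intro sum.cong) (auto simp: indicator_def)
  also have "\<dots> = ennreal (\<Sum>i<N. 1 / real N * indicator A (Y i))"
    by (intro sum_ennreal) auto
  also have "\<dots> = ennreal (\<Sum>i\<in>reps N X. mult N X i * indicator A (Y i))"
  proof (subst sum_reps[of N X])
    show "indicator A (Y i) = (indicator A (Y j) :: real)" if "i < N" "j < N" "X i = X j" for i j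
      using Y[OF that] by simp
  qed simp
  also have "\<dots> = (\<Sum>i\<in>reps N X. ennreal (mult N X i * indicator A (Y i)))"
    by (intro sum_ennreal[symmetric]) (auto simp: m0)
  also have "\<dots> = emeasure (atomic (reps N X) (mult N X) Y) A"
    unfolding emeasure_atomic[OF finite_reps A]
    by (intro sum.cong) (auto simp: indicator_def)
  finally show "emeasure (empirical N Y) A = emeasure (atomic (reps N X) (mult N X) Y) A" .
qed (simp add: empirical_def)

section \<open>Densities bounded by one\<close>

lemma K_setI:
  fixes g :: "real \<Rightarrow> real"
  assumes g: "g \<in> borel_measurable borel" "\<And>x. 0 \<le> g x" "\<And>x. g x \<le> 1" "\<And>x. x \<notin> {a..b} \<Longrightarrow> g x = 0"
    and int: "(\<integral>\<^sup>+x. ennreal (g x) \<partial>lborel) = 1"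
  shows "density lborel (\<lambda>x. ennreal (g x)) \<in> K_set {a..b}"
proof -
  let ?D = "density lborel (\<lambda>x. ennreal (g x))"
  have gm: "(\<lambda>x. ennreal (g x)) \<in> borel_measurable lborel" using g by simp
  have "AE x in lborel. ennreal (g x) = RN_deriv lborel ?D x"
    by (rule sigma_finite_measure.RN_deriv_unique[OF sigma_finite_lborel gm refl])
  then have "AE x in lborel. RN_deriv lborel ?D x \<le> 1"
    by eventually_elim (metis g(3) ennreal_leI ennreal_1)
  moreover have "emeasure ?D (- {a..b}) = 0"
  proof -
    have "ennreal (g x) * indicator (- {a..b}) x = 0" for x
      by (cases "x \<in> {a..b}") (simp_all add: indicator_def g(4) del: atLeastAtMost_iff)
    then have z: "(\<lambda>x. ennreal (g x) * indicator (- {a..b}) x) = (\<lambda>_. 0)" by (rule ext)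
    show ?thesis using gm by (subst emeasure_density) (simp_all add: z)
  qed
  moreover have "prob_space ?D"
    by (rule prob_spaceI) (use int gm in \<open>simp add: emeasure_density\<close>)
  moreover have "absolutely_continuous lborel ?D"
    by (rule absolutely_continuousI_density[OF gm])
  ultimately show ?thesis by (simp add: K_set_def P_ac_def)
qed

text \<open>
  A version of the density with all pointwise bounds, obtained by truncating the Radon-Nikodym derivative.
\<close>

lemma K_setE:
  assumes "\<sigma> \<in> K_set {a..b}"
  obtains g :: "real \<Rightarrow> real" where "g \<in> borel_measurable borel" "\<And>x. 0 \<le> g x" "\<And>x. g x \<le> 1"
    "\<And>x. x \<notin> {a..b} \<Longrightarrow> g x = 0" "\<sigma> = density lborel (\<lambda>x. ennreal (g x))"
    "(\<integral>\<^sup>+x. ennreal (g x) \<partial>lborel) = 1" "integrable lborel g" "integral\<^sup>L lborel g = 1"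
proof -
  have \<sigma>: "prob_space \<sigma>" "sets \<sigma> = sets lborel" "emeasure \<sigma> (- {a..b}) = 0"
    "absolutely_continuous lborel \<sigma>" "AE x in lborel. RN_deriv lborel \<sigma> x \<le> 1"
    using assms by (auto simp: K_set_def P_ac_def)
  define R where "R = RN_deriv lborel \<sigma>"
  have Rm[measurable]: "R \<in> borel_measurable borel" using borel_measurable_RN_deriv[of lborel \<sigma>] by (simp add: R_def)
  have dR: "density lborel R = \<sigma>" unfolding R_def by (rule sigma_finite_measure.density_RN_deriv[OF sigma_finite_lborel]) (use \<sigma> in auto)
  have "(\<integral>\<^sup>+x. R x * indicator (- {a..b}) x \<partial>lborel) = 0"
    using \<sigma>(3) unfolding dR[symmetric] by (subst (asm) emeasure_density) auto
  then have "AE x in lborel. R x * indicator (- {a..b}) x = 0"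
    by (subst (asm) nn_integral_0_iff_AE) auto
  then have out: "AE x in lborel. x \<notin> {a..b} \<longrightarrow> R x = 0"
    by eventually_elim auto
  define g where "g = (\<lambda>x. if x \<in> {a..b} then min 1 (enn2real (R x)) else 0)"
  have gm[measurable]: "g \<in> borel_measurable borel" unfolding g_def by measurable
  have "AE x in lborel. ennreal (g x) = R x"
    using out \<sigma>(5)
  proof eventually_elim
    case (elim x)
    show ?case
    proof (cases "x \<in> {a..b}")
      case True
      have "R x \<le> 1" using elim by (simp add: R_def)
      then obtain r where r: "R x = ennreal r" "0 \<le> r" "r \<le> 1"
        using le_less_trans[OF \<open>R x \<le> 1\<close> ennreal_one_less_top]
        by (cases "R x") (auto simp flip: ennreal_1)
      then show ?thesis using True by (simp add: g_def)
    qed (use elim in \<open>auto simp: g_def\<close>)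
  qed
  then have d: "density lborel (\<lambda>x. ennreal (g x)) = \<sigma>"
    unfolding dR[symmetric] by (intro density_cong) auto
  have n1: "(\<integral>\<^sup>+x. ennreal (g x) \<partial>lborel) = 1"
    using prob_space.emeasure_space_1[OF \<sigma>(1)] unfolding d[symmetric] by (simp add: emeasure_density)
  have g01: "0 \<le> g x" "g x \<le> 1" for x by (auto simp: g_def)
  have gi: "integrable lborel g" by (rule integrableI_nonneg) (use n1 g01 in auto)
  have "integral\<^sup>L lborel g = 1"
    by (subst integral_eq_nn_integral) (use n1 g01 in auto)
  moreover have "g x = 0" if "x \<notin> {a..b}" for x using that unfolding g_def by (rule if_not_P)
  ultimately show ?thesis using that[OF gm g01 _ d[symmetric] n1 gi] by blast
qed

section \<open>Couplings and transport costs\<close>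

lemma transport_cost_le: "\<pi> \<in> couplings \<mu> \<nu> \<Longrightarrow> transport_cost \<mu> \<nu> \<le> (\<integral>\<^sup>+ z. ennreal ((fst z - snd z)\<^sup>2) \<partial>\<pi>)"
  unfolding transport_cost_def by (rule INF_lower)

lemma distr_coupling:
  assumes [measurable]: "f \<in> borel_measurable P" "g \<in> borel_measurable P"
  shows "distr P borel (\<lambda>w. (f w, g w)) \<in> couplings (distr P borel f) (distr P borel g)"
    and "(\<integral>\<^sup>+ z. ennreal ((fst z - snd z)\<^sup>2) \<partial>distr P borel (\<lambda>w. (f w, g w))) = (\<integral>\<^sup>+ w. ennreal ((f w - g w)\<^sup>2) \<partial>P)"
proof -
  have [measurable]: "(\<lambda>w. (f w, g w)) \<in> borel_measurable P"
    unfolding borel_prod[symmetric] by measurable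
  have [measurable]: "fst \<in> borel_measurable (borel :: (real\<times>real) measure)" "snd \<in> borel_measurable (borel :: (real\<times>real) measure)"
    by (auto simp: borel_prod[symmetric])
  show "distr P borel (\<lambda>w. (f w, g w)) \<in> couplings (distr P borel f) (distr P borel g)"
    unfolding couplings_def by (auto simp: distr_distr comp_def)
  show "(\<integral>\<^sup>+ z. ennreal ((fst z - snd z)\<^sup>2) \<partial>distr P borel (\<lambda>w. (f w, g w))) = (\<integral>\<^sup>+ w. ennreal ((f w - g w)\<^sup>2) \<partial>P)"
    by (subst nn_integral_distr) auto
qed

lemma transport_cost_map_le:
  assumes "f \<in> borel_measurable P" "g \<in> borel_measurable P"
    "distr P borel f = \<mu>" "distr P borel g = \<nu>"
  shows "transport_cost \<mu> \<nu> \<le> (\<integral>\<^sup>+ w. ennreal ((f w - g w)\<^sup>2) \<partial>P)"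
  using transport_cost_le[OF distr_coupling(1)[OF assms(1,2)]] distr_coupling(2)[OF assms(1,2)] assms(3,4) by simp

lemma fst_snd_measurable [measurable]:
  "fst \<in> borel_measurable (borel :: (real\<times>real) measure)" "snd \<in> borel_measurable (borel :: (real\<times>real) measure)"
  by (auto simp: borel_prod[symmetric])

lemma couplingsD:
  assumes "\<pi> \<in> couplings \<mu> \<nu>"
  shows "sets \<pi> = sets borel" "space \<pi> = UNIV" "fst \<in> borel_measurable \<pi>" "snd \<in> borel_measurable \<pi>"
    "distr \<pi> borel fst = \<mu>" "distr \<pi> borel snd = \<nu>"
proof -
  show s: "sets \<pi> = sets borel" "distr \<pi> borel fst = \<mu>" "distr \<pi> borel snd = \<nu>"
    using assms by (auto simp: couplings_def)
  show "space \<pi> = UNIV" using sets_eq_imp_space_eq[OF s(1)] by simp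
  show "fst \<in> borel_measurable \<pi>" "snd \<in> borel_measurable \<pi>"
    by (simp_all add: measurable_cong_sets[OF s(1) refl])
qed

lemma coupling_prob_space:
  assumes "\<pi> \<in> couplings \<mu> \<nu>" "prob_space \<mu>" shows "prob_space \<pi>"
proof (rule prob_spaceI)
  note D = couplingsD[OF assms(1)]
  have "emeasure (distr \<pi> borel fst) (space (distr \<pi> borel fst)) = 1"
    unfolding D(5) by (rule prob_space.emeasure_space_1[OF assms(2)])
  then show "emeasure \<pi> (space \<pi>) = 1"
    by (subst (asm) emeasure_distr) (use D in auto)
qed

lemma AE_distrD2: "f \<in> borel_measurable M \<Longrightarrow> AE y in distr M borel f. P y \<Longrightarrow> AE z in M. P (f z)"
  by (rule AE_distrD[where M' = borel])

lemma transport_cost_commute: "transport_cost \<mu> \<nu> = transport_cost \<nu> \<mu>"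
proof -
  have "transport_cost \<nu> \<mu> \<le> transport_cost \<mu> \<nu>" for \<mu> \<nu>
    unfolding transport_cost_def[of \<mu>]
  proof (rule INF_greatest)
    fix \<pi> assume p: "\<pi> \<in> couplings \<mu> \<nu>"
    note D = couplingsD[OF p]
    have "transport_cost \<nu> \<mu> \<le> (\<integral>\<^sup>+ w. ennreal ((snd w - fst w)\<^sup>2) \<partial>\<pi>)"
      by (rule transport_cost_map_le) (use D in auto)
    then show "transport_cost \<nu> \<mu> \<le> (\<integral>\<^sup>+ z. ennreal ((fst z - snd z)\<^sup>2) \<partial>\<pi>)"
      by (simp add: power2_commute)
  qed
  then show ?thesis by (intro antisym)
qed

lemma W2_commute: "W2 \<mu> \<nu> = W2 \<nu> \<mu>"
  by (simp add: W2_def transport_cost_commute)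

lemma W2_square: "(W2 \<mu> \<nu>)\<^sup>2 = enn2real (transport_cost \<mu> \<nu>)"
  by (simp add: W2_def)

lemma transport_cost_finite:
  assumes \<mu>: "prob_space \<mu>" "sets \<mu> = sets borel" "AE x in \<mu>. \<bar>x\<bar> \<le> R"
    and \<nu>: "prob_space \<nu>" "sets \<nu> = sets borel" "AE x in \<nu>. \<bar>x\<bar> \<le> R"
  shows "transport_cost \<mu> \<nu> < \<infinity>"
proof -
  interpret M: prob_space \<mu> by fact
  interpret N: prob_space \<nu> by fact
  interpret P: pair_prob_space \<mu> \<nu> ..
  have [measurable_cong]: "sets \<mu> = sets borel" "sets \<nu> = sets borel" by fact+
  have d1: "distr (\<mu> \<Otimes>\<^sub>M \<nu>) borel fst = \<mu>"
  proof (rule measure_eqI)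
    fix A assume "A \<in> sets (distr (\<mu> \<Otimes>\<^sub>M \<nu>) borel fst)"
    then have A[measurable]: "A \<in> sets borel" by simp
    have "fst -` A \<inter> space (\<mu> \<Otimes>\<^sub>M \<nu>) = A \<times> space \<nu>"
      using sets_eq_imp_space_eq[OF \<mu>(2)] by (auto simp: space_pair_measure)
    moreover have "emeasure (\<mu> \<Otimes>\<^sub>M \<nu>) (A \<times> space \<nu>) = emeasure \<mu> A"
      by (subst N.emeasure_pair_measure_Times) (auto simp: N.emeasure_space_1 \<mu>)
    ultimately show "emeasure (distr (\<mu> \<Otimes>\<^sub>M \<nu>) borel fst) A = emeasure \<mu> A"
      by (simp add: emeasure_distr)
  qed (simp add: \<mu>)
  have d2: "distr (\<mu> \<Otimes>\<^sub>M \<nu>) borel snd = \<nu>"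
  proof (rule measure_eqI)
    fix A assume "A \<in> sets (distr (\<mu> \<Otimes>\<^sub>M \<nu>) borel snd)"
    then have A[measurable]: "A \<in> sets borel" by simp
    have "snd -` A \<inter> space (\<mu> \<Otimes>\<^sub>M \<nu>) = space \<mu> \<times> A"
      using sets_eq_imp_space_eq[OF \<nu>(2)] by (auto simp: space_pair_measure)
    moreover have "emeasure (\<mu> \<Otimes>\<^sub>M \<nu>) (space \<mu> \<times> A) = emeasure \<nu> A"
      by (subst N.emeasure_pair_measure_Times) (auto simp: M.emeasure_space_1 \<nu>)
    ultimately show "emeasure (distr (\<mu> \<Otimes>\<^sub>M \<nu>) borel snd) A = emeasure \<nu> A"
      by (simp add: emeasure_distr)
  qed (simp add: \<nu>)
  have "transport_cost \<mu> \<nu> \<le> (\<integral>\<^sup>+ w. ennreal ((fst w - snd w)\<^sup>2) \<partial>(\<mu> \<Otimes>\<^sub>M \<nu>))"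
    by (rule transport_cost_map_le[OF _ _ d1 d2]) auto
  also have "\<dots> \<le> (\<integral>\<^sup>+ w. ennreal ((2 * R)\<^sup>2) \<partial>(\<mu> \<Otimes>\<^sub>M \<nu>))"
  proof (rule nn_integral_mono_AE)
    have "AE w in \<mu> \<Otimes>\<^sub>M \<nu>. \<bar>fst w\<bar> \<le> R" 
    proof (rule AE_distrD2[where f = fst])
      show "AE y in distr (\<mu> \<Otimes>\<^sub>M \<nu>) borel fst. \<bar>y\<bar> \<le> R" unfolding d1 by (rule \<mu>(3))
    qed simp
    moreover have "AE w in \<mu> \<Otimes>\<^sub>M \<nu>. \<bar>snd w\<bar> \<le> R" 
    proof (rule AE_distrD2[where f = snd])
      show "AE y in distr (\<mu> \<Otimes>\<^sub>M \<nu>) borel snd. \<bar>y\<bar> \<le> R" unfolding d2 by (rule \<nu>(3))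
    qed simp
    ultimately show "AE w in \<mu> \<Otimes>\<^sub>M \<nu>. ennreal ((fst w - snd w)\<^sup>2) \<le> ennreal ((2 * R)\<^sup>2)"
    proof eventually_elim
      case (elim w)
      then have "\<bar>fst w - snd w\<bar> \<le> \<bar>2 * R\<bar>" by linarith
      then show ?case by (intro ennreal_leI) (simp only: abs_le_square_iff)
    qed
  qed
  also have "\<dots> = ennreal ((2 * R)\<^sup>2)"
    by (simp add: P.emeasure_space_1)
  also have "\<dots> < \<infinity>" by simp
  finally show ?thesis .
qed

section \<open>Duality: the packing is the projection\<close>

lemma cell_second_moment:
  fixes l m x :: real
  assumes "0 \<le> m"
  shows "has_bochner_integral lborel (\<lambda>y. (x - y)\<^sup>2 * indicator {l..l+m} y) (m * ((x - (l + m/2))\<^sup>2 + m\<^sup>2 / 12))"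
proof -
  define F where "F = (\<lambda>y. - (((x - y) ^ 3) / 3))"
  have "has_bochner_integral lborel (\<lambda>y. (x - y)\<^sup>2 * indicator {l..l+m} y) (F (l + m) - F l)"
  proof (rule has_bochner_integral_FTC_Icc_real)
    show "(F has_real_derivative (x - y)\<^sup>2) (at y)" for y
      unfolding F_def by (auto intro!: derivative_eq_intros simp: power2_eq_square)
    show "isCont (\<lambda>y. (x - y)\<^sup>2) y" for y by (intro continuous_intros)
  qed (use assms in auto)
  also have "F (l + m) - F l = m * ((x - (l + m/2))\<^sup>2 + m\<^sup>2 / 12)"
    by (simp add: F_def power2_eq_square power3_eq_cube field_simps)
  finally show ?thesis .
qed

context packing
begin

definition cell :: "nat \<Rightarrow> real set" where "cell i = {l i<..<l i + m i}"

text \<open>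
  The squared distance from \<open>x\<close> to the packing: the block of \<open>i\<close> contributes the squared distance of its
  center plus its variance \<open>(m i)\<^sup>2 / 12\<close>.
\<close>

definition cost :: real where "cost = (\<Sum>i\<in>I. m i * ((x i - \<beta> i)\<^sup>2 + (m i)\<^sup>2 / 12))"

definition rho :: "real \<Rightarrow> real" where "rho y = (\<Sum>i\<in>I. indicator (cell i) y)"

definition proj :: "real measure" where "proj = density lborel (\<lambda>y. ennreal (rho y))"

definition Pot :: "real \<Rightarrow> real" where "Pot y = 2 * pressure y + (\<Sum>j\<in>I. bump j y)"

definition uval :: "real \<Rightarrow> real" where "uval v = (\<Sum>i\<in>I. cert i (\<beta> i) * indicator {x i} v)"

definition step :: "(nat \<Rightarrow> real) \<Rightarrow> real \<Rightarrow> real" where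
  "step z y = (\<Sum>i\<in>I. z i * indicator (cell i) y)"

lemma cost_nonneg: "0 \<le> cost"
  unfolding cost_def by (intro sum_nonneg mult_nonneg_nonneg add_nonneg_nonneg) (auto intro: less_imp_le mpos)

lemma rho_measurable[measurable]: "rho \<in> borel_measurable borel"
  unfolding rho_def[abs_def] cell_def by measurable

lemma step_measurable[measurable]: "step z \<in> borel_measurable borel"
  unfolding step_def[abs_def] cell_def by measurable

lemma uval_measurable[measurable]: "uval \<in> borel_measurable borel"
  unfolding uval_def[abs_def] by measurable

lemma sum_indicator_cell:
  fixes f :: "nat \<Rightarrow> real"
  assumes "i \<in> I" "y \<in> cell i"
  shows "(\<Sum>j\<in>I. f j * indicator (cell j) y) = f i"
proof -
  have "(\<Sum>j\<in>I. f j * indicator (cell j) y) = (\<Sum>j\<in>I. if j = i then f i else 0)"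
    using cells_disjoint assms by (intro sum.cong) (auto simp: cell_def indicator_def)
  then show ?thesis using assms fin by simp
qed

lemma step_cell: "i \<in> I \<Longrightarrow> y \<in> cell i \<Longrightarrow> step z y = z i"
  unfolding step_def by (rule sum_indicator_cell)

lemma rho_cell: "i \<in> I \<Longrightarrow> y \<in> cell i \<Longrightarrow> rho y = 1"
  using sum_indicator_cell[of i y "\<lambda>_. 1"] by (simp add: rho_def)

lemma rho_outside: "(\<And>i. i \<in> I \<Longrightarrow> y \<notin> cell i) \<Longrightarrow> rho y = 0"
  unfolding rho_def by (intro sum.neutral) auto

lemma rho_01: "0 \<le> rho y" "rho y \<le> 1"
  using rho_cell[of _ y] rho_outside[of y] by (cases "\<exists>i\<in>I. y \<in> cell i"; force)+

lemma cell_sub: "i \<in> I \<Longrightarrow> cell i \<subseteq> {a..b}"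
  using cell_bounds[of i] by (auto simp: cell_def)

lemma nn_integral_proj:
  assumes [measurable]: "F \<in> borel_measurable borel"
  shows "(\<integral>\<^sup>+y. F y \<partial>proj) = (\<Sum>i\<in>I. \<integral>\<^sup>+y. F y * indicator (cell i) y \<partial>lborel)"
proof -
  have [measurable]: "cell i \<in> sets borel" for i by (simp add: cell_def)
  have r: "ennreal (rho y) = (\<Sum>i\<in>I. indicator (cell i) y)" for y
  proof -
    have "(\<Sum>i\<in>I. indicator (cell i) y :: ennreal) = (\<Sum>i\<in>I. ennreal (indicator (cell i) y))"
      by (intro sum.cong) (auto simp: indicator_def)
    also have "\<dots> = ennreal (rho y)" unfolding rho_def by (rule sum_ennreal) auto
    finally show ?thesis by simp
  qed
  have "(\<integral>\<^sup>+y. F y \<partial>proj) = (\<integral>\<^sup>+y. ennreal (rho y) * F y \<partial>lborel)"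
    unfolding proj_def by (rule nn_integral_density) auto
  also have "\<dots> = (\<integral>\<^sup>+y. (\<Sum>i\<in>I. F y * indicator (cell i) y) \<partial>lborel)"
    by (intro nn_integral_cong) (simp add: r sum_distrib_left mult.commute)
  also have "\<dots> = (\<Sum>i\<in>I. \<integral>\<^sup>+y. F y * indicator (cell i) y \<partial>lborel)"
    by (rule nn_integral_sum) auto
  finally show ?thesis .
qed

lemma emeasure_cell: "i \<in> I \<Longrightarrow> emeasure lborel (cell i) = ennreal (m i)"
  using mpos[of i] by (simp add: cell_def)

lemma proj_in_K: "proj \<in> K_set {a..b}"
  unfolding proj_def
proof (rule K_setI)
  show "rho x = 0" if "x \<notin> {a..b}" for x
    using that cell_sub by (intro rho_outside) blast
  have "(\<integral>\<^sup>+y. 1 \<partial>proj) = (\<Sum>i\<in>I. ennreal (m i))"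
    using emeasure_cell by (subst nn_integral_proj) (auto simp: cell_def intro!: sum.cong)
  also have "\<dots> = 1" using mpos msum by (subst sum_ennreal) (auto intro: less_imp_le)
  finally show "(\<integral>\<^sup>+x. ennreal (rho x) \<partial>lborel) = 1"
    unfolding proj_def by (subst (asm) nn_integral_density) auto
qed (use rho_01 in auto)

lemma distr_step: "distr proj borel (step z) = atomic I m z"
proof (rule measure_eqI)
  fix A assume "A \<in> sets (distr proj borel (step z))"
  then have A[measurable]: "A \<in> sets borel" by simp
  have sp: "sets proj = sets borel" by (simp add: proj_def)
  have "emeasure (distr proj borel (step z)) A = emeasure proj (step z -` A)"
    using A by (subst emeasure_distr) (auto simp: proj_def)
  also have "\<dots> = (\<integral>\<^sup>+y. indicator (step z -` A) y \<partial>proj)"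
    using measurable_sets[OF step_measurable A, of z] by (intro nn_integral_indicator[symmetric]) (simp add: sp)
  also have "\<dots> = (\<Sum>i\<in>I. \<integral>\<^sup>+y. indicator (step z -` A) y * indicator (cell i) y \<partial>lborel)"
    using measurable_sets[OF step_measurable A, of z] by (intro nn_integral_proj) simp
  also have "\<dots> = (\<Sum>i\<in>I. \<integral>\<^sup>+y. indicator A (z i) * indicator (cell i) y \<partial>lborel)"
    by (intro sum.cong nn_integral_cong refl) (auto simp: indicator_def step_cell)
  also have "\<dots> = (\<Sum>i\<in>I. ennreal (m i) * indicator A (z i))"
    by (intro sum.cong refl) (subst nn_integral_cmult, auto simp: cell_def less_imp_le mpos mult.commute)
  also have "\<dots> = emeasure (atomic I m z) A" by (simp add: emeasure_atomic fin)
  finally show "emeasure (distr proj borel (step z)) A = emeasure (atomic I m z) A" .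
qed simp

lemma nn_integral_cell_square:
  assumes "i \<in> I"
  shows "(\<integral>\<^sup>+y. ennreal ((v - y)\<^sup>2) * indicator (cell i) y \<partial>lborel) = ennreal (m i * ((v - \<beta> i)\<^sup>2 + (m i)\<^sup>2 / 12))"
proof -
  have "(\<integral>\<^sup>+y. ennreal ((v - y)\<^sup>2) * indicator (cell i) y \<partial>lborel)
      = (\<integral>\<^sup>+y. ennreal ((v - y)\<^sup>2 * indicator {l i..l i + m i} y) \<partial>lborel)"
  proof (rule nn_integral_cong_AE)
    have "AE y in lborel. y \<noteq> l i" "AE y in lborel. y \<noteq> l i + m i" by (rule AE_lborel_singleton)+
    then show "AE y in lborel. ennreal ((v - y)\<^sup>2) * indicator (cell i) y = ennreal ((v - y)\<^sup>2 * indicator {l i..l i + m i} y)"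
      by eventually_elim (auto simp: cell_def indicator_def)
  qed
  also have "\<dots> = ennreal (m i * ((v - \<beta> i)\<^sup>2 + (m i)\<^sup>2 / 12))"
    using cell_second_moment[of "m i" v "l i"] mpos[OF assms]
    by (subst nn_integral_eq_integral) (auto simp: has_bochner_integral_iff)
  finally show ?thesis .
qed

lemma nn_integral_step_square:
  "(\<integral>\<^sup>+y. ennreal ((step z y - y)\<^sup>2) \<partial>proj) = ennreal (\<Sum>i\<in>I. m i * ((z i - \<beta> i)\<^sup>2 + (m i)\<^sup>2 / 12))"
proof -
  have "(\<integral>\<^sup>+y. ennreal ((step z y - y)\<^sup>2) \<partial>proj) = (\<Sum>i\<in>I. \<integral>\<^sup>+y. ennreal ((step z y - y)\<^sup>2) * indicator (cell i) y \<partial>lborel)"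
    by (rule nn_integral_proj) measurable
  also have "\<dots> = (\<Sum>i\<in>I. \<integral>\<^sup>+y. ennreal ((z i - y)\<^sup>2) * indicator (cell i) y \<partial>lborel)"
    by (intro sum.cong nn_integral_cong refl) (auto simp: indicator_def step_cell)
  also have "\<dots> = (\<Sum>i\<in>I. ennreal (m i * ((z i - \<beta> i)\<^sup>2 + (m i)\<^sup>2 / 12)))"
    by (intro sum.cong refl nn_integral_cell_square)
  also have "\<dots> = ennreal (\<Sum>i\<in>I. m i * ((z i - \<beta> i)\<^sup>2 + (m i)\<^sup>2 / 12))"
    by (intro sum_ennreal mult_nonneg_nonneg) (auto intro: less_imp_le mpos)
  finally show ?thesis .
qed

lemma transport_cost_proj_le:
  "transport_cost (atomic I m z) proj \<le> ennreal (\<Sum>i\<in>I. m i * ((z i - \<beta> i)\<^sup>2 + (m i)\<^sup>2 / 12))"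
proof -
  have sp: "sets proj = sets borel" by (simp add: proj_def)
  have "transport_cost (atomic I m z) proj \<le> (\<integral>\<^sup>+y. ennreal ((step z y - y)\<^sup>2) \<partial>proj)"
    by (rule transport_cost_map_le[OF _ _ distr_step])
       (simp_all add: measurable_cong_sets[OF sp refl] distr_id2 sp)
  then show ?thesis by (simp add: nn_integral_step_square)
qed

lemma Pot_nonneg: "0 \<le> Pot y"
  unfolding Pot_def bump_def by (intro add_nonneg_nonneg mult_nonneg_nonneg sum_nonneg) (auto simp: pressure_nonneg)

lemma Pot_cell_pos: "i \<in> I \<Longrightarrow> y \<in> cell i \<Longrightarrow> 0 < Pot y"
  unfolding Pot_def using pressure_nonneg[of y] bump_pos[of i y] fin
  by (intro add_nonneg_pos sum_pos2[of I i]) (auto simp: cell_def bump_def)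

lemma cont_Pot: "continuous_on S Pot"
  unfolding Pot_def[abs_def] pressure_def[abs_def] bump_def[abs_def] ramp_def[abs_def]
  by (intro continuous_intros)

lemma Pot_measurable[measurable]: "Pot \<in> borel_measurable borel"
  using cont_Pot by (rule borel_measurable_continuous_onI)

lemma cert_Pot: "cert i y = (x i - y)\<^sup>2 + Pot y"
  by (simp add: cert_def Pot_def)

lemma uval_x: "i \<in> I \<Longrightarrow> uval (x i) = cert i (\<beta> i)"
proof -
  assume i: "i \<in> I"
  have "uval (x i) = (\<Sum>j\<in>I. if j = i then cert i (\<beta> i) else 0)"
    unfolding uval_def using i inj by (intro sum.cong) (auto simp: indicator_def inj_on_def)
  then show ?thesis using i fin by simp
qed

lemma AE_not_E: "AE y in lborel. y \<notin> E"
  using finite_imp_null_set_lborel[OF finE] by (rule AE_not_in)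

text \<open>
  The potential vanishes in the gaps, and on the block of \<open>i\<close> the certificate is constant; so the integral of \<open>Pot\<close> is
  the integral of \<open>cert i (\<beta> i) - (x i - y)\<^sup>2\<close> over the blocks.
\<close>

lemma Pot_integral: "has_bochner_integral lborel (\<lambda>y. Pot y * indicator {a..b} y) ((\<Sum>i\<in>I. m i * cert i (\<beta> i)) - cost)"
proof -
  have 1: "has_bochner_integral lborel (\<lambda>y. \<Sum>i\<in>I. cert i (\<beta> i) * indicator {l i..l i + m i} y - (x i - y)\<^sup>2 * indicator {l i..l i + m i} y)
     (\<Sum>i\<in>I. cert i (\<beta> i) * m i - m i * ((x i - \<beta> i)\<^sup>2 + (m i)\<^sup>2 / 12))"
  proof (intro has_bochner_integral_sum has_bochner_integral_diff cell_second_moment)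
    fix i assume i: "i \<in> I"
    show "has_bochner_integral lborel (\<lambda>y. cert i (\<beta> i) * indicator {l i..l i + m i} y) (cert i (\<beta> i) * m i)"
      using has_bochner_integral_real_indicator[of "{l i..l i + m i}" lborel] mpos[OF i]
      by (intro has_bochner_integral_mult_right) (auto simp: less_imp_le)
  qed (auto intro: less_imp_le mpos)
  have 2: "AE y in lborel. (\<Sum>i\<in>I. cert i (\<beta> i) * indicator {l i..l i + m i} y - (x i - y)\<^sup>2 * indicator {l i..l i + m i} y)
      = Pot y * indicator {a..b} y"
    using AE_not_E
  proof eventually_elim
    case (elim y)
    have "(\<Sum>i\<in>I. cert i (\<beta> i) * indicator {l i..l i + m i} y - (x i - y)\<^sup>2 * indicator {l i..l i + m i} y)
       = (\<Sum>i\<in>I. Pot y * indicator (cell i) y)"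
    proof (intro sum.cong refl)
      fix i assume i: "i \<in> I"
      have "y \<noteq> l i" "y \<noteq> l i + m i" using i elim by (auto simp: E_def)
      then show "cert i (\<beta> i) * indicator {l i..l i + m i} y - (x i - y)\<^sup>2 * indicator {l i..l i + m i} y = Pot y * indicator (cell i) y"
        using cert_eq_cell[OF i, of y] cert_Pot[of i y] by (auto simp: cell_def indicator_def)
    qed
    also have "\<dots> = Pot y * rho y" by (simp add: rho_def sum_distrib_left)
    also have "\<dots> = Pot y * indicator {a..b} y"
    proof (cases "\<exists>i\<in>I. y \<in> cell i")
      case True
      then obtain i where i: "i \<in> I" "y \<in> cell i" by auto
      then have "y \<in> {a..b}" using cell_sub by blast
      then show ?thesis using rho_cell[OF i] by simp
    next
      case False
      then have r: "rho y = 0" by (intro rho_outside) auto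
      show ?thesis
      proof (cases "y \<in> {a..b}")
        case True
        have n: "\<And>j. j \<in> I \<Longrightarrow> \<not> (l j < y \<and> y < l j + m j)" using False by (auto simp: cell_def)
        then have "gap y" using deriv_cert_gap(1)[OF elim _ _ n] True by auto
        moreover have "(\<Sum>j\<in>I. bump j y) = 0" using n by (intro sum.neutral ballI bump_outside) auto
        ultimately show ?thesis using r by (simp add: Pot_def pressure_gap)
      qed (use r in auto)
    qed
    finally show ?case .
  qed
  have 3: "(\<Sum>i\<in>I. cert i (\<beta> i) * m i - m i * ((x i - \<beta> i)\<^sup>2 + (m i)\<^sup>2 / 12)) = (\<Sum>i\<in>I. m i * cert i (\<beta> i)) - cost"
    by (simp add: cost_def sum_subtractf mult.commute)
  show ?thesis
    using 1 has_bochner_integral_cong_AE[THEN iffD1, OF _ _ 2 1] by (auto simp: 3)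
qed

text \<open>
  For a coupling with a density \<open>g \<le> 1\<close>, the excess of its cost over \<open>cost\<close> splits into the
  duality defect of the pair \<open>uval\<close>, \<open>Pot\<close> and the term \<open>Pot * (indicator {a..b} - g)\<close>. Both are
  nonnegative, which proves minimality of the packing; both vanish for a minimizer, which proves uniqueness.
\<close>

lemma coupling_duality:
  assumes \<pi>: "\<pi> \<in> couplings (atomic I m x) (density lborel (\<lambda>y. ennreal (g y)))"
    and g[measurable]: "g \<in> borel_measurable borel" and g01: "\<And>y. 0 \<le> g y" "\<And>y. g y \<le> 1"
    and gout: "\<forall>y. y \<notin> {a..b} \<longrightarrow> g y = 0" and g1: "(\<integral>\<^sup>+y. ennreal (g y) \<partial>lborel) = 1"
  shows "integrable \<pi> (\<lambda>z. (fst z - snd z)\<^sup>2)"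
    and "AE z in \<pi>. uval (fst z) - Pot (snd z) \<le> (fst z - snd z)\<^sup>2"
    and "(\<integral>z. (fst z - snd z)\<^sup>2 - (uval (fst z) - Pot (snd z)) \<partial>\<pi>) + (\<integral>y. Pot y * (indicator {a..b} y - g y) \<partial>lborel)
       = (\<integral>z. (fst z - snd z)\<^sup>2 \<partial>\<pi>) - cost"
    and "integrable \<pi> (\<lambda>z. (fst z - snd z)\<^sup>2 - (uval (fst z) - Pot (snd z)))"
    and "integrable lborel (\<lambda>y. Pot y * (indicator {a..b} y - g y))"
    and "AE z in \<pi>. fst z \<in> x ` I" 
proof -
  let ?\<sigma> = "density lborel (\<lambda>y. ennreal (g y))"
  have P: "prob_space (atomic I m x)" by (rule prob_space_atomic) (use fin mpos msum in \<open>auto intro: less_imp_le\<close>)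
  interpret \<pi>: prob_space \<pi> by (rule coupling_prob_space[OF \<pi> P])
  note D = couplingsD[OF \<pi>]
  note [measurable] = D(3,4)
  have a1: "AE z in \<pi>. fst z \<in> x ` I"
    using AE_atomic[OF fin, of x m] unfolding D(5)[symmetric] by (rule AE_distrD2[OF D(3)])
  have a2: "AE z in \<pi>. snd z \<in> {a..b}"
  proof (rule AE_distrD2[OF D(4)])
    show "AE y in distr \<pi> borel snd. y \<in> {a..b}"
      unfolding D(6)
    proof (subst AE_density)
      have "0 < ennreal (g y) \<longrightarrow> y \<in> {a..b}" for y
        using gout[rule_format, of y] by (cases "y \<in> {a..b}") (simp_all del: atLeastAtMost_iff)
      then show "AE y in lborel. 0 < ennreal (g y) \<longrightarrow> y \<in> {a..b}" by (intro AE_I2)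
    qed simp
  qed
  have fb: "bounded (x ` I)" using fin by (intro finite_imp_bounded) auto
  then obtain R where R: "\<And>i. i \<in> I \<Longrightarrow> \<bar>x i\<bar> \<le> R" by (auto simp: bounded_iff)
  have "compact (Pot ` {a..b})" by (intro compact_continuous_image cont_Pot) auto
  then have "bounded (Pot ` {a..b})" by (rule compact_imp_bounded)
  then obtain B where "\<forall>z\<in>Pot ` {a..b}. norm z \<le> B" unfolding bounded_iff by blast
  then have B: "\<And>y. y \<in> {a..b} \<Longrightarrow> \<bar>Pot y\<bar> \<le> B" by (simp del: atLeastAtMost_iff)
  have i1: "integrable \<pi> (\<lambda>z. (fst z - snd z)\<^sup>2)"
  proof (rule \<pi>.integrable_const_bound[where B = "(R + (\<bar>a\<bar> + \<bar>b\<bar>))\<^sup>2"])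
    show "AE z in \<pi>. norm ((fst z - snd z)\<^sup>2) \<le> (R + (\<bar>a\<bar> + \<bar>b\<bar>))\<^sup>2"
      using a1 a2
    proof eventually_elim
      case (elim z)
      then obtain i where i: "i \<in> I" "fst z = x i" by auto
      have "\<bar>fst z - snd z\<bar> \<le> \<bar>R + (\<bar>a\<bar> + \<bar>b\<bar>)\<bar>" using R[OF i(1)] i elim by auto
      then show ?case by (simp add: abs_le_square_iff)
    qed
  qed measurable
  have i2: "integrable \<pi> (\<lambda>z. Pot (snd z))"
  proof (rule \<pi>.integrable_const_bound[where B = B])
    show "AE z in \<pi>. norm (Pot (snd z)) \<le> B" using a2 by eventually_elim (simp add: B del: atLeastAtMost_iff)
  qed measurable
  have u: "integrable (atomic I m x) uval" "integral\<^sup>L (atomic I m x) uval = (\<Sum>i\<in>I. m i * cert i (\<beta> i))"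
    using integral_atomic[OF fin less_imp_le[OF mpos] uval_measurable, where x = x]
    by (simp_all add: uval_x cong: sum.cong)
  have i3: "integrable \<pi> (\<lambda>z. uval (fst z))" "(\<integral>z. uval (fst z) \<partial>\<pi>) = (\<Sum>i\<in>I. m i * cert i (\<beta> i))"
    using u unfolding D(5)[symmetric] by (auto simp: integrable_distr_eq integral_distr)
  have e: "(\<integral>z. Pot (snd z) \<partial>\<pi>) = (\<integral>y. Pot y * g y \<partial>lborel)"
  proof -
    have "(\<integral>z. Pot (snd z) \<partial>\<pi>) = integral\<^sup>L (distr \<pi> borel snd) Pot"
      by (rule integral_distr[symmetric]) auto
    also have "\<dots> = (\<integral>y. g y *\<^sub>R Pot y \<partial>lborel)" unfolding D(6)
      by (rule integral_density) (use g01 in auto)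
    finally show ?thesis by (simp add: mult.commute)
  qed
  have i4: "integrable lborel (\<lambda>y. Pot y * g y)"
  proof -
    have "integrable (distr \<pi> borel snd) Pot" using i2 by (subst integrable_distr_eq) auto
    then have "integrable lborel (\<lambda>y. g y *\<^sub>R Pot y)" unfolding D(6)
      by (subst (asm) integrable_density) (use g01 in auto)
    then show ?thesis by (simp add: mult.commute)
  qed
  show "integrable \<pi> (\<lambda>z. (fst z - snd z)\<^sup>2)" by (rule i1)
  show i5: "integrable \<pi> (\<lambda>z. (fst z - snd z)\<^sup>2 - (uval (fst z) - Pot (snd z)))"
    using i1 i2 i3 by (intro Bochner_Integration.integrable_diff)
  have eqn: "Pot y * (indicator {a..b} y - g y) = Pot y * indicator {a..b} y - Pot y * g y" for y
    by (simp add: right_diff_distrib)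
  note Pi = Pot_integral[unfolded has_bochner_integral_iff]
  show i6: "integrable lborel (\<lambda>y. Pot y * (indicator {a..b} y - g y))"
    unfolding eqn using Pi i4 by (intro Bochner_Integration.integrable_diff) auto
  have "(\<integral>y. Pot y * (indicator {a..b} y - g y) \<partial>lborel) = ((\<Sum>i\<in>I. m i * cert i (\<beta> i)) - cost) - (\<integral>y. Pot y * g y \<partial>lborel)"
    unfolding eqn using Pi i4 by (subst Bochner_Integration.integral_diff) auto
  moreover have "(\<integral>z. (fst z - snd z)\<^sup>2 - (uval (fst z) - Pot (snd z)) \<partial>\<pi>)
      = (\<integral>z. (fst z - snd z)\<^sup>2 \<partial>\<pi>) - ((\<Sum>i\<in>I. m i * cert i (\<beta> i)) - (\<integral>z. Pot (snd z) \<partial>\<pi>))"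
    using i1 i2 i3 by simp
  ultimately show "(\<integral>z. (fst z - snd z)\<^sup>2 - (uval (fst z) - Pot (snd z)) \<partial>\<pi>) + (\<integral>y. Pot y * (indicator {a..b} y - g y) \<partial>lborel)
       = (\<integral>z. (fst z - snd z)\<^sup>2 \<partial>\<pi>) - cost"
    using e by simp
  show "AE z in \<pi>. uval (fst z) - Pot (snd z) \<le> (fst z - snd z)\<^sup>2"
    using a1 a2
  proof eventually_elim
    case (elim z)
    then obtain i where i: "i \<in> I" "fst z = x i" by auto
    show ?case using cert_ge[OF i(1), of "snd z"] elim by (auto simp: i uval_x cert_Pot)
  qed
  show "AE z in \<pi>. fst z \<in> x ` I" by (rule a1)
qed

lemma cost_le_coupling:
  assumes \<sigma>: "\<sigma> \<in> K_set {a..b}" and \<pi>: "\<pi> \<in> couplings (atomic I m x) \<sigma>"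
  shows "ennreal cost \<le> (\<integral>\<^sup>+z. ennreal ((fst z - snd z)\<^sup>2) \<partial>\<pi>)"
proof -
  from K_setE[OF \<sigma>] obtain g where g: "g \<in> borel_measurable borel" "\<And>y. 0 \<le> g y" "\<And>y. g y \<le> 1"
    "\<And>y. y \<notin> {a..b} \<Longrightarrow> g y = 0" and sg: "\<sigma> = density lborel (\<lambda>y. ennreal (g y))" and g1: "(\<integral>\<^sup>+y. ennreal (g y) \<partial>lborel) = 1" by metis
  have g4: "\<forall>y. y \<notin> {a..b} \<longrightarrow> g y = 0" using g(4) by blast
  note D = coupling_duality[OF \<pi>[unfolded sg] g(1,2,3) g4 g1]
  have "0 \<le> (\<integral>z. (fst z - snd z)\<^sup>2 - (uval (fst z) - Pot (snd z)) \<partial>\<pi>)"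
    by (rule integral_nonneg_AE) (use D(2) in \<open>auto elim!: eventually_mono\<close>)
  moreover have "0 \<le> (\<integral>y. Pot y * (indicator {a..b} y - g y) \<partial>lborel)"
  proof (rule integral_nonneg_AE, rule AE_I2)
    fix y show "0 \<le> Pot y * (indicator {a..b} y - g y)"
      using g(3)[of y] g(4)[of y] by (intro mult_nonneg_nonneg Pot_nonneg) (auto simp: indicator_def)
  qed
  ultimately have "cost \<le> (\<integral>z. (fst z - snd z)\<^sup>2 \<partial>\<pi>)" using D(3) by simp
  then show ?thesis using D(1) by (subst nn_integral_eq_integral) (auto intro: ennreal_leI)
qed

lemma transport_cost_ge: "\<sigma> \<in> K_set {a..b} \<Longrightarrow> ennreal cost \<le> transport_cost (atomic I m x) \<sigma>"
  unfolding transport_cost_def by (intro INF_greatest cost_le_coupling)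

lemma transport_cost_proj: "transport_cost (atomic I m x) proj = ennreal cost"
  using transport_cost_ge[OF proj_in_K] transport_cost_proj_le[of x] by (intro antisym) (auto simp: cost_def)

lemma transport_cost_atomic_K_finite:
  assumes "\<sigma> \<in> K_set {a..b}" shows "transport_cost (atomic I m z) \<sigma> < \<infinity>"
proof -
  have s: "prob_space \<sigma>" "sets \<sigma> = sets borel" "emeasure \<sigma> (- {a..b}) = 0"
    using assms by (auto simp: K_set_def P_ac_def)
  have "bounded (z ` I)" using fin by (intro finite_imp_bounded) auto
  then obtain R where R: "\<And>i. i \<in> I \<Longrightarrow> \<bar>z i\<bar> \<le> R" by (auto simp: bounded_iff)
  let ?R = "max R (\<bar>a\<bar> + \<bar>b\<bar>)"
  show ?thesis
  proof (rule transport_cost_finite[where R = ?R])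
    show "prob_space (atomic I m z)" by (rule prob_space_atomic) (use fin mpos msum in \<open>auto intro: less_imp_le\<close>)
    show "AE x in atomic I m z. \<bar>x\<bar> \<le> ?R"
      using AE_atomic[OF fin, of z m] by eventually_elim (use R in \<open>force simp: le_max_iff_disj\<close>)
    show "AE x in \<sigma>. \<bar>x\<bar> \<le> ?R"
      by (rule AE_I[OF _ s(3)]) (auto simp: s)
  qed (use s in auto)
qed

lemma W2_ge: "\<sigma> \<in> K_set {a..b} \<Longrightarrow> cost \<le> (W2 (atomic I m x) \<sigma>)\<^sup>2"
  using transport_cost_ge[of \<sigma>] transport_cost_atomic_K_finite[of \<sigma> x] cost_nonneg enn2real_mono
  unfolding W2_square by fastforce

lemma W2_proj: "(W2 (atomic I m x) proj)\<^sup>2 = cost"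
  unfolding W2_square transport_cost_proj using cost_nonneg by simp

lemma W2_proj_le: "(W2 (atomic I m z) proj)\<^sup>2 \<le> (\<Sum>i\<in>I. m i * ((z i - \<beta> i)\<^sup>2 + (m i)\<^sup>2 / 12))"
  unfolding W2_square by (rule enn2real_leI[OF _ transport_cost_proj_le]) (auto intro!: sum_nonneg mult_nonneg_nonneg less_imp_le[OF mpos])

lemma INF_W2: "(INF \<sigma>\<in>K_set {a..b}. (W2 (atomic I m x) \<sigma>)\<^sup>2) = cost"
  by (rule cInf_eq_minimum) (use W2_proj proj_in_K W2_ge in force)+

lemma INF_W2_le: "(INF \<sigma>\<in>K_set {a..b}. (W2 (atomic I m z) \<sigma>)\<^sup>2) \<le> (\<Sum>i\<in>I. m i * ((z i - \<beta> i)\<^sup>2 + (m i)\<^sup>2 / 12))"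
proof (rule order_trans[OF _ W2_proj_le])
  show "(INF \<sigma>\<in>K_set {a..b}. (W2 (atomic I m z) \<sigma>)\<^sup>2) \<le> (W2 (atomic I m z) proj)\<^sup>2"
    by (rule cINF_lower[OF _ proj_in_K]) (auto intro!: bdd_belowI2[where m=0])
qed

end

context packing
begin

text \<open>
  Equality in the duality forces \<open>g = 1\<close> wherever the potential is positive, in particular on all blocks. As
  the blocks have total mass one, nothing is left outside them.
\<close>

lemma optimal_coupling:
  assumes \<sigma>: "\<sigma> \<in> K_set {a..b}" and \<pi>: "\<pi> \<in> couplings (atomic I m x) \<sigma>"
    and opt: "(\<integral>\<^sup>+z. ennreal ((fst z - snd z)\<^sup>2) \<partial>\<pi>) \<le> ennreal cost"
  shows "\<sigma> = proj" and "AE z in \<pi>. uval (fst z) - Pot (snd z) = (fst z - snd z)\<^sup>2"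
    and "AE z in \<pi>. fst z \<in> x ` I"
proof -
  from K_setE[OF \<sigma>] obtain g where g: "g \<in> borel_measurable borel" "\<And>y. 0 \<le> g y" "\<And>y. g y \<le> 1"
    "\<And>y. y \<notin> {a..b} \<Longrightarrow> g y = 0" and sg: "\<sigma> = density lborel (\<lambda>y. ennreal (g y))"
    and g1: "(\<integral>\<^sup>+y. ennreal (g y) \<partial>lborel) = 1" and gi: "integrable lborel g" "integral\<^sup>L lborel g = 1" by metis
  note [measurable] = g(1)
  have g4: "\<forall>y. y \<notin> {a..b} \<longrightarrow> g y = 0" using g(4) by blast
  note D = coupling_duality[OF \<pi>[unfolded sg] g(1,2,3) g4 g1]
  show "AE z in \<pi>. fst z \<in> x ` I" by (rule D(6))
  have n1: "AE z in \<pi>. 0 \<le> (fst z - snd z)\<^sup>2 - (uval (fst z) - Pot (snd z))"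
    using D(2) by eventually_elim simp
  have n2: "AE y in lborel. 0 \<le> Pot y * (indicator {a..b} y - g y)"
  proof (rule AE_I2)
    fix y show "0 \<le> Pot y * (indicator {a..b} y - g y)"
      using g(3)[of y] g(4)[of y] by (intro mult_nonneg_nonneg Pot_nonneg) (auto simp: indicator_def)
  qed
  have "ennreal (\<integral>z. (fst z - snd z)\<^sup>2 \<partial>\<pi>) \<le> ennreal cost"
    using opt D(1) by (subst (asm) nn_integral_eq_integral) auto
  then have "(\<integral>z. (fst z - snd z)\<^sup>2 \<partial>\<pi>) \<le> cost" using cost_nonneg by (simp add: ennreal_le_iff)
  then have z: "(\<integral>z. (fst z - snd z)\<^sup>2 - (uval (fst z) - Pot (snd z)) \<partial>\<pi>) = 0"
    "(\<integral>y. Pot y * (indicator {a..b} y - g y) \<partial>lborel) = 0"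
    using D(3) integral_nonneg_AE[OF n1] integral_nonneg_AE[OF n2] by auto
  have "AE z in \<pi>. (fst z - snd z)\<^sup>2 - (uval (fst z) - Pot (snd z)) = 0"
    using z(1) integral_nonneg_eq_0_iff_AE[OF D(4) n1] by simp
  then show "AE z in \<pi>. uval (fst z) - Pot (snd z) = (fst z - snd z)\<^sup>2"
    by eventually_elim simp
  have e: "AE y in lborel. Pot y * (indicator {a..b} y - g y) = 0"
    using z(2) integral_nonneg_eq_0_iff_AE[OF D(5) n2] by simp
  have ge: "AE y in lborel. 0 \<le> g y - rho y"
    using e
  proof eventually_elim
    case (elim y)
    show ?case
    proof (cases "\<exists>i\<in>I. y \<in> cell i")
      case True
      then obtain i where i: "i \<in> I" "y \<in> cell i" by auto
      then have "indicator {a..b} y - g y = 0" using elim Pot_cell_pos[OF i] by simp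
      moreover have "y \<in> {a..b}" using i cell_sub by blast
      ultimately show ?thesis using rho_cell[OF i] by simp
    next
      case False
      then have "rho y = 0" by (intro rho_outside) auto
      then show ?thesis using g(2)[of y] by simp
    qed
  qed
  from K_setE[OF proj_in_K] obtain r where r: "r \<in> borel_measurable borel" "\<And>y. 0 \<le> r y" "proj = density lborel (\<lambda>y. ennreal (r y))"
    by metis
  have "(\<integral>\<^sup>+y. ennreal (rho y) \<partial>lborel) = 1"
    using prob_space.emeasure_space_1[of proj] proj_in_K by (simp add: K_set_def P_ac_def proj_def emeasure_density)
  then have ri: "integrable lborel rho" "integral\<^sup>L lborel rho = 1"
    using rho_01(1) by (auto intro!: integrableI_nonneg simp: integral_eq_nn_integral)
  have "integral\<^sup>L lborel (\<lambda>y. g y - rho y) = 0" using gi ri by simp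
  then have "AE y in lborel. g y - rho y = 0"
    using integral_nonneg_eq_0_iff_AE[OF _ ge] gi ri by simp
  then have "AE y in lborel. ennreal (g y) = ennreal (rho y)" by eventually_elim simp
  then show "\<sigma> = proj" unfolding sg proj_def by (intro density_cong) auto
qed

text \<open>
  On the block of \<open>i\<close>, equality in the duality relation holds only for the atom \<open>x i\<close>, by the strict inequality
  \<open>cert_gt_other_cell\<close>.
\<close>

lemma projection_unique:
  assumes "is_projection {a..b} (atomic I m x) \<sigma>"
    and S: "is_optimal_map \<sigma> (atomic I m x) S"
  shows "\<sigma> = proj" and "AE y in proj. \<exists>i\<in>I. y \<in> cell i \<and> S y = x i"
proof -
  have \<sigma>: "\<sigma> \<in> K_set {a..b}" and le: "(W2 (atomic I m x) \<sigma>)\<^sup>2 \<le> (W2 (atomic I m x) proj)\<^sup>2"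
    using assms(1) proj_in_K by (auto simp: is_projection_def)
  have ss: "sets \<sigma> = sets borel" using \<sigma> by (simp add: K_set_def P_ac_def)
  have Sm[measurable]: "S \<in> borel_measurable \<sigma>" and d: "distr \<sigma> borel S = atomic I m x"
    and o: "(\<integral>\<^sup>+ x. ennreal ((x - S x)\<^sup>2) \<partial>\<sigma>) = transport_cost \<sigma> (atomic I m x)"
    using S by (auto simp: is_optimal_map_def measurable_cong_sets[OF ss refl])
  have idm[measurable]: "(\<lambda>y. y) \<in> borel_measurable \<sigma>" by (simp add: measurable_cong_sets[OF ss refl])
  have tc: "transport_cost (atomic I m x) \<sigma> \<le> ennreal cost"
    using le transport_cost_atomic_K_finite[OF \<sigma>, of x] unfolding W2_square W2_proj[unfolded W2_square]
    by (cases "transport_cost (atomic I m x) \<sigma>") (auto intro: ennreal_leI)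
  let ?\<pi> = "distr \<sigma> borel (\<lambda>y. (S y, y))"
  have id: "distr \<sigma> borel (\<lambda>y. y) = \<sigma>" using ss by (simp add: distr_id2)
  have \<pi>: "?\<pi> \<in> couplings (atomic I m x) \<sigma>"
    using distr_coupling(1)[OF Sm idm] by (simp add: d id)
  have c: "(\<integral>\<^sup>+ z. ennreal ((fst z - snd z)\<^sup>2) \<partial>?\<pi>) \<le> ennreal cost"
    unfolding distr_coupling(2)[OF Sm idm] using o tc
    by (simp add: power2_commute transport_cost_commute)
  note O = optimal_coupling[OF \<sigma> \<pi> c]
  show eq: "\<sigma> = proj" by (rule O(1))
  have m: "(\<lambda>y. (S y, y)) \<in> borel_measurable \<sigma>" unfolding borel_prod[symmetric] by measurable
  have A1: "AE y in \<sigma>. uval (S y) - Pot y = (S y - y)\<^sup>2"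
    using AE_distrD[OF m O(2)] by simp
  have A2: "AE y in \<sigma>. S y \<in> x ` I"
    using AE_distrD[OF m O(3)] by simp
  have A3: "AE y in \<sigma>. 0 < rho y"
    unfolding eq proj_def by (subst AE_density) auto
  have "AE y in \<sigma>. \<exists>i\<in>I. y \<in> cell i \<and> S y = x i"
    using A1 A2 A3
  proof eventually_elim
    case (elim y)
    from elim(3) obtain j where j: "j \<in> I" "y \<in> cell j" using rho_outside[of y] by force
    from elim(2) obtain i where i: "i \<in> I" "S y = x i" by auto
    have "cert i y = cert i (\<beta> i)" using elim(1) by (simp add: i uval_x cert_Pot)
    then have "i = j" using cert_gt_other_cell[OF i(1) j(1)] j(2) by (force simp: cell_def)
    then show ?case using i j by auto
  qed
  then show "AE y in proj. \<exists>i\<in>I. y \<in> cell i \<and> S y = x i" unfolding eq .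
qed

lemma first_moment_cell:
  assumes "i \<in> I"
  shows "has_bochner_integral lborel (\<lambda>y. y * indicator (cell i) y) (m i * \<beta> i)"
proof -
  have 1: "has_bochner_integral lborel (\<lambda>y. y * indicator {l i..l i + m i} y) ((l i + m i)\<^sup>2/2 - (l i)\<^sup>2/2)"
    by (rule has_bochner_integral_FTC_Icc_real)
       (use mpos[OF assms] in \<open>auto intro!: derivative_eq_intros\<close>)
  have "AE y in lborel. y \<noteq> l i" "AE y in lborel. y \<noteq> l i + m i" by (rule AE_lborel_singleton)+
  then have 2: "AE y in lborel. y * indicator {l i..l i + m i} y = y * indicator (cell i) y"
    by eventually_elim (auto simp: cell_def indicator_def)
  have 3: "(l i + m i)\<^sup>2/2 - (l i)\<^sup>2/2 = m i * \<beta> i" by (simp add: power2_eq_square field_simps)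
  show ?thesis
    using has_bochner_integral_cong_AE[THEN iffD1, OF _ _ 2 1] by (auto simp: 3 cell_def)
qed

text \<open>
  The preimage of \<open>x i\<close> under the optimal map is, up to a null set of the projection, the block of \<open>i\<close>.
\<close>

lemma barycenter_eq:
  assumes "is_projection {a..b} (atomic I m x) \<sigma>"
    and S: "is_optimal_map \<sigma> (atomic I m x) S" and i: "i \<in> I"
  shows "(LINT y:(S -` {x i} \<inter> {a..b})|\<sigma>. y) / measure \<sigma> (S -` {x i} \<inter> {a..b}) = \<beta> i"
proof -
  note P = projection_unique[OF assms(1) S]
  define A where "A = S -` {x i} \<inter> {a..b}"
  have Sm[measurable]: "S \<in> borel_measurable borel" using S by (simp add: is_optimal_map_def)
  have Am[measurable]: "A \<in> sets borel" 
    using measurable_sets[OF Sm, of "{x i}"] by (simp add: A_def)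
  have cm[measurable]: "cell i \<in> sets borel" by (simp add: cell_def)
  have sp[measurable_cong]: "sets proj = sets borel" by (simp add: proj_def)
  have AE: "AE y in proj. y \<in> A \<longleftrightarrow> y \<in> cell i"
    using P(2)
  proof eventually_elim
    case (elim y)
    then obtain j where j: "j \<in> I" "y \<in> cell j" "S y = x j" by auto
    show ?case
    proof
      assume "y \<in> A"
      then have "x j = x i" using j by (simp add: A_def)
      then have "j = i" using inj i j by (auto simp: inj_on_def)
      then show "y \<in> cell i" using j by simp
    next
      assume "y \<in> cell i"
      then have "j = i" using cells_disjoint j i by (auto simp: cell_def)
      then show "y \<in> A" using j cell_sub[of i] by (auto simp: A_def)
    qed
  qed
  have "measure proj A = measure proj (cell i)"
    using AE by (intro measure_eq_AE) auto
  also have "emeasure proj (cell i) = ennreal (m i)"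
  proof -
    have "emeasure proj (cell i) = (\<integral>\<^sup>+y. indicator (cell i) y \<partial>lborel)"
      unfolding proj_def
    proof (subst emeasure_density)
      have "ennreal (rho y) * indicator (cell i) y = indicator (cell i) y" for y
        using rho_cell[OF i, of y] by (auto simp: indicator_def)
      then show "(\<integral>\<^sup>+y. ennreal (rho y) * indicator (cell i) y \<partial>lborel) = (\<integral>\<^sup>+y. indicator (cell i) y \<partial>lborel)" by simp
    qed auto
    then show ?thesis using emeasure_cell[OF i] by simp
  qed
  then have "measure proj (cell i) = m i" using mpos[OF i] by (simp add: measure_def)
  finally have M: "measure proj A = m i" .
  have "(LINT y:A|proj. y) = (\<integral>y. indicator (cell i) y * y \<partial>proj)"
    unfolding set_lebesgue_integral_def
    using AE by (intro integral_cong_AE) (auto elim!: eventually_mono simp: indicator_def)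
  also have "\<dots> = (\<integral>y. rho y *\<^sub>R (indicator (cell i) y * y) \<partial>lborel)"
    unfolding proj_def by (rule integral_density) (auto simp: rho_01)
  also have "\<dots> = (\<integral>y. y * indicator (cell i) y \<partial>lborel)"
    by (intro Bochner_Integration.integral_cong) (auto simp: indicator_def rho_cell[OF i])
  also have "\<dots> = m i * \<beta> i" using first_moment_cell[OF i] by (simp add: has_bochner_integral_iff)
  finally have "(LINT y:A|proj. y) = m i * \<beta> i" .
  then show ?thesis using M mpos[OF i] unfolding P(1) A_def by simp
qed

end

section \<open>Both forms of the particle system give the same velocities\<close>

lemma empirical_permute:
  assumes N: "0 < N" and p: "p permutes {..<N}"
  shows "empirical N (\<lambda>k. Y (p k)) = empirical N Y"
proof (rule measure_eqI)
  fix A assume "A \<in> sets (empirical N (\<lambda>k. Y (p k)))"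
  then have A: "A \<in> sets borel" by (simp add: empirical_def)
  show "emeasure (empirical N (\<lambda>k. Y (p k))) A = emeasure (empirical N Y) A"
    unfolding empirical_eq_atomic[OF N] emeasure_atomic[OF finite_lessThan A]
    using sum.permute[OF p, of "\<lambda>i. ennreal (1 / real N) * indicator A (Y i)"] by (simp add: comp_def)
qed (simp add: empirical_def)

lemma energy_permute:
  assumes N: "0 < N" and p: "p permutes {..<N}"
  shows "energy \<Omega> V \<epsilon> N (\<lambda>k. Y (p k)) = energy \<Omega> V \<epsilon> N Y"
  unfolding energy_def empirical_permute[OF N p]
  using sum.permute[OF p, of "\<lambda>i. V (Y i)"] by (simp add: comp_def)

text \<open>
  The energy is symmetric under permutations of the particles, in particular under exchange of two coinciding ones.
\<close>

lemma gradient_tie_eq: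
  assumes N: "0 < N" and g: "has_gradient N (energy \<Omega> V \<epsilon> N) g X"
    and ij: "i < N" "j < N" "X i = X j"
  shows "g i = g j"
proof (rule ccontr)
  assume ne: "g i \<noteq> g j"
  define e where "e = \<bar>g i - g j\<bar> / 4"
  have e: "0 < e" using ne by (simp add: e_def)
  let ?F = "energy \<Omega> V \<epsilon> N"
  obtain d where d: "0 < d" and D: "\<And>Y. L2_set (\<lambda>i. Y i - X i) {..<N} < d \<Longrightarrow>
     \<bar>?F Y - ?F X - (\<Sum>i<N. g i * (Y i - X i))\<bar> \<le> e * L2_set (\<lambda>i. Y i - X i) {..<N}"
    using g e unfolding has_gradient_def by blast
  define t where "t = d / 2"
  have t: "0 < t" "t < d" using d by (auto simp: t_def)
  define Y where "Y = (\<lambda>k n. X n + (if n = k then t else 0))"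
  have L: "L2_set (\<lambda>n. Y k n - X n) {..<N} = t" if "k < N" for k
  proof -
    have "(\<Sum>n<N. (Y k n - X n)\<^sup>2) = (\<Sum>n<N. if n = k then t\<^sup>2 else 0)" by (intro sum.cong) (auto simp: Y_def)
    then show ?thesis using that t by (simp add: L2_set_def)
  qed
  have G: "(\<Sum>n<N. g n * (Y k n - X n)) = g k * t" if "k < N" for k
  proof -
    have "(\<Sum>n<N. g n * (Y k n - X n)) = (\<Sum>n<N. if n = k then g k * t else 0)" by (intro sum.cong) (auto simp: Y_def)
    then show ?thesis using that by simp
  qed
  have "Transposition.transpose i j permutes {..<N}" using ij by (intro permutes_swap_id) auto
  moreover have "(\<lambda>n. Y i (Transposition.transpose i j n)) = Y j"
  proof
    fix n
    show "Y i (Transposition.transpose i j n) = Y j n"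
      using ij(3) by (cases "n = i"; cases "n = j") (simp_all add: Y_def)
  qed
  ultimately have "?F (Y j) = ?F (Y i)" using energy_permute[OF N, of _ \<Omega> V \<epsilon> "Y i"] by metis
  then have "\<bar>g i * t - g j * t\<bar> \<le> 2 * e * t"
    using D[of "Y i"] D[of "Y j"] ij t by (simp add: L G)
  then have "\<bar>g i - g j\<bar> * t \<le> (2 * e) * t" using t by (simp add: abs_mult flip: left_diff_distrib)
  then have "\<bar>g i - g j\<bar> \<le> 2 * e" using t by simp
  then show False using e by (simp add: e_def)
qed

text \<open>
  A differentiable function which is bounded below by \<open>- o(|t|)\<close> on both sides has a critical point at zero.
\<close>

lemma derivative_zero_of_lower_bound:
  fixes \<phi> :: "real \<Rightarrow> real"
  assumes der: "(\<phi> has_real_derivative s) (at 0)" and 0: "\<phi> 0 = 0"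
    and lb: "\<And>e. 0 < e \<Longrightarrow> \<exists>d>0. \<forall>t. \<bar>t\<bar> < d \<longrightarrow> - e * \<bar>t\<bar> \<le> \<phi> t"
  shows "s = 0"
proof (rule ccontr)
  assume s: "s \<noteq> 0"
  define e where "e = \<bar>s\<bar> / 4"
  have e: "0 < e" using s by (simp add: e_def)
  from lb[OF e] obtain d1 where d1: "0 < d1" "\<And>t. \<bar>t\<bar> < d1 \<Longrightarrow> - e * \<bar>t\<bar> \<le> \<phi> t" by auto
  have "((\<lambda>h. (\<phi> (0 + h) - \<phi> 0) / h) \<longlongrightarrow> s) (at 0)" using der by (simp add: DERIV_def)
  then have "\<exists>d>0. \<forall>h. h \<noteq> 0 \<and> \<bar>h\<bar> < d \<longrightarrow> \<bar>\<phi> h / h - s\<bar> < e"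
    using e by (auto simp: LIM_def 0 dist_real_def)
  then obtain d2 where d2: "0 < d2" "\<And>h. h \<noteq> 0 \<Longrightarrow> \<bar>h\<bar> < d2 \<Longrightarrow> \<bar>\<phi> h / h - s\<bar> < e" by auto
  define r where "r = min d1 d2 / 2"
  have r: "0 < r" "r < d1" "r < d2" using d1 d2 by (auto simp: r_def)
  define h where "h = - sgn s * r"
  have h: "h \<noteq> 0" "\<bar>h\<bar> = r" using s r by (auto simp: h_def abs_mult sgn_if)
  have "\<bar>\<phi> h / h - s\<bar> < e" "- e * r \<le> \<phi> h" using d1(2)[of h] d2(2)[of h] h r by auto
  moreover have "\<phi> h = h * (\<phi> h / h)" using h by simp
  moreover have "h * (\<phi> h / h) < - e * r"
  proof (cases "s > 0")
    case True
    then have "\<phi> h / h > e" using \<open>\<bar>\<phi> h / h - s\<bar> < e\<close> unfolding e_def by linarith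
    then have "r * e < r * (\<phi> h / h)" using r by (intro mult_strict_left_mono) auto
    then show ?thesis using True by (simp add: h_def mult.commute)
  next
    case False
    then have "s < 0" using s by simp
    then have "\<phi> h / h < - e" using \<open>\<bar>\<phi> h / h - s\<bar> < e\<close> unfolding e_def by linarith
    then have "r * (\<phi> h / h) < r * (- e)" using r by (intro mult_strict_left_mono) auto
    then show ?thesis using \<open>s < 0\<close> by (simp add: h_def mult.commute)
  qed
  ultimately show False by simp
qed

lemma packing_reps_exists:
  "0 < N \<Longrightarrow> 1 \<le> b - a \<Longrightarrow> \<exists>l. packing (reps N X) (mult N X) X a b l"
proof (rule packing_exists)
  show "0 < mult N X i" if "i \<in> reps N X" for i using that reps_sub by (intro mult_pos) auto
qed (simp_all add: finite_reps inj_reps mult_sum)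

lemma energy_eq:
  assumes N: "0 < N" and P: "packing (reps N X) (mult N X) X a b l"
  shows "energy {a..b} V (1 / real N) N X = (\<Sum>i\<in>reps N X. mult N X i * V (X i)) + real N / 2 * packing.cost (reps N X) (mult N X) X l"
proof -
  have "(\<Sum>i<N. 1 / real N * V (X i)) = (\<Sum>i\<in>reps N X. mult N X i * V (X i))"
    by (rule sum_reps) simp
  moreover have "empirical N X = atomic (reps N X) (mult N X) X" by (rule empirical_eq_reps[OF N])
  ultimately show ?thesis unfolding energy_def using packing.INF_W2[OF P] by (simp add: sum_distrib_left)
qed

text \<open>
  Moving only the atoms and keeping the packing of \<open>X\<close> as competitor bounds the energy from above, with equality at
  \<open>Y = X\<close>; the bound is a smooth function of \<open>Y\<close>. Since \<open>Y\<close> is constant on ties of \<open>X\<close>, the packing still has matching masses.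
\<close>

lemma energy_le:
  assumes N: "0 < N" and P: "packing (reps N X) (mult N X) X a b l"
    and Y: "\<And>i j. i < N \<Longrightarrow> j < N \<Longrightarrow> X i = X j \<Longrightarrow> Y i = Y j"
  shows "energy {a..b} V (1 / real N) N Y \<le> (\<Sum>i\<in>reps N X. mult N X i * V (Y i)) +
    real N / 2 * (\<Sum>i\<in>reps N X. mult N X i * ((Y i - (l i + mult N X i / 2))\<^sup>2 + (mult N X i)\<^sup>2 / 12))"
proof -
  have "(\<Sum>i<N. 1 / real N * V (Y i)) = (\<Sum>i\<in>reps N X. mult N X i * V (Y i))"
  proof (rule sum_reps)
    show "V (Y i) = V (Y j)" if "i < N" "j < N" "X i = X j" for i j using Y[OF that] by simp
  qed
  moreover have "empirical N Y = atomic (reps N X) (mult N X) Y" by (rule empirical_eq_reps[OF N Y])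
  moreover have "real N / 2 * (INF \<sigma>\<in>K_set {a..b}. (W2 (atomic (reps N X) (mult N X) Y) \<sigma>)\<^sup>2) \<le>
     real N / 2 * (\<Sum>i\<in>reps N X. mult N X i * ((Y i - (l i + mult N X i / 2))\<^sup>2 + (mult N X i)\<^sup>2 / 12))"
    by (intro mult_left_mono packing.INF_W2_le[OF P]) simp
  ultimately show ?thesis unfolding energy_def by (simp add: sum_distrib_left)
qed

text \<open>
  The energy is not known to be differentiable, but if it is, then it touches from below the smooth upper bound
  \<open>energy_le\<close>, so that both have the same derivative when all particles at one position are moved together. With the
  equality of the gradient components on ties this determines the gradient, which is the one of the
  barycenter equation.
\<close>

lemma velocity_eq:
  fixes V :: "real \<Rightarrow> real"
  assumes N: "0 < N" and P: "packing (reps N X) (mult N X) X a b l"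
    and V: "\<And>x. (V has_real_derivative deriv V x) (at x)"
    and v: "(\<exists>g. has_gradient N (energy {a..b} V (1 / real N) N) g X \<and> (\<forall>i<N. (1 / real N) * v i = - g i)) \<or>
      (\<exists>\<beta>. is_barycenters {a..b} N X \<beta> \<and> (\<forall>i<N. v i = - deriv V (X i) + (1 / (1 / real N)) * (\<beta> i - X i)))"
    and i: "i < N" "r \<in> reps N X" "X i = X r"
  shows "v i = - deriv V (X r) - real N * (X r - (l r + mult N X r / 2))"
  using v
proof (elim disjE exE conjE)
  fix \<beta> assume b: "is_barycenters {a..b} N X \<beta>" and v: "\<forall>i<N. v i = - deriv V (X i) + (1 / (1 / real N)) * (\<beta> i - X i)"
  then obtain \<sigma> S where S: "is_projection {a..b} (empirical N X) \<sigma>" "is_optimal_map \<sigma> (empirical N X) S"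
    and b: "\<forall>i<N. \<beta> i = (LINT x:(S -` {X i} \<inter> {a..b})|\<sigma>. x) / measure \<sigma> (S -` {X i} \<inter> {a..b})"
    unfolding is_barycenters_def by blast
  have e: "empirical N X = atomic (reps N X) (mult N X) X" by (rule empirical_eq_reps[OF N]) simp
  have "\<beta> i = l r + mult N X r / 2"
    using b i(1) packing.barycenter_eq[OF P S[unfolded e] i(2)] by (simp add: i(3))
  then have "v i = - deriv V (X r) + (1 / (1 / real N)) * (l r + mult N X r / 2 - X r)"
    using v i by simp
  then show ?thesis by (simp add: algebra_simps)
next
  fix g assume g: "has_gradient N (energy {a..b} V (1 / real N) N) g X" and v: "\<forall>i<N. (1 / real N) * v i = - g i"
  let ?F = "energy {a..b} V (1 / real N) N"
  define G where "G = {j. j < N \<and> X j = X r}"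
  have rN: "r < N" using i(2) reps_sub by auto
  have finG: "finite G" and rG: "r \<in> G" using rN by (auto simp: G_def)
  define k where "k = real (card G)"
  have k: "0 < k" using finG rG by (auto simp: k_def card_gt_0_iff)
  have mk: "mult N X r = k / real N" by (simp add: mult_def k_def G_def)
  let ?\<beta> = "l r + mult N X r / 2"
  define \<phi> where "\<phi> = (\<lambda>t. mult N X r * (V (X r + t) - V (X r) + real N / 2 * ((X r + t - ?\<beta>)\<^sup>2 - (X r - ?\<beta>)\<^sup>2)) - t * (k * g r))"
  have "mult N X r * (deriv V (X r) + real N * (X r - ?\<beta>)) - k * g r = 0"
  proof (rule derivative_zero_of_lower_bound)
    have "((\<lambda>t. V (X r + t)) has_real_derivative deriv V (X r)) (at 0)"
      using V[of "X r"] DERIV_at_within_shift[of V "deriv V (X r)" "X r" 0 UNIV] by (simp add: add.commute)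
    then show "(\<phi> has_real_derivative mult N X r * (deriv V (X r) + real N * (X r - ?\<beta>)) - k * g r) (at 0)"
      unfolding \<phi>_def by (auto intro!: derivative_eq_intros simp: field_simps)
    show "\<phi> 0 = 0" by (simp add: \<phi>_def)
    fix e :: real assume e: "0 < e"
    define e' where "e' = e / sqrt k"
    have e': "0 < e'" using e k by (simp add: e'_def)
    obtain d where d: "0 < d" and D: "\<And>Y. L2_set (\<lambda>i. Y i - X i) {..<N} < d \<Longrightarrow>
       \<bar>?F Y - ?F X - (\<Sum>i<N. g i * (Y i - X i))\<bar> \<le> e' * L2_set (\<lambda>i. Y i - X i) {..<N}"
      using g e' unfolding has_gradient_def by blast
    show "\<exists>d>0. \<forall>t. \<bar>t\<bar> < d \<longrightarrow> - e * \<bar>t\<bar> \<le> \<phi> t"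
    proof (intro exI[of _ "d / sqrt k"] conjI allI impI)
      show "0 < d / sqrt k" using d k by simp
      fix t assume t: "\<bar>t\<bar> < d / sqrt k"
      define Y where "Y = (\<lambda>n. X n + (if X n = X r then t else 0))"
      have "(\<Sum>n<N. (Y n - X n)\<^sup>2) = (\<Sum>n<N. if X n = X r then t\<^sup>2 else 0)" by (intro sum.cong) (auto simp: Y_def)
      also have "\<dots> = k * t\<^sup>2" by (simp add: sum.If_cases k_def G_def lessThan_def Int_def)
      finally have L: "L2_set (\<lambda>n. Y n - X n) {..<N} = sqrt k * \<bar>t\<bar>" by (simp add: L2_set_def real_sqrt_mult)
      have "(\<Sum>n<N. g n * (Y n - X n)) = (\<Sum>n<N. if X n = X r then g r * t else 0)"
        using gradient_tie_eq[OF N g _ rN] by (intro sum.cong) (auto simp: Y_def)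
      also have "\<dots> = t * (k * g r)" by (simp add: sum.If_cases k_def G_def lessThan_def Int_def)
      finally have Gs: "(\<Sum>n<N. g n * (Y n - X n)) = t * (k * g r)" .
      have "\<bar>?F Y - ?F X - t * (k * g r)\<bar> \<le> e' * (sqrt k * \<bar>t\<bar>)"
      proof -
        have "L2_set (\<lambda>n. Y n - X n) {..<N} < d" unfolding L using t k by (simp add: field_simps)
        from D[OF this] show ?thesis unfolding L Gs .
      qed
      then have 1: "- e * \<bar>t\<bar> \<le> ?F Y - ?F X - t * (k * g r)" using k by (simp add: e'_def)
      let ?m = "mult N X" and ?R = "reps N X"
      have "?F Y - ?F X \<le> (\<Sum>i\<in>?R. ?m i * V (Y i)) + real N / 2 * (\<Sum>i\<in>?R. ?m i * ((Y i - (l i + ?m i / 2))\<^sup>2 + (?m i)\<^sup>2 / 12))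
         - ((\<Sum>i\<in>?R. ?m i * V (X i)) + real N / 2 * (\<Sum>i\<in>?R. ?m i * ((X i - (l i + ?m i / 2))\<^sup>2 + (?m i)\<^sup>2 / 12)))"
        using energy_le[OF N P, of Y V] energy_eq[OF N P, of V] by (auto simp: Y_def packing.cost_def[OF P])
      also have "\<dots> = (\<Sum>i\<in>?R. (?m i * V (Y i) + real N / 2 * (?m i * ((Y i - (l i + ?m i / 2))\<^sup>2 + (?m i)\<^sup>2 / 12)))
         - (?m i * V (X i) + real N / 2 * (?m i * ((X i - (l i + ?m i / 2))\<^sup>2 + (?m i)\<^sup>2 / 12))))"
        by (simp add: sum.distrib sum_subtractf sum_distrib_left)
      also have "\<dots> = (\<Sum>i\<in>?R. if i = r then \<phi> t + t * (k * g r) else 0)"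
      proof (intro sum.cong refl)
        fix n assume n: "n \<in> ?R"
        have "X n = X r \<longleftrightarrow> n = r" using inj_reps[of X N] n i(2) by (auto simp: inj_on_def)
        then show "(?m n * V (Y n) + real N / 2 * (?m n * ((Y n - (l n + ?m n / 2))\<^sup>2 + (?m n)\<^sup>2 / 12)))
         - (?m n * V (X n) + real N / 2 * (?m n * ((X n - (l n + ?m n / 2))\<^sup>2 + (?m n)\<^sup>2 / 12)))
          = (if n = r then \<phi> t + t * (k * g r) else 0)"
          by (cases "n = r") (simp_all add: Y_def \<phi>_def algebra_simps)
      qed
      also have "\<dots> = \<phi> t + t * (k * g r)" using i(2) finite_reps by simp
      finally show "- e * \<bar>t\<bar> \<le> \<phi> t" using 1 by simp
    qed
  qed
  then have "k * (deriv V (X r) + real N * (X r - ?\<beta>)) = k * (real N * g r)"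
    using N by (simp add: mk field_simps)
  then have "deriv V (X r) + real N * (X r - ?\<beta>) = real N * g r" using k by simp
  moreover have "g i = g r" by (rule gradient_tie_eq[OF N g i(1) rN i(3)])
  moreover have "v i = - real N * g i" using v i N by (auto simp: field_simps)
  ultimately show ?thesis by simp
qed

section \<open>Flows of packed particles and energy dissipation\<close>

lemma (in packing) best_approximation:
  assumes k: "feasible I m x a b k"
  shows "(\<Sum>i\<in>I. m i * (x i - \<beta> i)\<^sup>2) \<le> (\<Sum>i\<in>I. m i * (x i - (k i + m i / 2))\<^sup>2)"
proof -
  have "(\<Sum>i\<in>I. m i * (x i - (k i + m i / 2))\<^sup>2)
     = (\<Sum>i\<in>I. m i * (x i - \<beta> i)\<^sup>2 - 2 * (m i * (x i - \<beta> i) * (k i - l i)) + m i * (k i - l i)\<^sup>2)"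
    by (intro sum.cong refl) (simp add: power2_eq_square field_simps)
  also have "\<dots> = (\<Sum>i\<in>I. m i * (x i - \<beta> i)\<^sup>2) - 2 * (\<Sum>i\<in>I. m i * (x i - \<beta> i) * (k i - l i)) + (\<Sum>i\<in>I. m i * (k i - l i)\<^sup>2)"
    by (simp add: sum.distrib sum_subtractf sum_distrib_left)
  finally show ?thesis using VI[OF k] sum_nonneg[of I "\<lambda>i. m i * (k i - l i)\<^sup>2"] mpos by (force intro: less_imp_le)
qed

lemma feasible_order_cong:
  assumes "\<And>i j. i \<in> I \<Longrightarrow> j \<in> I \<Longrightarrow> x i < x j \<longleftrightarrow> y i < y j"
  shows "feasible I m x a b = feasible I m y a b"
proof -
  have "mass_left I m x i = mass_left I m y i" if "i \<in> I" for i
    unfolding mass_left_def using assms that by (intro sum.cong) auto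
  then show ?thesis unfolding feasible_def using assms by (simp cong: ball_cong)
qed

text \<open>
  The nearest point projection onto a convex set is nonexpansive. The order of the points enters as the feasible set
  depends on it.
\<close>

lemma projection_nonexpansive:
  assumes P: "packing I m x a b l" and Q: "packing I m y a b k"
    and ord: "\<And>i j. i \<in> I \<Longrightarrow> j \<in> I \<Longrightarrow> x i < x j \<longleftrightarrow> y i < y j"
  shows "(\<Sum>i\<in>I. m i * (k i - l i)\<^sup>2) \<le> (\<Sum>i\<in>I. m i * (y i - x i)\<^sup>2)"
proof -
  interpret P: packing I m x a b l by fact
  interpret Q: packing I m y a b k by fact
  have f: "feasible I m x a b = feasible I m y a b" using ord by (rule feasible_order_cong)
  have 1: "(\<Sum>i\<in>I. m i * (x i - (l i + m i / 2)) * (k i - l i)) \<le> 0" using Q.feas f by (intro P.VI) simp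
  have 2: "(\<Sum>i\<in>I. m i * (y i - (k i + m i / 2)) * (l i - k i)) \<le> 0" using P.feas f by (intro Q.VI) simp
  have "(\<Sum>i\<in>I. m i * (k i - l i)\<^sup>2) - (\<Sum>i\<in>I. m i * (y i - x i)\<^sup>2)
     = (\<Sum>i\<in>I. m i * (k i - l i)\<^sup>2 - m i * (y i - x i)\<^sup>2)" by (simp add: sum_subtractf)
  also have "\<dots> \<le> (\<Sum>i\<in>I. 2 * (m i * (x i - (l i + m i / 2)) * (k i - l i)) + 2 * (m i * (y i - (k i + m i / 2)) * (l i - k i)))"
  proof (intro sum_mono)
    fix i assume "i \<in> I"
    then have m: "0 < m i" by (rule P.mpos)
    have "2 * (m i * (x i - (l i + m i / 2)) * (k i - l i)) + 2 * (m i * (y i - (k i + m i / 2)) * (l i - k i))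
       - (m i * (k i - l i)\<^sup>2 - m i * (y i - x i)\<^sup>2) = m i * ((y i - x i) - (k i - l i))\<^sup>2"
      by (simp add: power2_eq_square field_simps)
    moreover have "0 \<le> m i * ((y i - x i) - (k i - l i))\<^sup>2" using m by simp
    ultimately show "m i * (k i - l i)\<^sup>2 - m i * (y i - x i)\<^sup>2 \<le> 2 * (m i * (x i - (l i + m i / 2)) * (k i - l i)) + 2 * (m i * (y i - (k i + m i / 2)) * (l i - k i))"
      by linarith
  qed
  also have "\<dots> = 2 * (\<Sum>i\<in>I. m i * (x i - (l i + m i / 2)) * (k i - l i)) + 2 * (\<Sum>i\<in>I. m i * (y i - (k i + m i / 2)) * (l i - k i))"
    by (simp add: sum.distrib sum_distrib_left)
  also have "\<dots> \<le> 0" using 1 2 by simp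
  finally show ?thesis by simp
qed

text \<open>
  A function that agrees with a differentiable one up to an error \<open>Q\<close> of second order has the same derivative.
\<close>

lemma derivative_by_comparison:
  fixes D A Q :: "real \<Rightarrow> real"
  assumes A: "(A has_real_derivative c) (at t within S)" and Q: "(Q has_real_derivative 0) (at t within S)" and Q0: "Q t = 0"
    and le: "\<And>s. s \<in> S \<Longrightarrow> \<bar>D s - D t - (A s - A t)\<bar> \<le> Q s"
  shows "(D has_real_derivative c) (at t within S)"
proof -
  have "((\<lambda>s. (Q s - Q t) / (s - t)) \<longlongrightarrow> 0) (at t within S)" using Q by (simp add: has_field_derivative_iff)
  then have q: "((\<lambda>s. \<bar>Q s / (s - t)\<bar>) \<longlongrightarrow> 0) (at t within S)" using Q0 tendsto_rabs_zero by fastforce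
  have "((\<lambda>s. (D s - D t) / (s - t) - (A s - A t) / (s - t)) \<longlongrightarrow> 0) (at t within S)"
  proof (rule Lim_null_comparison[OF _ q])
    have "\<forall>\<^sub>F s in at t within S. s \<in> S" by (simp add: eventually_at_filter)
    then show "\<forall>\<^sub>F s in at t within S. norm ((D s - D t) / (s - t) - (A s - A t) / (s - t)) \<le> \<bar>Q s / (s - t)\<bar>"
    proof eventually_elim
      case (elim s)
      have "\<bar>D s - D t - (A s - A t)\<bar> \<le> \<bar>Q s\<bar>" using le[OF elim] by linarith
      then show ?case by (simp add: abs_divide divide_right_mono flip: diff_divide_distrib)
    qed
  qed
  moreover have "((\<lambda>s. (A s - A t) / (s - t)) \<longlongrightarrow> c) (at t within S)" using A by (simp add: has_field_derivative_iff)
  ultimately have "((\<lambda>s. ((D s - D t) / (s - t) - (A s - A t) / (s - t)) + (A s - A t) / (s - t)) \<longlongrightarrow> 0 + c) (at t within S)"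
    by (rule tendsto_add)
  then show ?thesis by (simp add: has_field_derivative_iff)
qed

text \<open>
  A solution of the particle system after identification of ties. The order and the masses are constant
  in time, and \<open>ode\<close> is the equation in which the barycenters are the centers of the blocks.
\<close>

locale block_flow =
  fixes N :: nat and I :: "nat set" and m :: "nat \<Rightarrow> real" and x x' l :: "real \<Rightarrow> nat \<Rightarrow> real"
    and dV :: "real \<Rightarrow> real" and a b T :: real
  assumes N: "0 < N" and T: "0 < T" and ab: "1 \<le> b - a"
    and pack: "\<And>t. t \<in> {0..T} \<Longrightarrow> packing I m (x t) a b (l t)"
    and order: "\<And>s t i j. s \<in> {0..T} \<Longrightarrow> t \<in> {0..T} \<Longrightarrow> i \<in> I \<Longrightarrow> j \<in> I \<Longrightarrow> x s i < x s j \<Longrightarrow> x t i < x t j"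
    and deriv: "\<And>i t. i \<in> I \<Longrightarrow> t \<in> {0..T} \<Longrightarrow> ((\<lambda>s. x s i) has_real_derivative x' t i) (at t within {0..T})"
    and contx': "\<And>i. i \<in> I \<Longrightarrow> continuous_on {0..T} (\<lambda>t. x' t i)"
    and ode: "\<And>i t. i \<in> I \<Longrightarrow> t \<in> {0..T} \<Longrightarrow> x' t i = - dV (x t i) - real N * (x t i - (l t i + m i / 2))"
    and dVcont: "continuous_on UNIV dV"
    and mN: "\<And>i. i \<in> I \<Longrightarrow> 1 / real N \<le> m i"
begin

lemma T0: "0 \<in> {0..T}" using T by simp
lemma fin: "finite I" by (rule packing.fin[OF pack[OF T0]])
lemma mpos: "i \<in> I \<Longrightarrow> 0 < m i" by (rule packing.mpos[OF pack[OF T0]])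
lemma msum: "sum m I = 1" by (rule packing.msum[OF pack[OF T0]])

lemma mnonneg: "i \<in> I \<Longrightarrow> 0 \<le> m i" using mpos by (simp add: less_imp_le)

lemma contx: "i \<in> I \<Longrightarrow> continuous_on {0..T} (\<lambda>t. x t i)"
  unfolding continuous_on_eq_continuous_within by (intro ballI DERIV_continuous[OF deriv])

lemma l_eq: "i \<in> I \<Longrightarrow> t \<in> {0..T} \<Longrightarrow> l t i = x t i + (x' t i + dV (x t i)) / real N - m i / 2"
  using ode[of i t] N by (simp add: field_simps)

lemma cont_dVx: "i \<in> I \<Longrightarrow> continuous_on {0..T} (\<lambda>t. dV (x t i))"
  using continuous_on_compose2[OF dVcont contx] by blast

lemma contl: "i \<in> I \<Longrightarrow> continuous_on {0..T} (\<lambda>t. l t i)"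
proof -
  assume i: "i \<in> I"
  have "continuous_on {0..T} (\<lambda>t. x t i + (x' t i + dV (x t i)) / real N - m i / 2)"
    by (intro continuous_intros contx contx' cont_dVx i) (use N in auto)
  then show ?thesis by (rule continuous_on_eq) (use l_eq i in auto)
qed

text \<open>
  \<open>cst t\<close> is the squared Wasserstein distance of the particles at time \<open>t\<close> to \<open>K\<close>; \<open>dist2\<close> is its
  nonconstant part, the squared distance to the polyhedron of feasible centers.
\<close>

definition cst :: "real \<Rightarrow> real" where "cst t = packing.cost I m (x t) (l t)"
definition dist2 :: "real \<Rightarrow> real" where "dist2 t = (\<Sum>i\<in>I. m i * (x t i - (l t i + m i / 2))\<^sup>2)"

lemma cst_eq: "t \<in> {0..T} \<Longrightarrow> cst t = dist2 t + (\<Sum>i\<in>I. m i * ((m i)\<^sup>2 / 12))"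
  unfolding cst_def dist2_def by (subst packing.cost_def[OF pack]) (auto simp: distrib_left sum.distrib)

lemma nonexpansive:
  assumes "s \<in> {0..T}" "t \<in> {0..T}"
  shows "(\<Sum>i\<in>I. m i * (l s i - l t i)\<^sup>2) \<le> (\<Sum>i\<in>I. m i * (x s i - x t i)\<^sup>2)"
proof (rule projection_nonexpansive[OF pack[OF assms(2)] pack[OF assms(1)]])
  show "x t i < x t j \<longleftrightarrow> x s i < x s j" if "i \<in> I" "j \<in> I" for i j
    using order[OF assms(1,2) that] order[OF assms(2,1) that] by blast
qed

text \<open>
  The squared distance to a convex set is differentiable, with the derivative obtained by freezing the
  projection: using the old packing for the new points, and conversely, bounds the difference on both sides up to an error of
  second order.
\<close>

lemma deriv_dist2:
  assumes t: "t \<in> {0..T}"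
  shows "(dist2 has_real_derivative (\<Sum>i\<in>I. 2 * m i * (x t i - (l t i + m i / 2)) * x' t i)) (at t within {0..T})"
proof (rule derivative_by_comparison)
  let ?r = "\<lambda>i. x t i - (l t i + m i / 2)"
  let ?A = "\<lambda>s. \<Sum>i\<in>I. 2 * m i * ?r i * x s i"
  let ?Q = "\<lambda>s. \<Sum>i\<in>I. m i * (x s i - x t i)\<^sup>2"
  show "(?A has_real_derivative (\<Sum>i\<in>I. 2 * m i * ?r i * x' t i)) (at t within {0..T})"
    by (intro DERIV_sum DERIV_cmult deriv t)
  have "(?Q has_real_derivative (\<Sum>i\<in>I. m i * 0)) (at t within {0..T})"
  proof (intro DERIV_sum DERIV_cmult)
    fix i assume i: "i \<in> I"
    show "((\<lambda>s. (x s i - x t i)\<^sup>2) has_real_derivative 0) (at t within {0..T})"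
      by (rule derivative_eq_intros deriv[OF i t] refl | simp)+
  qed
  then show "(?Q has_real_derivative 0) (at t within {0..T})" by simp
  show "?Q t = 0" by simp
  fix s assume s: "s \<in> {0..T}"
  interpret P: packing I m "x t" a b "l t" by (rule pack[OF t])
  interpret S: packing I m "x s" a b "l s" by (rule pack[OF s])
  have f: "feasible I m (x t) a b = feasible I m (x s) a b" 
  proof (rule feasible_order_cong)
    show "x t i < x t j \<longleftrightarrow> x s i < x s j" if "i \<in> I" "j \<in> I" for i j
      using order[OF s t that] order[OF t s that] by blast
  qed
  have "dist2 s \<le> (\<Sum>i\<in>I. m i * (x s i - (l t i + m i / 2))\<^sup>2)"
    unfolding dist2_def using P.feas f by (intro S.best_approximation) simp
  also have "\<dots> = (\<Sum>i\<in>I. m i * (?r i)\<^sup>2 + (2 * m i * ?r i * x s i - 2 * m i * ?r i * x t i) + m i * (x s i - x t i)\<^sup>2)"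
    by (intro sum.cong refl) (simp add: power2_eq_square field_simps)
  finally have 1: "dist2 s - dist2 t - (?A s - ?A t) \<le> ?Q s"
    by (simp add: dist2_def sum.distrib sum_subtractf)
  have "dist2 t \<le> (\<Sum>i\<in>I. m i * (x t i - (l s i + m i / 2))\<^sup>2)"
    unfolding dist2_def using S.feas f by (intro P.best_approximation) simp
  also have "\<dots> = (\<Sum>i\<in>I. m i * (x s i - (l s i + m i / 2))\<^sup>2 - (2 * m i * ?r i * x s i - 2 * m i * ?r i * x t i)
      + (2 * (m i * (x s i - x t i) * (l s i - l t i)) - m i * (x s i - x t i)\<^sup>2))"
    by (intro sum.cong refl) (simp add: power2_eq_square field_simps)
  also have "\<dots> = dist2 s - (?A s - ?A t) + (\<Sum>i\<in>I. 2 * (m i * (x s i - x t i) * (l s i - l t i)) - m i * (x s i - x t i)\<^sup>2)"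
    by (simp add: dist2_def sum.distrib sum_subtractf)
  also have "(\<Sum>i\<in>I. 2 * (m i * (x s i - x t i) * (l s i - l t i)) - m i * (x s i - x t i)\<^sup>2) \<le> (\<Sum>i\<in>I. m i * (l s i - l t i)\<^sup>2)"
  proof (intro sum_mono)
    fix i assume "i \<in> I"
    then have "0 < m i" by (rule mpos)
    then have "0 \<le> m i * ((x s i - x t i) - (l s i - l t i))\<^sup>2" by simp
    then show "2 * (m i * (x s i - x t i) * (l s i - l t i)) - m i * (x s i - x t i)\<^sup>2 \<le> m i * (l s i - l t i)\<^sup>2"
      by (simp add: power2_eq_square field_simps)
  qed
  also have "\<dots> \<le> ?Q s" by (rule nonexpansive[OF s t])
  finally have 2: "- ?Q s \<le> dist2 s - dist2 t - (?A s - ?A t)" by simp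
  show "\<bar>dist2 s - dist2 t - (?A s - ?A t)\<bar> \<le> ?Q s" using 1 2 by linarith
qed

definition speed2 :: "real \<Rightarrow> real" where "speed2 t = (\<Sum>i\<in>I. m i * (x' t i)\<^sup>2)"

lemma cont_speed2: "continuous_on {0..T} speed2"
  unfolding speed2_def[abs_def] by (intro continuous_intros contx')

text \<open>
  The derivative of the energy along the flow is \<open>- speed2\<close>, because the velocity is minus the gradient.
\<close>

lemma dissipation:
  assumes V: "\<And>y. (V has_real_derivative dV y) (at y)" and s: "s \<in> {0..T}"
  shows "(\<Sum>i\<in>I. m i * V (x s i)) + real N / 2 * cst s + integral {0..s} speed2 = (\<Sum>i\<in>I. m i * V (x 0 i)) + real N / 2 * cst 0"
proof -
  define e where "e = (\<lambda>t. (\<Sum>i\<in>I. m i * V (x t i)) + real N / 2 * dist2 t)"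
  have de: "(e has_real_derivative - speed2 t) (at t within {0..T})" if t: "t \<in> {0..T}" for t
  proof -
    have "((\<lambda>t. V (x t i)) has_real_derivative dV (x t i) * x' t i) (at t within {0..T})" if "i \<in> I" for i
      by (rule DERIV_chain2[OF V deriv[OF that t]])
    then have "(e has_real_derivative (\<Sum>i\<in>I. m i * (dV (x t i) * x' t i)) + real N / 2 * (\<Sum>i\<in>I. 2 * m i * (x t i - (l t i + m i / 2)) * x' t i)) (at t within {0..T})"
      unfolding e_def by (intro DERIV_add DERIV_sum DERIV_cmult deriv_dist2 t)
    also have "(\<Sum>i\<in>I. m i * (dV (x t i) * x' t i)) + real N / 2 * (\<Sum>i\<in>I. 2 * m i * (x t i - (l t i + m i / 2)) * x' t i)
       = - speed2 t"
      unfolding speed2_def sum_distrib_left sum.distrib[symmetric] sum_negf[symmetric]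
    proof (intro sum.cong refl)
      fix i assume "i \<in> I"
      from ode[OF this t] have "dV (x t i) + real N * (x t i - (l t i + m i / 2)) = - x' t i" by simp
      moreover have "m i * (dV (x t i) * x' t i) + real N / 2 * (2 * m i * (x t i - (l t i + m i / 2)) * x' t i)
         = m i * x' t i * (dV (x t i) + real N * (x t i - (l t i + m i / 2)))"
        by (simp add: algebra_simps)
      ultimately show "m i * (dV (x t i) * x' t i) + real N / 2 * (2 * m i * (x t i - (l t i + m i / 2)) * x' t i) = - (m i * (x' t i)\<^sup>2)"
        by (simp add: power2_eq_square)
    qed
    finally show ?thesis .
  qed
  have "((\<lambda>t. - speed2 t) has_integral (e s - e 0)) {0..s}"
  proof (rule fundamental_theorem_of_calculus)
    fix t assume t: "t \<in> {0..s}"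
    then have "t \<in> {0..T}" using s by auto
    from de[OF this] show "(e has_vector_derivative - speed2 t) (at t within {0..s})"
      using s by (auto simp: has_real_derivative_iff_has_vector_derivative intro: has_vector_derivative_within_subset)
  qed (use s in auto)
  then have "integral {0..s} (\<lambda>t. - speed2 t) = e s - e 0" by (rule integral_unique)
  then have "integral {0..s} speed2 = e 0 - e s" by simp
  then show ?thesis using cst_eq[OF s] cst_eq[OF T0] by (simp add: e_def algebra_simps)
qed

text \<open>
  The factor \<open>N\<close> is lost because a single block may have mass as small as \<open>1 / N\<close>.
\<close>

lemma position_bound:
  assumes t: "t \<in> {0..T}" and i: "i \<in> I"
  shows "(x t i - (l t i + m i / 2))\<^sup>2 \<le> real N * cst t"
proof -
  have "m i * (x t i - (l t i + m i / 2))\<^sup>2 \<le> dist2 t"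
    unfolding dist2_def by (rule member_le_sum[OF i]) (use fin mnonneg in auto)
  moreover have "dist2 t \<le> cst t" unfolding cst_eq[OF t] by (simp add: sum_nonneg mnonneg)
  moreover have "1 / real N * (x t i - (l t i + m i / 2))\<^sup>2 \<le> m i * (x t i - (l t i + m i / 2))\<^sup>2"
    by (intro mult_right_mono mN i) simp
  ultimately have "1 / real N * (x t i - (l t i + m i / 2))\<^sup>2 \<le> cst t" by linarith
  then show ?thesis using N by (simp add: field_simps)
qed

lemma center_bounds: "t \<in> {0..T} \<Longrightarrow> i \<in> I \<Longrightarrow> a \<le> l t i + m i / 2 \<and> l t i + m i / 2 \<le> b"
  using packing.cell_bounds[OF pack] mpos[of i] by force

end

text \<open>
  Let \<open>w\<close> be \<open>N\<close> times the difference of the barycenters of \<open>j\<close> and \<open>i\<close>. It is continuous in time, because it can be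
  expressed by positions and velocities. As blocks have length at least \<open>1 / N\<close>, it is at least 1 while
  \<open>i\<close> is to the left of \<open>j\<close>, and at most 0 otherwise. By the intermediate value theorem one of the two
  alternatives holds for all times.
\<close>

lemma flow_order:
  fixes V :: "real \<Rightarrow> real"
  assumes N: "0 < N" and T: "0 < T" and ab: "1 \<le> b - a"
    and V: "\<And>x. (V has_real_derivative deriv V x) (at x)" and dV: "continuous_on UNIV (deriv V)"
    and C1: "C1_curve T N X X'"
    and sol: "solves_gradient_flow {a..b} V (1 / real N) T N X X' \<or> solves_barycenter_ode {a..b} V (1 / real N) T N X X'"
    and st: "s \<in> {0..T}" "t \<in> {0..T}" and ij: "i < N" "j < N" and lt: "X s i < X s j"
  shows "X t i < X t j"
proof (rule ccontr)
  assume n: "\<not> X t i < X t j"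
  define w where "w = (\<lambda>t. (X' t j - X' t i) + (deriv V (X t j) - deriv V (X t i)) + real N * (X t j - X t i))"
  have Xc: "continuous_on {0..T} (\<lambda>t. X t k)" if "k < N" for k
    unfolding continuous_on_eq_continuous_within
  proof
    fix t assume "t \<in> {0..T}"
    then have "((\<lambda>s. X s k) has_real_derivative X' t k) (at t within {0..T})" using C1 that by (simp add: C1_curve_def)
    then show "continuous (at t within {0..T}) (\<lambda>t. X t k)" by (rule DERIV_continuous)
  qed
  have X'c: "continuous_on {0..T} (\<lambda>t. X' t k)" if "k < N" for k
    using C1 that by (auto simp: C1_curve_def)
  have wc: "continuous_on {0..T} w"
    unfolding w_def using ij
    by (intro continuous_intros Xc X'c continuous_on_compose2[OF dV]) auto
  have w: "(X u i < X u j \<longrightarrow> 1 \<le> w u) \<and> (X u j \<le> X u i \<longrightarrow> w u \<le> 0)" if u: "u \<in> {0..T}" for u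
  proof -
    obtain l where P: "packing (reps N (X u)) (mult N (X u)) (X u) a b l" using packing_reps_exists[OF N ab] by blast
    interpret P: packing "reps N (X u)" "mult N (X u)" "X u" a b l by fact
    have v: "(\<exists>g. has_gradient N (energy {a..b} V (1 / real N) N) g (X u) \<and> (\<forall>i<N. (1 / real N) * X' u i = - g i)) \<or>
      (\<exists>\<beta>. is_barycenters {a..b} N (X u) \<beta> \<and> (\<forall>i<N. X' u i = - deriv V (X u i) + (1 / (1 / real N)) * (\<beta> i - X u i)))"
      using sol u unfolding solves_gradient_flow_def solves_barycenter_ode_def by blast
    obtain r where r: "r \<in> reps N (X u)" "X u r = X u i" using rep_exists[OF ij(1)] by blast
    obtain q where q: "q \<in> reps N (X u)" "X u q = X u j" using rep_exists[OF ij(2)] by blast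
    let ?B = "\<lambda>r. l r + mult N (X u) r / 2"
    have "X' u i = - deriv V (X u r) - real N * (X u r - ?B r)"
      by (rule velocity_eq[OF N P V v]) (use ij r in auto)
    moreover have "X' u j = - deriv V (X u q) - real N * (X u q - ?B q)"
      by (rule velocity_eq[OF N P V v]) (use ij q in auto)
    ultimately have w_eq: "w u = real N * (?B q - ?B r)"
      unfolding w_def using r q by (simp add: algebra_simps)
    have m: "1 / real N \<le> mult N (X u) k" if "k \<in> reps N (X u)" for k
      using that reps_sub[of N "X u"] by (intro mult_ge) auto
    show ?thesis
    proof (intro conjI impI)
      assume "X u i < X u j"
      then have "l r + mult N (X u) r \<le> l q" using r q by (intro P.cell_order) auto
      then have "1 / real N \<le> ?B q - ?B r" using m[OF r(1)] m[OF q(1)] by linarith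
      then have "real N * (1 / real N) \<le> real N * (?B q - ?B r)" by (rule mult_left_mono) simp
      then show "1 \<le> w u" using N by (simp add: w_eq)
    next
      assume le: "X u j \<le> X u i"
      have "?B q \<le> ?B r"
      proof (cases "X u j = X u i")
        case True
        then have "q = r" using r q P.inj by (auto simp: inj_on_def)
        then show ?thesis by simp
      next
        case False
        then have "l q + mult N (X u) q \<le> l r" using le r q by (intro P.cell_order) auto
        then show ?thesis using P.mpos[OF r(1)] P.mpos[OF q(1)] by linarith
      qed
      then show "w u \<le> 0" unfolding w_eq by (intro mult_nonneg_nonpos) auto
    qed
  qed
  have "connected (w ` {0..T})" by (intro connected_continuous_image wc) auto
  moreover have "w t \<le> 1/2" "1/2 \<le> w s" using w[OF st(2)] w[OF st(1)] n lt by auto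
  ultimately have "1/2 \<in> w ` {0..T}" using st connectedD_interval[of "w ` {0..T}" "w t" "w s" "1/2"] by blast
  then obtain u where "u \<in> {0..T}" "w u = 1/2" by auto
  then show False using w[of u] by (cases "X u i < X u j") auto
qed

text \<open>
  By \<open>flow_order\<close> the ties at time zero are the ties at all times, so one set of representatives serves the whole flow.
\<close>

lemma flow_block_flow:
  fixes V :: "real \<Rightarrow> real"
  assumes N: "0 < N" and T: "0 < T" and ab: "1 \<le> b - a"
    and V: "\<And>x. (V has_real_derivative deriv V x) (at x)" and dV: "continuous_on UNIV (deriv V)"
    and C1: "C1_curve T N X X'"
    and sol: "solves_gradient_flow {a..b} V (1 / real N) T N X X' \<or> solves_barycenter_ode {a..b} V (1 / real N) T N X X'"
  shows "\<exists>I m l. block_flow N I m X X' l (deriv V) a b T \<and> (\<forall>t\<in>{0..T}. empirical N (X t) = atomic I m (X t))"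
proof -
  note ord = flow_order[OF N T ab V dV C1 sol]
  define I where "I = reps N (X 0)"
  define m where "m = mult N (X 0)"
  have T0: "0 \<in> {0..T}" using T by simp
  have eq: "X t i = X t j \<longleftrightarrow> X 0 i = X 0 j" if "t \<in> {0..T}" "i < N" "j < N" for t i j
    using ord[OF T0 that(1), of i j] ord[OF T0 that(1), of j i] ord[OF that(1) T0, of i j] ord[OF that(1) T0, of j i] that
    by (metis less_irrefl linorder_neqE)
  have I: "reps N (X t) = I" if "t \<in> {0..T}" for t
    unfolding I_def reps_def using eq[OF that] by (auto dest: less_trans)
  have m: "mult N (X t) i = m i" if "t \<in> {0..T}" "i < N" for t i
  proof -
    have "{j. j < N \<and> X t j = X t i} = {j. j < N \<and> X 0 j = X 0 i}" using eq[OF that(1)] that(2) by auto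
    then show ?thesis by (simp add: m_def mult_def)
  qed
  have IN: "i < N" if "i \<in> I" for i using that reps_sub by (auto simp: I_def)
  have pcong: "packing I m x a b l" if "packing I m' x a b l" "\<And>i. i \<in> I \<Longrightarrow> m' i = m i" for m' x l
  proof -
    interpret packing I m' x a b l by fact
    have ml: "mass_left I m' x i = mass_left I m x i" for i
      unfolding mass_left_def using that(2) by (intro sum.cong) auto
    have fe: "feasible I m' x a b k = feasible I m x a b k" for k by (simp add: feasible_def ml)
    show ?thesis
    proof
      show "finite I" "inj_on x I" by (rule fin inj)+
      show "0 < m i" if "i \<in> I" for i using mpos[OF that] \<open>\<And>i. i \<in> I \<Longrightarrow> m' i = m i\<close>[OF that] by simp
      show "sum m I = 1" using msum that(2) by simp
      show "feasible I m x a b l" using feas fe by simp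
      show "(\<Sum>i\<in>I. m i * (x i - (l i + m i / 2)) * (k i - l i)) \<le> 0" if "feasible I m x a b k" for k
        using VI[of k] that fe \<open>\<And>i. i \<in> I \<Longrightarrow> m' i = m i\<close> by simp
    qed
  qed
  have "\<forall>t\<in>{0..T}. \<exists>l. packing I m (X t) a b l"
    using packing_reps_exists[OF N ab] pcong I m IN by metis
  then obtain l where l: "\<And>t. t \<in> {0..T} \<Longrightarrow> packing I m (X t) a b (l t)" by metis
  have l': "packing (reps N (X t)) (mult N (X t)) (X t) a b (l t)" if t: "t \<in> {0..T}" for t
  proof -
    interpret packing I m "X t" a b "l t" by (rule l[OF t])
    have mm: "mult N (X t) i = m i" if "i \<in> I" for i using m[OF t IN[OF that]] .
    have ml: "mass_left I (mult N (X t)) (X t) i = mass_left I m (X t) i" for i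
      unfolding mass_left_def using mm by (intro sum.cong) auto
    have fe: "feasible I (mult N (X t)) (X t) a b k = feasible I m (X t) a b k" for k by (simp add: feasible_def ml)
    show ?thesis unfolding I[OF t]
    proof
      show "finite I" "inj_on (X t) I" by (rule fin inj)+
      show "0 < mult N (X t) i" if "i \<in> I" for i using mpos[OF that] mm[OF that] by simp
      show "sum (mult N (X t)) I = 1" using msum mm by simp
      show "feasible I (mult N (X t)) (X t) a b (l t)" using feas fe by simp
      show "(\<Sum>i\<in>I. mult N (X t) i * (X t i - (l t i + mult N (X t) i / 2)) * (k i - l t i)) \<le> 0" if "feasible I (mult N (X t)) (X t) a b k" for k
        using VI[of k] that fe mm by simp
    qed
  qed
  have "block_flow N I m X X' l (deriv V) a b T"
  proof (rule block_flow.intro)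
    fix i t assume i: "i \<in> I" and t: "t \<in> {0..T}"
    have v: "(\<exists>g. has_gradient N (energy {a..b} V (1 / real N) N) g (X t) \<and> (\<forall>i<N. (1 / real N) * X' t i = - g i)) \<or>
      (\<exists>\<beta>. is_barycenters {a..b} N (X t) \<beta> \<and> (\<forall>i<N. X' t i = - deriv V (X t i) + (1 / (1 / real N)) * (\<beta> i - X t i)))"
      using sol t unfolding solves_gradient_flow_def solves_barycenter_ode_def by blast
    have "X' t i = - deriv V (X t i) - real N * (X t i - (l t i + mult N (X t) i / 2))"
      by (rule velocity_eq[OF N l'[OF t] V v]) (use i IN I[OF t] in auto)
    then show "X' t i = - deriv V (X t i) - real N * (X t i - (l t i + m i / 2))" using m[OF t IN[OF i]] by simp
  next
    show "1 / real N \<le> m i" if "i \<in> I" for i unfolding m_def by (intro mult_ge IN that)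
  next
    show "X t i < X t j" if "s \<in> {0..T}" "t \<in> {0..T}" "i \<in> I" "j \<in> I" "X s i < X s j" for s t i j
      by (rule ord[OF that(1,2) IN[OF that(3)] IN[OF that(4)] that(5)])
    show "((\<lambda>s. X s i) has_real_derivative X' t i) (at t within {0..T})" if "i \<in> I" "t \<in> {0..T}" for i t
      using C1 IN[OF that(1)] that(2) unfolding C1_curve_def by blast
    show "continuous_on {0..T} (\<lambda>t. X' t i)" if "i \<in> I" for i
      using C1 IN[OF that(1)] unfolding C1_curve_def by blast
  qed (fact N T ab l dV)+
  moreover have "empirical N (X t) = atomic I m (X t)" if t: "t \<in> {0..T}" for t
    unfolding I_def m_def using eq[OF t] by (intro empirical_eq_reps[OF N]) blast
  ultimately show ?thesis by blast
qed

section \<open>Weak compactness in L2\<close>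

definition square_int :: "'a measure \<Rightarrow> ('a \<Rightarrow> real) \<Rightarrow> bool" where
  "square_int M f \<longleftrightarrow> f \<in> borel_measurable M \<and> integrable M (\<lambda>x. (f x)\<^sup>2)"

lemma square_int_mult:
  assumes "square_int M f" "square_int M h" shows "integrable M (\<lambda>x. f x * h x)"
proof (rule Bochner_Integration.integrable_bound)
  show "integrable M (\<lambda>x. (f x)\<^sup>2 + (h x)\<^sup>2)" using assms by (simp add: square_int_def)
  show "(\<lambda>x. f x * h x) \<in> borel_measurable M" using assms by (auto simp: square_int_def)
  have "norm (f x * h x) \<le> norm ((f x)\<^sup>2 + (h x)\<^sup>2)" for x
  proof -
    have "0 \<le> (\<bar>f x\<bar> - \<bar>h x\<bar>)\<^sup>2" by simp
    then have "2 * (\<bar>f x\<bar> * \<bar>h x\<bar>) \<le> (f x)\<^sup>2 + (h x)\<^sup>2" by (simp add: power2_diff)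
    moreover have "0 \<le> \<bar>f x\<bar> * \<bar>h x\<bar>" by simp
    ultimately have "\<bar>f x\<bar> * \<bar>h x\<bar> \<le> (f x)\<^sup>2 + (h x)\<^sup>2" by linarith
    then show ?thesis by (simp add: abs_mult)
  qed
  then show "AE x in M. norm (f x * h x) \<le> norm ((f x)\<^sup>2 + (h x)\<^sup>2)" by simp
qed

lemma square_int_comb:
  assumes "square_int M f" "square_int M h" shows "square_int M (\<lambda>x. r * f x + s * h x)"
proof -
  have "(r * f x + s * h x)\<^sup>2 = r\<^sup>2 * (f x)\<^sup>2 + (2 * r * s) * (f x * h x) + s\<^sup>2 * (h x)\<^sup>2" for x
    by (simp add: power2_eq_square algebra_simps)
  then show ?thesis using assms square_int_mult[OF assms] by (auto simp: square_int_def)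
qed

lemma square_int_diff:
  assumes "square_int M f" "square_int M h" shows "square_int M (\<lambda>x. f x - h x)"
  using square_int_comb[OF assms, of 1 "-1"] by simp

lemma cauchy_schwarz:
  assumes f: "square_int M f" and h: "square_int M h"
  shows "(\<integral>x. f x * h x \<partial>M)\<^sup>2 \<le> (\<integral>x. (f x)\<^sup>2 \<partial>M) * (\<integral>x. (h x)\<^sup>2 \<partial>M)"
proof -
  define A where "A = (\<integral>x. (f x)\<^sup>2 \<partial>M)"
  define B where "B = (\<integral>x. f x * h x \<partial>M)"
  define C where "C = (\<integral>x. (h x)\<^sup>2 \<partial>M)"
  have q: "0 \<le> r\<^sup>2 * A + (2 * r * s) * B + s\<^sup>2 * C" for r s
  proof -
    have "0 \<le> (\<integral>x. (r * f x + s * h x)\<^sup>2 \<partial>M)" by simp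
    also have "\<dots> = (\<integral>x. r\<^sup>2 * (f x)\<^sup>2 + (2 * r * s) * (f x * h x) + s\<^sup>2 * (h x)\<^sup>2 \<partial>M)"
      by (intro Bochner_Integration.integral_cong) (auto simp: power2_eq_square algebra_simps)
    also have "\<dots> = r\<^sup>2 * A + (2 * r * s) * B + s\<^sup>2 * C"
      using f h square_int_mult[OF f h] by (simp add: square_int_def A_def B_def C_def)
    finally show ?thesis .
  qed
  have C0: "0 \<le> C" by (simp add: C_def)
  have "B\<^sup>2 \<le> A * C"
  proof (cases "C = 0")
    case True
    have "B = 0"
    proof (rule ccontr)
      assume "B \<noteq> 0"
      then show False using q[of 1 "- (A + 1) / (2 * B)"] True by (simp add: field_simps)
    qed
    then show ?thesis using True by simp
  next
    case False
    then have "0 < C" using C0 by simp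
    have "0 \<le> C\<^sup>2 * A + (2 * C * (- B)) * B + (- B)\<^sup>2 * C" by (rule q)
    also have "\<dots> = C * (A * C - B\<^sup>2)" by (simp add: power2_eq_square algebra_simps)
    finally show ?thesis using \<open>0 < C\<close> by (simp add: zero_le_mult_iff)
  qed
  then show ?thesis by (simp add: A_def B_def C_def)
qed

text \<open>
  The closure of the tail \<open>f n, f (n + 1), \<dots>\<close> under midpoints. It replaces the convex hull in the
  construction of weak limits: midpoints are all that the parallelogram law needs.
\<close>

inductive_set midtail :: "(nat \<Rightarrow> 'a \<Rightarrow> real) \<Rightarrow> nat \<Rightarrow> ('a \<Rightarrow> real) set" for f n where
  base: "n \<le> k \<Longrightarrow> f k \<in> midtail f n"
| mid: "u \<in> midtail f n \<Longrightarrow> v \<in> midtail f n \<Longrightarrow> (\<lambda>x. (u x + v x) / 2) \<in> midtail f n"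

lemma midtail_mono: "u \<in> midtail f n \<Longrightarrow> k \<le> n \<Longrightarrow> u \<in> midtail f k"
  by (induction rule: midtail.induct) (auto intro: midtail.intros)

lemma midtail_square_int:
  assumes "\<And>n. square_int M (f n)" "u \<in> midtail f n" shows "square_int M u"
  using assms(2)
proof (induction rule: midtail.induct)
  case (mid u v)
  then show ?case using square_int_comb[of M u v "1/2" "1/2"] by (simp add: add_divide_distrib)
qed (use assms in auto)

lemma parallelogram:
  assumes u: "square_int M u" and v: "square_int M v"
  shows "(\<integral>x. (u x - v x)\<^sup>2 \<partial>M) = 2 * (\<integral>x. (u x)\<^sup>2 \<partial>M) + 2 * (\<integral>x. (v x)\<^sup>2 \<partial>M) - 4 * (\<integral>x. ((u x + v x) / 2)\<^sup>2 \<partial>M)"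
proof -
  have "(u x - v x)\<^sup>2 = 2 * (u x)\<^sup>2 + 2 * (v x)\<^sup>2 - 4 * ((u x + v x) / 2)\<^sup>2" for x
    by (simp add: power2_eq_square field_simps)
  moreover have "integrable M (\<lambda>x. ((u x + v x) / 2)\<^sup>2)"
    using square_int_comb[OF u v, of "1/2" "1/2"] by (simp add: square_int_def add_divide_distrib)
  ultimately show ?thesis using u v by (simp add: square_int_def)
qed

text \<open>
  The series of the \<open>2 ^ n * (u (n + 1) - u n)\<^sup>2\<close> has a finite integral. As \<open>\<bar>r\<bar> \<le> (1/2) ^ n + 2 ^ n * r\<^sup>2\<close>, the telescoping
  series converges almost everywhere; the limit is taken pointwise and Fatou's lemma gives the estimate.
\<close>

lemma l2_complete:
  assumes u: "\<And>n. square_int M (u n)"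
    and c: "\<And>n k. n \<le> k \<Longrightarrow> (\<integral>x. (u n x - u k x)\<^sup>2 \<partial>M) \<le> (1/4) ^ n"
  shows "\<exists>g. square_int M g \<and> (\<forall>n. (\<integral>x. (g x - u n x)\<^sup>2 \<partial>M) \<le> (1/4) ^ n)"
proof -
  have [measurable]: "u n \<in> borel_measurable M" for n using u by (simp add: square_int_def)
  define D where "D = (\<lambda>n x. (u (Suc n) x - u n x)\<^sup>2)"
  have Dint: "integrable M (D n)" for n
    using square_int_diff[OF u u, of "Suc n" n] by (simp add: square_int_def D_def)
  have Dm[measurable]: "D n \<in> borel_measurable M" for n unfolding D_def by measurable
  have Dle: "(\<integral>\<^sup>+x. ennreal (D n x) \<partial>M) \<le> ennreal ((1/4) ^ n)" for n
  proof -
    have "(\<integral>\<^sup>+x. ennreal (D n x) \<partial>M) = ennreal (\<integral>x. D n x \<partial>M)"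
      by (rule nn_integral_eq_integral[OF Dint]) (simp add: D_def)
    also have "(\<integral>x. D n x \<partial>M) \<le> (1/4) ^ n" using c[of n "Suc n"] by (simp add: D_def power2_commute)
    finally show ?thesis by (simp add: ennreal_leI)
  qed
  have "(\<integral>\<^sup>+x. (\<Sum>n. ennreal (2 ^ n * D n x)) \<partial>M) = (\<Sum>n. \<integral>\<^sup>+x. ennreal (2 ^ n * D n x) \<partial>M)"
    by (rule nn_integral_suminf) measurable
  also have "\<dots> \<le> (\<Sum>n. ennreal ((1/2) ^ n))"
  proof (rule suminf_le)
    fix n
    have "(\<integral>\<^sup>+x. ennreal (2 ^ n * D n x) \<partial>M) = ennreal (2 ^ n) * (\<integral>\<^sup>+x. ennreal (D n x) \<partial>M)"
      by (subst nn_integral_cmult[symmetric]) (auto simp: ennreal_mult D_def)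
    also have "\<dots> \<le> ennreal (2 ^ n) * ennreal ((1/4) ^ n)" by (intro mult_left_mono Dle) simp
    also have "\<dots> = ennreal ((1/2) ^ n)" by (simp add: ennreal_mult[symmetric] power_mult_distrib[symmetric])
    finally show "(\<integral>\<^sup>+x. ennreal (2 ^ n * D n x) \<partial>M) \<le> ennreal ((1/2) ^ n)" .
  qed auto
  also have "\<dots> = ennreal (\<Sum>n. (1/2) ^ n)" by (rule suminf_ennreal2) (auto intro!: summable_geometric)
  also have "\<dots> < \<infinity>" by simp
  finally have "AE x in M. (\<Sum>n. ennreal (2 ^ n * D n x)) \<noteq> \<infinity>"
    by (intro nn_integral_PInf_AE) auto
  then have conv: "AE x in M. convergent (\<lambda>n. u n x)"
  proof eventually_elim
    case (elim x)
    have "summable (\<lambda>n. 2 ^ n * D n x)"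
      by (rule summable_suminf_not_top) (use elim in \<open>auto simp: D_def\<close>)
    then have s: "summable (\<lambda>n. (1/2) ^ n + 2 ^ n * D n x)" by (intro summable_add summable_geometric) auto
    have "summable (\<lambda>n. u (Suc n) x - u n x)"
    proof (rule summable_comparison_test'[OF s])
      fix n
      define z where "z = \<bar>u (Suc n) x - u n x\<bar>"
      have "0 \<le> (1 - 2 ^ n * z)\<^sup>2" by simp
      then have "2 * (2 ^ n * z) \<le> 1 + 2 ^ n * 2 ^ n * z\<^sup>2" by (simp add: power2_eq_square algebra_simps)
      then have "2 * z \<le> (1/2) ^ n + 2 ^ n * z\<^sup>2" by (simp add: field_simps power_divide)
      moreover have "0 \<le> z" by (simp add: z_def)
      moreover have "z\<^sup>2 = D n x" by (simp add: z_def D_def)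
      ultimately have "2 * z \<le> (1/2) ^ n + 2 ^ n * D n x" "0 \<le> z" by simp_all
      then have "z \<le> (1/2) ^ n + 2 ^ n * D n x" by linarith
      then show "norm (u (Suc n) x - u n x) \<le> (1/2) ^ n + 2 ^ n * D n x" by (simp add: z_def)
    qed
    then have "convergent (\<lambda>n. \<Sum>i<n. u (Suc i) x - u i x)" by (simp add: summable_iff_convergent)
    then have "convergent (\<lambda>n. u n x - u 0 x)"
      unfolding sum_lessThan_telescope[of "\<lambda>n. u n x"] .
    from convergent_add[OF this convergent_const[of "u 0 x"]] show ?case by simp
  qed
  define g where "g = (\<lambda>x. lim (\<lambda>n. u n x))"
  have gm[measurable]: "g \<in> borel_measurable M" unfolding g_def by measurable
  have lim: "AE x in M. (\<lambda>n. u n x) \<longlonglongrightarrow> g x"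
    using conv by eventually_elim (simp add: g_def convergent_LIMSEQ_iff)
  have F: "(\<integral>\<^sup>+x. ennreal ((g x - u n x)\<^sup>2) \<partial>M) \<le> ennreal ((1/4) ^ n)" for n
  proof -
    have "(\<integral>\<^sup>+x. ennreal ((g x - u n x)\<^sup>2) \<partial>M) = (\<integral>\<^sup>+x. liminf (\<lambda>k. ennreal ((u k x - u n x)\<^sup>2)) \<partial>M)"
    proof (rule nn_integral_cong_AE)
      show "AE x in M. ennreal ((g x - u n x)\<^sup>2) = liminf (\<lambda>k. ennreal ((u k x - u n x)\<^sup>2))"
        using lim
      proof eventually_elim
        case (elim x)
        have "(\<lambda>k. ennreal ((u k x - u n x)\<^sup>2)) \<longlonglongrightarrow> ennreal ((g x - u n x)\<^sup>2)"
          by (intro tendsto_ennrealI tendsto_intros elim)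
        then show ?case by (intro lim_imp_Liminf[symmetric]) auto
      qed
    qed
    also have "\<dots> \<le> liminf (\<lambda>k. \<integral>\<^sup>+x. ennreal ((u k x - u n x)\<^sup>2) \<partial>M)"
      by (rule nn_integral_liminf) measurable
    also have "\<dots> \<le> ennreal ((1/4) ^ n)"
    proof (rule Liminf_le[OF sequentially_bot], rule eventually_sequentiallyI)
      fix k assume nk: "n \<le> k"
      have "(\<integral>\<^sup>+x. ennreal ((u k x - u n x)\<^sup>2) \<partial>M) = ennreal (\<integral>x. (u k x - u n x)\<^sup>2 \<partial>M)"
        using square_int_diff[OF u u] by (intro nn_integral_eq_integral) (auto simp: square_int_def)
      also have "\<dots> \<le> ennreal ((1/4) ^ n)" using c[OF nk] by (intro ennreal_leI) (simp add: power2_commute)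
      finally show "(\<integral>\<^sup>+x. ennreal ((u k x - u n x)\<^sup>2) \<partial>M) \<le> ennreal ((1/4) ^ n)" .
    qed
    finally show ?thesis .
  qed
  have sd: "square_int M (\<lambda>x. g x - u n x)" for n
    unfolding square_int_def using F[of n] by (auto intro!: integrableI_nonneg simp: le_less_trans)
  have "square_int M g"
    using square_int_comb[OF sd[of 0] u[of 0], of 1 1] by simp
  moreover have "(\<integral>x. (g x - u n x)\<^sup>2 \<partial>M) \<le> (1/4) ^ n" for n
    using F[of n] sd[of n] by (subst (asm) nn_integral_eq_integral) (auto simp: square_int_def ennreal_le_iff)
  ultimately show ?thesis by blast
qed

text \<open>
  Every asymptotic lower bound of a linear functional on the sequence is inherited by midpoints of tails.
  Almost minimal elements of the tails are Cauchy by the parallelogram law, because the minimal squared norms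
  \<open>\<alpha>\<close> of the tails increase to a finite limit; their strong limit \<open>g\<close> therefore inherits all these bounds.
  In this form no subsequence is needed: wherever the functionals on the sequence converge, \<open>g\<close> has the limit as its value.
\<close>

lemma weak_L2_limit:
  assumes f: "\<And>n. square_int M (f n)" and B: "\<And>n. (\<integral>x. (f n x)\<^sup>2 \<partial>M) \<le> B"
  shows "\<exists>g. square_int M g \<and> (\<forall>h A. square_int M h \<longrightarrow> (\<forall>\<^sub>F n in sequentially. A \<le> (\<integral>x. f n x * h x \<partial>M)) \<longrightarrow> A \<le> (\<integral>x. g x * h x \<partial>M))"
proof -
  let ?n = "\<lambda>u. (\<integral>x. (u x)\<^sup>2 \<partial>M)"
  note ms = midtail_square_int[OF f]
  define \<alpha> where "\<alpha> n = Inf (?n ` midtail f n)" for n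
  have ne: "?n ` midtail f n \<noteq> {}" for n using midtail.base[of n n f] by auto
  have bdd: "bdd_below (?n ` midtail f n)" for n by (rule bdd_belowI2[where m=0]) simp
  have \<alpha>le: "\<alpha> n \<le> ?n u" if "u \<in> midtail f n" for n u
    unfolding \<alpha>_def by (rule cInf_lower) (use that bdd in auto)
  have \<alpha>mono: "\<alpha> n \<le> \<alpha> k" if "n \<le> k" for n k
    unfolding \<alpha>_def using midtail_mono[OF _ that, of _ f]
    by (intro cInf_superset_mono ne bdd image_mono subsetI) blast
  have \<alpha>B: "\<alpha> n \<le> B" for n using \<alpha>le[OF midtail.base[of n n f]] B[of n] by simp
  have "incseq \<alpha>" by (simp add: incseq_def \<alpha>mono)
  then obtain L where "\<alpha> \<longlonglongrightarrow> L" by (rule incseq_convergent) (use \<alpha>B in auto)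
  then have "convergent \<alpha>" by (auto simp: convergent_def)
  then have cau: "Cauchy \<alpha>" by (simp add: Cauchy_convergent_iff)
  have "\<exists>k\<ge>n. \<forall>j\<ge>k. \<alpha> j - \<alpha> k \<le> (1/4) ^ n / 8" for n :: nat
  proof -
    have "0 < (1/4::real) ^ n / 8" by simp
    from CauchyD[OF cau this] obtain K where K: "\<And>i j. i \<ge> K \<Longrightarrow> j \<ge> K \<Longrightarrow> norm (\<alpha> i - \<alpha> j) < (1/4) ^ n / 8" by blast
    show ?thesis
    proof (intro exI[of _ "max n K"] conjI allI impI)
      fix j assume "max n K \<le> j"
      then show "\<alpha> j - \<alpha> (max n K) \<le> (1/4) ^ n / 8" 
      proof -
        have "K \<le> j" "K \<le> max n K" using \<open>max n K \<le> j\<close> by auto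
        then show ?thesis using K[of j "max n K"] unfolding real_norm_def by linarith
      qed
    qed simp
  qed
  then obtain k where k: "\<And>n. n \<le> k n" "\<And>n j. k n \<le> j \<Longrightarrow> \<alpha> j - \<alpha> (k n) \<le> (1/4) ^ n / 8" by metis
  define r where "r n = (MAX j\<in>{..n}. k j)" for n
  have rk: "k n \<le> r n" for n unfolding r_def by (intro Max_ge) auto
  have rm: "r n \<le> r j" if "n \<le> j" for n j unfolding r_def by (rule Max_mono) (use that in auto)
  have rn: "n \<le> r n" for n using k(1)[of n] rk[of n] by simp
  have ra: "\<alpha> j - \<alpha> (r n) \<le> (1/4) ^ n / 8" if "r n \<le> j" for n j
    using k(2)[of n j] \<alpha>mono[OF rk[of n]] rk[of n] that by force
  have "\<exists>u\<in>midtail f (r n). ?n u < \<alpha> (r n) + (1/4) ^ n / 16" for n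
  proof -
    have "Inf (?n ` midtail f (r n)) < \<alpha> (r n) + (1/4) ^ n / 16" by (simp add: \<alpha>_def)
    from cInf_lessD[OF ne this] show ?thesis by auto
  qed
  then obtain u where u: "\<And>n. u n \<in> midtail f (r n)" "\<And>n. ?n (u n) < \<alpha> (r n) + (1/4) ^ n / 16" by metis
  have us: "square_int M (u n)" for n by (rule ms[OF u(1)])
  have "\<exists>g. square_int M g \<and> (\<forall>n. (\<integral>x. (g x - u n x)\<^sup>2 \<partial>M) \<le> (1/4) ^ n)"
  proof (rule l2_complete[OF us])
    fix n j :: nat assume nj: "n \<le> j"
    have "u j \<in> midtail f (r n)" using midtail_mono[OF u(1) rm[OF nj]] .
    then have "(\<lambda>x. (u n x + u j x) / 2) \<in> midtail f (r n)" by (intro midtail.mid u(1))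
    from \<alpha>le[OF this] have mid: "\<alpha> (r n) \<le> (\<integral>x. ((u n x + u j x) / 2)\<^sup>2 \<partial>M)" .
    have "(\<integral>x. (u n x - u j x)\<^sup>2 \<partial>M) \<le> 2 * (\<alpha> (r n) + (1/4) ^ n / 16) + 2 * (\<alpha> (r j) + (1/4) ^ j / 16) - 4 * \<alpha> (r n)"
    proof -
      have "2 * A + 2 * B - 4 * M \<le> 2 * p + 2 * q - 4 * c" if "A < p" "B < q" "c \<le> M" for A B M p q c :: real
        using that by linarith
      from this[OF u(2)[of n] u(2)[of j] mid] show ?thesis unfolding parallelogram[OF us us] .
    qed
    also have "\<dots> \<le> 2 * (1/4) ^ n / 16 + 2 * (1/4) ^ j / 16 + 2 * ((1/4) ^ n / 8)"
      using ra[OF rm[OF nj]] by simp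
    also have "\<dots> \<le> (1/4) ^ n"
    proof -
      have "(1/4::real) ^ j \<le> (1/4) ^ n" using nj by (intro power_decreasing) auto
      moreover have "0 \<le> (1/4::real) ^ n" by simp
      ultimately show ?thesis by linarith
    qed
    finally show "(\<integral>x. (u n x - u j x)\<^sup>2 \<partial>M) \<le> (1/4) ^ n" .
  qed
  then obtain g where g: "square_int M g" "\<And>n. (\<integral>x. (g x - u n x)\<^sup>2 \<partial>M) \<le> (1/4) ^ n" by blast
  have "A \<le> (\<integral>x. g x * h x \<partial>M)" if h: "square_int M h" and ev: "\<forall>\<^sub>F n in sequentially. A \<le> (\<integral>x. f n x * h x \<partial>M)" for h A
  proof -
    obtain n0 where n0: "\<And>n. n \<ge> n0 \<Longrightarrow> A \<le> (\<integral>x. f n x * h x \<partial>M)" using ev by (auto simp: eventually_sequentially)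
    have mt: "A \<le> (\<integral>x. v x * h x \<partial>M)" if "v \<in> midtail f n0" for v
      using that
    proof (induction rule: midtail.induct)
      case (mid u v)
      have "(\<integral>x. (u x + v x) / 2 * h x \<partial>M) = (\<integral>x. (1/2) * (u x * h x) + (1/2) * (v x * h x) \<partial>M)"
        by (intro Bochner_Integration.integral_cong) (auto simp: field_simps)
      also have "\<dots> = (1/2) * (\<integral>x. u x * h x \<partial>M) + (1/2) * (\<integral>x. v x * h x \<partial>M)"
        using square_int_mult[OF ms[OF mid(1)] h] square_int_mult[OF ms[OF mid(2)] h] by simp
      finally show ?case using mid by simp
    qed (rule n0)
    have "(\<lambda>n. (\<integral>x. (g x - u n x) * h x \<partial>M)) \<longlonglongrightarrow> 0"
    proof (rule tendsto_rabs_zero_cancel, rule Lim_null_comparison)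
      show "\<forall>\<^sub>F n in sequentially. norm \<bar>\<integral>x. (g x - u n x) * h x \<partial>M\<bar> \<le> sqrt ((1/4) ^ n * ?n h)"
      proof (intro always_eventually allI)
        fix n
        have "(\<integral>x. (g x - u n x) * h x \<partial>M)\<^sup>2 \<le> (\<integral>x. (g x - u n x)\<^sup>2 \<partial>M) * ?n h"
          by (rule cauchy_schwarz[OF square_int_diff[OF g(1) us] h])
        also have "\<dots> \<le> (1/4) ^ n * ?n h" by (intro mult_right_mono g) simp
        finally show "norm \<bar>\<integral>x. (g x - u n x) * h x \<partial>M\<bar> \<le> sqrt ((1/4) ^ n * ?n h)"
          by (intro real_le_rsqrt) simp
      qed
      have "(\<lambda>n. sqrt ((1/4) ^ n * ?n h)) \<longlonglongrightarrow> sqrt (0 * ?n h)"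
        by (intro tendsto_intros LIMSEQ_power_zero) auto
      then show "(\<lambda>n. sqrt ((1/4) ^ n * ?n h)) \<longlonglongrightarrow> 0" by simp
    qed
    then have "(\<lambda>n. (\<integral>x. g x * h x \<partial>M) - (\<integral>x. (g x - u n x) * h x \<partial>M)) \<longlonglongrightarrow> (\<integral>x. g x * h x \<partial>M) - 0"
      by (intro tendsto_intros)
    moreover have "(\<integral>x. g x * h x \<partial>M) - (\<integral>x. (g x - u n x) * h x \<partial>M) = (\<integral>x. u n x * h x \<partial>M)" for n
      using square_int_mult[OF g(1) h] square_int_mult[OF us h, of n] by (simp add: left_diff_distrib)
    ultimately have "(\<lambda>n. (\<integral>x. u n x * h x \<partial>M)) \<longlonglongrightarrow> (\<integral>x. g x * h x \<partial>M)" by simp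
    moreover have "\<forall>\<^sub>F n in sequentially. A \<le> (\<integral>x. u n x * h x \<partial>M)"
    proof (rule eventually_sequentiallyI[of n0])
      fix n assume "n0 \<le> n"
      then have "u n \<in> midtail f n0" using midtail_mono[OF u(1), of n0] rn[of n] by simp
      then show "A \<le> (\<integral>x. u n x * h x \<partial>M)" by (rule mt)
    qed
    ultimately show ?thesis by (intro tendsto_lowerbound) auto
  qed
  then show ?thesis using g(1) by blast
qed

section \<open>Transport cost and distribution functions\<close>

lemma cdf_distribution_support:
  assumes "cdf_distribution M" and F: "\<And>y. y < a \<Longrightarrow> cdf M y = 0" "\<And>y. b \<le> y \<Longrightarrow> cdf M y = 1"
    and w: "0 < \<omega>" "\<omega> < 1"
  shows "a \<le> right_continuous_mono.I (cdf M) \<omega>" "right_continuous_mono.I (cdf M) \<omega> \<le> b"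
proof -
  interpret cdf_distribution M by fact
  have p: "\<omega> \<le> cdf M x \<longleftrightarrow> I \<omega> \<le> x" for x by (rule pseudoinverse) (use w in auto)
  show "I \<omega> \<le> b" using p[of b] F(2)[of b] w by simp
  show "a \<le> I \<omega>"
  proof (rule ccontr)
    assume "\<not> a \<le> I \<omega>"
    then show False using p[of "I \<omega>"] F(1)[of "I \<omega>"] w by simp
  qed
qed

text \<open>
  The quantile functions \<open>I1\<close> and \<open>I2\<close> of the two measures on the unit interval give a coupling. Their L1 distance is the
  area between the two distribution functions, and \<open>(I1 - I2)\<^sup>2 \<le> (b - a) * \<bar>I1 - I2\<bar>\<close>. Composing with \<open>S\<close>
  estimates the distance from an image of the first measure, here from the atoms that
  project to it.
\<close>

lemma transport_cost_cdf_le: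
  assumes M1: "real_distribution M1" and M2: "real_distribution M2"
    and F1: "\<And>y. y < a \<Longrightarrow> cdf M1 y = 0" "\<And>y. b \<le> y \<Longrightarrow> cdf M1 y = 1"
    and F2: "\<And>y. y < a \<Longrightarrow> cdf M2 y = 0" "\<And>y. b \<le> y \<Longrightarrow> cdf M2 y = 1"
    and e: "\<And>y. \<bar>cdf M1 y - cdf M2 y\<bar> \<le> e" and ab: "a \<le> b" and e0: "0 \<le> e"
    and S: "S \<in> borel_measurable borel" and k: "(\<integral>\<^sup>+y. ennreal ((S y - y)\<^sup>2) \<partial>M1) \<le> ennreal k" and k0: "0 \<le> k"
  shows "transport_cost (distr M1 borel S) M2 \<le> ennreal (2 * k + 4 * (b - a)\<^sup>2 * e)"
proof -
  interpret M1: real_distribution M1 by fact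
  interpret M2: real_distribution M2 by fact
  interpret C1: cdf_distribution M1 ..
  interpret C2: cdf_distribution M2 ..
  have cd: "cdf_distribution M1" "cdf_distribution M2" ..
  let ?U = "restrict_space lborel {0<..<1::real}"
  let ?I1 = "C1.I" and ?I2 = "C2.I"
  have U[simp]: "space ?U = {0<..<1}" by (simp add: space_restrict_space)
  have Ib: "sets (restrict_space borel {0<..<1::real}) = sets ?U" by (simp add: sets_restrict_space)
  have I1[measurable]: "?I1 \<in> borel_measurable ?U" using C1.measurable_CI by (simp add: measurable_cong_sets[OF Ib refl])
  have I2[measurable]: "?I2 \<in> borel_measurable ?U" using C2.measurable_CI by (simp add: measurable_cong_sets[OF Ib refl])
  note S[measurable]
  have d1: "distr ?U borel ?I1 = M1" by (rule C1.distr_I_eq_M)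
  have d2: "distr ?U borel ?I2 = M2" by (rule C2.distr_I_eq_M)
  have dS: "distr ?U borel (\<lambda>w. S (?I1 w)) = distr M1 borel S"
  proof -
    have "distr (distr ?U borel ?I1) borel S = distr ?U borel (\<lambda>w. S (?I1 w))"
      by (subst distr_distr) (auto simp: comp_def)
    then show ?thesis by (simp only: d1)
  qed
  have b1: "a \<le> ?I1 w" "?I1 w \<le> b" if "0 < w" "w < 1" for w
    using cdf_distribution_support[OF cd(1) F1 that] by auto
  have b2: "a \<le> ?I2 w" "?I2 w \<le> b" if "0 < w" "w < 1" for w
    using cdf_distribution_support[OF cd(2) F2 that] by auto
  have p1: "w \<le> cdf M1 y \<longleftrightarrow> ?I1 w \<le> y" if "0 < w" "w < 1" for w y
    by (rule C1.pseudoinverse[OF that])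
  have p2: "w \<le> cdf M2 y \<longleftrightarrow> ?I2 w \<le> y" if "0 < w" "w < 1" for w y
    by (rule C2.pseudoinverse[OF that])
  have C1m[measurable]: "cdf M1 \<in> borel_measurable borel" and C2m[measurable]: "cdf M2 \<in> borel_measurable borel" by (rule C1.measurable_C C2.measurable_C)+
  \<comment> \<open>The region between the graphs: its vertical and horizontal sections measure the distance of the distribution functions and of the quantile functions.\<close>
  define A where "A = {(w, y). 0 < w \<and> w < 1 \<and> \<not> (w \<le> cdf M1 y \<longleftrightarrow> w \<le> cdf M2 y)}"
  have Am[measurable]: "A \<in> sets (lborel \<Otimes>\<^sub>M lborel)"
  proof -
    have "A = {z\<in>space (lborel \<Otimes>\<^sub>M lborel). 0 < fst z \<and> fst z < 1 \<and> \<not> (fst z \<le> cdf M1 (snd z) \<longleftrightarrow> fst z \<le> cdf M2 (snd z))}"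
      by (auto simp: A_def space_pair_measure)
    also have "\<dots> \<in> sets (lborel \<Otimes>\<^sub>M lborel)" by measurable
    finally show ?thesis .
  qed
  have dist: "ennreal \<bar>?I1 w - ?I2 w\<bar> = (\<integral>\<^sup>+y. indicator A (w, y) \<partial>lborel)" if w: "0 < w" "w < 1" for w
  proof -
    have "indicator A (w, y) = (indicator {min (?I1 w) (?I2 w)..<max (?I1 w) (?I2 w)} y :: ennreal)" for y
      using w p1[OF w, of y] p2[OF w, of y] by (auto simp: A_def indicator_def)
    then show ?thesis by (simp add: max_def min_def)
  qed
  have slice: "(\<integral>\<^sup>+w. indicator A (w, y) \<partial>lborel) \<le> ennreal (2 * e) * indicator {a..b} y" for y
  proof (cases "y \<in> {a..b}")
    case True
    have "(\<integral>\<^sup>+w. indicator A (w, y) \<partial>lborel) \<le> (\<integral>\<^sup>+w. indicator {cdf M1 y - e..cdf M1 y + e} w \<partial>lborel)"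
    proof (rule nn_integral_mono)
      fix w show "indicator A (w, y) \<le> (indicator {cdf M1 y - e..cdf M1 y + e} w :: ennreal)"
        using e[of y] by (auto simp: A_def indicator_def)
    qed
    also have "\<dots> = ennreal (2 * e)" using e0 by simp
    finally show ?thesis using True by simp
  next
    case False
    then have "cdf M1 y = cdf M2 y" using F1[of y] F2[of y] by (cases "y < a") auto
    then show ?thesis by (simp add: A_def)
  qed
  have L1: "(\<integral>\<^sup>+w. ennreal \<bar>?I1 w - ?I2 w\<bar> \<partial>?U) \<le> ennreal (2 * e * (b - a))"
  proof -
    have "(\<integral>\<^sup>+w. ennreal \<bar>?I1 w - ?I2 w\<bar> \<partial>?U) = (\<integral>\<^sup>+w. ennreal \<bar>?I1 w - ?I2 w\<bar> * indicator {0<..<1} w \<partial>lborel)"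
      by (rule nn_integral_restrict_space) simp
    also have "\<dots> \<le> (\<integral>\<^sup>+w. (\<integral>\<^sup>+y. indicator A (w, y) \<partial>lborel) \<partial>lborel)"
      by (rule nn_integral_mono) (auto simp: indicator_def dist)
    also have "\<dots> = (\<integral>\<^sup>+y. (\<integral>\<^sup>+w. indicator A (w, y) \<partial>lborel) \<partial>lborel)"
      by (rule lborel_pair.Fubini'[symmetric]) simp
    also have "\<dots> \<le> (\<integral>\<^sup>+y. ennreal (2 * e) * indicator {a..b} y \<partial>lborel)"
      by (rule nn_integral_mono) (rule slice)
    also have "\<dots> = ennreal (2 * e * (b - a))"
      using ab e0 by (subst nn_integral_cmult) (auto simp: ennreal_mult)
    finally show ?thesis .
  qed
  have "transport_cost (distr M1 borel S) M2 \<le> (\<integral>\<^sup>+w. ennreal ((S (?I1 w) - ?I2 w)\<^sup>2) \<partial>?U)"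
    by (rule transport_cost_map_le[OF _ _ dS d2]) measurable
  also have "\<dots> \<le> (\<integral>\<^sup>+w. 2 * ennreal ((S (?I1 w) - ?I1 w)\<^sup>2) + ennreal (2 * (b - a)) * ennreal \<bar>?I1 w - ?I2 w\<bar> \<partial>?U)"
  proof (rule nn_integral_mono)
    fix w assume "w \<in> space ?U"
    then have w: "0 < w" "w < 1" by auto
    define p where "p = S (?I1 w) - ?I1 w"
    define q where "q = ?I1 w - ?I2 w"
    have "\<bar>q\<bar> \<le> b - a" using b1[OF w] b2[OF w] by (auto simp: q_def)
    then have "\<bar>q\<bar> * \<bar>q\<bar> \<le> (b - a) * \<bar>q\<bar>" by (intro mult_right_mono) auto
    then have q2: "q\<^sup>2 \<le> (b - a) * \<bar>q\<bar>" by (simp add: power2_eq_square)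
    have "(S (?I1 w) - ?I2 w)\<^sup>2 = (p + q)\<^sup>2" by (simp add: p_def q_def)
    also have "\<dots> \<le> 2 * p\<^sup>2 + 2 * q\<^sup>2" using zero_le_power2[of "p - q"] by (simp add: power2_diff power2_sum)
    also have "\<dots> \<le> 2 * p\<^sup>2 + 2 * (b - a) * \<bar>q\<bar>" using q2 by (simp only: mult.assoc)
    finally have "ennreal ((S (?I1 w) - ?I2 w)\<^sup>2) \<le> ennreal (2 * p\<^sup>2 + 2 * (b - a) * \<bar>q\<bar>)" by (rule ennreal_leI)
    also have "\<dots> = 2 * ennreal (p\<^sup>2) + ennreal (2 * (b - a)) * ennreal \<bar>q\<bar>"
      using ab by (simp add: ennreal_plus ennreal_mult)
    finally show "ennreal ((S (?I1 w) - ?I2 w)\<^sup>2) \<le> 2 * ennreal ((S (?I1 w) - ?I1 w)\<^sup>2) + ennreal (2 * (b - a)) * ennreal \<bar>?I1 w - ?I2 w\<bar>"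
      by (simp add: p_def q_def)
  qed
  also have "\<dots> = 2 * (\<integral>\<^sup>+w. ennreal ((S (?I1 w) - ?I1 w)\<^sup>2) \<partial>?U) + ennreal (2 * (b - a)) * (\<integral>\<^sup>+w. ennreal \<bar>?I1 w - ?I2 w\<bar> \<partial>?U)"
    by (subst nn_integral_add) (auto simp: nn_integral_cmult)
  also have "(\<integral>\<^sup>+w. ennreal ((S (?I1 w) - ?I1 w)\<^sup>2) \<partial>?U) = (\<integral>\<^sup>+y. ennreal ((S y - y)\<^sup>2) \<partial>M1)"
  proof -
    have "(\<integral>\<^sup>+y. ennreal ((S y - y)\<^sup>2) \<partial>distr ?U borel ?I1) = (\<integral>\<^sup>+w. ennreal ((S (?I1 w) - ?I1 w)\<^sup>2) \<partial>?U)"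
      by (subst nn_integral_distr) auto
    then show ?thesis by (simp only: d1)
  qed
  also have "2 * (\<integral>\<^sup>+y. ennreal ((S y - y)\<^sup>2) \<partial>M1) + ennreal (2 * (b - a)) * (\<integral>\<^sup>+w. ennreal \<bar>?I1 w - ?I2 w\<bar> \<partial>?U)
     \<le> 2 * ennreal k + ennreal (2 * (b - a)) * ennreal (2 * e * (b - a))"
    by (intro add_mono mult_left_mono k L1) auto
  also have "\<dots> = ennreal (2 * k + 4 * (b - a)\<^sup>2 * e)"
  proof -
    have d: "0 \<le> b - a" using ab by simp
    have "ennreal (2 * (b - a)) * ennreal (2 * e * (b - a)) = ennreal ((2 * (b - a)) * (2 * e * (b - a)))"
      by (rule ennreal_mult[symmetric]) (use d e0 in auto)
    also have "(2 * (b - a)) * (2 * e * (b - a)) = 4 * (b - a)\<^sup>2 * e"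
      by (simp add: power2_eq_square algebra_simps)
    finally have 1: "ennreal (2 * (b - a)) * ennreal (2 * e * (b - a)) = ennreal (4 * (b - a)\<^sup>2 * e)" .
    have 2: "2 * ennreal k = ennreal (2 * k)" using k0 by (simp add: ennreal_mult)
    show ?thesis unfolding 1 2 by (rule ennreal_plus[symmetric]) (use k0 e0 in auto)
  qed
  finally show ?thesis .
qed

section \<open>Equicontinuity of the distribution functions\<close>

text \<open>
  The primitive of \<open>ramp l m\<close> vanishing at \<open>l\<close>, in the form of a Legendre transform: it is the maximum of
  \<open>c * (y - l) - c\<^sup>2 / 2\<close> over \<open>c \<in> [0, m]\<close> (for \<open>m \<ge> 0\<close>), attained at \<open>c = ramp l m y\<close>.
\<close>

definition ramp2 :: "real \<Rightarrow> real \<Rightarrow> real \<Rightarrow> real" where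
  "ramp2 l m y = ramp l m y * (y - l) - (ramp l m y)\<^sup>2 / 2"

lemma ramp_bounds: "0 \<le> m \<Longrightarrow> 0 \<le> ramp l m y \<and> ramp l m y \<le> m"
  by (auto simp: ramp_def)

lemma ramp2_max: assumes "0 \<le> c" "c \<le> m" shows "c * (y - l) - c\<^sup>2 / 2 \<le> ramp2 l m y"
proof -
  define w where "w = y - l"
  define r where "r = max 0 (min m w)"
  have "0 \<le> (r - c) * (w - (r + c) / 2)"
  proof -
    consider "w \<le> 0" | "0 \<le> w" "w \<le> m" | "m \<le> w" by linarith
    then show ?thesis
    proof cases
      case 1
      then have "r = 0" using assms by (auto simp: r_def)
      then show ?thesis using 1 assms by (intro mult_nonpos_nonpos) auto
    next
      case 2
      then have "r = w" by (auto simp: r_def)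
      then have "(r - c) * (w - (r + c) / 2) = (w - c)\<^sup>2 / 2" by (simp add: power2_eq_square field_simps)
      then show ?thesis using zero_le_power2[of "w - c"] by linarith
    next
      case 3
      then have "r = m" using assms by (auto simp: r_def)
      then show ?thesis using 3 assms by (intro mult_nonneg_nonneg) auto
    qed
  qed
  also have "(r - c) * (w - (r + c) / 2) = (r * w - r\<^sup>2 / 2) - (c * w - c\<^sup>2 / 2)"
    by (simp add: power2_eq_square field_simps)
  finally show ?thesis by (simp add: ramp2_def ramp_def r_def w_def)
qed

lemma ramp2_le:
  assumes "0 \<le> m"
  shows "ramp2 l m y - ramp2 l' m y' \<le> ramp l m y * ((y - l) - (y' - l'))"
  using ramp2_max[of "ramp l m y" m y' l'] ramp_bounds[OF assms, of l y]
  by (simp add: ramp2_def algebra_simps)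

lemma ramp2_lipschitz:
  assumes "0 \<le> m" shows "\<bar>ramp2 l m y - ramp2 l' m y\<bar> \<le> m * \<bar>l - l'\<bar>"
proof -
  have *: "ramp2 l m y - ramp2 l' m y \<le> m * \<bar>l - l'\<bar>" for l l'
  proof -
    have "ramp2 l m y - ramp2 l' m y \<le> ramp l m y * (l' - l)" using ramp2_le[OF assms, of l y l' y] by simp
    also have "\<dots> \<le> ramp l m y * \<bar>l - l'\<bar>" using ramp_bounds[OF assms, of l y] by (intro mult_left_mono) auto
    also have "\<dots> \<le> m * \<bar>l - l'\<bar>" using ramp_bounds[OF assms, of l y] by (intro mult_right_mono) auto
    finally show ?thesis .
  qed
  show ?thesis using *[of l l'] *[of l' l] by (simp add: abs_le_iff abs_minus_commute)
qed

context packing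
begin

definition cdfp :: "real \<Rightarrow> real" where "cdfp y = (\<Sum>i\<in>I. ramp (l i) (m i) y)"

lemma cont_cdfp: "continuous_on S cdfp"
  unfolding cdfp_def[abs_def] by (intro continuous_on_sum cont_ramp)

lemma cdfp_mono: "y \<le> z \<Longrightarrow> cdfp y \<le> cdfp z"
  unfolding cdfp_def by (intro sum_mono) (auto simp: ramp_def)

lemma cdfp_left: "y \<le> a \<Longrightarrow> cdfp y = 0"
  unfolding cdfp_def using cell_bounds(1) mpos by (intro sum.neutral) (force simp: ramp_def)

lemma cdfp_right: "b \<le> y \<Longrightarrow> cdfp y = 1"
proof -
  assume y: "b \<le> y"
  have "cdfp y = sum m I" unfolding cdfp_def
  proof (intro sum.cong refl)
    fix i assume "i \<in> I"
    then show "ramp (l i) (m i) y = m i" using cell_bounds(2)[of i] mpos[of i] y by (auto simp: ramp_def)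
  qed
  then show ?thesis by (simp add: msum)
qed

lemma cdfp_lipschitz: assumes "y \<le> z" shows "cdfp z - cdfp y \<le> z - y"
proof -
  have "y - cdfp y \<le> z - cdfp z"
  proof (rule nondecreasing_off_finite[OF finE assms, where f = "\<lambda>y. y - cdfp y" and f' = "\<lambda>y. 1 - (\<Sum>i\<in>I. if l i < y \<and> y < l i + m i then 1 else 0)"])
    show "continuous_on {y..z} (\<lambda>y. y - cdfp y)" by (intro continuous_intros cont_cdfp)
    fix u assume u: "u \<notin> E"
    have "(cdfp has_real_derivative (\<Sum>i\<in>I. if l i < u \<and> u < l i + m i then 1 else 0)) (at u)"
      unfolding cdfp_def[abs_def] using u by (intro DERIV_sum deriv_ramp mpos) (auto simp: E_def)
    then show "((\<lambda>y. y - cdfp y) has_real_derivative 1 - (\<Sum>i\<in>I. if l i < u \<and> u < l i + m i then 1 else 0)) (at u)"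
      by (intro derivative_intros)
    have "(\<Sum>i\<in>I. if l i < u \<and> u < l i + m i then 1 else 0) = rho u"
      unfolding rho_def by (intro sum.cong) (auto simp: cell_def indicator_def)
    then show "0 \<le> 1 - (\<Sum>i\<in>I. if l i < u \<and> u < l i + m i then 1 else 0 :: real)" using rho_01(2)[of u] by simp
  qed
  then show ?thesis by simp
qed

lemma real_distribution_proj: "real_distribution proj"
proof -
  have "prob_space proj" "sets proj = sets borel" using proj_in_K by (auto simp: K_set_def P_ac_def)
  then interpret prob_space proj by simp
  show ?thesis by standard fact
qed

lemma cdf_proj: "cdf proj y = cdfp y"
proof -
  have "emeasure proj {..y} = (\<integral>\<^sup>+z. indicator {..y} z \<partial>proj)" by (simp add: proj_def)
  also have "\<dots> = (\<Sum>i\<in>I. \<integral>\<^sup>+z. indicator {..y} z * indicator (cell i) z \<partial>lborel)"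
    by (rule nn_integral_proj) simp
  also have "\<dots> = (\<Sum>i\<in>I. ennreal (ramp (l i) (m i) y))"
  proof (intro sum.cong refl)
    fix i assume i: "i \<in> I"
    have "(\<integral>\<^sup>+z. indicator {..y} z * indicator (cell i) z \<partial>lborel) = (\<integral>\<^sup>+z. indicator {l i..l i + ramp (l i) (m i) y} z \<partial>lborel)"
    proof (rule nn_integral_cong_AE)
      have "AE z in lborel. z \<noteq> l i" "AE z in lborel. z \<noteq> l i + m i" "AE z in lborel. z \<noteq> y" by (rule AE_lborel_singleton)+
      then show "AE z in lborel. indicator {..y} z * indicator (cell i) z = (indicator {l i..l i + ramp (l i) (m i) y} z :: ennreal)"
        by eventually_elim (use mpos[OF i] in \<open>auto simp: cell_def indicator_def ramp_def\<close>)
    qed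
    also have "\<dots> = ennreal (ramp (l i) (m i) y)" using ramp_bounds[of "m i" "l i" y] mpos[OF i] by simp
    finally show "(\<integral>\<^sup>+z. indicator {..y} z * indicator (cell i) z \<partial>lborel) = ennreal (ramp (l i) (m i) y)" .
  qed
  also have "\<dots> = ennreal (cdfp y)"
    unfolding cdfp_def by (intro sum_ennreal) (simp add: ramp_bounds mpos less_imp_le)
  finally have "emeasure proj {..y} = ennreal (cdfp y)" .
  moreover have "0 \<le> cdfp y" unfolding cdfp_def by (intro sum_nonneg) (simp add: ramp_bounds mpos less_imp_le)
  ultimately show ?thesis by (simp add: cdf_def measure_def)
qed

end

text \<open>
  The primitives of the two distribution functions differ by at most \<open>\<delta>\<^sup>2\<close>. By monotonicity a value of
  the first function is at most its mean over an interval of length \<open>\<delta>\<close> to the right, which is compared with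
  the mean of the second, and the Lipschitz bound replaces that mean by the value. The means are differences of the primitives, whence the convexity inequality \<open>ramp2_le\<close>.
\<close>

lemma cdfp_sup_distance:
  assumes P: "packing I m x a b l" and Q: "packing I m y a b k"
    and W: "(\<Sum>i\<in>I. m i * \<bar>l i - k i\<bar>) \<le> \<delta>\<^sup>2" and d: "0 < \<delta>"
  shows "\<bar>packing.cdfp I m l z - packing.cdfp I m k z\<bar> \<le> 3 * \<delta>"
proof -
  have *: "packing.cdfp I m l z - packing.cdfp I m k z \<le> 3 * \<delta>"
    if P: "packing I m x a b l" and Q: "packing I m y a b k"
    and W: "(\<Sum>i\<in>I. m i * \<bar>l i - k i\<bar>) \<le> \<delta>\<^sup>2" for x y l k
  proof -
    interpret P: packing I m x a b l by fact
    interpret Q: packing I m y a b k by fact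
    have m0: "0 \<le> m i" if "i \<in> I" for i using P.mpos[OF that] by simp
    let ?\<Phi> = "\<lambda>l z. \<Sum>i\<in>I. ramp2 (l i) (m i) z"
    have lip: "\<bar>?\<Phi> l u - ?\<Phi> k u\<bar> \<le> \<delta>\<^sup>2" for u
    proof -
      have "\<bar>?\<Phi> l u - ?\<Phi> k u\<bar> \<le> (\<Sum>i\<in>I. \<bar>ramp2 (l i) (m i) u - ramp2 (k i) (m i) u\<bar>)"
        unfolding sum_subtractf[symmetric] by (rule sum_abs)
      also have "\<dots> \<le> (\<Sum>i\<in>I. m i * \<bar>l i - k i\<bar>)" by (intro sum_mono ramp2_lipschitz m0)
      finally show ?thesis using W by simp
    qed
    have 1: "\<delta> * P.cdfp z \<le> ?\<Phi> l (z + \<delta>) - ?\<Phi> l z"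
    proof -
      have "?\<Phi> l z - ?\<Phi> l (z + \<delta>) \<le> (\<Sum>i\<in>I. ramp (l i) (m i) z * ((z - l i) - (z + \<delta> - l i)))"
        unfolding sum_subtractf[symmetric] by (intro sum_mono ramp2_le m0)
      also have "\<dots> = - \<delta> * P.cdfp z" unfolding P.cdfp_def sum_distrib_left by (intro sum.cong) (auto simp: algebra_simps)
      finally show ?thesis by simp
    qed
    have 2: "?\<Phi> k (z + \<delta>) - ?\<Phi> k z \<le> \<delta> * Q.cdfp (z + \<delta>)"
    proof -
      have "?\<Phi> k (z + \<delta>) - ?\<Phi> k z \<le> (\<Sum>i\<in>I. ramp (k i) (m i) (z + \<delta>) * ((z + \<delta> - k i) - (z - k i)))"
        unfolding sum_subtractf[symmetric] by (intro sum_mono ramp2_le m0)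
      also have "\<dots> = \<delta> * Q.cdfp (z + \<delta>)" unfolding Q.cdfp_def sum_distrib_left by (intro sum.cong) (auto simp: algebra_simps)
      finally show ?thesis by simp
    qed
    have "Q.cdfp (z + \<delta>) \<le> Q.cdfp z + \<delta>" using Q.cdfp_lipschitz[of z "z + \<delta>"] d by simp
    then have "\<delta> * Q.cdfp (z + \<delta>) \<le> \<delta> * (Q.cdfp z + \<delta>)" using d by (intro mult_left_mono) auto
    then have "\<delta> * P.cdfp z \<le> \<delta> * (Q.cdfp z + \<delta>) + 2 * \<delta>\<^sup>2"
      using 1 2 lip[of z] lip[of "z + \<delta>"] by linarith
    then have "\<delta> * P.cdfp z \<le> \<delta> * (Q.cdfp z + 3 * \<delta>)" by (simp add: power2_eq_square algebra_simps)
    then show ?thesis using d by simp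
  qed
  show ?thesis using *[OF P Q W] *[OF Q P] W by (simp add: abs_le_iff abs_minus_commute)
qed

lemma integral_square_le:
  fixes g :: "real \<Rightarrow> real"
  assumes st: "s \<le> t" and g: "continuous_on {s..t} g"
  shows "(integral {s..t} g)\<^sup>2 \<le> (t - s) * integral {s..t} (\<lambda>u. (g u)\<^sup>2)"
proof (cases "s = t")
  case False
  then have d: "0 < t - s" using st by simp
  define \<mu> where "\<mu> = integral {s..t} g / (t - s)"
  have i1: "g integrable_on {s..t}" "(\<lambda>u. (g u)\<^sup>2) integrable_on {s..t}"
    using g by (auto intro!: integrable_continuous_real continuous_intros)
  have "0 \<le> integral {s..t} (\<lambda>u. (g u - \<mu>)\<^sup>2)"
    by (intro integral_nonneg integrable_continuous_real continuous_intros g) auto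
  also have "(\<lambda>u. (g u - \<mu>)\<^sup>2) = (\<lambda>u. ((g u)\<^sup>2 - (2 * \<mu>) * g u) + \<mu>\<^sup>2)"
    by (simp add: power2_eq_square algebra_simps fun_eq_iff)
  also have "integral {s..t} \<dots> = integral {s..t} (\<lambda>u. (g u)\<^sup>2) - 2 * \<mu> * integral {s..t} g + (t - s) * \<mu>\<^sup>2"
  proof (rule integral_unique, intro has_integral_add has_integral_diff has_integral_mult_right integrable_integral i1)
    show "((\<lambda>x. \<mu>\<^sup>2) has_integral (t - s) * \<mu>\<^sup>2) {s..t}" using has_integral_const_real[of "\<mu>\<^sup>2" s t] st by simp
  qed
  also have "2 * \<mu> * integral {s..t} g = 2 * ((t - s) * \<mu>\<^sup>2)"
    using d by (simp add: \<mu>_def power2_eq_square)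
  finally have "(t - s) * ((t - s) * \<mu>\<^sup>2) \<le> (t - s) * integral {s..t} (\<lambda>u. (g u)\<^sup>2)"
    using d by (intro mult_left_mono) auto
  also have "(t - s) * ((t - s) * \<mu>\<^sup>2) = (integral {s..t} g)\<^sup>2"
    using d by (simp add: \<mu>_def power2_eq_square)
  finally show ?thesis .
qed simp

context block_flow
begin

lemma displacement:
  assumes st: "s \<in> {0..T}" "t \<in> {0..T}" "s \<le> t"
  shows "(\<Sum>i\<in>I. m i * (x t i - x s i)\<^sup>2) \<le> (t - s) * integral {0..T} speed2"
proof -
  have sub: "{s..t} \<subseteq> {0..T}" using st by auto
  have c: "continuous_on {s..t} (\<lambda>u. x' u i)" if "i \<in> I" for i
    using contx'[OF that] sub continuous_on_subset by blast
  have "(\<Sum>i\<in>I. m i * (x t i - x s i)\<^sup>2) \<le> (\<Sum>i\<in>I. m i * ((t - s) * integral {s..t} (\<lambda>u. (x' u i)\<^sup>2)))"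
  proof (intro sum_mono mult_left_mono mnonneg)
    fix i assume i: "i \<in> I"
    have "((\<lambda>u. x' u i) has_integral (x t i - x s i)) {s..t}"
    proof (rule fundamental_theorem_of_calculus[OF st(3)])
      fix u assume "u \<in> {s..t}"
      then have "u \<in> {0..T}" using sub by auto
      from deriv[OF i this] show "((\<lambda>s. x s i) has_vector_derivative x' u i) (at u within {s..t})"
        using sub by (auto simp: has_real_derivative_iff_has_vector_derivative intro: has_vector_derivative_within_subset)
    qed
    then have "x t i - x s i = integral {s..t} (\<lambda>u. x' u i)" by (simp add: integral_unique)
    then show "(x t i - x s i)\<^sup>2 \<le> (t - s) * integral {s..t} (\<lambda>u. (x' u i)\<^sup>2)"
      using integral_square_le[OF st(3) c[OF i]] by simp
  qed
  also have "\<dots> = (t - s) * integral {s..t} speed2"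
  proof -
    have "integral {s..t} speed2 = (\<Sum>i\<in>I. integral {s..t} (\<lambda>u. m i * (x' u i)\<^sup>2))"
      unfolding speed2_def[abs_def]
      by (intro Henstock_Kurzweil_Integration.integral_sum fin integrable_continuous_real continuous_intros c)
    then show ?thesis by (simp add: sum_distrib_left mult_ac)
  qed
  also have "\<dots> \<le> (t - s) * integral {0..T} speed2"
  proof (rule mult_left_mono)
    have "speed2 integrable_on {s..t}" "speed2 integrable_on {0..T}"
      using cont_speed2 sub by (auto intro!: integrable_continuous_real intro: continuous_on_subset)
    moreover have "0 \<le> speed2 u" for u unfolding speed2_def by (intro sum_nonneg mult_nonneg_nonneg mnonneg) auto
    ultimately show "integral {s..t} speed2 \<le> integral {0..T} speed2" by (intro integral_subset_le sub) auto
  qed (use st in auto)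
  finally show ?thesis .
qed

definition Fc :: "real \<Rightarrow> real \<Rightarrow> real" where "Fc t y = packing.cdfp I m (l t) y"

text \<open>
  The action bounds the displacement of the particles, and by nonexpansiveness that of the blocks.
\<close>

lemma Fc_time:
  assumes st: "s \<in> {0..T}" "t \<in> {0..T}" and C: "integral {0..T} speed2 \<le> C"
    and d: "0 < \<delta>" "\<bar>t - s\<bar> * C \<le> \<delta> ^ 4"
  shows "\<bar>Fc t y - Fc s y\<bar> \<le> 3 * \<delta>"
  unfolding Fc_def
proof (rule cdfp_sup_distance[OF pack[OF st(2)] pack[OF st(1)] _ d(1)])
  have X: "(\<Sum>i\<in>I. m i * (x t i - x s i)\<^sup>2) \<le> \<bar>t - s\<bar> * C"
  proof (cases "s \<le> t")
    case True
    then show ?thesis using displacement[OF st True] mult_left_mono[OF C, of "t - s"] by simp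
  next
    case False
    then have ts: "t \<le> s" by simp
    have "(\<Sum>i\<in>I. m i * (x t i - x s i)\<^sup>2) = (\<Sum>i\<in>I. m i * (x s i - x t i)\<^sup>2)" by (simp add: power2_commute)
    then show ?thesis using displacement[OF st(2,1) ts] mult_left_mono[OF C, of "s - t"] ts by simp
  qed
  have n: "(\<Sum>i\<in>I. m i * (l t i - l s i)\<^sup>2) \<le> (\<delta>\<^sup>2)\<^sup>2"
    using nonexpansive[OF st(2,1)] X d(2) by (simp add: power_mult[symmetric])
  have "(\<Sum>i\<in>I. m i * \<bar>l t i - l s i\<bar>) * (2 * \<delta>\<^sup>2) = (\<Sum>i\<in>I. m i * (2 * \<bar>l t i - l s i\<bar> * \<delta>\<^sup>2))"
    unfolding sum_distrib_right by (intro sum.cong) auto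
  also have "\<dots> \<le> (\<Sum>i\<in>I. m i * ((l t i - l s i)\<^sup>2 + (\<delta>\<^sup>2)\<^sup>2))"
  proof (intro sum_mono mult_left_mono mnonneg)
    fix i
    define r where "r = \<bar>l t i - l s i\<bar>"
    have "0 \<le> (r - \<delta>\<^sup>2)\<^sup>2" by (rule zero_le_power2)
    also have "\<dots> = r\<^sup>2 + (\<delta>\<^sup>2)\<^sup>2 - 2 * r * \<delta>\<^sup>2" by (rule power2_diff)
    finally show "2 * \<bar>l t i - l s i\<bar> * \<delta>\<^sup>2 \<le> (l t i - l s i)\<^sup>2 + (\<delta>\<^sup>2)\<^sup>2" by (simp only: r_def power2_abs)
  qed
  also have "\<dots> = (\<Sum>i\<in>I. m i * (l t i - l s i)\<^sup>2) + (\<delta>\<^sup>2)\<^sup>2"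
    using msum by (simp add: distrib_left sum.distrib sum_distrib_right[symmetric])
  also have "\<dots> \<le> \<delta>\<^sup>2 * (2 * \<delta>\<^sup>2)" using n by (simp add: power2_eq_square)
  finally have "(\<Sum>i\<in>I. m i * \<bar>l t i - l s i\<bar>) * (2 * \<delta>\<^sup>2) \<le> \<delta>\<^sup>2 * (2 * \<delta>\<^sup>2)" .
  then show "(\<Sum>i\<in>I. m i * \<bar>l t i - l s i\<bar>) \<le> \<delta>\<^sup>2" using d(1) by (simp add: mult_le_cancel_right)
qed

end

section \<open>The discrete pressure gradient\<close>

lemma has_integral_open_upto:
  fixes u v y :: real
  assumes "0 \<le> v"
  shows "has_bochner_integral lborel (\<lambda>z. (if u < z \<and> z < u + v then 1 else 0) * indicator {..y} z) (ramp u v y)"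
proof -
  have 1: "has_bochner_integral lborel (indicator {u..u + ramp u v y} :: real \<Rightarrow> real) (measure lborel {u..u + ramp u v y})"
    by (rule has_bochner_integral_real_indicator) (auto simp: emeasure_lborel_Icc_eq)
  have 2: "measure lborel {u..u + ramp u v y} = ramp u v y" using ramp_bounds[OF assms, of u y] by simp
  have "AE z in lborel. z \<noteq> u" "AE z in lborel. z \<noteq> u + v" "AE z in lborel. z \<noteq> y" by (rule AE_lborel_singleton)+
  then have "AE z in lborel. (indicator {u..u + ramp u v y} z :: real) = (if u < z \<and> z < u + v then 1 else 0) * indicator {..y} z"
    by eventually_elim (use assms in \<open>auto simp: indicator_def ramp_def\<close>)
  from has_bochner_integral_cong_AE[THEN iffD1, OF _ _ this 1] show ?thesis unfolding 2 by simp
qed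

lemma has_integral_unit_upto:
  fixes a y :: real
  shows "has_bochner_integral lborel (\<lambda>z. (if a - 1 \<le> z \<and> z < a then 1 else 0) * indicator {..y} z) (ramp (a - 1) 1 y)"
proof -
  have "AE z in lborel. z \<noteq> a - 1" by (rule AE_lborel_singleton)
  then have "AE z in lborel. (if a - 1 < z \<and> z < a - 1 + 1 then 1 else 0) * indicator {..y} z = (if a - 1 \<le> z \<and> z < a then 1 else 0 :: real) * indicator {..y} z"
    by eventually_elim auto
  from has_bochner_integral_cong_AE[THEN iffD1, OF _ _ this has_integral_open_upto[of 1 "a - 1" y]] show ?thesis by simp
qed

text \<open>
  Fubini on the region \<open>z \<le> x\<close>.
\<close>

lemma primitive_by_parts:
  fixes f h :: "real \<Rightarrow> real"
  assumes f: "integrable lborel f" and h: "integrable lborel h"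
  shows "(\<integral>x. h x * (\<integral>z. f z * indicator {..x} z \<partial>lborel) \<partial>lborel) = (\<integral>z. f z * (\<integral>x. h x * indicator {z..} x \<partial>lborel) \<partial>lborel)"
proof -
  have fm[measurable]: "f \<in> borel_measurable borel" and hm[measurable]: "h \<in> borel_measurable borel" using f h by auto
  let ?k = "\<lambda>x z. h x * (f z * indicator {..x} z) :: real"
  have km: "(\<lambda>(x, z). ?k x z) \<in> borel_measurable (lborel \<Otimes>\<^sub>M lborel)"
  proof -
    have "(\<lambda>(x, z). ?k x z) = (\<lambda>w. if snd w \<le> fst w then h (fst w) * f (snd w) else 0)"
      by (auto simp: fun_eq_iff indicator_def)
    also have "\<dots> \<in> borel_measurable (lborel \<Otimes>\<^sub>M lborel)" by measurable
    finally show ?thesis .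
  qed
  have fi: "integrable lborel (\<lambda>z. f z * indicator {..x} z)" for x
    using f by (intro integrable_real_mult_indicator) auto
  have ki: "integrable (lborel \<Otimes>\<^sub>M lborel) (\<lambda>(x, z). ?k x z)"
  proof (rule lborel_pair.Fubini_integrable[OF km])
    show "AE x in lborel. integrable lborel (\<lambda>z. case (x, z) of (x, z) \<Rightarrow> ?k x z)"
      using fi by auto
    have 1: "integrable lborel (\<lambda>x. norm (h x) * (\<integral>z. norm (f z) \<partial>lborel))" using h by auto
    show "integrable lborel (\<lambda>x. \<integral>z. norm (case (x, z) of (x, z) \<Rightarrow> ?k x z) \<partial>lborel)"
    proof (rule Bochner_Integration.integrable_bound[OF 1])
      show "(\<lambda>x. \<integral>z. norm (case (x, z) of (x, z) \<Rightarrow> ?k x z) \<partial>lborel) \<in> borel_measurable lborel"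
        using km by (intro lborel.borel_measurable_lebesgue_integral borel_measurable_norm) (simp add: case_prod_unfold)
      have "(\<integral>z. norm (?k x z) \<partial>lborel) \<le> (\<integral>z. norm (h x) * norm (f z) \<partial>lborel)" for x
        using f by (intro integral_mono integrable_norm integrable_mult_right fi) (auto simp: indicator_def abs_mult)
      then show "AE x in lborel. norm (\<integral>z. norm (case (x, z) of (x, z) \<Rightarrow> ?k x z) \<partial>lborel) \<le> norm (norm (h x) * (\<integral>z. norm (f z) \<partial>lborel))"
        by (auto simp: abs_mult)
    qed
  qed
  have "(\<integral>x. (\<integral>z. ?k x z \<partial>lborel) \<partial>lborel) = (\<integral>z. (\<integral>x. ?k x z \<partial>lborel) \<partial>lborel)"
    by (rule lborel_pair.Fubini_integral[OF ki, symmetric])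
  moreover have "(\<integral>z. ?k x z \<partial>lborel) = h x * (\<integral>z. f z * indicator {..x} z \<partial>lborel)" for x
    by simp
  moreover have "(\<integral>x. ?k x z \<partial>lborel) = f z * (\<integral>x. h x * indicator {z..} x \<partial>lborel)" for z
  proof -
    have "(\<lambda>x. ?k x z) = (\<lambda>x. f z * (h x * indicator {z..} x))" by (auto simp: indicator_def fun_eq_iff)
    then show ?thesis by (simp only:) simp
  qed
  ultimately show ?thesis by simp
qed

lemma (in packing) has_integral_cell_square:
  assumes "i \<in> I"
  shows "has_bochner_integral lborel (\<lambda>y. (v - y)\<^sup>2 * indicator (cell i) y) (m i * ((v - \<beta> i)\<^sup>2 + (m i)\<^sup>2 / 12))"
proof -
  have "AE y in lborel. y \<noteq> l i" "AE y in lborel. y \<noteq> l i + m i" by (rule AE_lborel_singleton)+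
  then have "AE y in lborel. (v - y)\<^sup>2 * indicator {l i..l i + m i} y = (v - y)\<^sup>2 * indicator (cell i) y"
    by eventually_elim (auto simp: cell_def indicator_def)
  from has_bochner_integral_cong_AE[THEN iffD1, OF _ _ this cell_second_moment] show ?thesis
    using mpos[OF assms] by (auto simp: cell_def)
qed

lemma (in packing) has_integral_cell:
  assumes "i \<in> I" shows "has_bochner_integral lborel (\<lambda>y. indicator (cell i) y :: real) (m i)"
  using has_bochner_integral_real_indicator[of "cell i" lborel] emeasure_cell[OF assms] mpos[OF assms]
  by (simp add: cell_def measure_def)

text \<open>
  Evaluation at the clamped time extends functions on \<open>[0, T]\<close> to the line without losing measurability.
\<close>

definition clampT :: "real \<Rightarrow> real \<Rightarrow> real" where "clampT T t = max 0 (min T t)"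

lemma cont_clampT: "continuous_on S (clampT T)"
  unfolding clampT_def[abs_def] by (intro continuous_intros)

lemma clampT_in: "0 < T \<Longrightarrow> clampT T t \<in> {0..T}" by (auto simp: clampT_def)
lemma clampT_id: "t \<in> {0..T} \<Longrightarrow> clampT T t = t" by (auto simp: clampT_def)

lemma continuous_on_clampT:
  assumes "continuous_on {0..T} f" "0 < T"
  shows "(\<lambda>t. f (clampT T t)) \<in> borel_measurable borel"
  by (rule borel_measurable_continuous_onI, rule continuous_on_compose2[OF assms(1) cont_clampT])
     (use clampT_in assms(2) in auto)

context block_flow
begin

definition force :: "real \<Rightarrow> nat \<Rightarrow> real" where "force t i = real N * (x t i - (l t i + m i / 2))"

text \<open>
  To the left of \<open>a\<close>, \<open>N\<close> times the pressure is the constant \<open>N * c\<close>, in general not zero. Spreading it over the unit interval \<open>[a - 1, a]\<close> yields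
  a function \<open>fieldS t\<close> of compact support, whose primitive is \<open>N\<close> times the pressure on \<open>[a, \<infinity>)\<close>
  (\<open>slice_primitive\<close>). The integration constant thus becomes a part of the function whose weak limit is taken.
\<close>

definition base :: "real \<Rightarrow> real" where "base t = real N * packing.c I m (x t) (l t)"

definition fieldS :: "real \<Rightarrow> real \<Rightarrow> real" where
  "fieldS t y = base t * (if a - 1 \<le> y \<and> y < a then 1 else 0) +
     (\<Sum>i\<in>I. force t i * (if l t i < y \<and> y < l t i + m i then 1 else 0))"

definition field :: "real \<times> real \<Rightarrow> real" where
  "field z = (if fst z \<in> {0..T} then fieldS (clampT T (fst z)) (snd z) else 0)"

lemma field_eq: "t \<in> {0..T} \<Longrightarrow> field (t, y) = fieldS t y"
  by (simp add: field_def clampT_id)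

lemma field_out: "t \<notin> {0..T} \<Longrightarrow> field (t, y) = 0"
  by (simp add: field_def del: atLeastAtMost_iff)

lemma force_eq: "i \<in> I \<Longrightarrow> t \<in> {0..T} \<Longrightarrow> force t i = - x' t i - dV (x t i)"
  using ode[of i t] by (simp add: force_def)

lemma cont_force: "i \<in> I \<Longrightarrow> continuous_on {0..T} (\<lambda>t. force t i)"
  unfolding force_def by (intro continuous_intros contx contl)

text \<open>
  The family of initial segments is constant in time, so \<open>c\<close> is a maximum of finitely many continuous functions.
\<close>

lemma base_measurable: "(\<lambda>t. base (clampT T t)) \<in> borel_measurable borel"
proof -
  define \<J> where "\<J> = {J. packing.initseg I (x 0) J}"
  have fJ: "finite \<J>" unfolding \<J>_def by (rule packing.finite_initsegs[OF pack[OF T0]])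
  have ini: "packing.initseg I (x t) J \<longleftrightarrow> J \<in> \<J>" if t: "t \<in> {0..T}" for t J
  proof -
    have o: "x t i \<le> x t j \<longleftrightarrow> x 0 i \<le> x 0 j" if "i \<in> I" "j \<in> I" for i j
      using order[OF t T0 that(2,1)] order[OF T0 t that(2,1)] by linarith
    show ?thesis unfolding \<J>_def packing.initseg_def[OF pack[OF t]] packing.initseg_def[OF pack[OF T0]] mem_Collect_eq
      using o by (auto; blast)
  qed
  have JI: "J \<subseteq> I" if "J \<in> \<J>" for J
    using that by (auto simp: \<J>_def packing.initseg_def[OF pack[OF T0]])
  have "{J. packing.initseg I (x t) J} = \<J>" if "t \<in> {0..T}" for t using ini[OF that] by blast
  then have "base t = real N * Max ((\<lambda>J. - (\<Sum>j\<in>J. m j * (x t j - (l t j + m j / 2)))) ` \<J>)" if "t \<in> {0..T}" for t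
    unfolding base_def packing.c_def[OF pack[OF that]] packing.U_def[OF pack[OF that]]
    using that by simp
  then have e: "base (clampT T t) = real N * Max ((\<lambda>J. - (\<Sum>j\<in>J. m j * (x (clampT T t) j - (l (clampT T t) j + m j / 2)))) ` \<J>)" for t
    using clampT_in[OF T] by blast
  have "(\<lambda>t. - (\<Sum>j\<in>J. m j * (x (clampT T t) j - (l (clampT T t) j + m j / 2)))) \<in> borel_measurable borel" if "J \<in> \<J>" for J
    using continuous_on_clampT[OF contx T] continuous_on_clampT[OF contl T] JI[OF that]
    by (intro borel_measurable_uminus borel_measurable_sum borel_measurable_times borel_measurable_diff borel_measurable_add) auto
  then show ?thesis unfolding e using fJ by (intro borel_measurable_times borel_measurable_Max) auto
qed

lemma field_measurable[measurable]: "field \<in> borel_measurable borel"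
proof -
  have [measurable]: "(\<lambda>t. base (clampT T t)) \<in> borel_measurable borel" by (rule base_measurable)
  have f: "(\<lambda>t. force (clampT T t) i) \<in> borel_measurable borel" if "i \<in> I" for i
    by (rule continuous_on_clampT[OF cont_force[OF that] T])
  have l: "(\<lambda>t. l (clampT T t) i) \<in> borel_measurable borel" if "i \<in> I" for i
    by (rule continuous_on_clampT[OF contl[OF that] T])
  have s: "(\<lambda>z. force (clampT T (fst z)) i * (if l (clampT T (fst z)) i < snd z \<and> snd z < l (clampT T (fst z)) i + m i then 1 else 0)) \<in> borel_measurable (borel :: (real \<times> real) measure)"
    if i: "i \<in> I" for i
  proof -
    note [measurable] = f[OF i] l[OF i]
    show ?thesis by measurable
  qed
  have "(\<lambda>z. fieldS (clampT T (fst z)) (snd z)) \<in> borel_measurable (borel :: (real \<times> real) measure)"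
    unfolding fieldS_def by (intro borel_measurable_add borel_measurable_sum s) measurable
  then show ?thesis unfolding field_def by measurable
qed

lemma cell_ind: "t \<in> {0..T} \<Longrightarrow> (if l t i < y \<and> y < l t i + m i then 1 else 0) = (indicator (packing.cell m (l t) i) y :: real)"
  by (simp add: packing.cell_def[OF pack] indicator_def)

lemma base_le: assumes t: "t \<in> {0..T}" shows "(base t)\<^sup>2 \<le> (\<Sum>i\<in>I. m i * (force t i)\<^sup>2)"
proof -
  have "\<bar>base t\<bar> = real N * \<bar>packing.c I m (x t) (l t)\<bar>" by (simp add: base_def abs_mult)
  also have "\<dots> \<le> real N * (\<Sum>i\<in>I. m i * \<bar>x t i - (l t i + m i / 2)\<bar>)"
    by (intro mult_left_mono packing.abs_c_le[OF pack[OF t]]) simp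
  also have "\<dots> = (\<Sum>i\<in>I. m i * \<bar>force t i\<bar>)" unfolding sum_distrib_left by (intro sum.cong) (auto simp: force_def abs_mult)
  finally have 1: "\<bar>base t\<bar> \<le> (\<Sum>i\<in>I. m i * \<bar>force t i\<bar>)" .
  let ?A = "\<Sum>i\<in>I. m i * \<bar>force t i\<bar>"
  have "0 \<le> (\<Sum>i\<in>I. m i * (\<bar>force t i\<bar> - ?A)\<^sup>2)" by (intro sum_nonneg mult_nonneg_nonneg mnonneg) auto
  also have "\<dots> = (\<Sum>i\<in>I. m i * (force t i)\<^sup>2 - 2 * ?A * (m i * \<bar>force t i\<bar>) + m i * ?A\<^sup>2)"
    by (intro sum.cong refl) (simp add: power2_diff algebra_simps)
  also have "\<dots> = (\<Sum>i\<in>I. m i * (force t i)\<^sup>2) - 2 * ?A * ?A + ?A\<^sup>2"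
    using msum by (simp add: sum.distrib sum_subtractf sum_distrib_left[symmetric] sum_distrib_right[symmetric])
  finally have "?A\<^sup>2 \<le> (\<Sum>i\<in>I. m i * (force t i)\<^sup>2)" by (simp add: power2_eq_square)
  moreover have "(base t)\<^sup>2 \<le> ?A\<^sup>2" using power_mono[OF 1, of 2] by simp
  ultimately show ?thesis by linarith
qed

lemma slice_square:
  assumes t: "t \<in> {0..T}"
  shows "has_bochner_integral lborel (\<lambda>y. (fieldS t y)\<^sup>2) ((base t)\<^sup>2 + (\<Sum>i\<in>I. m i * (force t i)\<^sup>2))"
proof -
  interpret P: packing I m "x t" a b "l t" by (rule pack[OF t])
  have u: "has_bochner_integral lborel (\<lambda>y. if a - 1 \<le> y \<and> y < a then 1 else 0 :: real) 1"
  proof -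
    have "has_bochner_integral lborel (indicator {a-1..<a} :: real \<Rightarrow> real) (measure lborel {a-1..<a})"
      by (rule has_bochner_integral_real_indicator) auto
    then show ?thesis by (rule has_bochner_integral_cong[THEN iffD1, rotated -1]) (auto simp: indicator_def)
  qed
  have "has_bochner_integral lborel (\<lambda>y. (base t)\<^sup>2 * (if a - 1 \<le> y \<and> y < a then 1 else 0) + (\<Sum>i\<in>I. (force t i)\<^sup>2 * indicator (P.cell i) y))
     ((base t)\<^sup>2 * 1 + (\<Sum>i\<in>I. (force t i)\<^sup>2 * m i))"
    by (intro has_bochner_integral_add has_bochner_integral_sum has_bochner_integral_mult_right u P.has_integral_cell)
  moreover have "(fieldS t y)\<^sup>2 = (base t)\<^sup>2 * (if a - 1 \<le> y \<and> y < a then 1 else 0) + (\<Sum>i\<in>I. (force t i)\<^sup>2 * indicator (P.cell i) y)" for y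
  proof (cases "\<exists>i\<in>I. y \<in> P.cell i")
    case True
    then obtain i where i: "i \<in> I" "y \<in> P.cell i" by auto
    then have "\<not> y < a" using P.cell_bounds[OF i(1)] by (auto simp: P.cell_def)
    then show ?thesis unfolding fieldS_def cell_ind[OF t] using P.sum_indicator_cell[OF i] by simp
  next
    case False
    then have "(\<Sum>i\<in>I. g i * indicator (P.cell i) y) = 0" for g :: "nat \<Rightarrow> real" by (intro sum.neutral) auto
    then show ?thesis unfolding fieldS_def cell_ind[OF t] by simp
  qed
  ultimately show ?thesis by (simp add: mult.commute)
qed

lemma slice_primitive:
  assumes t: "t \<in> {0..T}" and y: "a \<le> y"
  shows "has_bochner_integral lborel (\<lambda>z. fieldS t z * indicator {..y} z) (real N * packing.pressure I m (x t) (l t) y)"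
proof -
  interpret P: packing I m "x t" a b "l t" by (rule pack[OF t])
  have "has_bochner_integral lborel (\<lambda>z. base t * ((if a - 1 \<le> z \<and> z < a then 1 else 0) * indicator {..y} z) +
     (\<Sum>i\<in>I. force t i * ((if l t i < z \<and> z < l t i + m i then 1 else 0) * indicator {..y} z)))
     (base t * ramp (a - 1) 1 y + (\<Sum>i\<in>I. force t i * ramp (l t i) (m i) y))"
    by (intro has_bochner_integral_add has_bochner_integral_sum has_bochner_integral_mult_right
        has_integral_unit_upto has_integral_open_upto mnonneg)
  moreover have "ramp (a - 1) 1 y = 1" using y by (simp add: ramp_def)
  moreover have "base t * 1 + (\<Sum>i\<in>I. force t i * ramp (l t i) (m i) y) = real N * P.pressure y"
    unfolding P.pressure_def base_def force_def by (simp add: distrib_left sum_distrib_left mult.assoc)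
  ultimately show ?thesis
    by (simp add: fieldS_def distrib_right sum_distrib_right mult.assoc)
qed

lemma slice_integrable:
  assumes t: "t \<in> {0..T}" shows "integrable lborel (fieldS t)"
proof -
  interpret P: packing I m "x t" a b "l t" by (rule pack[OF t])
  have "integrable lborel (\<lambda>z. fieldS t z * indicator {..b} z)"
    using slice_primitive[OF t, of b] ab by (auto simp: has_bochner_integral_iff)
  moreover have "fieldS t z * indicator {..b} z = fieldS t z" for z
  proof (cases "z \<le> b")
    case False
    have "(if l t i < z \<and> z < l t i + m i then 1 else 0) = (0::real)" if "i \<in> I" for i
      using P.cell_bounds[OF that] False by auto
    then have "fieldS t z = 0" using False ab by (simp add: fieldS_def)
    then show ?thesis by simp
  qed simp
  ultimately show ?thesis by simp
qed

lemma fieldS_support: assumes t: "t \<in> {0..T}" "fieldS t y \<noteq> 0" shows "a - 1 \<le> y \<and> y \<le> b"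
proof (rule ccontr)
  interpret P: packing I m "x t" a b "l t" by (rule pack[OF t(1)])
  assume n: "\<not> (a - 1 \<le> y \<and> y \<le> b)"
  have "(if l t i < y \<and> y < l t i + m i then 1 else 0) = (0::real)" if "i \<in> I" for i
    using P.cell_bounds[OF that] n by auto
  moreover have "(if a - 1 \<le> y \<and> y < a then 1 else 0) = (0::real)" using n ab by auto
  ultimately have "fieldS t y = 0" unfolding fieldS_def by (simp only:) simp
  then show False using t by simp
qed

text \<open>
  This is \<open>N * (\<integral> pressure * (1 - rho)) = 0\<close>, written by \<open>primitive_by_parts\<close> so that only the field and the distribution
  function occur: the pressure vanishes in the gaps and the density is one on the blocks.
\<close>

lemma slice_slack:
  assumes t: "t \<in> {0..T}"
  shows "(\<integral>y. fieldS t y * (b - max y a - 1 + Fc t y) \<partial>lborel) = 0"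
proof -
  interpret P: packing I m "x t" a b "l t" by (rule pack[OF t])
  define h where "h = (\<lambda>y. indicator {a..b} y * (1 - P.rho y))"
  have r: "has_bochner_integral lborel (\<lambda>y. P.rho y * indicator {..u} y) (P.cdfp u)" for u
  proof -
    have "has_bochner_integral lborel (\<lambda>y. \<Sum>i\<in>I. (if l t i < y \<and> y < l t i + m i then 1 else 0) * indicator {..u} y) (\<Sum>i\<in>I. ramp (l t i) (m i) u)"
      by (intro has_bochner_integral_sum has_integral_open_upto mnonneg)
    then show ?thesis by (simp add: P.cdfp_def P.rho_def cell_ind[OF t] sum_distrib_right)
  qed
  have rb: "P.rho y * indicator {..b} y = P.rho y" for y
    using P.rho_outside[of y] P.cell_sub by (cases "y \<le> b") force+
  have ri: "has_bochner_integral lborel P.rho 1"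
    using r[of b] P.cdfp_right[of b] by (simp add: rb)
  have hi: "has_bochner_integral lborel (\<lambda>y. h y * indicator {z..} y) (b - max z a - 1 + P.cdfp z)" if z: "z \<le> b" for z
  proof -
    have 1: "has_bochner_integral lborel (indicator {max z a..b} :: real \<Rightarrow> real) (b - max z a)"
      using has_bochner_integral_real_indicator[of "{max z a..b}" lborel] z ab by simp
    have "has_bochner_integral lborel (\<lambda>y. indicator {max z a..b} y - (P.rho y - P.rho y * indicator {..z} y)) ((b - max z a) - (1 - P.cdfp z))"
      by (intro has_bochner_integral_diff 1 ri r)
    moreover have "AE y in lborel. indicator {max z a..b} y - (P.rho y - P.rho y * indicator {..z} y) = h y * indicator {z..} y"
    proof -
      have "AE y in lborel. y \<noteq> z" by (rule AE_lborel_singleton)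
      then show ?thesis
      proof eventually_elim
        case (elim y)
        show ?case
        proof (cases "y \<in> {a..b}")
          case True then show ?thesis using elim by (auto simp: h_def indicator_def)
        next
          case False
          then have "P.rho y = 0" using P.cell_sub by (intro P.rho_outside) blast
          then show ?thesis using False by (auto simp: h_def indicator_def)
        qed
      qed
    qed
    ultimately have "has_bochner_integral lborel (\<lambda>y. h y * indicator {z..} y) ((b - max z a) - (1 - P.cdfp z))"
      by (subst has_bochner_integral_cong_AE[symmetric]) (auto simp: h_def)
    moreover have "(b - max z a) - (1 - P.cdfp z) = b - max z a - 1 + P.cdfp z" by simp
    ultimately show ?thesis by (simp only:)
  qed
  have hint: "integrable lborel h"
  proof -
    have "(\<lambda>y. h y * indicator {a..} y) = h" by (auto simp: h_def indicator_def fun_eq_iff)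
    then show ?thesis using hi[of a] ab by (simp add: has_bochner_integral_iff)
  qed
  have "(\<integral>y. fieldS t y * (b - max y a - 1 + Fc t y) \<partial>lborel) = (\<integral>z. fieldS t z * (\<integral>y. h y * indicator {z..} y \<partial>lborel) \<partial>lborel)"
  proof (intro Bochner_Integration.integral_cong refl)
    fix z show "fieldS t z * (b - max z a - 1 + Fc t z) = fieldS t z * (\<integral>y. h y * indicator {z..} y \<partial>lborel)"
      using hi[of z] fieldS_support[OF t, of z] by (cases "fieldS t z = 0") (auto simp: has_bochner_integral_iff Fc_def)
  qed
  also have "\<dots> = (\<integral>y. h y * (\<integral>z. fieldS t z * indicator {..y} z \<partial>lborel) \<partial>lborel)"
    by (rule primitive_by_parts[OF slice_integrable[OF t] hint, symmetric])
  also have "\<dots> = integral\<^sup>L (lborel :: real measure) (\<lambda>y. 0)"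
  proof (rule integral_cong_AE)
    show "AE y in lborel. h y * (\<integral>z. fieldS t z * indicator {..y} z \<partial>lborel) = 0"
      using P.AE_not_E
    proof eventually_elim
      case (elim y)
      show ?case
      proof (cases "y \<in> {a..b} \<and> (\<forall>i\<in>I. y \<notin> P.cell i)")
        case True
        then have "P.gap y" using P.deriv_cert_gap(1)[OF elim] by (auto simp: P.cell_def)
        then have "P.pressure y = 0" by (rule P.pressure_gap)
        then show ?thesis using slice_primitive[OF t, of y] True by (simp add: has_bochner_integral_iff)
      next
        case False
        then have "h y = 0" using P.rho_cell[of _ y] by (auto simp: h_def)
        then show ?thesis by simp
      qed
    qed
    show "(\<lambda>y. h y * (\<integral>z. fieldS t z * indicator {..y} z \<partial>lborel)) \<in> borel_measurable lborel"
    proof -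
      have [measurable]: "fieldS t \<in> borel_measurable borel" using slice_integrable[OF t] by auto
      have "(\<lambda>y. \<integral>z. fieldS t z * indicator {..y} z \<partial>lborel) \<in> borel_measurable lborel"
      proof (rule lborel.borel_measurable_lebesgue_integral)
        have "(\<lambda>(y, z). fieldS t z * indicator {..y} z) = (\<lambda>w. if snd w \<le> fst w then fieldS t (snd w) else 0)"
          by (auto simp: fun_eq_iff indicator_def)
        also have "\<dots> \<in> borel_measurable (lborel \<Otimes>\<^sub>M lborel)" by measurable
        finally show "(\<lambda>(y, z). fieldS t z * indicator {..y} z) \<in> borel_measurable (lborel \<Otimes>\<^sub>M lborel)" .
      qed
      then show ?thesis using hint by auto
    qed
  qed auto
  finally show ?thesis by simp
qed

text \<open>
  The sum is the integral of the field against the test function frozen at \<open>x t i\<close> on the block of \<open>i\<close>. Young's inequality with weight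
  \<open>\<delta>\<close> separates the field from the variation of \<open>\<phi>\<close>; the latter is controlled by the squared transport
  distance \<open>cst t\<close>, up to \<open>e\<close>.
\<close>

lemma slice_error:
  fixes \<phi> :: "real \<Rightarrow> real"
  assumes t: "t \<in> {0..T}" and \<phi>m[measurable]: "\<phi> \<in> borel_measurable borel"
    and Rx: "\<And>i. i \<in> I \<Longrightarrow> \<bar>x t i\<bar> \<le> R" and Rab: "\<bar>a\<bar> \<le> R" "\<bar>b\<bar> \<le> R"
    and e: "\<And>u v. \<bar>u\<bar> \<le> R \<Longrightarrow> \<bar>v\<bar> \<le> R \<Longrightarrow> (\<phi> u - \<phi> v)\<^sup>2 \<le> e + K * (u - v)\<^sup>2"
    and \<phi>B: "\<And>u. \<bar>u\<bar> \<le> R \<Longrightarrow> \<bar>\<phi> u\<bar> \<le> B" and \<delta>: "0 < \<delta>"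
  shows "\<bar>(\<Sum>i\<in>I. m i * (\<phi> (x t i) * force t i)) - (\<integral>y. \<phi> y * (fieldS t y * indicator {a..b} y) \<partial>lborel)\<bar>
     \<le> \<delta> / 2 * (\<Sum>i\<in>I. m i * (force t i)\<^sup>2) + (e + K * cst t) / (2 * \<delta>)"
proof -
  interpret P: packing I m "x t" a b "l t" by (rule pack[OF t])
  have cm[measurable]: "P.cell i \<in> sets borel" for i by (simp add: P.cell_def)
  have cR: "\<bar>y\<bar> \<le> R" if "i \<in> I" "y \<in> P.cell i" for i y
  proof -
    have "y \<in> {a..b}" using P.cell_sub[OF that(1)] that(2) by blast
    then show ?thesis using Rab by auto
  qed
  have \<phi>i: "integrable lborel (\<lambda>y. \<phi> y * indicator (P.cell i) y)" if i: "i \<in> I" for i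
  proof (rule Bochner_Integration.integrable_bound[of _ "\<lambda>y. B * indicator (P.cell i) y"])
    show "integrable lborel (\<lambda>y. B * indicator (P.cell i) y)"
      using P.has_integral_cell[OF i] by (auto simp: has_bochner_integral_iff)
    have "norm (\<phi> y * indicator (P.cell i) y) \<le> norm (B * indicator (P.cell i) y)" for y
      using \<phi>B[OF cR[OF i, of y]] by (cases "y \<in> P.cell i") auto
    then show "AE y in lborel. norm (\<phi> y * indicator (P.cell i) y) \<le> norm (B * indicator (P.cell i) y)" by simp
  qed auto
  have 1: "has_bochner_integral lborel (\<lambda>y. \<Sum>i\<in>I. force t i * (\<phi> (x t i) * indicator (P.cell i) y - \<phi> y * indicator (P.cell i) y))
     (\<Sum>i\<in>I. force t i * (\<phi> (x t i) * m i - (\<integral>y. \<phi> y * indicator (P.cell i) y \<partial>lborel)))"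
    by (intro has_bochner_integral_sum has_bochner_integral_mult_right has_bochner_integral_diff P.has_integral_cell has_bochner_integral_integrable \<phi>i)
  have 2: "has_bochner_integral lborel (\<lambda>y. \<Sum>i\<in>I. (\<delta> / 2 * (force t i)\<^sup>2 + e / (2 * \<delta>)) * indicator (P.cell i) y + K / (2 * \<delta>) * ((x t i - y)\<^sup>2 * indicator (P.cell i) y))
     (\<Sum>i\<in>I. (\<delta> / 2 * (force t i)\<^sup>2 + e / (2 * \<delta>)) * m i + K / (2 * \<delta>) * (m i * ((x t i - (l t i + m i / 2))\<^sup>2 + (m i)\<^sup>2 / 12)))"
    by (intro has_bochner_integral_sum has_bochner_integral_mult_right has_bochner_integral_add P.has_integral_cell P.has_integral_cell_square)
  have le: "\<bar>\<Sum>i\<in>I. force t i * (\<phi> (x t i) * indicator (P.cell i) y - \<phi> y * indicator (P.cell i) y)\<bar>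
     \<le> (\<Sum>i\<in>I. (\<delta> / 2 * (force t i)\<^sup>2 + e / (2 * \<delta>)) * indicator (P.cell i) y + K / (2 * \<delta>) * ((x t i - y)\<^sup>2 * indicator (P.cell i) y))" for y
  proof -
    have "\<bar>\<Sum>i\<in>I. force t i * (\<phi> (x t i) * indicator (P.cell i) y - \<phi> y * indicator (P.cell i) y)\<bar>
      \<le> (\<Sum>i\<in>I. \<bar>force t i * (\<phi> (x t i) * indicator (P.cell i) y - \<phi> y * indicator (P.cell i) y)\<bar>)" by (rule sum_abs)
    also have "\<dots> \<le> (\<Sum>i\<in>I. (\<delta> / 2 * (force t i)\<^sup>2 + e / (2 * \<delta>)) * indicator (P.cell i) y + K / (2 * \<delta>) * ((x t i - y)\<^sup>2 * indicator (P.cell i) y))"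
    proof (intro sum_mono)
      fix i assume i: "i \<in> I"
      show "\<bar>force t i * (\<phi> (x t i) * indicator (P.cell i) y - \<phi> y * indicator (P.cell i) y)\<bar>
        \<le> (\<delta> / 2 * (force t i)\<^sup>2 + e / (2 * \<delta>)) * indicator (P.cell i) y + K / (2 * \<delta>) * ((x t i - y)\<^sup>2 * indicator (P.cell i) y)"
      proof (cases "y \<in> P.cell i")
        case True
        define F where "F = \<bar>force t i\<bar>"
        define D where "D = \<bar>\<phi> (x t i) - \<phi> y\<bar>"
        have "D\<^sup>2 \<le> e + K * (x t i - y)\<^sup>2" unfolding D_def power2_abs by (rule e[OF Rx[OF i] cR[OF i True]])
        then have d2: "D\<^sup>2 / (2 * \<delta>) \<le> (e + K * (x t i - y)\<^sup>2) / (2 * \<delta>)" using \<delta> by (intro divide_right_mono) auto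
        have "0 \<le> (\<delta> * F - D)\<^sup>2 / (2 * \<delta>)" using \<delta> by simp
        also have "\<dots> = \<delta> / 2 * F\<^sup>2 + D\<^sup>2 / (2 * \<delta>) - F * D" using \<delta> by (simp add: power2_eq_square field_simps)
        finally have "F * D \<le> \<delta> / 2 * F\<^sup>2 + (e + K * (x t i - y)\<^sup>2) / (2 * \<delta>)" using d2 by linarith
        moreover have "F\<^sup>2 = (force t i)\<^sup>2" by (simp add: F_def)
        ultimately show ?thesis using True by (simp add: F_def D_def abs_mult add_divide_distrib)
      qed simp
    qed
    finally show ?thesis .
  qed
  have f: "(\<integral>y. \<phi> y * (fieldS t y * indicator {a..b} y) \<partial>lborel) = (\<Sum>i\<in>I. force t i * (\<integral>y. \<phi> y * indicator (P.cell i) y \<partial>lborel))"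
  proof -
    have "\<phi> y * (fieldS t y * indicator {a..b} y) = (\<Sum>i\<in>I. force t i * (\<phi> y * indicator (P.cell i) y))" for y
    proof (cases "y \<in> {a..b}")
      case True
      then show ?thesis by (auto simp: fieldS_def cell_ind[OF t] sum_distrib_left intro!: sum.cong)
    next
      case False
      then have "y \<notin> P.cell i" if "i \<in> I" for i using P.cell_sub[OF that] by blast
      then show ?thesis using False by simp
    qed
    then show ?thesis using \<phi>i by (simp add: Bochner_Integration.integral_sum)
  qed
  have "\<bar>(\<Sum>i\<in>I. m i * (\<phi> (x t i) * force t i)) - (\<integral>y. \<phi> y * (fieldS t y * indicator {a..b} y) \<partial>lborel)\<bar>
     = \<bar>\<integral>y. (\<Sum>i\<in>I. force t i * (\<phi> (x t i) * indicator (P.cell i) y - \<phi> y * indicator (P.cell i) y)) \<partial>lborel\<bar>"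
    unfolding f has_bochner_integral_integral_eq[OF 1] by (simp add: right_diff_distrib sum_subtractf mult_ac)
  also have "\<dots> \<le> (\<integral>y. \<bar>\<Sum>i\<in>I. force t i * (\<phi> (x t i) * indicator (P.cell i) y - \<phi> y * indicator (P.cell i) y)\<bar> \<partial>lborel)"
    by (rule integral_abs_bound)
  also have "\<dots> \<le> (\<integral>y. (\<Sum>i\<in>I. (\<delta> / 2 * (force t i)\<^sup>2 + e / (2 * \<delta>)) * indicator (P.cell i) y + K / (2 * \<delta>) * ((x t i - y)\<^sup>2 * indicator (P.cell i) y)) \<partial>lborel)"
    by (rule integral_mono) (use 1 2 le in \<open>auto simp only: has_bochner_integral_iff intro!: integrable_abs\<close>)
  also have "\<dots> = (\<Sum>i\<in>I. (\<delta> / 2 * (force t i)\<^sup>2 + e / (2 * \<delta>)) * m i + K / (2 * \<delta>) * (m i * ((x t i - (l t i + m i / 2))\<^sup>2 + (m i)\<^sup>2 / 12)))"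
    by (rule has_bochner_integral_integral_eq[OF 2])
  also have "\<dots> = \<delta> / 2 * (\<Sum>i\<in>I. m i * (force t i)\<^sup>2) + e / (2 * \<delta>) * sum m I + K / (2 * \<delta>) * cst t"
  proof -
    have "(\<Sum>i\<in>I. (\<delta> / 2 * (force t i)\<^sup>2 + e / (2 * \<delta>)) * m i + K / (2 * \<delta>) * (m i * ((x t i - (l t i + m i / 2))\<^sup>2 + (m i)\<^sup>2 / 12)))
      = (\<Sum>i\<in>I. \<delta> / 2 * (m i * (force t i)\<^sup>2) + e / (2 * \<delta>) * m i + K / (2 * \<delta>) * (m i * ((x t i - (l t i + m i / 2))\<^sup>2 + (m i)\<^sup>2 / 12)))"
      by (intro sum.cong refl) (simp add: algebra_simps)
    then show ?thesis unfolding cst_def P.cost_def by (simp only: sum.distrib sum_distrib_left)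
  qed
  also have "\<dots> = \<delta> / 2 * (\<Sum>i\<in>I. m i * (force t i)\<^sup>2) + (e + K * cst t) / (2 * \<delta>)"
    using msum by (simp add: add_divide_distrib)
  finally show ?thesis .
qed

end

section \<open>The weak equation of the discrete flows\<close>

text \<open>
  The support condition speaks of \<open>\<zeta>\<close>; outside the support \<open>\<zeta>\<close> vanishes on an open set of times, hence so do its derivatives.
\<close>

lemma test_support:
  assumes T: "0 < T" and test: "C1c_test T \<zeta> \<zeta>t \<zeta>x"
  shows "\<exists>T1. 0 \<le> T1 \<and> T1 < T \<and> (\<forall>t y. T1 < t \<longrightarrow> t < T \<longrightarrow> \<zeta> (t, y) = 0 \<and> \<zeta>t (t, y) = 0 \<and> \<zeta>x (t, y) = 0)"
proof -
  have "\<exists>C. compact C \<and> C \<subseteq> {0..<T} \<times> UNIV \<and> (\<forall>z\<in>{0..<T} \<times> UNIV - C. \<zeta> z = 0)"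
    using test by (simp only: C1c_test_def)
  then obtain K where K: "compact K" "K \<subseteq> {0..<T} \<times> UNIV" "\<forall>z\<in>{0..<T} \<times> UNIV - K. \<zeta> z = 0"
    by (elim exE conjE)
  obtain T1 where T1: "0 \<le> T1" "T1 < T" "\<And>z. z \<in> K \<Longrightarrow> fst z \<le> T1"
  proof (cases "K = {}")
    case True
    then show ?thesis using that[of 0] T by simp
  next
    case False
    have "continuous_on K (fst :: real \<times> real \<Rightarrow> real)" by (intro continuous_intros)
    from continuous_attains_sup[OF K(1) False this] obtain z where z: "z \<in> K" "\<forall>w\<in>K. fst w \<le> fst z" by blast
    then have "z \<in> {0..<T} \<times> UNIV" using K(2) by blast
    then show ?thesis using that[of "fst z"] z(2) by auto
  qed
  have z0: "\<zeta> (t, y) = 0" if "T1 < t" "t < T" for t y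
  proof -
    have "(t, y) \<notin> K" using T1(3)[of "(t, y)"] that by auto
    then show ?thesis using K(3) T1(1) that by simp
  qed
  have d0: "\<zeta>t (t, y) = 0 \<and> \<zeta>x (t, y) = 0" if t: "T1 < t" "t < T" for t y
  proof -
    let ?S = "{0..<T} \<times> (UNIV :: real set)" and ?U = "{T1<..<T} \<times> (UNIV :: real set)"
    have oU: "open ?U" by (intro open_Times) auto
    have "(\<zeta> has_derivative (\<lambda>h. \<zeta>t (t, y) * fst h + \<zeta>x (t, y) * snd h)) (at (t, y) within ?S)"
      using test t T1(1) unfolding C1c_test_def by simp
    then have "(\<zeta> has_derivative (\<lambda>h. \<zeta>t (t, y) * fst h + \<zeta>x (t, y) * snd h)) (at (t, y) within ?U)"
      by (rule has_derivative_subset) (use T1(1) in auto)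
    then have "(\<zeta> has_derivative (\<lambda>h. \<zeta>t (t, y) * fst h + \<zeta>x (t, y) * snd h)) (at (t, y))"
      using oU t by (subst (asm) at_within_open) auto
    moreover have "(\<zeta> has_derivative (\<lambda>h. 0)) (at (t, y))"
    proof (rule has_derivative_transform_within_open[OF has_derivative_const oU])
      show "(t, y) \<in> ?U" using t by simp
      show "\<And>z. z \<in> ?U \<Longrightarrow> 0 = \<zeta> z" using z0 by auto
    qed
    ultimately have "(\<lambda>h. \<zeta>t (t, y) * fst h + \<zeta>x (t, y) * snd h) = (\<lambda>h. 0)" by (rule has_derivative_unique)
    then have e: "\<zeta>t (t, y) * fst h + \<zeta>x (t, y) * snd h = 0" for h by metis
    show ?thesis using e[of "(1, 0)"] e[of "(0, 1)"] by simp
  qed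
  show ?thesis using T1 z0 d0 by blast
qed

lemma cutoff_integral:
  fixes f :: "real \<Rightarrow> real"
  assumes c: "continuous_on {0..<T} f" and T: "0 \<le> T1" "T1 < T2" "T2 < T" and z: "\<And>t. T1 < t \<Longrightarrow> t < T \<Longrightarrow> f t = 0"
  shows "set_integrable lborel {0..<T} f" "(LINT t:{0..<T}|lborel. f t) = integral {0..T2} f"
proof -
  have c2: "continuous_on {0..T2} f" by (rule continuous_on_subset[OF c]) (use T in auto)
  have e: "indicat_real {0..<T} t *\<^sub>R f t = indicat_real {0..T2} t *\<^sub>R f t" for t
    using z[of t] T by (auto simp: indicator_def)
  have i: "set_integrable lborel {0..T2} f" by (rule borel_integrable_atLeastAtMost'[OF c2])
  then show "set_integrable lborel {0..<T} f" by (simp only: set_integrable_def e)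
  show "(LINT t:{0..<T}|lborel. f t) = integral {0..T2} f"
    using set_borel_integral_eq_integral(2)[OF i] by (simp only: set_lebesgue_integral_def e)
qed

context block_flow
begin

text \<open>
  Differentiate \<open>\<Sum>i\<in>I. m i * \<zeta> (t, x t i)\<close> in time and integrate; the velocity is replaced using the equation,
  \<open>x' = - dV - force\<close>.
\<close>

lemma flow_weak_identity:
  assumes test: "C1c_test T \<zeta> \<zeta>t \<zeta>x"
  shows "set_integrable lborel {0..<T} (\<lambda>t. \<Sum>i\<in>I. m i * (\<zeta>t (t, x t i) - \<zeta>x (t, x t i) * dV (x t i)))"
    and "set_integrable lborel {0..<T} (\<lambda>t. \<Sum>i\<in>I. m i * (\<zeta>x (t, x t i) * force t i))"
    and "(LINT t:{0..<T}|lborel. (\<Sum>i\<in>I. m i * (\<zeta>x (t, x t i) * force t i))) =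
      (LINT t:{0..<T}|lborel. (\<Sum>i\<in>I. m i * (\<zeta>t (t, x t i) - \<zeta>x (t, x t i) * dV (x t i)))) + (\<Sum>i\<in>I. m i * \<zeta> (0, x 0 i))"
proof -
  obtain T1 where T1: "0 \<le> T1" "T1 < T" and z: "\<And>t y. T1 < t \<Longrightarrow> t < T \<Longrightarrow> \<zeta> (t, y) = 0 \<and> \<zeta>t (t, y) = 0 \<and> \<zeta>x (t, y) = 0"
    using test_support[OF T test] by blast
  define T2 where "T2 = (T1 + T) / 2"
  have T2: "T1 < T2" "T2 < T" using T1 by (auto simp: T2_def)
  let ?S = "{0..<T} \<times> (UNIV :: real set)"
  have sub: "{0..<T} \<subseteq> {0..T}" by auto
  have xc: "continuous_on {0..<T} (\<lambda>t. (t, x t i))" if "i \<in> I" for i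
    by (intro continuous_intros continuous_on_subset[OF contx[OF that] sub])
  have zc: "continuous_on {0..<T} (\<lambda>t. \<zeta>t (t, x t i))" "continuous_on {0..<T} (\<lambda>t. \<zeta>x (t, x t i))" if "i \<in> I" for i
    using test unfolding C1c_test_def by (auto intro!: continuous_on_compose2[OF _ xc[OF that], of ?S])
  have dc: "continuous_on {0..<T} (\<lambda>t. dV (x t i))" "continuous_on {0..<T} (\<lambda>t. force t i)" if "i \<in> I" for i
    by (rule continuous_on_subset[OF cont_dVx[OF that] sub], rule continuous_on_subset[OF cont_force[OF that] sub])
  let ?A = "\<lambda>t. \<Sum>i\<in>I. m i * (\<zeta>t (t, x t i) - \<zeta>x (t, x t i) * dV (x t i))"
  let ?B = "\<lambda>t. \<Sum>i\<in>I. m i * (\<zeta>x (t, x t i) * force t i)"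
  have Ac: "continuous_on {0..<T} ?A" by (intro continuous_intros zc dc)
  have Bc: "continuous_on {0..<T} ?B" by (intro continuous_intros zc dc)
  have A: "set_integrable lborel {0..<T} ?A" "(LINT t:{0..<T}|lborel. ?A t) = integral {0..T2} ?A"
    by (rule cutoff_integral[OF Ac T1(1) T2]; simp add: z)+
  have B: "set_integrable lborel {0..<T} ?B" "(LINT t:{0..<T}|lborel. ?B t) = integral {0..T2} ?B"
    by (rule cutoff_integral[OF Bc T1(1) T2]; simp add: z)+
  show "set_integrable lborel {0..<T} ?A" "set_integrable lborel {0..<T} ?B" by (rule A B)+
  have "((\<lambda>t. ?A t - ?B t) has_integral ((\<Sum>i\<in>I. m i * \<zeta> (T2, x T2 i)) - (\<Sum>i\<in>I. m i * \<zeta> (0, x 0 i)))) {0..T2}"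
  proof (rule fundamental_theorem_of_calculus)
    fix t assume t: "t \<in> {0..T2}"
    then have tT: "t \<in> {0..T}" "t \<in> {0..<T}" using T2 by auto
    have "((\<lambda>s. \<zeta> (s, x s i)) has_real_derivative (\<zeta>t (t, x t i) + \<zeta>x (t, x t i) * x' t i)) (at t within {0..T2})" if i: "i \<in> I" for i
    proof -
      have "((\<lambda>s. x s i) has_derivative (\<lambda>h. x' t i * h)) (at t within {0..T2})"
        using DERIV_subset[OF deriv[OF i tT(1)], of "{0..T2}"] T2 by (auto simp: has_field_derivative_def)
      then have 1: "((\<lambda>s. (s, x s i)) has_derivative (\<lambda>h. (h, x' t i * h))) (at t within {0..T2})"
        by (intro has_derivative_Pair has_derivative_ident)
      have "(\<zeta> has_derivative (\<lambda>h. \<zeta>t (t, x t i) * fst h + \<zeta>x (t, x t i) * snd h)) (at (t, x t i) within ?S)"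
        using test tT unfolding C1c_test_def by simp
      then have 2: "(\<zeta> has_derivative (\<lambda>h. \<zeta>t (t, x t i) * fst h + \<zeta>x (t, x t i) * snd h)) (at (t, x t i) within (\<lambda>s. (s, x s i)) ` {0..T2})"
        by (rule has_derivative_subset) (use T2 in auto)
      from diff_chain_within[OF 1 2] show ?thesis
        unfolding has_field_derivative_def comp_def
        by (rule has_derivative_eq_rhs) (auto simp: fun_eq_iff algebra_simps)
    qed
    then have "((\<lambda>s. \<Sum>i\<in>I. m i * \<zeta> (s, x s i)) has_real_derivative (\<Sum>i\<in>I. m i * (\<zeta>t (t, x t i) + \<zeta>x (t, x t i) * x' t i))) (at t within {0..T2})"
      by (intro DERIV_sum DERIV_cmult)
    also have "(\<Sum>i\<in>I. m i * (\<zeta>t (t, x t i) + \<zeta>x (t, x t i) * x' t i)) = ?A t - ?B t"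
      unfolding sum_subtractf[symmetric]
    proof (intro sum.cong refl)
      fix i assume "i \<in> I"
      from force_eq[OF this tT(1)] have x': "x' t i = - dV (x t i) - force t i" by simp
      show "m i * (\<zeta>t (t, x t i) + \<zeta>x (t, x t i) * x' t i) = m i * (\<zeta>t (t, x t i) - \<zeta>x (t, x t i) * dV (x t i)) - m i * (\<zeta>x (t, x t i) * force t i)"
        unfolding x' by (simp add: algebra_simps)
    qed
    finally show "((\<lambda>s. \<Sum>i\<in>I. m i * \<zeta> (s, x s i)) has_vector_derivative (?A t - ?B t)) (at t within {0..T2})"
      by (simp add: has_real_derivative_iff_has_vector_derivative)
  qed (use T1 T2 in auto)
  moreover have "\<zeta> (T2, y) = 0" for y using z[of T2 y] T2 by simp
  ultimately have "integral {0..T2} (\<lambda>t. ?A t - ?B t) = - (\<Sum>i\<in>I. m i * \<zeta> (0, x 0 i))"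
    by (simp add: integral_unique)
  moreover have "integral {0..T2} (\<lambda>t. ?A t - ?B t) = integral {0..T2} ?A - integral {0..T2} ?B"
    by (rule Henstock_Kurzweil_Integration.integral_diff)
       (use T2 in \<open>auto intro!: integrable_continuous_real continuous_on_subset[OF Ac] continuous_on_subset[OF Bc]\<close>)
  ultimately show "(LINT t:{0..<T}|lborel. ?B t) = (LINT t:{0..<T}|lborel. ?A t) + (\<Sum>i\<in>I. m i * \<zeta> (0, x 0 i))"
    using A(2) B(2) by simp
qed

end

section \<open>Lebesgue differentiation on the line\<close>

lemma lebesgue_differentiation_right:
  fixes f :: "real \<Rightarrow> real"
  assumes f: "integrable lborel f"
  shows "AE y in lborel. (\<lambda>n. real (Suc n) * ((\<integral>z. f z * indicator {..y + 1 / real (Suc n)} z \<partial>lborel) - (\<integral>z. f z * indicator {..y} z \<partial>lborel))) \<longlonglongrightarrow> f y"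
proof -
  have fi: "integrable lborel (\<lambda>z. f z * indicator A z)" if "A \<in> sets borel" for A
    using f that by (intro integrable_real_mult_indicator) auto
  have "f integrable_on cbox u v" for u v
  proof -
    have "f integrable_on UNIV" using f by (rule integrable_on_lborel)
    then show ?thesis by (rule integrable_on_subcbox) simp
  qed
  from integrable_ccontinuous_explicit[of f, OF this] obtain N where N: "negligible N"
    and lim: "\<And>x e. x \<notin> N \<Longrightarrow> 0 < e \<Longrightarrow> \<exists>d>0. \<forall>h. 0 < h \<and> h < d \<longrightarrow> norm (integral (cbox x (x + h *\<^sub>R One)) f /\<^sub>R h ^ DIM(real) - f x) < e"
    by blast
  have diff: "(\<integral>z. f z * indicator {..y + h} z \<partial>lborel) - (\<integral>z. f z * indicator {..y} z \<partial>lborel) = integral {y..y + h} f" if "0 < h" for y h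
  proof -
    have "(\<integral>z. f z * indicator {..y + h} z \<partial>lborel) - (\<integral>z. f z * indicator {..y} z \<partial>lborel) = (\<integral>z. f z * indicator {..y + h} z - f z * indicator {..y} z \<partial>lborel)"
      by (rule Bochner_Integration.integral_diff[symmetric]) (auto intro: fi)
    also have "\<dots> = (\<integral>z. f z * indicator {y..y + h} z \<partial>lborel)"
    proof (rule integral_cong_AE)
      have "AE z in lborel. z \<noteq> y" by (rule AE_lborel_singleton)
      then show "AE z in lborel. f z * indicator {..y + h} z - f z * indicator {..y} z = f z * indicator {y..y + h} z"
        by eventually_elim (use that in \<open>auto simp: indicator_def\<close>)
    qed (use f in auto)
    also have "\<dots> = (LINT z:{y..y + h}|lborel. f z)" by (simp add: set_lebesgue_integral_def mult.commute)
    also have "\<dots> = integral {y..y + h} f"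
      by (rule set_borel_integral_eq_integral(2)) (use fi[of "{y..y + h}"] in \<open>simp add: set_integrable_def mult.commute\<close>)
    finally show ?thesis .
  qed
  have "AE y in lebesgue. y \<notin> N" using N by (simp add: negligible_iff_null_sets AE_not_in)
  then have "AE y in lborel. y \<notin> N" by (simp add: AE_completion_iff)
  then show ?thesis
  proof eventually_elim
    case (elim y)
    show ?case
    proof (rule LIMSEQ_I)
      fix e :: real assume "0 < e"
      from lim[OF elim this] obtain d where d: "0 < d" "\<And>h. 0 < h \<Longrightarrow> h < d \<Longrightarrow> norm (integral (cbox y (y + h *\<^sub>R One)) f /\<^sub>R h ^ DIM(real) - f y) < e" by blast
      obtain n0 where n0: "1 / real (Suc n0) < d" using d(1) nat_approx_posE by blast
      show "\<exists>no. \<forall>n\<ge>no. norm (real (Suc n) * ((\<integral>z. f z * indicator {..y + 1 / real (Suc n)} z \<partial>lborel) - (\<integral>z. f z * indicator {..y} z \<partial>lborel)) - f y) < e"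
      proof (intro exI allI impI)
        fix n assume "n0 \<le> n"
        then have "1 / real (Suc n) \<le> 1 / real (Suc n0)" by (intro divide_left_mono) auto
        then have "1 / real (Suc n) < d" using n0 by linarith
        from d(2)[OF _ this] show "norm (real (Suc n) * ((\<integral>z. f z * indicator {..y + 1 / real (Suc n)} z \<partial>lborel) - (\<integral>z. f z * indicator {..y} z \<partial>lborel)) - f y) < e"
          by (subst diff) (auto simp: mult.commute)
      qed
    qed
  qed
qed

lemma AE_lborel_uminus:
  fixes P :: "real \<Rightarrow> bool"
  assumes "AE y in lborel. P y" shows "AE y in lborel. P (- y)"
proof -
  have d: "distr lborel borel uminus = (lborel :: real measure)" by (rule lborel_distr_uminus)
  have "AE y in distr lborel borel uminus. P y" unfolding d by (rule assms)
  then show ?thesis by (rule AE_distrD[rotated]) simp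
qed

text \<open>
  Reflection of the line.
\<close>

lemma lebesgue_differentiation_left:
  fixes f :: "real \<Rightarrow> real"
  assumes f: "integrable lborel f"
  shows "AE y in lborel. (\<lambda>n. real (Suc n) * ((\<integral>z. f z * indicator {..y} z \<partial>lborel) - (\<integral>z. f z * indicator {..y - 1 / real (Suc n)} z \<partial>lborel))) \<longlonglongrightarrow> f y"
proof -
  have fi: "integrable lborel (\<lambda>z. f z * indicator A z)" if "A \<in> sets borel" for A
    using f that by (intro integrable_real_mult_indicator) auto
  have g: "integrable lborel (\<lambda>z. f (- z))" using lborel_integrable_real_affine[OF f, of "-1" 0] by simp
  have c: "(\<integral>z. f (- z) * indicator {..w} z \<partial>lborel) = (\<integral>z. f z \<partial>lborel) - (\<integral>z. f z * indicator {..- w} z \<partial>lborel)" for w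
  proof -
    have "(\<integral>z. f (- z) * indicator {..w} z \<partial>lborel) = (\<integral>z. f z * indicator {- w..} z \<partial>lborel)"
      using lborel_integral_real_affine[of "-1" "\<lambda>z. f z * indicator {- w..} z" 0]
      by (simp add: indicator_def le_minus_iff minus_le_iff)
    also have "\<dots> = (\<integral>z. f z - f z * indicator {..- w} z \<partial>lborel)"
    proof (rule integral_cong_AE)
      have "AE z in lborel. z \<noteq> - w" by (rule AE_lborel_singleton)
      then show "AE z in lborel. f z * indicator {- w..} z = f z - f z * indicator {..- w} z"
        by eventually_elim (auto simp: indicator_def)
    qed (use f in auto)
    also have "\<dots> = (\<integral>z. f z \<partial>lborel) - (\<integral>z. f z * indicator {..- w} z \<partial>lborel)"
      by (rule Bochner_Integration.integral_diff) (auto intro: f fi)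
    finally show ?thesis .
  qed
  from AE_lborel_uminus[OF lebesgue_differentiation_right[OF g]] show ?thesis
    by eventually_elim (simp add: c)
qed

lemma AE_lborel_plus:
  fixes P :: "real \<Rightarrow> bool"
  assumes "AE y in lborel. P y" shows "AE y in lborel. P (c + y)"
proof -
  have d: "distr lborel borel ((+) c) = (lborel :: real measure)" by (rule lborel_distr_plus)
  have "AE y in distr lborel borel ((+) c). P y" unfolding d by (rule assms)
  then show ?thesis by (rule AE_distrD[rotated]) simp
qed

text \<open>
  Where a nonnegative primitive vanishes, its right difference quotients are nonnegative and its left ones nonpositive.
  Both converge to \<open>f y\<close> almost everywhere. Nonnegativity is available only almost everywhere, but by translation it
  holds, for almost every \<open>y\<close>, at all points \<open>y \<plusminus> 1 / (n + 1)\<close>.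
\<close>

lemma derivative_zero_on_zero_set:
  fixes f :: "real \<Rightarrow> real"
  assumes f: "integrable lborel f"
    and nn: "AE y in lborel. a \<le> y \<and> y \<le> b \<longrightarrow> 0 \<le> (\<integral>z. f z * indicator {..y} z \<partial>lborel)"
  shows "AE y in lborel. a < y \<and> y < b \<and> (\<integral>z. f z * indicator {..y} z \<partial>lborel) = 0 \<longrightarrow> f y = 0"
proof -
  define P where "P = (\<lambda>y. \<integral>z. f z * indicator {..y} z \<partial>lborel)"
  have P_fold: "(\<integral>z. f z * indicator {..y} z \<partial>lborel) = P y" for y by (simp add: P_def)
  have nn': "AE y in lborel. a \<le> y \<and> y \<le> b \<longrightarrow> 0 \<le> P y" using nn by (simp add: P_def)
  have r: "AE y in lborel. \<forall>n. a \<le> 1 / real (Suc n) + y \<and> 1 / real (Suc n) + y \<le> b \<longrightarrow> 0 \<le> P (1 / real (Suc n) + y)"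
    unfolding AE_all_countable
  proof
    fix n show "AE y in lborel. a \<le> 1 / real (Suc n) + y \<and> 1 / real (Suc n) + y \<le> b \<longrightarrow> 0 \<le> P (1 / real (Suc n) + y)"
      by (rule AE_lborel_plus[OF nn'])
  qed
  have l: "AE y in lborel. \<forall>n. a \<le> - (1 / real (Suc n)) + y \<and> - (1 / real (Suc n)) + y \<le> b \<longrightarrow> 0 \<le> P (- (1 / real (Suc n)) + y)"
    unfolding AE_all_countable
  proof
    fix n show "AE y in lborel. a \<le> - (1 / real (Suc n)) + y \<and> - (1 / real (Suc n)) + y \<le> b \<longrightarrow> 0 \<le> P (- (1 / real (Suc n)) + y)"
      by (rule AE_lborel_plus[OF nn'])
  qed
  show ?thesis
    using lebesgue_differentiation_right[OF f] lebesgue_differentiation_left[OF f] r l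
    unfolding P_fold
  proof eventually_elim
    case (elim y)
    show ?case
    proof (intro impI)
      assume y: "a < y \<and> y < b \<and> P y = 0"
      then have "0 < min (y - a) (b - y)" by simp
      then obtain n0 where n0: "1 / real (Suc n0) < min (y - a) (b - y)" using nat_approx_posE by blast
      have small: "0 \<le> 1 / real (Suc n)" "1 / real (Suc n) < min (y - a) (b - y)" if "n0 \<le> n" for n
      proof -
        have "1 / real (Suc n) \<le> 1 / real (Suc n0)" using that by (intro divide_left_mono) auto
        then show "1 / real (Suc n) < min (y - a) (b - y)" using n0 by linarith
      qed simp
      have "0 \<le> f y"
      proof (rule tendsto_lowerbound[OF elim(1)])
        show "\<forall>\<^sub>F n in sequentially. 0 \<le> real (Suc n) * (P (y + 1 / real (Suc n)) - P y)"
        proof (rule eventually_sequentiallyI[of n0])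
          fix n assume n: "n0 \<le> n"
          have "a \<le> 1 / real (Suc n) + y" "1 / real (Suc n) + y \<le> b" using small[OF n] y by linarith+
          then have "0 \<le> P (1 / real (Suc n) + y)" using elim(3) by blast
          then show "0 \<le> real (Suc n) * (P (y + 1 / real (Suc n)) - P y)" using y by (simp add: add.commute)
        qed
      qed simp
      moreover have "f y \<le> 0"
      proof (rule tendsto_upperbound[OF elim(2)])
        show "\<forall>\<^sub>F n in sequentially. real (Suc n) * (P y - P (y - 1 / real (Suc n))) \<le> 0"
        proof (rule eventually_sequentiallyI[of n0])
          fix n assume n: "n0 \<le> n"
          have "a \<le> - (1 / real (Suc n)) + y" "- (1 / real (Suc n)) + y \<le> b" using small[OF n] y by linarith+
          then have "0 \<le> P (- (1 / real (Suc n)) + y)" using elim(4) by blast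
          then have "0 \<le> P (y - 1 / real (Suc n))" by simp
          then show "real (Suc n) * (P y - P (y - 1 / real (Suc n))) \<le> 0" using y by (simp add: mult_nonneg_nonpos)
        qed
      qed simp
      ultimately show "f y = 0" by simp
    qed
  qed
qed

section \<open>Lipschitz distribution functions and convergence of observables\<close>

text \<open>
  Absolute continuity follows as the quantile function maps back a null set \<open>A\<close> into \<open>G ` A\<close>, a null set as \<open>G\<close>
  is Lipschitz. The density is then the limit of difference quotients; the explicit formula \<open>r\<close>, truncated to
  \<open>[0, 1]\<close>, is used since it is jointly measurable when \<open>G\<close> depends on a parameter.
\<close>

lemma lipschitz_cdf_density:
  fixes G :: "real \<Rightarrow> real"
  assumes mono: "\<And>y z. y \<le> z \<Longrightarrow> G y \<le> G z" and lip: "\<And>y z. y \<le> z \<Longrightarrow> G z - G y \<le> z - y"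
    and left: "\<And>y. y \<le> a \<Longrightarrow> G y = 0" and right: "\<And>y. b \<le> y \<Longrightarrow> G y = 1"
    and r: "r = (\<lambda>y. if a \<le> y \<and> y \<le> b then max 0 (min 1 (lim (\<lambda>n. real (Suc n) * (G (y + 1 / real (Suc n)) - G y)))) else 0)"
  shows "real_distribution (interval_measure G)" "cdf (interval_measure G) = G"
    "interval_measure G = density lborel (\<lambda>y. ennreal (r y))" "r \<in> borel_measurable borel"
    "interval_measure G \<in> K_set {a..b}"
proof -
  let ?M = "interval_measure G"
  have lip': "\<bar>G y - G z\<bar> \<le> \<bar>y - z\<bar>" for y z
    using mono[of y z] mono[of z y] lip[of y z] lip[of z y] by (cases "y \<le> z") auto
  have cont: "continuous_on UNIV G"
    unfolding continuous_on_iff dist_real_def using lip' le_less_trans by blast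
  have Gm[measurable]: "G \<in> borel_measurable borel" by (rule borel_measurable_continuous_onI[OF cont])
  have rc: "continuous (at_right y) G" for y
    using cont by (simp add: continuous_at_imp_continuous_within continuous_on_eq_continuous_at)
  have lb: "(G \<longlongrightarrow> 0) at_bot"
    by (rule tendsto_eventually) (use left in \<open>auto simp: eventually_at_bot_linorder\<close>)
  have lt: "(G \<longlongrightarrow> 1) at_top"
    by (rule tendsto_eventually) (use right in \<open>auto simp: eventually_at_top_linorder\<close>)
  show rd: "real_distribution ?M" by (rule real_distribution_interval_measure[OF mono rc lb lt])
  show cd: "cdf ?M = G" by (rule cdf_interval_measure[OF mono rc lb])
  interpret M: real_distribution ?M by (rule rd)
  interpret C: cdf_distribution ?M ..
  show rm: "r \<in> borel_measurable borel" unfolding r by measurable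
  have ac: "absolutely_continuous lborel ?M"
    unfolding absolutely_continuous_def
  proof
    fix A assume A: "A \<in> null_sets (lborel :: real measure)"
    then have Ab[measurable]: "A \<in> sets borel" and negA: "negligible A"
      by (auto simp: negligible_iff_null_sets null_sets_completionI)
    define S where "S = C.I -` A \<inter> {0<..<1}"
    have "S \<subseteq> G ` A"
    proof
      fix w assume w: "w \<in> S"
      then have w01: "0 < w" "w < 1" "C.I w \<in> A" by (auto simp: S_def)
      have p: "w \<le> G y \<longleftrightarrow> C.I w \<le> y" for y using C.pseudoinverse[OF w01(1,2), of y] by (simp add: cd)
      have 1: "w \<le> G (C.I w)" using p by simp
      have "G (C.I w) \<le> w"
      proof (rule ccontr)
        assume n: "\<not> G (C.I w) \<le> w"
        define y where "y = C.I w - (G (C.I w) - w)"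
        have "G (C.I w) - G y \<le> C.I w - y" by (rule lip) (use n in \<open>simp add: y_def\<close>)
        then have "w \<le> G y" by (simp add: y_def)
        then have "C.I w \<le> y" using p by simp
        then show False using n by (simp add: y_def)
      qed
      then show "w \<in> G ` A" using 1 w01(3) by (intro image_eqI[of w G "C.I w"]) auto
    qed
    moreover have "negligible (G ` A)"
    proof (rule negligible_locally_Lipschitz_image[OF _ negA])
      show "\<exists>T B. open T \<and> x \<in> T \<and> (\<forall>y\<in>A \<inter> T. norm (G y - G x) \<le> B * norm (y - x))" for x
        by (rule exI[of _ UNIV], rule exI[of _ 1]) (use lip' in auto)
    qed simp
    ultimately have "negligible S" by (rule negligible_subset[rotated])
    have Im: "C.I \<in> borel_measurable (restrict_space lborel {0<..<1})"
      using C.measurable_CI measurable_cong_sets[of "restrict_space lborel {0<..<1::real}" "restrict_space borel {0<..<1}"]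
      by (simp add: sets_restrict_space)
    have "S \<in> sets (restrict_space lborel {0<..<1})"
      using measurable_sets[OF Im Ab] by (simp add: S_def space_restrict_space)
    then have Sb: "S \<in> sets lborel" by (auto simp: sets_restrict_space)
    have "emeasure ?M A = emeasure (distr (restrict_space lborel {0<..<1}) borel C.I) A"
      by (subst C.distr_I_eq_M) (rule refl)
    also have "\<dots> = emeasure (restrict_space lborel {0<..<1}) S"
      by (subst emeasure_distr[OF Im Ab]) (simp add: S_def space_restrict_space)
    also have "\<dots> = emeasure lborel S"
      by (rule emeasure_restrict_space) (auto simp: S_def)
    also have "\<dots> = 0" using \<open>negligible S\<close> Sb by (simp add: negligible_iff_null_sets null_sets_completion_iff null_setsD1)
    finally show "A \<in> null_sets ?M" using Ab by (simp add: null_sets_def)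
  qed
  define R where "R = RN_deriv lborel ?M"
  have Rm[measurable]: "R \<in> borel_measurable borel" using borel_measurable_RN_deriv[of lborel ?M] by (simp add: R_def)
  have dR: "density lborel R = ?M" unfolding R_def by (rule sigma_finite_measure.density_RN_deriv[OF sigma_finite_lborel ac]) simp
  have R1: "(\<integral>\<^sup>+y. R y \<partial>lborel) = 1"
    using M.emeasure_space_1 unfolding dR[symmetric] by (simp add: emeasure_density)
  have Rfin: "AE y in lborel. R y \<noteq> \<infinity>" by (rule nn_integral_PInf_AE) (auto simp: R1)
  define f where "f = (\<lambda>y. enn2real (R y))"
  have fm[measurable]: "f \<in> borel_measurable borel" unfolding f_def by measurable
  have fR: "AE y in lborel. ennreal (f y) = R y" using Rfin by eventually_elim (simp add: f_def less_top)
  have f1: "(\<integral>\<^sup>+y. ennreal (f y) \<partial>lborel) = 1" using nn_integral_cong_AE[OF fR] R1 by simp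
  have fi: "integrable lborel f" by (rule integrableI_nonneg) (use f1 in \<open>auto simp: f_def\<close>)
  have df: "density lborel (\<lambda>y. ennreal (f y)) = ?M" unfolding dR[symmetric] using fR by (intro density_cong) auto
  have Gf: "(\<integral>z. f z * indicator {..y} z \<partial>lborel) = G y" for y
  proof -
    have "emeasure ?M {..y} = (\<integral>\<^sup>+z. ennreal (f z * indicator {..y} z) \<partial>lborel)"
      unfolding df[symmetric] by (subst emeasure_density) (auto intro!: nn_integral_cong simp: indicator_def)
    also have "\<dots> = ennreal (\<integral>z. f z * indicator {..y} z \<partial>lborel)"
      by (rule nn_integral_eq_integral) (use fi in \<open>auto intro!: integrable_real_mult_indicator simp: f_def\<close>)
    finally have "emeasure ?M {..y} = ennreal (\<integral>z. f z * indicator {..y} z \<partial>lborel)" .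
    moreover have "0 \<le> (\<integral>z. f z * indicator {..y} z \<partial>lborel)" by (rule integral_nonneg_AE) (simp add: f_def)
    moreover have "enn2real (emeasure ?M {..y}) = G y" using cd by (simp add: cdf_def fun_eq_iff measure_def)
    ultimately show ?thesis by simp
  qed
  have "AE y in lborel. ennreal (f y) = ennreal (r y)"
    using lebesgue_differentiation_right[OF fi]
  proof eventually_elim
    case (elim y)
    let ?q = "\<lambda>n. real (Suc n) * (G (y + 1 / real (Suc n)) - G y)"
    have lim: "?q \<longlonglongrightarrow> f y" using elim by (simp add: Gf)
    have q0: "0 \<le> ?q n" for n using mono[of y "y + 1 / real (Suc n)"] by (intro mult_nonneg_nonneg) auto
    have q1: "?q n \<le> 1" for n
    proof -
      have "?q n \<le> real (Suc n) * (1 / real (Suc n))" using lip[of y "y + 1 / real (Suc n)"] by (intro mult_left_mono) auto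
      then show ?thesis by simp
    qed
    have "0 \<le> f y" by (simp add: f_def)
    moreover have "f y \<le> 1" by (rule tendsto_upperbound[OF lim]) (use q1 in auto)
    moreover have "f y = 0" if n: "\<not> (a \<le> y \<and> y \<le> b)"
    proof -
      have "\<forall>\<^sub>F n in sequentially. ?q n = 0"
      proof (cases "b < y")
        case True
        have "?q n = 0" for n
        proof -
          have "0 \<le> 1 / real (Suc n)" by simp
          then have "b \<le> y + 1 / real (Suc n)" using True by linarith
          then show ?thesis using right[of y] right[of "y + 1 / real (Suc n)"] True by simp
        qed
        then show ?thesis by simp
      next
        case False
        then have "0 < a - y" using n by auto
        then obtain n0 where n0: "1 / real (Suc n0) < a - y" using nat_approx_posE by blast
        show ?thesis
        proof (rule eventually_sequentiallyI[of n0])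
          fix n assume "n0 \<le> n"
          then have "1 / real (Suc n) \<le> 1 / real (Suc n0)" by (intro divide_left_mono) auto
          then have "y + 1 / real (Suc n) \<le> a" using n0 by linarith
          moreover have "y \<le> a" using n False by auto
          ultimately show "?q n = 0" using left by simp
        qed
      qed
      then have "?q \<longlonglongrightarrow> 0" by (rule tendsto_eventually)
      then show ?thesis using lim LIMSEQ_unique by blast
    qed
    ultimately show ?case using limI[OF lim] by (auto simp: r)
  qed
  then have "density lborel (\<lambda>y. ennreal (f y)) = density lborel (\<lambda>y. ennreal (r y))"
    using rm by (intro density_cong) auto
  then show dens: "?M = density lborel (\<lambda>y. ennreal (r y))" using df by simp
  have "(\<integral>\<^sup>+y. ennreal (r y) \<partial>lborel) = 1"
    using M.emeasure_space_1 rm unfolding dens by (simp add: emeasure_density)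
  then have "density lborel (\<lambda>y. ennreal (r y)) \<in> K_set {a..b}"
    by (intro K_setI rm) (auto simp: r)
  then show "?M \<in> K_set {a..b}" using dens by simp
qed

text \<open>
  Uniform continuity handles near points, boundedness far ones. The quadratic form of the modulus is what can be
  integrated against a coupling of finite quadratic cost.
\<close>

lemma compact_modulus:
  fixes f :: "'a::metric_space \<Rightarrow> real"
  assumes S: "compact S" and f: "continuous_on S f" and e: "0 < e"
  shows "\<exists>K\<ge>0. \<forall>z\<in>S. \<forall>w\<in>S. (f z - f w)\<^sup>2 \<le> e + K * (dist z w)\<^sup>2"
proof -
  have "bounded (f ` S)" by (intro compact_imp_bounded compact_continuous_image f S)
  then obtain B where B: "\<forall>u\<in>f ` S. norm u \<le> B" unfolding bounded_iff by blast
  have "uniformly_continuous_on S f" by (rule compact_uniformly_continuous[OF f S])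
  moreover have "0 < sqrt e" using e by simp
  ultimately obtain d where d: "0 < d" "\<And>z w. z \<in> S \<Longrightarrow> w \<in> S \<Longrightarrow> dist w z < d \<Longrightarrow> dist (f w) (f z) < sqrt e"
    unfolding uniformly_continuous_on_def by metis
  show ?thesis
  proof (intro exI[of _ "(2 * B / d)\<^sup>2"] conjI ballI)
    fix z w assume zw: "z \<in> S" "w \<in> S"
    show "(f z - f w)\<^sup>2 \<le> e + (2 * B / d)\<^sup>2 * (dist z w)\<^sup>2"
    proof (cases "dist z w < d")
      case True
      then have "\<bar>f z - f w\<bar> < sqrt e" using d(2)[OF zw(2,1)] by (simp add: dist_real_def)
      then have "\<bar>f z - f w\<bar>\<^sup>2 \<le> (sqrt e)\<^sup>2" by (intro power_mono) auto
      then have "(f z - f w)\<^sup>2 \<le> e" using e by simp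
      then show ?thesis by (simp add: add_increasing2)
    next
      case False
      have "\<bar>f z\<bar> \<le> B" "\<bar>f w\<bar> \<le> B" using B zw by auto
      then have fb: "\<bar>f z - f w\<bar> \<le> 2 * B" by linarith
      then have "2 * B * 1 \<le> 2 * B * (dist z w / d)" using False d(1) by (intro mult_left_mono) (auto simp: field_simps)
      then have "\<bar>f z - f w\<bar> \<le> 2 * B / d * dist z w" using fb by simp
      then have "\<bar>f z - f w\<bar>\<^sup>2 \<le> (2 * B / d * dist z w)\<^sup>2" by (intro power_mono) auto
      then have "(f z - f w)\<^sup>2 \<le> (2 * B / d)\<^sup>2 * (dist z w)\<^sup>2"
        by (simp only: power2_abs power_mult_distrib[of "2 * B / d"])
      then show ?thesis using e by linarith
    qed
  qed simp
qed

lemma observable_le: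
  fixes \<phi> :: "real \<Rightarrow> real"
  assumes \<mu>: "prob_space \<mu>" "sets \<mu> = sets borel" "AE u in \<mu>. \<bar>u\<bar> \<le> R"
    and \<nu>: "prob_space \<nu>" "sets \<nu> = sets borel" "AE u in \<nu>. \<bar>u\<bar> \<le> R"
    and \<phi>[measurable]: "\<phi> \<in> borel_measurable borel"
    and e: "\<And>u v. \<bar>u\<bar> \<le> R \<Longrightarrow> \<bar>v\<bar> \<le> R \<Longrightarrow> (\<phi> u - \<phi> v)\<^sup>2 \<le> e + K * (u - v)\<^sup>2" and K: "0 \<le> K"
    and B: "\<And>u. \<bar>u\<bar> \<le> R \<Longrightarrow> \<bar>\<phi> u\<bar> \<le> B"
    and c: "transport_cost \<mu> \<nu> < ennreal c"
  shows "((\<integral>u. \<phi> u \<partial>\<mu>) - (\<integral>u. \<phi> u \<partial>\<nu>))\<^sup>2 \<le> e + K * c"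
proof -
  from c obtain \<pi> where \<pi>: "\<pi> \<in> couplings \<mu> \<nu>" and pc: "(\<integral>\<^sup>+z. ennreal ((fst z - snd z)\<^sup>2) \<partial>\<pi>) < ennreal c"
    unfolding transport_cost_def INF_less_iff by blast
  note D = couplingsD[OF \<pi>]
  note [measurable] = D(3,4)
  interpret \<pi>: prob_space \<pi> by (rule coupling_prob_space[OF \<pi> \<mu>(1)])
  have "AE u in distr \<pi> borel fst. \<bar>u\<bar> \<le> R" unfolding D(5) by (rule \<mu>(3))
  then have a1: "AE z in \<pi>. \<bar>fst z\<bar> \<le> R" by (rule AE_distrD2[OF D(3)])
  have "AE u in distr \<pi> borel snd. \<bar>u\<bar> \<le> R" unfolding D(6) by (rule \<nu>(3))
  then have a2: "AE z in \<pi>. \<bar>snd z\<bar> \<le> R" by (rule AE_distrD2[OF D(4)])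
  have i1: "integrable \<pi> (\<lambda>z. \<phi> (fst z))"
  proof (rule \<pi>.integrable_const_bound[where B = B])
    show "AE z in \<pi>. norm (\<phi> (fst z)) \<le> B" using a1 by eventually_elim (simp add: B)
  qed measurable
  have i2: "integrable \<pi> (\<lambda>z. \<phi> (snd z))"
  proof (rule \<pi>.integrable_const_bound[where B = B])
    show "AE z in \<pi>. norm (\<phi> (snd z)) \<le> B" using a2 by eventually_elim (simp add: B)
  qed measurable
  have ic: "integrable \<pi> (\<lambda>z. (fst z - snd z)\<^sup>2)"
    by (rule integrableI_nonneg) (use pc in \<open>auto simp: less_trans\<close>)
  have c2: "(\<integral>z. (fst z - snd z)\<^sup>2 \<partial>\<pi>) \<le> c"
  proof -
    have "ennreal (\<integral>z. (fst z - snd z)\<^sup>2 \<partial>\<pi>) < ennreal c" using pc by (subst (asm) nn_integral_eq_integral[OF ic]) auto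
    then show ?thesis by (subst (asm) ennreal_less_iff) auto
  qed
  let ?g = "\<lambda>z. \<phi> (fst z) - \<phi> (snd z)"
  have ig: "integrable \<pi> (\<lambda>z. (?g z)\<^sup>2)"
  proof (rule \<pi>.integrable_const_bound[where B = "(2 * B)\<^sup>2"])
    show "AE z in \<pi>. norm ((?g z)\<^sup>2) \<le> (2 * B)\<^sup>2"
      using a1 a2
    proof eventually_elim
      case (elim z)
      have "\<bar>?g z\<bar> \<le> \<bar>2 * B\<bar>" using B[OF elim(1)] B[OF elim(2)] by linarith
      then show ?case by (simp only: abs_le_square_iff real_norm_def abs_power2)
    qed
  qed measurable
  have "((\<integral>u. \<phi> u \<partial>\<mu>) - (\<integral>u. \<phi> u \<partial>\<nu>)) = (\<integral>z. ?g z * 1 \<partial>\<pi>)"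
    using i1 i2 unfolding D(5)[symmetric] D(6)[symmetric] by (simp add: integral_distr)
  then have "((\<integral>u. \<phi> u \<partial>\<mu>) - (\<integral>u. \<phi> u \<partial>\<nu>))\<^sup>2 = (\<integral>z. ?g z * 1 \<partial>\<pi>)\<^sup>2" by simp
  also have "\<dots> \<le> (\<integral>z. (?g z)\<^sup>2 \<partial>\<pi>) * (\<integral>z. 1\<^sup>2 \<partial>\<pi>)"
    by (rule cauchy_schwarz) (use ig in \<open>auto simp: square_int_def\<close>)
  also have "\<dots> = (\<integral>z. (?g z)\<^sup>2 \<partial>\<pi>)" by (simp add: \<pi>.prob_space)
  also have "\<dots> \<le> (\<integral>z. e + K * (fst z - snd z)\<^sup>2 \<partial>\<pi>)"
  proof (rule integral_mono_AE[OF ig])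
    show "integrable \<pi> (\<lambda>z. e + K * (fst z - snd z)\<^sup>2)" using ic by simp
    show "AE z in \<pi>. (?g z)\<^sup>2 \<le> e + K * (fst z - snd z)\<^sup>2" using a1 a2 by eventually_elim (rule e)
  qed
  also have "\<dots> = e + K * (\<integral>z. (fst z - snd z)\<^sup>2 \<partial>\<pi>)" using ic by (simp add: \<pi>.prob_space)
  also have "\<dots> \<le> e + K * c" using c2 K by (intro add_left_mono mult_left_mono)
  finally show ?thesis .
qed

lemma observable_tendsto:
  fixes \<phi> :: "real \<Rightarrow> real"
  assumes \<mu>: "\<And>n. prob_space (\<mu> n)" "\<And>n. sets (\<mu> n) = sets borel" "\<And>n. AE u in \<mu> n. \<bar>u\<bar> \<le> R"
    and \<nu>: "prob_space \<nu>" "sets \<nu> = sets borel" "AE u in \<nu>. \<bar>u\<bar> \<le> R"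
    and \<phi>: "continuous_on UNIV \<phi>"
    and c: "\<And>n. transport_cost (\<mu> n) \<nu> \<le> ennreal (c n)" and c0: "\<And>n. 0 \<le> c n" "c \<longlonglongrightarrow> 0"
  shows "(\<lambda>n. \<integral>u. \<phi> u \<partial>\<mu> n) \<longlonglongrightarrow> (\<integral>u. \<phi> u \<partial>\<nu>)"
proof (rule LIMSEQ_I)
  fix e :: real assume e: "0 < e"
  have \<phi>m: "\<phi> \<in> borel_measurable borel" by (rule borel_measurable_continuous_onI[OF \<phi>])
  have \<phi>c: "continuous_on {-R..R} \<phi>" by (rule continuous_on_subset[OF \<phi>]) simp
  have "0 < e\<^sup>2 / 2" using e by simp
  from compact_modulus[OF compact_Icc \<phi>c this] obtain K where K: "0 \<le> K" "\<And>u v. u \<in> {-R..R} \<Longrightarrow> v \<in> {-R..R} \<Longrightarrow> (\<phi> u - \<phi> v)\<^sup>2 \<le> e\<^sup>2 / 2 + K * (dist u v)\<^sup>2" by blast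
  have K': "(\<phi> u - \<phi> v)\<^sup>2 \<le> e\<^sup>2 / 2 + K * (u - v)\<^sup>2" if "\<bar>u\<bar> \<le> R" "\<bar>v\<bar> \<le> R" for u v
    using K(2)[of u v] that by (simp add: dist_real_def abs_le_iff)
  have "bounded (\<phi> ` {-R..R})" by (intro compact_imp_bounded compact_continuous_image \<phi>c) auto
  then obtain B where "\<forall>w\<in>\<phi> ` {-R..R}. norm w \<le> B" unfolding bounded_iff by blast
  then have B: "\<bar>\<phi> u\<bar> \<le> B" if "\<bar>u\<bar> \<le> R" for u using that by (simp add: abs_le_iff)
  define \<eta> where "\<eta> = e\<^sup>2 / (4 * (K + 1))"
  have \<eta>: "0 < \<eta>" using e K by (simp add: \<eta>_def)
  have "K * \<eta> \<le> e\<^sup>2 / 4"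
  proof -
    have "K * \<eta> \<le> (K + 1) * \<eta>" using \<eta> by simp
    also have "\<dots> = e\<^sup>2 / 4" using K by (simp add: \<eta>_def field_simps)
    finally show ?thesis .
  qed
  moreover have "0 < e\<^sup>2" using e by simp
  ultimately have K\<eta>: "e\<^sup>2 / 2 + K * \<eta> < e\<^sup>2" by linarith
  obtain n0 where n0: "\<And>n. n \<ge> n0 \<Longrightarrow> c n < \<eta>"
    using order_tendstoD(2)[OF c0(2) \<eta>] by (auto simp: eventually_sequentially)
  show "\<exists>no. \<forall>n\<ge>no. norm ((\<integral>u. \<phi> u \<partial>\<mu> n) - (\<integral>u. \<phi> u \<partial>\<nu>)) < e"
  proof (intro exI allI impI)
    fix n assume n: "n0 \<le> n"
    have "transport_cost (\<mu> n) \<nu> < ennreal \<eta>"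
      using c[of n] n0[OF n] c0(1)[of n] by (metis ennreal_lessI le_less_trans \<eta>)
    from observable_le[OF \<mu> \<nu> \<phi>m K' K(1) B this]
    have "((\<integral>u. \<phi> u \<partial>\<mu> n) - (\<integral>u. \<phi> u \<partial>\<nu>))\<^sup>2 \<le> e\<^sup>2 / 2 + K * \<eta>" by blast
    then have "\<bar>(\<integral>u. \<phi> u \<partial>\<mu> n) - (\<integral>u. \<phi> u \<partial>\<nu>)\<bar>\<^sup>2 < e\<^sup>2" using K\<eta> by simp
    then show "norm ((\<integral>u. \<phi> u \<partial>\<mu> n) - (\<integral>u. \<phi> u \<partial>\<nu>)) < e"
      using e by (simp only: real_norm_def) (rule power_less_imp_less_base[of _ 2], auto)
  qed
qed

text \<open>
  Continuous ramps sandwich the distribution functions.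
\<close>

lemma real_distribution_eqI_observables:
  assumes M: "real_distribution M" and N: "real_distribution N"
    and eq: "\<And>\<phi> :: real \<Rightarrow> real. continuous_on UNIV \<phi> \<Longrightarrow> (\<integral>u. \<phi> u \<partial>M) = (\<integral>u. \<phi> u \<partial>N)"
  shows "M = N"
proof (rule cdf_unique[OF M N], rule ext)
  have cc: "continuous_on UNIV (cts_step x y)" if "x < y" for x y
    using cts_step_uniformly_continuous[OF that] by (rule uniformly_continuous_imp_continuous)
  have le: "cdf M x \<le> cdf N x" if M: "real_distribution M" and N: "real_distribution N"
    and eq: "\<And>\<phi> :: real \<Rightarrow> real. continuous_on UNIV \<phi> \<Longrightarrow> (\<integral>u. \<phi> u \<partial>M) = (\<integral>u. \<phi> u \<partial>N)" for M N x
  proof -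
    interpret M: real_distribution M by fact
    interpret N: real_distribution N by fact
    have "cdf M x \<le> cdf N y" if "x < y" for y
      using M.cdf_cts_step(1)[OF that] N.cdf_cts_step(2)[OF that] eq[OF cc[OF that]] by simp
    moreover have "(cdf N \<longlongrightarrow> cdf N x) (at_right x)" using N.cdf_is_right_cont[of x] by (simp add: continuous_within)
    ultimately show ?thesis
      by (intro tendsto_lowerbound[of "cdf N" _ "at_right x"]) (auto simp: eventually_at_filter)
  qed
  fix x show "cdf M x = cdf N x" using le[OF M N eq] le[OF N M eq[symmetric]] by (intro antisym) auto
qed

section \<open>Compactness of a sequence of flows\<close>

text \<open>
  Flows along a sequence of particle numbers that tends to infinity, with the uniform bounds that follow from energy dissipation.
\<close>

locale flow_sequence =
  fixes N :: "nat \<Rightarrow> nat" and I :: "nat \<Rightarrow> nat set" and m :: "nat \<Rightarrow> nat \<Rightarrow> real" and x x' l :: "nat \<Rightarrow> real \<Rightarrow> nat \<Rightarrow> real"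
    and dV :: "real \<Rightarrow> real" and a b T R C M :: real
  assumes flow: "\<And>n. block_flow (N n) (I n) (m n) (x n) (x' n) (l n) dV a b T"
    and Nn: "\<And>n. n < N n"
    and pos: "\<And>n t i. t \<in> {0..T} \<Longrightarrow> i \<in> I n \<Longrightarrow> \<bar>x n t i\<bar> \<le> R"
    and aR: "\<bar>a\<bar> \<le> R" and bR: "\<bar>b\<bar> \<le> R"
    and cost: "\<And>n t. t \<in> {0..T} \<Longrightarrow> block_flow.cst (I n) (m n) (x n) (l n) t \<le> C / real (N n)"
    and speed: "\<And>n. integral {0..T} (block_flow.speed2 (I n) (m n) (x' n)) \<le> C"
    and dVM: "\<And>y. \<bar>y\<bar> \<le> R \<Longrightarrow> \<bar>dV y\<bar> \<le> M"
begin

abbreviation "F n \<equiv> block_flow.Fc (I n) (m n) (l n)"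

lemma ab: "1 \<le> b - a" by (rule block_flow.ab[OF flow])
lemma T: "0 < T" by (rule block_flow.T[OF flow])

lemma F_facts:
  assumes t: "t \<in> {0..T}"
  shows "y \<le> z \<Longrightarrow> F n t y \<le> F n t z" "y \<le> z \<Longrightarrow> F n t z - F n t y \<le> z - y"
    "y \<le> a \<Longrightarrow> F n t y = 0" "b \<le> y \<Longrightarrow> F n t y = 1"
  using block_flow.pack[OF flow t, of n] unfolding block_flow.Fc_def[OF flow]
  by (auto intro: packing.cdfp_mono packing.cdfp_lipschitz packing.cdfp_left packing.cdfp_right)

text \<open>
  The distribution functions of the projections are equicontinuous, by \<open>Fc_time\<close> in time and by the bound 1 for the density in space.
\<close>

lemma F_compact:
  "\<exists>g k. continuous_on ({0..T} \<times> {a..b}) g \<and> strict_mono (k :: nat \<Rightarrow> nat) \<and>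
    (\<forall>e>0. \<exists>n0. \<forall>n t y. n0 \<le> n \<longrightarrow> t \<in> {0..T} \<longrightarrow> y \<in> {a..b} \<longrightarrow> \<bar>F (k n) t y - g (t, y)\<bar> < e)"
proof -
  let ?S = "{0..T} \<times> {a..b}"
  let ?F = "\<lambda>n z. F n (fst z) (snd z)"
  have cS: "compact ?S" by (intro compact_Times) auto
  have bd: "norm (?F n z) \<le> 1" if z: "z \<in> ?S" for n z
  proof -
    have t: "fst z \<in> {0..T}" and y: "a \<le> snd z" "snd z \<le> b" using z by auto
    show ?thesis using F_facts(1)[OF t y(1), of n] F_facts(1)[OF t y(2), of n] F_facts(3)[OF t order_refl, of n] F_facts(4)[OF t order_refl, of n] by simp
  qed
  have eq: "\<exists>d. 0 < d \<and> (\<forall>n w. w \<in> ?S \<and> norm (z - w) < d \<longrightarrow> norm (?F n z - ?F n w) < e)" if z: "z \<in> ?S" and e: "0 < e" for z e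
  proof -
    define C' where "C' = max C 1"
    have C': "0 < C'" "C \<le> C'" by (auto simp: C'_def)
    define \<delta> where "\<delta> = e / 8"
    have \<delta>: "0 < \<delta>" using e by (simp add: \<delta>_def)
    define d where "d = min (\<delta> ^ 4 / C') (e / 4)"
    have d: "0 < d" using \<delta> C' e by (simp add: d_def)
    have "norm (?F n z - ?F n w) < e" if w: "w \<in> ?S" "norm (z - w) < d" for n w
    proof -
      have tz: "fst z \<in> {0..T}" and tw: "fst w \<in> {0..T}" using z w by auto
      have nt: "\<bar>fst z - fst w\<bar> < d" using dist_fst_le[of z w] w by (simp add: dist_norm)
      have ny: "\<bar>snd z - snd w\<bar> < d" using dist_snd_le[of z w] w by (simp add: dist_norm)
      have "\<bar>fst z - fst w\<bar> * C' \<le> d * C'" using nt C' by (intro mult_right_mono) auto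
      also have "\<dots> \<le> \<delta> ^ 4 / C' * C'" using C' by (intro mult_right_mono) (auto simp: d_def)
      also have "\<dots> = \<delta> ^ 4" using C' by simp
      finally have "\<bar>fst z - fst w\<bar> * C' \<le> \<delta> ^ 4" .
      moreover have "integral {0..T} (block_flow.speed2 (I n) (m n) (x' n)) \<le> C'" using speed[of n] C' by simp
      ultimately have 1: "\<bar>F n (fst z) (snd z) - F n (fst w) (snd z)\<bar> \<le> 3 * \<delta>"
        by (intro block_flow.Fc_time[OF flow tw tz _ \<delta>])
      have 2: "\<bar>F n (fst w) (snd z) - F n (fst w) (snd w)\<bar> \<le> \<bar>snd z - snd w\<bar>"
        using F_facts(1,2)[OF tw, of "snd z" "snd w" n] F_facts(1,2)[OF tw, of "snd w" "snd z" n] by (cases "snd z \<le> snd w") auto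
      have "d \<le> e / 4" unfolding d_def by (rule min.cobounded2)
      then show ?thesis using 1 2 ny e unfolding \<delta>_def real_norm_def by linarith
    qed
    then show ?thesis using d by blast
  qed
  obtain g k where gk: "continuous_on ?S g" "strict_mono (k :: nat \<Rightarrow> nat)"
    and L: "\<And>e. 0 < e \<Longrightarrow> \<exists>N. \<forall>n z. n \<ge> N \<and> z \<in> ?S \<longrightarrow> norm (?F (k n) z - g z) < e"
    using Arzela_Ascoli[of ?S ?F 1, OF cS bd eq] by blast
  have "\<exists>n0. \<forall>n t y. n0 \<le> n \<longrightarrow> t \<in> {0..T} \<longrightarrow> y \<in> {a..b} \<longrightarrow> \<bar>F (k n) t y - g (t, y)\<bar> < e" if "0 < e" for e
  proof -
    from L[OF that] obtain n0 where n0: "\<forall>n z. n \<ge> n0 \<and> z \<in> ?S \<longrightarrow> norm (?F (k n) z - g z) < e" ..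
    show ?thesis
    proof (intro exI allI impI)
      fix n t y assume "n0 \<le> n" "t \<in> {0..T}" "y \<in> {a..b}"
      then show "\<bar>F (k n) t y - g (t, y)\<bar> < e" using n0[rule_format, of n "(t, y)"] by simp
    qed
  qed
  then show ?thesis using gk by blast
qed

end

locale flow_limit = flow_sequence +
  fixes G :: "real \<Rightarrow> real \<Rightarrow> real"
  assumes Gcont: "continuous_on UNIV (\<lambda>z. G (fst z) (snd z))"
    and conv: "\<And>e. 0 < e \<Longrightarrow> \<exists>n0. \<forall>n\<ge>n0. \<forall>t\<in>{0..T}. \<forall>y. \<bar>F n t y - G t y\<bar> < e"
begin

lemma F_tendsto: "t \<in> {0..T} \<Longrightarrow> (\<lambda>n. F n t y) \<longlonglongrightarrow> G t y"
proof (rule LIMSEQ_I)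
  fix e :: real assume t: "t \<in> {0..T}" and "0 < e"
  from conv[OF this(2)] obtain n0 where n0: "\<forall>n\<ge>n0. \<forall>t\<in>{0..T}. \<forall>y. \<bar>F n t y - G t y\<bar> < e" ..
  show "\<exists>no. \<forall>n\<ge>no. norm (F n t y - G t y) < e"
    by (rule exI[of _ n0]) (use n0 t in auto)
qed

lemma G_mono: assumes t: "t \<in> {0..T}" and "y \<le> z" shows "G t y \<le> G t z"
  using F_facts(1)[OF t assms(2)] by (intro LIMSEQ_le[OF F_tendsto[OF t] F_tendsto[OF t]]) auto

lemma G_lip: assumes t: "t \<in> {0..T}" and yz: "y \<le> z" shows "G t z - G t y \<le> z - y"
  by (rule tendsto_upperbound[OF tendsto_diff[OF F_tendsto[OF t] F_tendsto[OF t]]])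
     (use F_facts(2)[OF t yz] in auto)

lemma G_left: assumes t: "t \<in> {0..T}" and "y \<le> a" shows "G t y = 0"
proof -
  have "(\<lambda>n. F n t y) = (\<lambda>n. 0)" using F_facts(3)[OF t assms(2)] by (intro ext)
  then show ?thesis using F_tendsto[OF t, of y] LIMSEQ_unique[OF _ tendsto_const] by metis
qed

lemma G_right: assumes t: "t \<in> {0..T}" and "b \<le> y" shows "G t y = 1"
proof -
  have "(\<lambda>n. F n t y) = (\<lambda>n. 1)" using F_facts(4)[OF t assms(2)] by (intro ext)
  then show ?thesis using F_tendsto[OF t, of y] LIMSEQ_unique[OF _ tendsto_const] by metis
qed

definition \<rho> :: "real \<Rightarrow> real measure" where "\<rho> t = interval_measure (G t)"

definition dens :: "real \<times> real \<Rightarrow> real" where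
  "dens z = (if a \<le> snd z \<and> snd z \<le> b then max 0 (min 1 (lim (\<lambda>n. real (Suc n) * (G (fst z) (snd z + 1 / real (Suc n)) - G (fst z) (snd z))))) else 0)"

lemma dens_measurable[measurable]: "dens \<in> borel_measurable borel"
proof -
  have g: "(\<lambda>z. G (fst z) (snd z + c)) \<in> borel_measurable borel" for c
  proof (rule borel_measurable_continuous_onI)
    have "continuous_on UNIV (\<lambda>z. (\<lambda>w. G (fst w) (snd w)) (fst z, snd z + c))"
      by (rule continuous_on_compose2[OF Gcont]) (auto intro!: continuous_intros)
    then show "continuous_on UNIV (\<lambda>z. G (fst z) (snd z + c))" by simp
  qed
  note [measurable] = g g[of 0, simplified]
  show ?thesis unfolding dens_def[abs_def] by measurable
qed

lemma dens_01: "0 \<le> dens z" "dens z \<le> 1" by (auto simp: dens_def)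

lemma \<rho>_facts:
  assumes t: "t \<in> {0..T}"
  shows "real_distribution (\<rho> t)" "cdf (\<rho> t) = G t" "\<rho> t = density lborel (\<lambda>y. ennreal (dens (t, y)))" "\<rho> t \<in> K_set {a..b}"
proof -
  have r: "(\<lambda>y. dens (t, y)) = (\<lambda>y. if a \<le> y \<and> y \<le> b then max 0 (min 1 (lim (\<lambda>n. real (Suc n) * (G t (y + 1 / real (Suc n)) - G t y)))) else 0)"
    by (simp add: dens_def fun_eq_iff)
  note D = lipschitz_cdf_density[of "G t" a b "\<lambda>y. dens (t, y)"]
  show "real_distribution (\<rho> t)" unfolding \<rho>_def
    by (rule D(1); (rule r | erule G_mono[OF t] | erule G_lip[OF t] | erule G_left[OF t] | erule G_right[OF t]))
  show "cdf (\<rho> t) = G t" unfolding \<rho>_def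
    by (rule D(2); (rule r | erule G_mono[OF t] | erule G_lip[OF t] | erule G_left[OF t] | erule G_right[OF t]))
  show "\<rho> t = density lborel (\<lambda>y. ennreal (dens (t, y)))" unfolding \<rho>_def
    by (rule D(3); (rule r | erule G_mono[OF t] | erule G_lip[OF t] | erule G_left[OF t] | erule G_right[OF t]))
  show "\<rho> t \<in> K_set {a..b}" unfolding \<rho>_def
    by (rule D(5); (rule r | erule G_mono[OF t] | erule G_lip[OF t] | erule G_left[OF t] | erule G_right[OF t]))
qed

lemma \<rho>_prob: "t \<in> {0..T} \<Longrightarrow> prob_space (\<rho> t)" "t \<in> {0..T} \<Longrightarrow> sets (\<rho> t) = sets borel"
  using \<rho>_facts(4) by (auto simp: K_set_def P_ac_def)

lemma \<rho>_AE: assumes t: "t \<in> {0..T}" shows "AE u in \<rho> t. \<bar>u\<bar> \<le> R"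
proof (rule AE_I)
  show "{u \<in> space (\<rho> t). \<not> \<bar>u\<bar> \<le> R} \<subseteq> - {a..b}" using aR bR by auto
  show "emeasure (\<rho> t) (- {a..b}) = 0" using \<rho>_facts(4)[OF t] by (auto simp: K_set_def P_ac_def)
  show "- {a..b} \<in> sets (\<rho> t)" using \<rho>_prob(2)[OF t] by simp
qed

definition \<mu> :: "nat \<Rightarrow> real \<Rightarrow> real measure" where "\<mu> n t = atomic (I n) (m n) (x n t)"

lemma C0: "0 \<le> C"
proof -
  have "0 \<le> integral {0..T} (block_flow.speed2 (I 0) (m 0) (x' 0))"
    by (intro Henstock_Kurzweil_Integration.integral_nonneg integrable_continuous_real block_flow.cont_speed2[OF flow])
       (auto simp: block_flow.speed2_def[OF flow] intro!: sum_nonneg mult_nonneg_nonneg block_flow.mnonneg[OF flow])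
  then show ?thesis using speed[of 0] by simp
qed

lemma \<mu>_prob: "prob_space (\<mu> n t)" "sets (\<mu> n t) = sets borel"
  unfolding \<mu>_def using block_flow.fin[OF flow] block_flow.mnonneg[OF flow] block_flow.msum[OF flow]
  by (auto intro!: prob_space_atomic)

lemma \<mu>_AE: assumes t: "t \<in> {0..T}" shows "AE u in \<mu> n t. \<bar>u\<bar> \<le> R"
  unfolding \<mu>_def using AE_atomic[OF block_flow.fin[OF flow]]
  by eventually_elim (use pos[OF t] in auto)

lemma \<mu>_integral: "\<phi> \<in> borel_measurable borel \<Longrightarrow> (\<integral>u. \<phi> u \<partial>\<mu> n t) = (\<Sum>i\<in>I n. m n i * \<phi> (x n t i))"
  unfolding \<mu>_def by (intro integral_atomic block_flow.fin[OF flow] block_flow.mnonneg[OF flow])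

text \<open>
  The particles are the image of their projection under the optimal map, whose cost is \<open>cst\<close>.
\<close>

lemma transport_bound:
  assumes t: "t \<in> {0..T}" and e: "\<And>y. \<bar>F n t y - G t y\<bar> \<le> e" "0 \<le> e"
  shows "transport_cost (\<mu> n t) (\<rho> t) \<le> ennreal (2 * (C / real (N n)) + 4 * (b - a)\<^sup>2 * e)"
proof -
  interpret P: packing "I n" "m n" "x n t" a b "l n t" by (rule block_flow.pack[OF flow t])
  have k: "(\<integral>\<^sup>+y. ennreal ((P.step (x n t) y - y)\<^sup>2) \<partial>P.proj) \<le> ennreal (C / real (N n))"
    unfolding P.nn_integral_step_square
    using cost[OF t, of n] by (intro ennreal_leI) (simp add: block_flow.cst_def[OF flow] P.cost_def)
  have "transport_cost (distr P.proj borel (P.step (x n t))) (\<rho> t) \<le> ennreal (2 * (C / real (N n)) + 4 * (b - a)\<^sup>2 * e)"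
  proof (rule transport_cost_cdf_le[OF P.real_distribution_proj \<rho>_facts(1)[OF t] _ _ _ _ _ _ e(2) P.step_measurable k])
    show "cdf P.proj y = 0" if "y < a" for y using P.cdfp_left[of y] that by (simp add: P.cdf_proj)
    show "cdf P.proj y = 1" if "b \<le> y" for y using P.cdfp_right[of y] that by (simp add: P.cdf_proj)
    show "cdf (\<rho> t) y = 0" if "y < a" for y using G_left[OF t, of y] that by (simp add: \<rho>_facts(2)[OF t])
    show "cdf (\<rho> t) y = 1" if "b \<le> y" for y using G_right[OF t, of y] that by (simp add: \<rho>_facts(2)[OF t])
    show "\<bar>cdf P.proj y - cdf (\<rho> t) y\<bar> \<le> e" for y
      using e(1)[of y] by (simp add: \<rho>_facts(2)[OF t] P.cdf_proj block_flow.Fc_def[OF flow])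
    show "a \<le> b" using ab by simp
    show "0 \<le> C / real (N n)" using C0 by simp
  qed
  then show ?thesis unfolding P.distr_step \<mu>_def .
qed

lemma transport_uniform:
  assumes e: "0 < e"
  shows "\<exists>n0. \<forall>n\<ge>n0. \<forall>t\<in>{0..T}. transport_cost (\<mu> n t) (\<rho> t) \<le> ennreal e"
proof -
  define e1 where "e1 = e / (8 * (b - a)\<^sup>2)"
  have ba: "0 < b - a" using ab by simp
  have e1: "0 < e1" using e ba by (simp add: e1_def)
  from conv[OF e1] obtain n1 where n1: "\<forall>n\<ge>n1. \<forall>t\<in>{0..T}. \<forall>y. \<bar>F n t y - G t y\<bar> < e1" ..
  obtain n2 :: nat where n2: "4 * C / e < real n2" using reals_Archimedean2 by blast
  show ?thesis
  proof (intro exI allI ballI impI)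
    fix n t assume n: "max n1 n2 \<le> n" and t: "t \<in> {0..T}"
    have "transport_cost (\<mu> n t) (\<rho> t) \<le> ennreal (2 * (C / real (N n)) + 4 * (b - a)\<^sup>2 * e1)"
      by (rule transport_bound[OF t]) (use n1 n t e1 in \<open>auto intro: less_imp_le\<close>)
    also have "\<dots> \<le> ennreal e"
    proof (rule ennreal_leI)
      have "real n2 \<le> real (N n)" using n Nn[of n] by linarith
      then have 1: "4 * C / e < real (N n)" using n2 by linarith
      have "0 < real (N n)" using Nn[of n] by simp
      then have "2 * (C / real (N n)) \<le> e / 2" using 1 e by (simp add: field_simps)
      moreover have "4 * (b - a)\<^sup>2 * e1 = e / 2" using ba by (simp add: e1_def)
      ultimately show "2 * (C / real (N n)) + 4 * (b - a)\<^sup>2 * e1 \<le> e" by simp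
    qed
    finally show "transport_cost (\<mu> n t) (\<rho> t) \<le> ennreal e" .
  qed
qed

lemma W2_le: "transport_cost p q \<le> ennreal e \<Longrightarrow> 0 \<le> e \<Longrightarrow> W2 p q \<le> sqrt e"
  unfolding W2_def by (intro real_sqrt_le_mono enn2real_leI)

lemma converges: "converges_C0_W2 T \<mu> \<rho>"
  unfolding converges_C0_W2_def
proof (intro allI impI)
  fix e :: real assume e: "0 < e"
  then have "0 < (e / 2)\<^sup>2" by simp
  from transport_uniform[OF this] obtain n0 where n0: "\<forall>n\<ge>n0. \<forall>t\<in>{0..T}. transport_cost (\<mu> n t) (\<rho> t) \<le> ennreal ((e / 2)\<^sup>2)" ..
  show "\<forall>\<^sub>F n in sequentially. \<forall>t\<in>{0..T}. W2 (\<mu> n t) (\<rho> t) < e"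
  proof (rule eventually_sequentiallyI[of n0], intro ballI)
    fix n t assume "n0 \<le> n" "t \<in> {0..T}"
    then have "W2 (\<mu> n t) (\<rho> t) \<le> sqrt ((e / 2)\<^sup>2)" using n0 by (intro W2_le) auto
    then show "W2 (\<mu> n t) (\<rho> t) < e" using e by simp
  qed
qed

lemma C0_\<rho>: "C0_W2 T \<rho>"
  unfolding C0_W2_def
proof (intro ballI conjI)
  fix t assume t: "t \<in> {0..T}"
  interpret prob_space "\<rho> t" by (rule \<rho>_prob(1)[OF t])
  have "integrable (\<rho> t) (\<lambda>x. x\<^sup>2)"
  proof (rule integrable_const_bound[where B = "R\<^sup>2"])
    show "AE u in \<rho> t. norm (u\<^sup>2) \<le> R\<^sup>2"
      using \<rho>_AE[OF t]
    proof eventually_elim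
      case (elim u)
      then have "\<bar>u\<bar>\<^sup>2 \<le> R\<^sup>2" by (intro power_mono) auto
      then show ?case by simp
    qed
    show "(\<lambda>u. u\<^sup>2) \<in> borel_measurable (\<rho> t)" by (simp add: measurable_cong_sets[OF \<rho>_prob(2)[OF t] refl])
  qed
  then show "\<rho> t \<in> W2_space" using \<rho>_prob[OF t] by (simp add: W2_space_def)
  show "((\<lambda>s. W2 (\<rho> s) (\<rho> t)) \<longlongrightarrow> 0) (at t within {0..T})"
  proof (rule tendstoI)
    fix e :: real assume e: "0 < e"
    define e1 where "e1 = (e / 2)\<^sup>2 / (4 * (b - a)\<^sup>2)"
    have ba: "0 < b - a" using ab by simp
    have e1: "0 < e1" using e ba by (simp add: e1_def)
    have "uniformly_continuous_on ({0..T} \<times> {a..b}) (\<lambda>z. G (fst z) (snd z))"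
      by (rule compact_uniformly_continuous[OF continuous_on_subset[OF Gcont] compact_Times]) auto
    then obtain d where d: "0 < d" "\<And>z w. z \<in> {0..T} \<times> {a..b} \<Longrightarrow> w \<in> {0..T} \<times> {a..b} \<Longrightarrow> dist w z < d \<Longrightarrow> dist (G (fst w) (snd w)) (G (fst z) (snd z)) < e1"
      unfolding uniformly_continuous_on_def using e1 by blast
    have close: "\<bar>G s y - G t y\<bar> \<le> e1" if s: "s \<in> {0..T}" "dist s t < d" for s y
    proof (cases "y \<in> {a..b}")
      case True
      have "dist (s, y) (t, y) < d" using s(2) by (simp add: dist_Pair_Pair)
      then show ?thesis using d(2)[of "(t, y)" "(s, y)"] True s t by (auto simp: dist_real_def)
    next
      case False
      then have "G s y = G t y" using G_left[OF t, of y] G_left[OF s(1), of y] G_right[OF t, of y] G_right[OF s(1), of y]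
        by (cases "y \<le> a") auto
      then show ?thesis using e1 by simp
    qed
    have "\<forall>\<^sub>F s in at t within {0..T}. s \<in> {0..T} \<and> dist s t < d"
      using d(1) by (auto simp: eventually_at intro!: exI[of _ d])
    then show "\<forall>\<^sub>F s in at t within {0..T}. dist (W2 (\<rho> s) (\<rho> t)) 0 < e"
    proof eventually_elim
      case (elim s)
      then have s: "s \<in> {0..T}" "dist s t < d" by auto
      interpret S: real_distribution "\<rho> s" by (rule \<rho>_facts(1)[OF s(1)])
      have "transport_cost (distr (\<rho> s) borel (\<lambda>y. y)) (\<rho> t) \<le> ennreal (2 * 0 + 4 * (b - a)\<^sup>2 * e1)"
      proof (rule transport_cost_cdf_le[OF \<rho>_facts(1)[OF s(1)] \<rho>_facts(1)[OF t], where a = a and b = b])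
        show "cdf (\<rho> s) y = 0" if "y < a" for y using G_left[OF s(1), of y] that by (simp add: \<rho>_facts(2)[OF s(1)])
        show "cdf (\<rho> s) y = 1" if "b \<le> y" for y using G_right[OF s(1), of y] that by (simp add: \<rho>_facts(2)[OF s(1)])
        show "cdf (\<rho> t) y = 0" if "y < a" for y using G_left[OF t, of y] that by (simp add: \<rho>_facts(2)[OF t])
        show "cdf (\<rho> t) y = 1" if "b \<le> y" for y using G_right[OF t, of y] that by (simp add: \<rho>_facts(2)[OF t])
        show "\<bar>cdf (\<rho> s) y - cdf (\<rho> t) y\<bar> \<le> e1" for y using close[OF s] by (simp add: \<rho>_facts(2)[OF t] \<rho>_facts(2)[OF s(1)])
      qed (use ba e1 in auto)
      also have "distr (\<rho> s) borel (\<lambda>y. y) = \<rho> s" using \<rho>_prob(2)[OF s(1)] by (simp add: distr_id2)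
      also have "2 * 0 + 4 * (b - a)\<^sup>2 * e1 = (e / 2)\<^sup>2" using ba by (simp add: e1_def)
      finally have "W2 (\<rho> s) (\<rho> t) \<le> sqrt ((e / 2)\<^sup>2)" by (intro W2_le) auto
      moreover have "0 \<le> W2 (\<rho> s) (\<rho> t)" by (simp add: W2_def)
      ultimately show ?case using e by (simp add: dist_real_def)
    qed
  qed
qed

lemma observable_limit:
  assumes t: "t \<in> {0..T}" and \<phi>: "continuous_on UNIV \<phi>"
  shows "(\<lambda>n. \<Sum>i\<in>I n. m n i * \<phi> (x n t i)) \<longlonglongrightarrow> (\<integral>u. \<phi> u \<partial>\<rho> t)"
proof -
  define c where "c = (\<lambda>n. enn2real (transport_cost (\<mu> n t) (\<rho> t)))"
  have b1: "\<bar>F n t y - G t y\<bar> \<le> 1" for n y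
  proof -
    have "0 \<le> F n t y \<and> F n t y \<le> 1"
      using F_facts(1)[OF t, of "min a y" y n] F_facts(1)[OF t, of y "max b y" n] F_facts(3)[OF t, of "min a y" n] F_facts(4)[OF t, of "max b y" n] by simp
    moreover have "0 \<le> G t y \<and> G t y \<le> 1"
      using G_mono[OF t, of "min a y" y] G_mono[OF t, of y "max b y"] G_left[OF t, of "min a y"] G_right[OF t, of "max b y"] by simp
    ultimately show ?thesis by linarith
  qed
  have fin: "transport_cost (\<mu> n t) (\<rho> t) < \<infinity>" for n
    using transport_bound[OF t b1, of n] le_less_trans by fastforce
  have cn: "transport_cost (\<mu> n t) (\<rho> t) \<le> ennreal (c n)" for n
    using fin[of n] by (simp add: c_def)
  have c0: "c \<longlonglongrightarrow> 0"
  proof (rule LIMSEQ_I)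
    fix e :: real assume e: "0 < e"
    then have "0 < e / 2" by simp
    from transport_uniform[OF this] obtain n0 where n0: "\<forall>n\<ge>n0. \<forall>t\<in>{0..T}. transport_cost (\<mu> n t) (\<rho> t) \<le> ennreal (e / 2)" ..
    show "\<exists>no. \<forall>n\<ge>no. norm (c n - 0) < e"
    proof (intro exI allI impI)
      fix n assume "n0 \<le> n"
      then have "c n \<le> e / 2" unfolding c_def using n0 t e by (intro enn2real_leI) auto
      then show "norm (c n - 0) < e" using e by (simp add: c_def)
    qed
  qed
  have "(\<lambda>n. \<integral>u. \<phi> u \<partial>\<mu> n t) \<longlonglongrightarrow> (\<integral>u. \<phi> u \<partial>\<rho> t)"
    by (rule observable_tendsto[OF \<mu>_prob \<mu>_AE[OF t] \<rho>_prob(1)[OF t] \<rho>_prob(2)[OF t] \<rho>_AE[OF t] \<phi> cn _ c0]) (simp add: c_def)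
  then show ?thesis by (simp add: \<mu>_integral[OF borel_measurable_continuous_onI[OF \<phi>]])
qed

end

section \<open>Primitives in the space variable\<close>

lemma square_int_bounded:
  fixes u :: "'a::euclidean_space \<Rightarrow> real"
  assumes u: "u \<in> borel_measurable borel" and S: "bounded S" "S \<in> sets borel" and le: "\<And>z. \<bar>u z\<bar> \<le> B" and out: "\<forall>z. z \<notin> S \<longrightarrow> u z = 0"
  shows "square_int lborel u"
  unfolding square_int_def
proof
  show "u \<in> borel_measurable lborel" using u by simp
  show "integrable lborel (\<lambda>z. (u z)\<^sup>2)"
  proof (rule Bochner_Integration.integrable_bound)
    show "integrable lborel (\<lambda>z. B\<^sup>2 * indicator S z :: real)"
      using S emeasure_bounded_finite[OF S(1)] by (intro integrable_mult_right integrable_real_indicator) auto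
    show "(\<lambda>z. (u z)\<^sup>2) \<in> borel_measurable lborel" using u by simp
    have "norm ((u z)\<^sup>2) \<le> norm (B\<^sup>2 * indicator S z)" for z
    proof (cases "z \<in> S")
      case True
      have "\<bar>u z\<bar>\<^sup>2 \<le> B\<^sup>2" by (rule power_mono[OF le]) simp
      then show ?thesis using True by simp
    qed (simp add: out)
    then show "AE z in lborel. norm ((u z)\<^sup>2) \<le> norm (B\<^sup>2 * indicator S z)" by simp
  qed
qed

definition prim :: "(real \<times> real \<Rightarrow> real) \<Rightarrow> real \<times> real \<Rightarrow> real" where
  "prim w z = (\<integral>u. w (fst z, u) * indicator {..snd z} u \<partial>lborel)"

lemma prim_measurable:
  assumes w: "w \<in> borel_measurable borel" shows "prim w \<in> borel_measurable borel"
  unfolding prim_def[abs_def]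
proof (rule lborel.borel_measurable_lebesgue_integral)
  have [measurable]: "w \<in> borel_measurable (borel \<Otimes>\<^sub>M borel)" using w by (simp add: borel_prod)
  have "(\<lambda>(z, u). w (fst z, u) * indicator {..snd z} u) = (\<lambda>p. if snd p \<le> snd (fst p) then w (fst (fst p), snd p) else 0)"
    by (auto simp: fun_eq_iff indicator_def)
  also have "\<dots> \<in> borel_measurable ((borel \<Otimes>\<^sub>M borel) \<Otimes>\<^sub>M lborel)" by measurable
  finally show "(\<lambda>(z, u). w (fst z, u) * indicator {..snd z} u) \<in> borel_measurable (borel \<Otimes>\<^sub>M lborel)"
    by (simp only: borel_prod)
qed

lemma upper_integral_measurable:
  fixes h :: "real \<times> real \<Rightarrow> real"
  assumes h: "h \<in> borel_measurable borel" shows "(\<lambda>z. \<integral>u. h (fst z, u) * indicator {snd z..} u \<partial>lborel) \<in> borel_measurable borel"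
proof (rule lborel.borel_measurable_lebesgue_integral)
  have [measurable]: "h \<in> borel_measurable (borel \<Otimes>\<^sub>M borel)" using h by (simp add: borel_prod)
  have "(\<lambda>(z, u). h (fst z, u) * indicator {snd z..} u) = (\<lambda>p. if snd (fst p) \<le> snd p then h (fst (fst p), snd p) else 0)"
    by (auto simp: fun_eq_iff indicator_def)
  also have "\<dots> \<in> borel_measurable ((borel \<Otimes>\<^sub>M borel) \<Otimes>\<^sub>M lborel)" by measurable
  finally show "(\<lambda>(z, u). h (fst z, u) * indicator {snd z..} u) \<in> borel_measurable (borel \<Otimes>\<^sub>M lborel)"
    by (simp only: borel_prod)
qed

text \<open>
  Functions in this locale live on \<open>D\<close>, the space-time cylinder enlarged by one unit on the left, where the fields carry
  the integration constants of the pressures.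
\<close>

locale strip =
  fixes T a b :: real
  assumes Tpos: "0 < T" and ablt: "a < b"
begin

definition D :: "(real \<times> real) set" where "D = {0..T} \<times> {a - 1..b}"
definition \<Omega>T :: "(real \<times> real) set" where "\<Omega>T = {0..T} \<times> {a..b}"

lemma D_sets[measurable]: "D \<in> sets borel" and \<Omega>T_sets[measurable]: "\<Omega>T \<in> sets borel"
  unfolding D_def \<Omega>T_def by (auto intro!: borel_closed closed_Times)

lemma D_bounded: "bounded D" and \<Omega>T_bounded: "bounded \<Omega>T"
  unfolding D_def \<Omega>T_def by (auto intro!: bounded_Times)

lemma slice_square_integrable:
  assumes w: "square_int lborel w" shows "AE t in lborel. integrable lborel (\<lambda>y. (w (t, y))\<^sup>2)"
proof -
  have "integrable (lborel \<Otimes>\<^sub>M lborel) (\<lambda>z. (w z)\<^sup>2)" using w by (simp add: square_int_def lborel_prod)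
  from lborel_pair.AE_integrable_fst'[OF this] show ?thesis .
qed

lemma slice_measurable: "w \<in> borel_measurable borel \<Longrightarrow> (\<lambda>y. w (t, y)) \<in> borel_measurable borel" for w :: "real \<times> real \<Rightarrow> real"
proof -
  assume "w \<in> borel_measurable borel"
  then have [measurable]: "w \<in> borel_measurable (borel \<Otimes>\<^sub>M borel)" by (simp add: borel_prod)
  show ?thesis by measurable
qed

lemma slice_integrable1:
  fixes w :: "real \<times> real \<Rightarrow> real"
  assumes wm: "w \<in> borel_measurable borel" and out: "\<forall>z. z \<notin> D \<longrightarrow> w z = 0" and i: "integrable lborel (\<lambda>y. (w (t, y))\<^sup>2)"
  shows "integrable lborel (\<lambda>y. w (t, y))"
proof (rule Bochner_Integration.integrable_bound)
  show "integrable lborel (\<lambda>y. indicator {a - 1..b} y + (w (t, y))\<^sup>2)"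
    using i by (intro Bochner_Integration.integrable_add integrable_real_indicator) (auto simp: emeasure_lborel_Icc_eq)
  show "(\<lambda>y. w (t, y)) \<in> borel_measurable lborel" using slice_measurable[OF wm] by simp
  have "norm (w (t, y)) \<le> norm (indicator {a - 1..b} y + (w (t, y))\<^sup>2)" for y
  proof (cases "y \<in> {a - 1..b}")
    case True
    define v where "v = \<bar>w (t, y)\<bar>"
    have "0 \<le> (v - 1)\<^sup>2" by simp
    also have "\<dots> = v\<^sup>2 + 1 - 2 * v" by (simp add: power2_eq_square algebra_simps)
    finally have "2 * v \<le> 1 + v\<^sup>2" by simp
    moreover have "0 \<le> v" by (simp add: v_def)
    ultimately have "v \<le> 1 + v\<^sup>2" by linarith
    then show ?thesis using True by (simp add: v_def)
  next
    case False
    then have "(t, y) \<notin> D" unfolding D_def by blast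
    then show ?thesis using out by simp
  qed
  then show "AE y in lborel. norm (w (t, y)) \<le> norm (indicator {a - 1..b} y + (w (t, y))\<^sup>2)" by simp
qed

text \<open>
  Cauchy-Schwarz on an interval of length \<open>b - a + 1\<close>.
\<close>

lemma prim_square_le:
  fixes w :: "real \<times> real \<Rightarrow> real"
  assumes wm: "w \<in> borel_measurable borel" and out: "\<forall>z. z \<notin> D \<longrightarrow> w z = 0" and i: "integrable lborel (\<lambda>y. (w (t, y))\<^sup>2)"
  shows "(prim w (t, x))\<^sup>2 \<le> (b - a + 1) * (\<integral>y. (w (t, y))\<^sup>2 \<partial>lborel)"
proof -
  let ?h = "\<lambda>u. indicator ({a - 1..b} \<inter> {..x}) u :: real"
  have e: "emeasure lborel ({a - 1..b} \<inter> {..x}) \<le> ennreal (b - a + 1)"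
  proof -
    have "emeasure lborel ({a - 1..b} \<inter> {..x}) \<le> emeasure lborel {a - 1..b}" by (intro emeasure_mono) auto
    then show ?thesis using ablt by (simp add: algebra_simps)
  qed
  have hi: "integrable lborel ?h" using e by (intro integrable_real_indicator) (auto simp: le_less_trans)
  have h2: "(\<lambda>u. (?h u)\<^sup>2) = ?h" by (auto simp: fun_eq_iff indicator_def)
  have "prim w (t, x) = (\<integral>u. w (t, u) * ?h u \<partial>lborel)"
    unfolding prim_def fst_conv snd_conv
  proof (intro Bochner_Integration.integral_cong refl)
    fix u show "w (t, u) * indicator {..x} u = w (t, u) * ?h u"
    proof (cases "u \<in> {a - 1..b}")
      case False
      then have "(t, u) \<notin> D" unfolding D_def by blast
      then show ?thesis using out by simp
    qed (auto simp: indicator_def)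
  qed
  then have "(prim w (t, x))\<^sup>2 = (\<integral>u. w (t, u) * ?h u \<partial>lborel)\<^sup>2" by simp
  also have "\<dots> \<le> (\<integral>u. (w (t, u))\<^sup>2 \<partial>lborel) * (\<integral>u. (?h u)\<^sup>2 \<partial>lborel)"
  proof (rule cauchy_schwarz)
    show "square_int lborel (\<lambda>u. w (t, u))" using i slice_measurable[OF wm] by (simp add: square_int_def)
    show "square_int lborel ?h" unfolding square_int_def h2 using hi by blast
  qed
  also have "\<dots> \<le> (\<integral>u. (w (t, u))\<^sup>2 \<partial>lborel) * (b - a + 1)"
  proof (rule mult_left_mono)
    have "measure lborel ({a - 1..b} \<inter> {..x}) \<le> b - a + 1"
      using e ablt by (simp add: measure_def enn2real_leI)
    then show "(\<integral>u. (?h u)\<^sup>2 \<partial>lborel) \<le> b - a + 1" unfolding h2 by simp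
  qed simp
  finally show ?thesis by (simp add: mult.commute)
qed

lemma prim_square_int:
  assumes w: "square_int lborel w" and out: "\<forall>z. z \<notin> D \<longrightarrow> w z = 0"
  shows "square_int lborel (\<lambda>z. indicator \<Omega>T z * prim w z)"
proof -
  have wm: "w \<in> borel_measurable borel" using w by (simp add: square_int_def)
  have pm[measurable]: "prim w \<in> borel_measurable borel" by (rule prim_measurable[OF wm])
  let ?u = "\<lambda>z. indicator \<Omega>T z * prim w z :: real"
  have um: "?u \<in> borel_measurable borel" by measurable
  have wsm: "(\<lambda>z. ennreal ((w z)\<^sup>2)) \<in> borel_measurable (lborel \<Otimes>\<^sub>M lborel)" using wm by (simp add: lborel_prod)
  have usm: "(\<lambda>z. ennreal ((?u z)\<^sup>2)) \<in> borel_measurable (lborel \<Otimes>\<^sub>M lborel)" using um by (simp add: lborel_prod)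
  have "(\<integral>\<^sup>+z. ennreal ((?u z)\<^sup>2) \<partial>lborel) = (\<integral>\<^sup>+t. (\<integral>\<^sup>+x. ennreal ((?u (t, x))\<^sup>2) \<partial>lborel) \<partial>lborel)"
    by (subst lborel.nn_integral_fst[OF usm]) (simp add: lborel_prod)
  also have "\<dots> \<le> (\<integral>\<^sup>+t. ennreal ((b - a) * (b - a + 1)) * (\<integral>\<^sup>+y. ennreal ((w (t, y))\<^sup>2) \<partial>lborel) \<partial>lborel)"
  proof (rule nn_integral_mono_AE)
    show "AE t in lborel. (\<integral>\<^sup>+x. ennreal ((?u (t, x))\<^sup>2) \<partial>lborel) \<le> ennreal ((b - a) * (b - a + 1)) * (\<integral>\<^sup>+y. ennreal ((w (t, y))\<^sup>2) \<partial>lborel)"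
      using slice_square_integrable[OF w]
    proof eventually_elim
      case (elim t)
      let ?S = "\<integral>y. (w (t, y))\<^sup>2 \<partial>lborel"
      have S0: "0 \<le> ?S" by simp
      have "(\<integral>\<^sup>+x. ennreal ((?u (t, x))\<^sup>2) \<partial>lborel) \<le> (\<integral>\<^sup>+x. ennreal ((b - a + 1) * ?S) * indicator {a..b} x \<partial>lborel)"
      proof (rule nn_integral_mono)
        fix x show "ennreal ((?u (t, x))\<^sup>2) \<le> ennreal ((b - a + 1) * ?S) * indicator {a..b} x"
        proof (cases "(t, x) \<in> \<Omega>T")
          case True
          then have "x \<in> {a..b}" unfolding \<Omega>T_def by blast
          then show ?thesis using True prim_square_le[OF wm out elim, of x] by (simp add: ennreal_leI)
        qed simp
      qed
      also have "\<dots> = ennreal ((b - a + 1) * ?S) * ennreal (b - a)"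
        using ablt by (subst nn_integral_cmult_indicator) auto
      also have "\<dots> = ennreal ((b - a) * (b - a + 1)) * ennreal ?S"
      proof -
        have "ennreal ((b - a + 1) * ?S) * ennreal (b - a) = ennreal (((b - a + 1) * ?S) * (b - a))"
          by (rule ennreal_mult[symmetric]) (use ablt S0 in auto)
        also have "((b - a + 1) * ?S) * (b - a) = ((b - a) * (b - a + 1)) * ?S" by (simp only: mult_ac)
        also have "ennreal (((b - a) * (b - a + 1)) * ?S) = ennreal ((b - a) * (b - a + 1)) * ennreal ?S"
          by (rule ennreal_mult) (use ablt S0 in auto)
        finally show ?thesis .
      qed
      also have "ennreal ?S = (\<integral>\<^sup>+y. ennreal ((w (t, y))\<^sup>2) \<partial>lborel)" by (rule nn_integral_eq_integral[symmetric, OF elim]) simp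
      finally show ?case .
    qed
  qed
  also have "\<dots> = ennreal ((b - a) * (b - a + 1)) * (\<integral>\<^sup>+t. (\<integral>\<^sup>+y. ennreal ((w (t, y))\<^sup>2) \<partial>lborel) \<partial>lborel)"
    by (rule nn_integral_cmult) (use lborel.borel_measurable_nn_integral_fst[OF wsm] in simp)
  also have "(\<integral>\<^sup>+t. (\<integral>\<^sup>+y. ennreal ((w (t, y))\<^sup>2) \<partial>lborel) \<partial>lborel) = (\<integral>\<^sup>+z. ennreal ((w z)\<^sup>2) \<partial>lborel)"
    by (subst lborel.nn_integral_fst[OF wsm]) (simp add: lborel_prod)
  also have "\<dots> = ennreal (\<integral>z. (w z)\<^sup>2 \<partial>lborel)"
    by (rule nn_integral_eq_integral) (use w in \<open>auto simp: square_int_def\<close>)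
  also have "ennreal ((b - a) * (b - a + 1)) * \<dots> < \<infinity>" by (simp add: ennreal_mult_less_top)
  finally have "(\<integral>\<^sup>+z. ennreal ((?u z)\<^sup>2) \<partial>lborel) < \<infinity>" .
  then show ?thesis unfolding square_int_def using um by (auto intro!: integrableI_nonneg)
qed

text \<open>
  The adjoint of \<open>prim\<close>, by \<open>pairing\<close>: testing a primitive with \<open>h\<close> is testing the function itself with \<open>lift h\<close>. This transfers weak convergence from the fields to their primitives.
\<close>

definition lift :: "(real \<times> real \<Rightarrow> real) \<Rightarrow> real \<times> real \<Rightarrow> real" where
  "lift h z = indicator D z * (\<integral>u. h (fst z, u) * indicator {snd z..} u \<partial>lborel)"

lemma h_slice_integrable:
  assumes hm: "h \<in> borel_measurable borel" and hB: "\<And>z. \<bar>h z\<bar> \<le> B" and hout: "\<forall>z. z \<notin> \<Omega>T \<longrightarrow> h z = 0"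
  shows "integrable lborel (\<lambda>u. h (t, u))" "(\<integral>u. \<bar>h (t, u)\<bar> \<partial>lborel) \<le> B * (b - a)"
proof -
  have Bi: "integrable lborel (\<lambda>u. B * indicator {a..b} u)"
    by (intro integrable_mult_right integrable_real_indicator) (auto simp: emeasure_lborel_Icc_eq)
  have le: "\<bar>h (t, u)\<bar> \<le> B * indicator {a..b} u" for u
  proof (cases "u \<in> {a..b}")
    case False
    then have "(t, u) \<notin> \<Omega>T" unfolding \<Omega>T_def by blast
    then show ?thesis using False hout by simp
  qed (use hB in simp)
  show hi: "integrable lborel (\<lambda>u. h (t, u))"
  proof (rule Bochner_Integration.integrable_bound[OF Bi])
    show "(\<lambda>u. h (t, u)) \<in> borel_measurable lborel" using slice_measurable[OF hm] by simp
    show "AE u in lborel. norm (h (t, u)) \<le> norm (B * indicator {a..b} u)"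
      using le by (intro AE_I2) (metis abs_ge_self order_trans real_norm_def)
  qed
  have "(\<integral>u. \<bar>h (t, u)\<bar> \<partial>lborel) \<le> (\<integral>u. B * indicator {a..b} u \<partial>lborel)"
    by (rule integral_mono[OF integrable_abs[OF hi] Bi le])
  also have "\<dots> = B * (b - a)" using ablt by simp
  finally show "(\<integral>u. \<bar>h (t, u)\<bar> \<partial>lborel) \<le> B * (b - a)" .
qed

lemma lift_square_int:
  assumes hm: "h \<in> borel_measurable borel" and hB: "\<And>z. \<bar>h z\<bar> \<le> B" and hout: "\<forall>z. z \<notin> \<Omega>T \<longrightarrow> h z = 0"
  shows "square_int lborel (lift h)"
proof (rule square_int_bounded[OF _ D_bounded D_sets, where B = "B * (b - a)"])
  note [measurable] = upper_integral_measurable[OF hm]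
  show "lift h \<in> borel_measurable borel" unfolding lift_def[abs_def] by measurable
  have B0: "0 \<le> B" using hB[of undefined] by linarith
  fix z
  have "\<bar>\<integral>u. h (fst z, u) * indicator {snd z..} u \<partial>lborel\<bar> \<le> (\<integral>u. \<bar>h (fst z, u) * indicator {snd z..} u\<bar> \<partial>lborel)"
    by (rule integral_abs_bound)
  also have "\<dots> \<le> (\<integral>u. \<bar>h (fst z, u)\<bar> \<partial>lborel)"
    by (intro integral_mono integrable_abs integrable_real_mult_indicator h_slice_integrable(1)[OF hm hB hout]) (auto simp: indicator_def)
  also have "\<dots> \<le> B * (b - a)" by (rule h_slice_integrable(2)[OF hm hB hout])
  finally show "\<bar>lift h z\<bar> \<le> B * (b - a)" using B0 ablt by (auto simp: lift_def indicator_def)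
qed (simp add: lift_def)

lemma pairing:
  assumes w: "square_int lborel w" and out: "\<forall>z. z \<notin> D \<longrightarrow> w z = 0"
    and hm: "h \<in> borel_measurable borel" and hB: "\<And>z. \<bar>h z\<bar> \<le> B" and hout: "\<forall>z. z \<notin> \<Omega>T \<longrightarrow> h z = 0"
  shows "(\<integral>z. w z * lift h z \<partial>lborel) = (\<integral>z. h z * prim w z \<partial>lborel)" "integrable lborel (\<lambda>z. h z * prim w z)"
proof -
  have wm: "w \<in> borel_measurable borel" using w by (simp add: square_int_def)
  have hs: "square_int lborel h" by (rule square_int_bounded[OF hm \<Omega>T_bounded \<Omega>T_sets hB hout])
  have e: "h z * prim w z = h z * (indicator \<Omega>T z * prim w z)" for z using hout[rule_format, of z] by (auto simp: indicator_def)
  show i2: "integrable lborel (\<lambda>z. h z * prim w z)"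
    unfolding e by (rule square_int_mult[OF hs prim_square_int[OF w out]])
  have i1: "integrable lborel (\<lambda>z. w z * lift h z)"
    by (rule square_int_mult[OF w lift_square_int[OF hm hB hout]])
  have "(\<integral>z. w z * lift h z \<partial>lborel) = (\<integral>t. (\<integral>y. w (t, y) * lift h (t, y) \<partial>lborel) \<partial>lborel)"
    using lborel_pair.integral_fst'[of "\<lambda>z. w z * lift h z"] i1 by (simp add: lborel_prod)
  also have "\<dots> = (\<integral>t. (\<integral>x. h (t, x) * prim w (t, x) \<partial>lborel) \<partial>lborel)"
  proof (rule integral_cong_AE)
    show "AE t in lborel. (\<integral>y. w (t, y) * lift h (t, y) \<partial>lborel) = (\<integral>x. h (t, x) * prim w (t, x) \<partial>lborel)"
      using slice_square_integrable[OF w]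
    proof eventually_elim
      case (elim t)
      have "(\<integral>y. w (t, y) * lift h (t, y) \<partial>lborel) = (\<integral>y. w (t, y) * (\<integral>u. h (t, u) * indicator {y..} u \<partial>lborel) \<partial>lborel)"
        using out by (intro Bochner_Integration.integral_cong refl) (auto simp: lift_def indicator_def)
      also have "\<dots> = (\<integral>x. h (t, x) * (\<integral>u. w (t, u) * indicator {..x} u \<partial>lborel) \<partial>lborel)"
        by (rule primitive_by_parts[symmetric, OF slice_integrable1[OF wm out elim] h_slice_integrable(1)[OF hm hB hout]])
      finally show ?case by (simp add: prim_def)
    qed
    show "(\<lambda>t. \<integral>y. w (t, y) * lift h (t, y) \<partial>lborel) \<in> borel_measurable lborel"
      using lborel_pair.integrable_fst'[of "\<lambda>z. w z * lift h z"] i1 by (auto simp: lborel_prod)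
    show "(\<lambda>t. \<integral>x. h (t, x) * prim w (t, x) \<partial>lborel) \<in> borel_measurable lborel"
      using lborel_pair.integrable_fst'[of "\<lambda>z. h z * prim w z"] i2 by (auto simp: lborel_prod)
  qed
  also have "\<dots> = (\<integral>z. h z * prim w z \<partial>lborel)"
    using lborel_pair.integral_fst'[of "\<lambda>z. h z * prim w z"] i2 by (simp add: lborel_prod)
  finally show "(\<integral>z. w z * lift h z \<partial>lborel) = (\<integral>z. h z * prim w z \<partial>lborel)" .
qed

end

section \<open>The limit pressure\<close>

sublocale flow_limit \<subseteq> strip T a b
  by unfold_locales (use T ab in auto)

context flow_limit
begin

abbreviation "f n \<equiv> block_flow.field (N n) (I n) (m n) (x n) (l n) a T"

definition force2 :: "nat \<Rightarrow> real \<Rightarrow> real" where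
  "force2 n t = (\<Sum>i\<in>I n. m n i * (block_flow.force (N n) (m n) (x n) (l n) t i)\<^sup>2)"

lemma force2_nonneg: "0 \<le> force2 n t"
  unfolding force2_def by (intro sum_nonneg mult_nonneg_nonneg block_flow.mnonneg[OF flow]) auto

lemma force2_cont: "continuous_on {0..T} (force2 n)"
  unfolding force2_def[abs_def] by (intro continuous_intros block_flow.cont_force[OF flow])

lemma force2_le:
  assumes t: "t \<in> {0..T}"
  shows "force2 n t \<le> 2 * block_flow.speed2 (I n) (m n) (x' n) t + 2 * M\<^sup>2"
proof -
  interpret B: block_flow "N n" "I n" "m n" "x n" "x' n" "l n" dV a b T by (rule flow)
  have "force2 n t \<le> (\<Sum>i\<in>I n. m n i * (2 * (x' n t i)\<^sup>2 + 2 * M\<^sup>2))"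
    unfolding force2_def
  proof (intro sum_mono mult_left_mono)
    fix i assume i: "i \<in> I n"
    show "0 \<le> m n i" by (rule B.mnonneg[OF i])
    have "\<bar>dV (x n t i)\<bar>\<^sup>2 \<le> M\<^sup>2" by (intro power_mono dVM pos[OF t i]) auto
    then have d: "(dV (x n t i))\<^sup>2 \<le> M\<^sup>2" by simp
    have "(B.force t i)\<^sup>2 + (x' n t i - dV (x n t i))\<^sup>2 = 2 * (x' n t i)\<^sup>2 + 2 * (dV (x n t i))\<^sup>2"
      unfolding B.force_eq[OF i t] by (simp add: power2_eq_square algebra_simps)
    moreover have "0 \<le> (x' n t i - dV (x n t i))\<^sup>2" by simp
    ultimately show "(B.force t i)\<^sup>2 \<le> 2 * (x' n t i)\<^sup>2 + 2 * M\<^sup>2" using d by linarith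
  qed
  also have "\<dots> = 2 * B.speed2 t + 2 * M\<^sup>2"
  proof -
    have "(\<Sum>i\<in>I n. m n i * (2 * (x' n t i)\<^sup>2 + 2 * M\<^sup>2)) = 2 * (\<Sum>i\<in>I n. m n i * (x' n t i)\<^sup>2) + 2 * M\<^sup>2 * (\<Sum>i\<in>I n. m n i)"
      by (simp add: distrib_left sum.distrib sum_distrib_left sum_distrib_right mult_ac)
    then show ?thesis by (simp add: B.speed2_def B.msum)
  qed
  finally show ?thesis .
qed

definition B1 :: real where "B1 = 2 * C + 2 * M\<^sup>2 * T"

lemma B1_nonneg: "0 \<le> B1" using C0 T by (simp add: B1_def)

lemma force2_integral: "set_integrable lborel {0..T} (force2 n)" "(LINT t:{0..T}|lborel. force2 n t) \<le> B1"
proof -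
  interpret B: block_flow "N n" "I n" "m n" "x n" "x' n" "l n" dV a b T by (rule flow)
  show s: "set_integrable lborel {0..T} (force2 n)" by (rule borel_integrable_atLeastAtMost'[OF force2_cont])
  have "(LINT t:{0..T}|lborel. force2 n t) = integral {0..T} (force2 n)"
    by (rule set_borel_integral_eq_integral(2)[OF s])
  also have "\<dots> \<le> integral {0..T} (\<lambda>t. 2 * B.speed2 t + 2 * M\<^sup>2)"
    by (intro integral_le integrable_continuous_real force2_cont continuous_intros B.cont_speed2 force2_le)
  also have "\<dots> = 2 * integral {0..T} B.speed2 + 2 * M\<^sup>2 * T"
    using T by (subst Henstock_Kurzweil_Integration.integral_add) (auto intro!: integrable_continuous_real continuous_intros B.cont_speed2)
  also have "\<dots> \<le> B1" using speed[of n] by (simp add: B1_def)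
  finally show "(LINT t:{0..T}|lborel. force2 n t) \<le> B1" .
qed

lemma f_out: "\<forall>z. z \<notin> D \<longrightarrow> f n z = 0"
proof (intro allI impI)
  fix z
  interpret B: block_flow "N n" "I n" "m n" "x n" "x' n" "l n" dV a b T by (rule flow)
  assume z: "z \<notin> D"
  obtain t y where [simp]: "z = (t, y)" by (cases z)
  show "f n z = 0"
  proof (cases "t \<in> {0..T}")
    case True
    then have "\<not> (a - 1 \<le> y \<and> y \<le> b)" using z by (auto simp: D_def)
    then have "B.fieldS t y = 0" using B.fieldS_support[OF True, of y] by blast
    then show ?thesis using B.field_eq[OF True] by simp
  qed (use B.field_out in simp)
qed

lemma f_slice_square:
  assumes t: "t \<in> {0..T}" shows "integrable lborel (\<lambda>y. (f n (t, y))\<^sup>2)" "(\<integral>y. (f n (t, y))\<^sup>2 \<partial>lborel) \<le> 2 * force2 n t"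
proof -
  interpret B: block_flow "N n" "I n" "m n" "x n" "x' n" "l n" dV a b T by (rule flow)
  have h: "has_bochner_integral lborel (\<lambda>y. (f n (t, y))\<^sup>2) ((B.base t)\<^sup>2 + force2 n t)"
    using B.slice_square[OF t] by (simp add: B.field_eq[OF t] force2_def)
  then show "integrable lborel (\<lambda>y. (f n (t, y))\<^sup>2)" by (simp add: has_bochner_integral_iff)
  show "(\<integral>y. (f n (t, y))\<^sup>2 \<partial>lborel) \<le> 2 * force2 n t"
    using h B.base_le[OF t] by (simp add: has_bochner_integral_iff force2_def)
qed

lemma f_measurable[measurable]: "f n \<in> borel_measurable borel"
  by (rule block_flow.field_measurable[OF flow])

lemma f_square_int: "square_int lborel (f n)" "(\<integral>z. (f n z)\<^sup>2 \<partial>lborel) \<le> 2 * B1"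
proof -
  interpret B: block_flow "N n" "I n" "m n" "x n" "x' n" "l n" dV a b T by (rule flow)
  have m: "(\<lambda>z. ennreal ((f n z)\<^sup>2)) \<in> borel_measurable (lborel \<Otimes>\<^sub>M lborel)" using f_measurable[of n] by (simp add: lborel_prod)
  have "(\<integral>\<^sup>+z. ennreal ((f n z)\<^sup>2) \<partial>lborel) = (\<integral>\<^sup>+t. (\<integral>\<^sup>+y. ennreal ((f n (t, y))\<^sup>2) \<partial>lborel) \<partial>lborel)"
    by (subst lborel.nn_integral_fst[OF m]) (simp add: lborel_prod)
  also have "\<dots> \<le> (\<integral>\<^sup>+t. ennreal (2 * (indicator {0..T} t *\<^sub>R force2 n t)) \<partial>lborel)"
  proof (rule nn_integral_mono)
    fix t
    show "(\<integral>\<^sup>+y. ennreal ((f n (t, y))\<^sup>2) \<partial>lborel) \<le> ennreal (2 * (indicator {0..T} t *\<^sub>R force2 n t))"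
    proof (cases "t \<in> {0..T}")
      case True
      have "(\<integral>\<^sup>+y. ennreal ((f n (t, y))\<^sup>2) \<partial>lborel) = ennreal (\<integral>y. (f n (t, y))\<^sup>2 \<partial>lborel)"
        by (rule nn_integral_eq_integral[OF f_slice_square(1)[OF True]]) simp
      then show ?thesis using f_slice_square(2)[OF True, of n] True by (simp add: ennreal_leI)
    next
      case False
      then show ?thesis using B.field_out[OF False] by simp
    qed
  qed
  also have "\<dots> = ennreal (\<integral>t. 2 * (indicator {0..T} t *\<^sub>R force2 n t) \<partial>lborel)"
    using force2_integral(1)[of n] unfolding set_integrable_def
    by (intro nn_integral_eq_integral integrable_mult_right AE_I2) (auto simp: force2_nonneg)
  also have "\<dots> \<le> ennreal (2 * B1)"
    using force2_integral(2)[of n] by (intro ennreal_leI) (simp add: set_lebesgue_integral_def)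
  finally have nn: "(\<integral>\<^sup>+z. ennreal ((f n z)\<^sup>2) \<partial>lborel) \<le> ennreal (2 * B1)" .
  then have i: "integrable lborel (\<lambda>z. (f n z)\<^sup>2)"
    using f_measurable[of n] by (intro integrableI_nonneg) (auto simp: le_less_trans)
  then show "square_int lborel (f n)" using f_measurable[of n] by (simp add: square_int_def)
  have "ennreal (\<integral>z. (f n z)\<^sup>2 \<partial>lborel) \<le> ennreal (2 * B1)"
    using nn nn_integral_eq_integral[OF i] by simp
  then show "(\<integral>z. (f n z)\<^sup>2 \<partial>lborel) \<le> 2 * B1" using B1_nonneg by (simp add: ennreal_le_iff)
qed

definition is_limit :: "(real \<times> real \<Rightarrow> real) \<Rightarrow> bool" where
  "is_limit q \<longleftrightarrow> square_int lborel q \<and> (\<forall>z. z \<notin> D \<longrightarrow> q z = 0) \<and>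
    (\<forall>h A. square_int lborel h \<longrightarrow> (\<forall>\<^sub>F n in sequentially. A \<le> (\<integral>z. f n z * h z \<partial>lborel)) \<longrightarrow> A \<le> (\<integral>z. q z * h z \<partial>lborel))"

text \<open>
  The weak limit is cut off outside \<open>D\<close>, where all fields vanish anyway.
\<close>

lemma is_limit_exists: "\<exists>q. is_limit q"
proof -
  obtain g where g: "square_int lborel g" and gl: "\<And>h A. square_int lborel h \<Longrightarrow> (\<forall>\<^sub>F n in sequentially. A \<le> (\<integral>z. f n z * h z \<partial>lborel)) \<Longrightarrow> A \<le> (\<integral>z. g z * h z \<partial>lborel)"
    using weak_L2_limit[of lborel f "2 * B1"] f_square_int by blast
  have ind: "square_int lborel (\<lambda>z. indicator D z * h z)" if h: "square_int lborel h" for h :: "real \<times> real \<Rightarrow> real"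
  proof -
    have e: "(indicator D z * h z)\<^sup>2 = indicator D z *\<^sub>R (h z)\<^sup>2" for z by (simp add: indicator_def)
    show ?thesis using h D_sets unfolding square_int_def e
      by (auto intro!: integrable_mult_indicator simp del: real_scaleR_def)
  qed
  show ?thesis
  proof (intro exI[of _ "\<lambda>z. indicator D z * g z"], unfold is_limit_def, intro conjI allI impI)
    show "square_int lborel (\<lambda>z. indicator D z * g z)" by (rule ind[OF g])
    fix h A assume h: "square_int lborel h" and ev: "\<forall>\<^sub>F n in sequentially. A \<le> (\<integral>z. f n z * h z \<partial>lborel)"
    have e: "f n z * h z = f n z * (indicator D z * h z)" for n z using f_out[rule_format, of z n] by (auto simp: indicator_def)
    have "A \<le> (\<integral>z. g z * (indicator D z * h z) \<partial>lborel)" by (rule gl[OF ind[OF h] ev[unfolded e]])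
    then show "A \<le> (\<integral>z. indicator D z * g z * h z \<partial>lborel)" by (simp add: mult_ac)
  qed simp
qed

definition q :: "real \<times> real \<Rightarrow> real" where "q = (SOME q. is_limit q)"

lemma is_limit_q: "is_limit q"
  unfolding q_def by (rule someI_ex[OF is_limit_exists])

lemma q_props: "square_int lborel q" "\<forall>z. z \<notin> D \<longrightarrow> q z = 0"
  and q_lower: "\<And>h A. square_int lborel h \<Longrightarrow> (\<forall>\<^sub>F n in sequentially. A \<le> (\<integral>z. f n z * h z \<partial>lborel)) \<Longrightarrow> A \<le> (\<integral>z. q z * h z \<partial>lborel)"
  using is_limit_q unfolding is_limit_def by blast+

lemma q_measurable[measurable]: "q \<in> borel_measurable borel"
  using q_props(1) by (simp add: square_int_def)

lemma q_limit:
  assumes h: "square_int lborel h" and L: "(\<lambda>n. \<integral>z. f n z * h z \<partial>lborel) \<longlonglongrightarrow> L"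
  shows "(\<integral>z. q z * h z \<partial>lborel) = L"
proof (rule antisym)
  have lo: "L - e \<le> (\<integral>z. q z * h z \<partial>lborel)" if e: "0 < e" for e
  proof (rule q_lower[OF h])
    have "\<forall>\<^sub>F n in sequentially. L - e < (\<integral>z. f n z * h z \<partial>lborel)" by (rule order_tendstoD(1)[OF L]) (use e in simp)
    then show "\<forall>\<^sub>F n in sequentially. L - e \<le> (\<integral>z. f n z * h z \<partial>lborel)" by (rule eventually_mono) simp
  qed
  show "L \<le> (\<integral>z. q z * h z \<partial>lborel)"
  proof (rule field_le_epsilon)
    fix e :: real assume "0 < e"
    from lo[OF this] show "L \<le> (\<integral>z. q z * h z \<partial>lborel) + e" by linarith
  qed
  have h': "square_int lborel (\<lambda>z. - h z)" using h by (simp add: square_int_def)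
  have "- L - e \<le> (\<integral>z. q z * - h z \<partial>lborel)" if e: "0 < e" for e
  proof (rule q_lower[OF h'])
    have "\<forall>\<^sub>F n in sequentially. (\<integral>z. f n z * h z \<partial>lborel) < L + e" by (rule order_tendstoD(2)[OF L]) (use e in simp)
    then show "\<forall>\<^sub>F n in sequentially. - L - e \<le> (\<integral>z. f n z * - h z \<partial>lborel)" by (rule eventually_mono) simp
  qed
  then have "- L - e \<le> - (\<integral>z. q z * h z \<partial>lborel)" if "0 < e" for e using that by simp
  then have hi: "(\<integral>z. q z * h z \<partial>lborel) \<le> L + e" if "0 < e" for e
  proof -
    assume "\<And>e. 0 < e \<Longrightarrow> - L - e \<le> - (\<integral>z. q z * h z \<partial>lborel)"
    from this[OF that] show ?thesis by linarith
  qed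
  show "(\<integral>z. q z * h z \<partial>lborel) \<le> L" by (rule field_le_epsilon) (rule hi)
qed

definition p :: "real \<times> real \<Rightarrow> real" where "p = prim q"

lemma p_measurable[measurable]: "p \<in> borel_measurable borel"
  unfolding p_def by (rule prim_measurable[OF q_measurable])

lemma prim_f_nonneg:
  assumes z: "z \<in> \<Omega>T" shows "0 \<le> prim (f n) z"
proof -
  interpret B: block_flow "N n" "I n" "m n" "x n" "x' n" "l n" dV a b T by (rule flow)
  obtain t y where z': "z = (t, y)" by (cases z)
  have t: "t \<in> {0..T}" and y: "a \<le> y" using z by (auto simp: z' \<Omega>T_def)
  interpret P: packing "I n" "m n" "x n t" a b "l n t" by (rule B.pack[OF t])
  have "prim (f n) z = real (N n) * P.pressure y"
    using B.slice_primitive[OF t y] by (simp add: prim_def z' B.field_eq[OF t] has_bochner_integral_iff)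
  then show ?thesis using P.pressure_nonneg[of y] by simp
qed

text \<open>
  Test with the indicator of the set where the limit is negative: the discrete primitives are nonnegative there.
\<close>

lemma p_nonneg: "AE z in lborel. z \<in> \<Omega>T \<longrightarrow> 0 \<le> p z"
proof -
  define h where "h = (\<lambda>z. indicator {z \<in> \<Omega>T. p z < 0} z :: real)"
  have S: "{z \<in> \<Omega>T. p z < 0} \<in> sets borel"
  proof -
    have "{z \<in> \<Omega>T. p z < 0} = \<Omega>T \<inter> {z \<in> space borel. p z < 0}" by auto
    also have "\<dots> \<in> sets borel" by measurable
    finally show ?thesis .
  qed
  have hm: "h \<in> borel_measurable borel" unfolding h_def using S by simp
  have hB: "\<And>z. \<bar>h z\<bar> \<le> 1" and hout: "\<forall>z. z \<notin> \<Omega>T \<longrightarrow> h z = 0" by (auto simp: h_def indicator_def)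
  have "0 \<le> (\<integral>z. q z * lift h z \<partial>lborel)"
  proof (rule q_lower[OF lift_square_int[OF hm hB hout]], rule always_eventually, rule allI)
    fix n
    have "0 \<le> (\<integral>z. h z * prim (f n) z \<partial>lborel)"
      by (rule integral_nonneg_AE) (use prim_f_nonneg[of _ n] in \<open>auto simp: h_def indicator_def\<close>)
    then show "0 \<le> (\<integral>z. f n z * lift h z \<partial>lborel)" using pairing(1)[OF f_square_int(1) f_out hm hB hout] by simp
  qed
  then have ge: "0 \<le> (\<integral>z. h z * p z \<partial>lborel)" using pairing(1)[OF q_props(1,2) hm hB hout] by (simp add: p_def)
  have i: "integrable lborel (\<lambda>z. h z * p z)" unfolding p_def by (rule pairing(2)[OF q_props(1,2) hm hB hout])
  have nn: "AE z in lborel. 0 \<le> - (h z * p z)" by (auto simp: h_def indicator_def)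
  have "0 \<le> (\<integral>z. - (h z * p z) \<partial>lborel)" by (rule integral_nonneg_AE[OF nn])
  then have "(\<integral>z. - (h z * p z) \<partial>lborel) = 0" using ge by simp
  then have "AE z in lborel. - (h z * p z) = 0"
    using integral_nonneg_eq_0_iff_AE[OF Bochner_Integration.integrable_minus[OF i] nn] by simp
  then show ?thesis by eventually_elim (auto simp: h_def indicator_def split: if_splits)
qed

lemma integrable_times_bounded:
  fixes u k :: "real \<Rightarrow> real"
  assumes u: "integrable lborel u" and k: "k \<in> borel_measurable borel" and B: "\<And>y. \<bar>k y\<bar> \<le> B"
  shows "integrable lborel (\<lambda>y. u y * k y)" "\<bar>\<integral>y. u y * k y \<partial>lborel\<bar> \<le> B * (\<integral>y. \<bar>u y\<bar> \<partial>lborel)"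
proof -
  have le: "\<bar>u y * k y\<bar> \<le> B * \<bar>u y\<bar>" for y using mult_right_mono[OF B[of y], of "\<bar>u y\<bar>"] by (simp add: abs_mult mult.commute)
  have Bi: "integrable lborel (\<lambda>y. B * \<bar>u y\<bar>)" using u by (intro integrable_mult_right integrable_abs)
  show i: "integrable lborel (\<lambda>y. u y * k y)"
  proof (rule Bochner_Integration.integrable_bound[OF Bi])
    show "(\<lambda>y. u y * k y) \<in> borel_measurable lborel" using u k by simp
    show "AE y in lborel. norm (u y * k y) \<le> norm (B * \<bar>u y\<bar>)"
      using le by (intro AE_I2) (metis abs_ge_self order_trans real_norm_def)
  qed
  have "\<bar>\<integral>y. u y * k y \<partial>lborel\<bar> \<le> (\<integral>y. \<bar>u y * k y\<bar> \<partial>lborel)" by (rule integral_abs_bound)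
  also have "\<dots> \<le> (\<integral>y. B * \<bar>u y\<bar> \<partial>lborel)" by (rule integral_mono[OF integrable_abs[OF i] Bi le])
  finally show "\<bar>\<integral>y. u y * k y \<partial>lborel\<bar> \<le> B * (\<integral>y. \<bar>u y\<bar> \<partial>lborel)" by simp
qed

definition slack :: "real \<times> real \<Rightarrow> real" where "slack z = indicator \<Omega>T z * (1 - dens z)"

lemma slack_props:
  "slack \<in> borel_measurable borel" "\<And>z. \<bar>slack z\<bar> \<le> 1" "\<forall>z. z \<notin> \<Omega>T \<longrightarrow> slack z = 0"
proof -
  show "slack \<in> borel_measurable borel" unfolding slack_def[abs_def] by measurable
  show "\<bar>slack z\<bar> \<le> 1" for z using dens_01[of z] by (simp add: slack_def indicator_def)
qed (simp add: slack_def)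

lemma dens_slice:
  assumes t: "t \<in> {0..T}"
  shows "integrable lborel (\<lambda>y. dens (t, y))" "(\<integral>y. dens (t, y) \<partial>lborel) = 1" "(\<integral>u. dens (t, u) * indicator {..y} u \<partial>lborel) = G t y"
proof -
  interpret R: real_distribution "\<rho> t" by (rule \<rho>_facts(1)[OF t])
  have dm[measurable]: "(\<lambda>y. dens (t, y)) \<in> borel_measurable borel" by (rule slice_measurable[OF dens_measurable])
  have e: "(\<integral>u. g u \<partial>\<rho> t) = (\<integral>u. dens (t, u) * g u \<partial>lborel)" if "g \<in> borel_measurable borel" for g :: "real \<Rightarrow> real"
    unfolding \<rho>_facts(3)[OF t] using that dens_01 by (subst integral_density) auto
  show int: "integrable lborel (\<lambda>y. dens (t, y))"
  proof -
    have "integrable (\<rho> t) (\<lambda>_. 1 :: real)" by simp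
    then show ?thesis unfolding \<rho>_facts(3)[OF t] using dens_01 by (subst (asm) integrable_density) auto
  qed
  show "(\<integral>y. dens (t, y) \<partial>lborel) = 1" using e[of "\<lambda>_. 1"] R.prob_space by simp
  have "G t y = measure (\<rho> t) {..y}" unfolding \<rho>_facts(2)[OF t, symmetric] cdf_def ..
  also have "\<dots> = (\<integral>u. indicator {..y} u \<partial>\<rho> t)" by simp
  also have "\<dots> = (\<integral>u. dens (t, u) * indicator {..y} u \<partial>lborel)" by (rule e) simp
  finally show "(\<integral>u. dens (t, u) * indicator {..y} u \<partial>lborel) = G t y" by simp
qed

text \<open>
  With this formula the pairing in \<open>slice_slack\<close> differs from the one with \<open>lift slack\<close> only by the distribution function of the flow in place of its limit.
\<close>

lemma lift_slack:
  assumes z: "(t, y) \<in> D" shows "lift slack (t, y) = b - max y a - 1 + G t y"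
proof -
  have t: "t \<in> {0..T}" and y: "a - 1 \<le> y" "y \<le> b" using z by (auto simp: D_def)
  note ds = dens_slice[OF t]
  have i1: "integrable lborel (\<lambda>u. indicator {max y a..b} u :: real)" by (intro integrable_real_indicator) (auto simp: emeasure_lborel_Icc_eq)
  have i2: "integrable lborel (\<lambda>u. dens (t, u) * indicator {..y} u)" by (intro integrable_real_mult_indicator ds(1)) simp
  have "lift slack (t, y) = (\<integral>u. slack (t, u) * indicator {y..} u \<partial>lborel)" using z by (simp add: lift_def)
  also have "\<dots> = (\<integral>u. indicator {max y a..b} u - (dens (t, u) - dens (t, u) * indicator {..y} u) \<partial>lborel)"
  proof (rule integral_cong_AE)
    have [measurable]: "(\<lambda>u. dens (t, u)) \<in> borel_measurable borel" "(\<lambda>u. slack (t, u)) \<in> borel_measurable borel"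
      by (intro slice_measurable dens_measurable slack_props)+
    show "(\<lambda>u. slack (t, u) * indicator {y..} u) \<in> borel_measurable lborel" by measurable
    show "(\<lambda>u. indicator {max y a..b} u - (dens (t, u) - dens (t, u) * indicator {..y} u)) \<in> borel_measurable lborel" by measurable
    show "AE u in lborel. slack (t, u) * indicator {y..} u = indicator {max y a..b} u - (dens (t, u) - dens (t, u) * indicator {..y} u)"
      using AE_lborel_singleton[of y]
    proof eventually_elim
      case (elim u)
      have "dens (t, u) = 0" if "u \<notin> {a..b}" using that by (auto simp: dens_def)
      moreover have "(t, u) \<in> \<Omega>T \<longleftrightarrow> u \<in> {a..b}" using t by (auto simp: \<Omega>T_def)
      ultimately show ?case using elim by (cases "u \<in> {a..b}") (auto simp: slack_def indicator_def)
    qed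
  qed
  also have "\<dots> = (b - max y a) - (1 - G t y)"
    using i1 i2 ds y ablt by (simp add: Bochner_Integration.integral_diff)
  finally show ?thesis by simp
qed

text \<open>
  By \<open>slice_slack\<close> the pairing of the field with its own slack vanishes; the slacks converge uniformly and the fields are bounded in L2, hence in L1.
\<close>

lemma f_slack_tendsto: "(\<lambda>n. \<integral>z. f n z * lift slack z \<partial>lborel) \<longlonglongrightarrow> 0"
proof (rule LIMSEQ_I)
  fix e :: real assume e: "0 < e"
  define W where "W = T * (b - a + 1) + 2 * B1 + 1"
  have W: "0 < W" using T ab B1_nonneg by (simp add: W_def add_nonneg_pos)
  define e1 where "e1 = e / (2 * W)"
  have e1: "0 < e1" using e W by (simp add: e1_def)
  from conv[OF e1] obtain n0 where n0: "\<forall>n\<ge>n0. \<forall>t\<in>{0..T}. \<forall>y. \<bar>F n t y - G t y\<bar> < e1" ..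
  show "\<exists>no. \<forall>n\<ge>no. norm ((\<integral>z. f n z * lift slack z \<partial>lborel) - 0) < e"
  proof (intro exI allI impI)
    fix n assume n: "n0 \<le> n"
    interpret B: block_flow "N n" "I n" "m n" "x n" "x' n" "l n" dV a b T by (rule flow)
    note ls = lift_square_int[OF slack_props]
    have i: "integrable lborel (\<lambda>z. f n z * lift slack z)" by (rule square_int_mult[OF f_square_int(1) ls])
    have i': "integrable lborel (\<lambda>t. \<integral>y. f n (t, y) * lift slack (t, y) \<partial>lborel)"
      using lborel_pair.integrable_fst'[of "\<lambda>z. f n z * lift slack z"] i by (simp add: lborel_prod)
    have j: "integrable lborel (\<lambda>z. (f n z)\<^sup>2)" using f_square_int(1) by (simp add: square_int_def)
    have j': "integrable lborel (\<lambda>t. \<integral>y. (f n (t, y))\<^sup>2 \<partial>lborel)"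
      using lborel_pair.integrable_fst'[of "\<lambda>z. (f n z)\<^sup>2"] j by (simp add: lborel_prod)
    have k: "\<bar>\<integral>y. f n (t, y) * lift slack (t, y) \<partial>lborel\<bar> \<le> e1 * ((b - a + 1) * indicator {0..T} t + (\<integral>y. (f n (t, y))\<^sup>2 \<partial>lborel))" for t
    proof (cases "t \<in> {0..T}")
      case False
      then show ?thesis using B.field_out[OF False] by simp
    next
      case True
      note t = True
      define w where "w = (\<lambda>y. indicator {a - 1..b} y * (G t y - F n t y))"
      define s where "s = (\<lambda>y. indicator {a - 1..b} y * (b - max y a - 1 + F n t y))"
      have mF: "mono (F n t)" using F_facts(1)[OF t] by (auto simp: mono_def)
      have mG: "mono (G t)" using G_mono[OF t] by (auto simp: mono_def)
      note [measurable] = borel_measurable_mono[OF mF] borel_measurable_mono[OF mG]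
      have wm: "w \<in> borel_measurable borel" unfolding w_def by measurable
      have sm: "s \<in> borel_measurable borel" unfolding s_def by measurable
      have wB: "\<bar>w y\<bar> \<le> e1" for y using n0 n t e1 by (auto simp: w_def indicator_def abs_minus_commute less_imp_le)
      have F01: "0 \<le> F n t y" "F n t y \<le> 1" for y
        using F_facts(1)[OF t, of "min a y" y n] F_facts(1)[OF t, of y "max b y" n] F_facts(3)[OF t, of "min a y" n] F_facts(4)[OF t, of "max b y" n] by auto
      have sB: "\<bar>s y\<bar> \<le> (b - a) + 2" for y using F01[of y] ablt by (auto simp: s_def indicator_def)
      have fi: "integrable lborel (\<lambda>y. f n (t, y))" by (rule slice_integrable1[OF f_measurable f_out f_slice_square(1)[OF t]])
      have out: "f n (t, y) = 0" if "y \<notin> {a - 1..b}" for y using that by (intro f_out[rule_format]) (auto simp: D_def)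
      have e: "f n (t, y) * lift slack (t, y) = f n (t, y) * s y + f n (t, y) * w y" for y
      proof (cases "y \<in> {a - 1..b}")
        case True
        then have "(t, y) \<in> D" using t by (simp add: D_def)
        from lift_slack[OF this] show ?thesis using True by (simp add: s_def w_def distrib_left[symmetric])
      qed (simp add: out)
      have "(\<integral>y. f n (t, y) * s y \<partial>lborel) = (\<integral>y. B.fieldS t y * (b - max y a - 1 + F n t y) \<partial>lborel)"
        by (intro Bochner_Integration.integral_cong refl) (use out B.field_eq[OF t] in \<open>auto simp: s_def indicator_def\<close>)
      also have "\<dots> = 0" by (rule B.slice_slack[OF t])
      finally have s0: "(\<integral>y. f n (t, y) * s y \<partial>lborel) = 0" .
      have "(\<integral>y. f n (t, y) * lift slack (t, y) \<partial>lborel) = (\<integral>y. f n (t, y) * w y \<partial>lborel)"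
        unfolding e using s0 by (subst Bochner_Integration.integral_add[OF integrable_times_bounded(1)[OF fi sm sB] integrable_times_bounded(1)[OF fi wm wB]]) simp
      also have "\<bar>\<dots>\<bar> \<le> e1 * (\<integral>y. \<bar>f n (t, y)\<bar> \<partial>lborel)" by (rule integrable_times_bounded(2)[OF fi wm wB])
      also have "\<dots> \<le> e1 * (\<integral>y. indicator {a - 1..b} y + (f n (t, y))\<^sup>2 \<partial>lborel)"
      proof (intro mult_left_mono integral_mono integrable_abs fi Bochner_Integration.integrable_add f_slice_square(1)[OF t] integrable_real_indicator)
        fix y
        show "\<bar>f n (t, y)\<bar> \<le> indicator {a - 1..b} y + (f n (t, y))\<^sup>2"
        proof (cases "y \<in> {a - 1..b}")
          case True
          define v where "v = \<bar>f n (t, y)\<bar>"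
          have "0 \<le> (v - 1)\<^sup>2" by simp
          also have "\<dots> = v\<^sup>2 + 1 - 2 * v" by (simp add: power2_eq_square algebra_simps)
          finally have "2 * v \<le> 1 + v\<^sup>2" by simp
          moreover have "0 \<le> v" by (simp add: v_def)
          ultimately have "v \<le> 1 + v\<^sup>2" by linarith
          then show ?thesis using True by (simp add: v_def)
        qed (simp add: out)
      qed (use e1 in \<open>auto simp: emeasure_lborel_Icc_eq\<close>)
      also have "\<dots> = e1 * ((b - a + 1) * indicator {0..T} t + (\<integral>y. (f n (t, y))\<^sup>2 \<partial>lborel))"
        using t ablt by (subst Bochner_Integration.integral_add[OF _ f_slice_square(1)[OF t]]) (auto simp: emeasure_lborel_Icc_eq)
      finally show ?thesis .
    qed
    have "\<bar>\<integral>z. f n z * lift slack z \<partial>lborel\<bar> = \<bar>\<integral>t. (\<integral>y. f n (t, y) * lift slack (t, y) \<partial>lborel) \<partial>lborel\<bar>"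
      using lborel_pair.integral_fst'[of "\<lambda>z. f n z * lift slack z"] i by (simp add: lborel_prod)
    also have "\<dots> \<le> (\<integral>t. \<bar>\<integral>y. f n (t, y) * lift slack (t, y) \<partial>lborel\<bar> \<partial>lborel)" by (rule integral_abs_bound)
    also have "\<dots> \<le> (\<integral>t. e1 * ((b - a + 1) * indicator {0..T} t + (\<integral>y. (f n (t, y))\<^sup>2 \<partial>lborel)) \<partial>lborel)"
      by (intro integral_mono integrable_abs i' integrable_mult_right Bochner_Integration.integrable_add j' integrable_real_indicator k)
         (auto simp: emeasure_lborel_Icc_eq)
    also have "\<dots> = e1 * ((b - a + 1) * T + (\<integral>t. (\<integral>y. (f n (t, y))\<^sup>2 \<partial>lborel) \<partial>lborel))"
      using T by (subst integral_mult_right_zero, subst Bochner_Integration.integral_add[OF _ j']) (auto simp: emeasure_lborel_Icc_eq)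
    also have "(\<integral>t. (\<integral>y. (f n (t, y))\<^sup>2 \<partial>lborel) \<partial>lborel) = (\<integral>z. (f n z)\<^sup>2 \<partial>lborel)"
      using lborel_pair.integral_fst'[of "\<lambda>z. (f n z)\<^sup>2"] j by (simp add: lborel_prod)
    also have "e1 * ((b - a + 1) * T + \<dots>) \<le> e1 * W"
      using f_square_int(2)[of n] e1 by (intro mult_left_mono) (simp_all add: W_def algebra_simps)
    also have "\<dots> < e" using e W by (simp add: e1_def)
    finally show "norm ((\<integral>z. f n z * lift slack z \<partial>lborel) - 0) < e" by simp
  qed
qed

lemma p_slack: "AE z in lborel. z \<in> \<Omega>T \<longrightarrow> p z * (1 - dens z) = 0"
proof -
  have "(\<integral>z. slack z * p z \<partial>lborel) = 0"
    using q_limit[OF lift_square_int[OF slack_props] f_slack_tendsto] pairing(1)[OF q_props(1,2) slack_props] by (simp add: p_def)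
  moreover have i: "integrable lborel (\<lambda>z. slack z * p z)" unfolding p_def by (rule pairing(2)[OF q_props(1,2) slack_props])
  moreover have nn: "AE z in lborel. 0 \<le> slack z * p z"
    using p_nonneg by eventually_elim (use dens_01 in \<open>auto simp: slack_def indicator_def\<close>)
  ultimately have "AE z in lborel. slack z * p z = 0" using integral_nonneg_eq_0_iff_AE[OF i nn] by simp
  then show ?thesis by eventually_elim (auto simp: slack_def indicator_def split: if_splits)
qed

lemma AE_slices: "(AE z in lborel. P z) \<Longrightarrow> AE t in lborel. AE y in lborel. P (t, y)" for P :: "real \<times> real \<Rightarrow> bool"
  by (rule lborel_pair.AE_pair[of P, unfolded lborel_prod])

lemma q_slice:
  "AE t in lborel. integrable lborel (\<lambda>y. (q (t, y))\<^sup>2) \<and> integrable lborel (\<lambda>y. q (t, y))"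
  using slice_square_integrable[OF q_props(1)]
  by eventually_elim (use slice_integrable1[OF q_measurable q_props(2)] in blast)

text \<open>
  Where the density is below one the pressure vanishes, and with it, almost everywhere, its derivative.
\<close>

lemma q_saturated: "AE t in lborel. t \<in> {0..T} \<longrightarrow> (AE y in lborel. y \<in> {a..b} \<longrightarrow> q (t, y) * dens (t, y) = q (t, y))"
  using q_slice AE_slices[OF p_nonneg] AE_slices[OF p_slack]
proof eventually_elim
  case (elim t)
  show ?case
  proof
    assume t: "t \<in> {0..T}"
    have O: "(t, y) \<in> \<Omega>T \<longleftrightarrow> y \<in> {a..b}" for y using t by (auto simp: \<Omega>T_def)
    have pe: "p (t, y) = (\<integral>z. q (t, z) * indicator {..y} z \<partial>lborel)" for y by (simp add: p_def prim_def)
    have nn: "AE y in lborel. a \<le> y \<and> y \<le> b \<longrightarrow> 0 \<le> (\<integral>z. q (t, z) * indicator {..y} z \<partial>lborel)"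
      using elim(2) by eventually_elim (simp add: O pe)
    have "AE y in lborel. a < y \<and> y < b \<and> p (t, y) = 0 \<longrightarrow> q (t, y) = 0"
      unfolding pe by (rule derivative_zero_on_zero_set[OF _ nn]) (use elim(1) in blast)
    then show "AE y in lborel. y \<in> {a..b} \<longrightarrow> q (t, y) * dens (t, y) = q (t, y)"
      using elim(3) AE_lborel_singleton[of a] AE_lborel_singleton[of b]
      by eventually_elim (auto simp: O)
  qed
qed

end

section \<open>The weak equation of the limit\<close>

lemma integrable_on_interval_bounded:
  fixes h :: "real \<Rightarrow> real"
  assumes "h \<in> borel_measurable borel" "\<And>y. \<bar>h y\<bar> \<le> B * indicator {a..b} y"
  shows "integrable lborel h"
proof (rule Bochner_Integration.integrable_bound)
  show "integrable lborel (\<lambda>y. B * indicator {a..b} y)"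
    by (intro integrable_mult_right integrable_real_indicator) (auto simp: emeasure_lborel_Icc_eq)
  show "h \<in> borel_measurable lborel" using assms(1) by simp
  show "AE y in lborel. norm (h y) \<le> norm (B * indicator {a..b} y)"
    using assms(2) by (intro AE_I2) (metis abs_ge_self order_trans real_norm_def)
qed

context flow_limit
begin

lemma dens_off: "y \<notin> {a..b} \<Longrightarrow> dens (t, y) = 0"
  by (auto simp: dens_def)

lemma \<rho>_integral:
  assumes t: "t \<in> {0..T}" and g: "g \<in> borel_measurable borel"
  shows "(\<integral>u. g u \<partial>\<rho> t) = (\<integral>u. indicator {a..b} u * (g u * dens (t, u)) \<partial>lborel)"
proof -
  have "(\<integral>u. g u \<partial>\<rho> t) = (\<integral>u. dens (t, u) *\<^sub>R g u \<partial>lborel)"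
    unfolding \<rho>_facts(3)[OF t] using g dens_01 slice_measurable[OF dens_measurable]
    by (intro integral_density) auto
  also have "\<dots> = (\<integral>u. indicator {a..b} u * (g u * dens (t, u)) \<partial>lborel)"
    by (intro Bochner_Integration.integral_cong refl) (use dens_off in \<open>auto simp: indicator_def mult.commute\<close>)
  finally show ?thesis .
qed

text \<open>
  The pressure is the primitive of \<open>q\<close> starting from \<open>a - 1\<close>; on \<open>[a, b]\<close> its weak derivative is \<open>q\<close> as test functions vanish at both ends.
\<close>

lemma slice_in_H1:
  assumes q2: "integrable lborel (\<lambda>y. (q (t, y))\<^sup>2)"
  shows "in_H1 {a..b} (\<lambda>x. p (t, x)) (\<lambda>x. q (t, x))"
  unfolding in_H1_def
proof (intro conjI allI impI)
  have q1: "integrable lborel (\<lambda>y. q (t, y))" by (rule slice_integrable1[OF q_measurable q_props(2) q2])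
  have [measurable]: "(\<lambda>x. p (t, x)) \<in> borel_measurable borel" "(\<lambda>x. q (t, x)) \<in> borel_measurable borel"
    by (intro slice_measurable p_measurable q_measurable)+
  show "set_borel_measurable lborel {a..b} (\<lambda>x. p (t, x))" "set_borel_measurable lborel {a..b} (\<lambda>x. q (t, x))"
    unfolding set_borel_measurable_def by measurable
  show "set_integrable lborel {a..b} (\<lambda>x. (p (t, x))\<^sup>2)"
    unfolding set_integrable_def
  proof (rule integrable_on_interval_bounded)
    show "(\<lambda>x. indicator {a..b} x *\<^sub>R (p (t, x))\<^sup>2) \<in> borel_measurable borel" by measurable
    show "\<bar>indicator {a..b} x *\<^sub>R (p (t, x))\<^sup>2\<bar> \<le> ((b - a + 1) * (\<integral>y. (q (t, y))\<^sup>2 \<partial>lborel)) * indicator {a..b} x" for x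
      using prim_square_le[OF q_measurable q_props(2) q2, of x] by (simp add: p_def indicator_def)
  qed
  show "set_integrable lborel {a..b} (\<lambda>x. (q (t, x))\<^sup>2)"
    unfolding set_integrable_def by (intro integrable_mult_indicator q2) simp
  fix \<phi> :: "real \<Rightarrow> real"
  assume \<phi>: "\<phi> C1_differentiable_on UNIV" and supp: "\<exists>C. compact C \<and> C \<subseteq> interior {a..b} \<and> (\<forall>x. x \<notin> C \<longrightarrow> \<phi> x = 0)"
  from \<phi> obtain D where D: "\<And>x. (\<phi> has_vector_derivative D x) (at x)" and Dc: "continuous_on UNIV D"
    unfolding C1_differentiable_on_def by auto
  have D': "(\<phi> has_real_derivative D x) (at x)" for x using D by (simp add: has_real_derivative_iff_has_vector_derivative)
  have dD: "deriv \<phi> = D" using D' by (intro ext DERIV_imp_deriv)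
  have z: "\<phi> x = 0" if "x \<le> a \<or> b \<le> x" for x using supp that by (fastforce simp: interior_atLeastAtMost_real)
  let ?h = "\<lambda>u. indicator {a..b} u * D u :: real"
  have hi: "integrable lborel ?h"
    using borel_integrable_atLeastAtMost'[OF continuous_on_subset[OF Dc], of a b] by (simp add: set_integrable_def)
  have up: "(\<integral>x. ?h x * indicator {y..} x \<partial>lborel) = - (indicator {a..b} y * \<phi> y)" for y
  proof (cases "y \<le> b")
    case True
    let ?c = "max a y"
    have "(\<integral>x. ?h x * indicator {y..} x \<partial>lborel) = (\<integral>x. D x * indicator {?c..b} x \<partial>lborel)"
      by (intro Bochner_Integration.integral_cong refl) (auto simp: indicator_def)
    also have "\<dots> = \<phi> b - \<phi> ?c"
      by (rule integral_FTC_Icc_real) (use True ablt D' Dc in \<open>auto simp: continuous_on_eq_continuous_at\<close>)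
    also have "\<dots> = - (indicator {a..b} y * \<phi> y)" using z[of b] z[of ?c] True by (auto simp: indicator_def max_def)
    finally show ?thesis .
  next
    case False
    then have "(\<lambda>x. ?h x * indicator {y..} x) = (\<lambda>x. 0)" by (auto simp: indicator_def fun_eq_iff)
    then have "(\<integral>x. ?h x * indicator {y..} x \<partial>lborel) = 0" by (simp only: Bochner_Integration.integral_zero)
    then show ?thesis using False by simp
  qed
  have "(LINT x:{a..b}|lborel. p (t, x) * deriv \<phi> x) = (\<integral>x. ?h x * (\<integral>z. q (t, z) * indicator {..x} z \<partial>lborel) \<partial>lborel)"
    unfolding set_lebesgue_integral_def dD by (intro Bochner_Integration.integral_cong refl) (simp add: p_def prim_def)
  also have "\<dots> = (\<integral>y. q (t, y) * (\<integral>x. ?h x * indicator {y..} x \<partial>lborel) \<partial>lborel)"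
    by (rule primitive_by_parts[OF q1 hi])
  also have "\<dots> = (\<integral>y. - (indicator {a..b} y * (q (t, y) * \<phi> y)) \<partial>lborel)"
    unfolding up by (intro Bochner_Integration.integral_cong refl) simp
  also have "\<dots> = - (LINT x:{a..b}|lborel. q (t, x) * \<phi> x)" by (simp add: set_lebesgue_integral_def)
  finally show "(LINT x:{a..b}|lborel. p (t, x) * deriv \<phi> x) = - (LINT x:{a..b}|lborel. q (t, x) * \<phi> x)" .
qed

lemma pressure_in_L2_H1: "in_L2_H1 T {a..b} p q"
  unfolding in_L2_H1_def
proof (intro conjI p_measurable q_measurable)
  show "AE t in lborel. t \<in> {0..T} \<longrightarrow> in_H1 {a..b} (\<lambda>x. p (t, x)) (\<lambda>x. q (t, x))"
    using q_slice by eventually_elim (use slice_in_H1 in blast)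
  have p2: "integrable lborel (\<lambda>z. (indicator \<Omega>T z * p z)\<^sup>2)"
    using prim_square_int[OF q_props(1,2)] by (simp add: square_int_def p_def)
  have q2: "integrable lborel (\<lambda>z. indicator \<Omega>T z *\<^sub>R (q z)\<^sup>2)"
    using q_props(1) by (intro integrable_mult_indicator) (simp_all add: square_int_def)
  have e: "(indicator \<Omega>T z * p z)\<^sup>2 + indicator \<Omega>T z *\<^sub>R (q z)\<^sup>2 = indicator \<Omega>T z *\<^sub>R ((p z)\<^sup>2 + (q z)\<^sup>2)" for z
    by (simp add: indicator_def)
  show "set_integrable lborel ({0..T} \<times> {a..b}) (\<lambda>z. (p z)\<^sup>2 + (q z)\<^sup>2)"
    using Bochner_Integration.integrable_add[OF p2 q2] unfolding e set_integrable_def \<Omega>T_def[symmetric] .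
qed

end

locale limit_test = flow_limit +
  fixes \<zeta> \<zeta>t \<zeta>x :: "real \<times> real \<Rightarrow> real"
  assumes test: "C1c_test T \<zeta> \<zeta>t \<zeta>x"
begin

lemma cont_\<zeta>: "continuous_on ({0..<T} \<times> UNIV) \<zeta>" "continuous_on ({0..<T} \<times> UNIV) \<zeta>t" "continuous_on ({0..<T} \<times> UNIV) \<zeta>x"
proof -
  show "continuous_on ({0..<T} \<times> UNIV) \<zeta>"
    using test unfolding C1c_test_def
    by (intro has_derivative_continuous_on[where f' = "\<lambda>z h. \<zeta>t z * fst h + \<zeta>x z * snd h"]) blast
qed (use test in \<open>auto simp: C1c_test_def\<close>)

lemma cont_slice: "continuous_on ({0..<T} \<times> UNIV) g \<Longrightarrow> t \<in> {0..<T} \<Longrightarrow> continuous_on UNIV (\<lambda>y. g (t, y))" for g :: "real \<times> real \<Rightarrow> real"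
  by (rule continuous_on_compose2[of "{0..<T} \<times> UNIV" g]) (auto intro!: continuous_intros)

lemma test_bounds:
  obtains B where "\<And>t y. t \<in> {0..<T} \<Longrightarrow> \<bar>y\<bar> \<le> R \<Longrightarrow> \<bar>\<zeta>t (t, y)\<bar> \<le> B" "\<And>t y. t \<in> {0..<T} \<Longrightarrow> \<bar>y\<bar> \<le> R \<Longrightarrow> \<bar>\<zeta>x (t, y)\<bar> \<le> B" "0 \<le> B"
    "\<And>e. 0 < e \<Longrightarrow> \<exists>K\<ge>0. \<forall>t\<in>{0..<T}. \<forall>u v. \<bar>u\<bar> \<le> R \<longrightarrow> \<bar>v\<bar> \<le> R \<longrightarrow> (\<zeta>x (t, u) - \<zeta>x (t, v))\<^sup>2 \<le> e + K * (u - v)\<^sup>2"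
proof -
  obtain T1 where T1: "0 \<le> T1" "T1 < T" and z: "\<And>t y. T1 < t \<Longrightarrow> t < T \<Longrightarrow> \<zeta> (t, y) = 0 \<and> \<zeta>t (t, y) = 0 \<and> \<zeta>x (t, y) = 0"
    using test_support[OF T test] by blast
  let ?S = "{0..T1} \<times> {- R..R}"
  have S: "compact ?S" by (intro compact_Times) auto
  have sub: "?S \<subseteq> {0..<T} \<times> UNIV" using T1 by auto
  have c: "continuous_on ?S \<zeta>t" "continuous_on ?S \<zeta>x" by (rule continuous_on_subset[OF cont_\<zeta>(2) sub], rule continuous_on_subset[OF cont_\<zeta>(3) sub])
  have "bounded (\<zeta>t ` ?S)" "bounded (\<zeta>x ` ?S)" by (intro compact_imp_bounded compact_continuous_image c S)+
  then obtain B1 B2 where B: "\<forall>u\<in>\<zeta>t ` ?S. norm u \<le> B1" "\<forall>u\<in>\<zeta>x ` ?S. norm u \<le> B2" unfolding bounded_iff by blast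
  define B where "B = max 0 (max B1 B2)"
  show thesis
  proof (rule that[of B])
    show "\<bar>\<zeta>t (t, y)\<bar> \<le> B" if "t \<in> {0..<T}" "\<bar>y\<bar> \<le> R" for t y
    proof (cases "t \<le> T1")
      case True
      then have "(t, y) \<in> ?S" using that by auto
      then have "norm (\<zeta>t (t, y)) \<le> B1" using B(1) by blast
      then show ?thesis by (simp add: B_def)
    qed (use z[of t y] that in \<open>simp add: B_def\<close>)
    show "\<bar>\<zeta>x (t, y)\<bar> \<le> B" if "t \<in> {0..<T}" "\<bar>y\<bar> \<le> R" for t y
    proof (cases "t \<le> T1")
      case True
      then have "(t, y) \<in> ?S" using that by auto
      then have "norm (\<zeta>x (t, y)) \<le> B2" using B(2) by blast
      then show ?thesis by (simp add: B_def)
    qed (use z[of t y] that in \<open>simp add: B_def\<close>)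
    show "0 \<le> B" by (simp add: B_def)
    fix e :: real assume e: "0 < e"
    from compact_modulus[OF S c(2) e] obtain K where K: "0 \<le> K" "\<forall>z\<in>?S. \<forall>w\<in>?S. (\<zeta>x z - \<zeta>x w)\<^sup>2 \<le> e + K * (dist z w)\<^sup>2" by blast
    show "\<exists>K\<ge>0. \<forall>t\<in>{0..<T}. \<forall>u v. \<bar>u\<bar> \<le> R \<longrightarrow> \<bar>v\<bar> \<le> R \<longrightarrow> (\<zeta>x (t, u) - \<zeta>x (t, v))\<^sup>2 \<le> e + K * (u - v)\<^sup>2"
    proof (intro exI[of _ K] conjI ballI allI impI K(1))
      fix t u v assume t: "t \<in> {0..<T}" and u: "\<bar>u\<bar> \<le> R" "\<bar>v\<bar> \<le> R"
      show "(\<zeta>x (t, u) - \<zeta>x (t, v))\<^sup>2 \<le> e + K * (u - v)\<^sup>2"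
      proof (cases "t \<le> T1")
        case True
        then have "(t, u) \<in> ?S" "(t, v) \<in> ?S" using t u by auto
        then have "(\<zeta>x (t, u) - \<zeta>x (t, v))\<^sup>2 \<le> e + K * (dist (t, u) (t, v))\<^sup>2" using K(2) by blast
        then show ?thesis by (simp add: dist_Pair_Pair dist_real_def)
      next
        case False
        then show ?thesis using z[of t u] z[of t v] t e K(1) by simp
      qed
    qed
  qed
qed

definition h :: "real \<times> real \<Rightarrow> real" where "h z = indicator ({0..<T} \<times> {a..b}) z * \<zeta>x z"

lemma h_props: "h \<in> borel_measurable borel" "square_int lborel h"
proof -
  have S: "{0..<T} \<times> {a..b} \<in> sets (borel :: (real \<times> real) measure)"
    unfolding borel_prod[symmetric] by (intro pair_measureI) auto
  have "continuous_on ({0..<T} \<times> {a..b}) \<zeta>x" by (rule continuous_on_subset[OF cont_\<zeta>(3)]) auto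
  from borel_measurable_continuous_on_indicator[OF S this]
  show m: "h \<in> borel_measurable borel" by (simp add: h_def[abs_def])
  obtain B where B: "\<And>t y. t \<in> {0..<T} \<Longrightarrow> \<bar>y\<bar> \<le> R \<Longrightarrow> \<bar>\<zeta>x (t, y)\<bar> \<le> B" "0 \<le> B"
    using test_bounds by metis
  show "square_int lborel h"
  proof (rule square_int_bounded[OF m \<Omega>T_bounded \<Omega>T_sets])
    show "\<bar>h z\<bar> \<le> B" for z using B aR bR by (cases z) (auto simp: h_def indicator_def)
    show "\<forall>z. z \<notin> \<Omega>T \<longrightarrow> h z = 0" by (auto simp: h_def \<Omega>T_def indicator_def)
  qed
qed

definition lin :: "nat \<Rightarrow> real \<Rightarrow> real" where
  "lin n t = (\<Sum>i\<in>I n. m n i * (\<zeta>x (t, x n t i) * block_flow.force (N n) (m n) (x n) (l n) t i))"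

definition obs :: "real \<Rightarrow> real \<Rightarrow> real" where "obs t u = \<zeta>t (t, u) - \<zeta>x (t, u) * dV u"

lemma discrete_identity:
  shows "set_integrable lborel {0..<T} (\<lambda>t. \<Sum>i\<in>I n. m n i * obs t (x n t i))" "set_integrable lborel {0..<T} (lin n)"
    and "(LINT t:{0..<T}|lborel. lin n t) = (LINT t:{0..<T}|lborel. (\<Sum>i\<in>I n. m n i * obs t (x n t i))) + (\<Sum>i\<in>I n. m n i * \<zeta> (0, x n 0 i))"
  using block_flow.flow_weak_identity[OF flow test, of n] unfolding obs_def lin_def[abs_def] by auto

lemma obs_cont: "t \<in> {0..<T} \<Longrightarrow> continuous_on UNIV (obs t)"
  unfolding obs_def[abs_def] by (intro continuous_intros cont_slice cont_\<zeta> block_flow.dVcont[OF flow])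

definition A1 :: real where "A1 = (LINT t:{0..<T}|lborel. (\<integral>u. obs t u \<partial>\<rho> t))"
definition A0 :: real where "A0 = (\<integral>u. \<zeta> (0, u) \<partial>\<rho> 0)"

text \<open>
  Pointwise in time this is \<open>observable_limit\<close>, and the bounds on the support of the test function allow dominated convergence.
\<close>

lemma obs_tendsto:
  "(\<lambda>n. LINT t:{0..<T}|lborel. (\<Sum>i\<in>I n. m n i * obs t (x n t i))) \<longlonglongrightarrow> A1"
  "set_integrable lborel {0..<T} (\<lambda>t. \<integral>u. obs t u \<partial>\<rho> t)"
proof -
  obtain B where B: "\<And>t y. t \<in> {0..<T} \<Longrightarrow> \<bar>y\<bar> \<le> R \<Longrightarrow> \<bar>\<zeta>t (t, y)\<bar> \<le> B" "\<And>t y. t \<in> {0..<T} \<Longrightarrow> \<bar>y\<bar> \<le> R \<Longrightarrow> \<bar>\<zeta>x (t, y)\<bar> \<le> B" "0 \<le> B"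
    using test_bounds by metis
  define s where "s = (\<lambda>n t. indicator {0..<T} t *\<^sub>R (\<Sum>i\<in>I n. m n i * obs t (x n t i)))"
  define g where "g = (\<lambda>t. indicator {0..<T} t *\<^sub>R (\<integral>u. obs t u \<partial>\<rho> t))"
  have si: "integrable lborel (s n)" for n using discrete_identity(1)[of n] by (simp add: s_def set_integrable_def)
  have lim: "(\<lambda>n. s n t) \<longlonglongrightarrow> g t" for t
  proof (cases "t \<in> {0..<T}")
    case True
    then have "t \<in> {0..T}" by auto
    from observable_limit[OF this obs_cont[OF True]] show ?thesis using True by (simp add: s_def g_def)
  qed (simp add: s_def g_def)
  have sm: "s n \<in> borel_measurable lborel" for n using si by (rule borel_measurable_integrable)
  have gm: "g \<in> borel_measurable lborel" by (rule borel_measurable_LIMSEQ_real[OF lim sm])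
  have wi: "integrable lborel (\<lambda>t. indicator {0..<T} t * (B * (1 + M)))"
    by (intro integrable_mult_left integrable_real_indicator) (use T in auto)
  have bound: "norm (s n t) \<le> indicator {0..<T} t * (B * (1 + M))" for n t
  proof (cases "t \<in> {0..<T}")
    case True
    then have t: "t \<in> {0..T}" by auto
    have ob: "\<bar>obs t (x n t i)\<bar> \<le> B * (1 + M)" if i: "i \<in> I n" for i
    proof -
      have "\<bar>\<zeta>x (t, x n t i) * dV (x n t i)\<bar> \<le> B * M"
        unfolding abs_mult by (intro mult_mono B True pos[OF t i] dVM) auto
      moreover have "\<bar>\<zeta>t (t, x n t i)\<bar> \<le> B" by (intro B True pos[OF t i])
      ultimately show ?thesis by (simp add: obs_def distrib_left)
    qed
    have "\<bar>\<Sum>i\<in>I n. m n i * obs t (x n t i)\<bar> \<le> (\<Sum>i\<in>I n. m n i * (B * (1 + M)))"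
      by (rule order_trans[OF sum_abs sum_mono])
         (use ob block_flow.mnonneg[OF flow] in \<open>auto simp: abs_mult intro!: mult_left_mono\<close>)
    also have "\<dots> = B * (1 + M)" using block_flow.msum[OF flow] by (simp add: sum_distrib_right[symmetric])
    finally show ?thesis using True by (simp add: s_def)
  qed (simp add: s_def)
  show "set_integrable lborel {0..<T} (\<lambda>t. \<integral>u. obs t u \<partial>\<rho> t)"
    using integrable_dominated_convergence[OF gm sm wi AE_I2[OF lim] AE_I2[OF bound]]
    by (simp add: set_integrable_def g_def)
  have "(\<lambda>n. integral\<^sup>L lborel (s n)) \<longlonglongrightarrow> integral\<^sup>L lborel g"
    by (rule integral_dominated_convergence[OF gm sm wi AE_I2[OF lim] AE_I2[OF bound]])
  then show "(\<lambda>n. LINT t:{0..<T}|lborel. (\<Sum>i\<in>I n. m n i * obs t (x n t i))) \<longlonglongrightarrow> A1"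
    by (simp add: set_lebesgue_integral_def A1_def s_def g_def)
qed

lemma lin_tendsto: "(\<lambda>n. LINT t:{0..<T}|lborel. lin n t) \<longlonglongrightarrow> A1 + A0"
proof -
  have "(\<lambda>n. \<Sum>i\<in>I n. m n i * \<zeta> (0, x n 0 i)) \<longlonglongrightarrow> A0"
    unfolding A0_def using T by (intro observable_limit cont_slice[OF cont_\<zeta>(1)]) auto
  from tendsto_add[OF obs_tendsto(1) this] show ?thesis by (simp add: discrete_identity(3))
qed

lemma pairing_slices:
  assumes "square_int lborel w"
  shows "integrable lborel (\<lambda>t. \<integral>y. w (t, y) * h (t, y) \<partial>lborel)" "(\<integral>z. w z * h z \<partial>lborel) = (\<integral>t. (\<integral>y. w (t, y) * h (t, y) \<partial>lborel) \<partial>lborel)"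
proof -
  have i: "integrable lborel (\<lambda>z. w z * h z)" by (rule square_int_mult[OF assms h_props(2)])
  show "integrable lborel (\<lambda>t. \<integral>y. w (t, y) * h (t, y) \<partial>lborel)"
    using lborel_pair.integrable_fst'[of "\<lambda>z. w z * h z"] i by (simp add: lborel_prod)
  show "(\<integral>z. w z * h z \<partial>lborel) = (\<integral>t. (\<integral>y. w (t, y) * h (t, y) \<partial>lborel) \<partial>lborel)"
    using lborel_pair.integral_fst'[of "\<lambda>z. w z * h z"] i by (simp add: lborel_prod)
qed

text \<open>
  The time integral of \<open>slice_error\<close>.
\<close>

lemma lin_close:
  assumes \<delta>: "0 < \<delta>" and e: "0 \<le> K" "\<forall>t\<in>{0..<T}. \<forall>u v. \<bar>u\<bar> \<le> R \<longrightarrow> \<bar>v\<bar> \<le> R \<longrightarrow> (\<zeta>x (t, u) - \<zeta>x (t, v))\<^sup>2 \<le> e + K * (u - v)\<^sup>2"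
  shows "\<bar>(\<integral>z. f n z * h z \<partial>lborel) - (LINT t:{0..<T}|lborel. lin n t)\<bar> \<le> \<delta> / 2 * B1 + T * ((e + K * (C / real (N n))) / (2 * \<delta>))"
proof -
  interpret B: block_flow "N n" "I n" "m n" "x n" "x' n" "l n" dV a b T by (rule flow)
  obtain B where B: "\<And>t y. t \<in> {0..<T} \<Longrightarrow> \<bar>y\<bar> \<le> R \<Longrightarrow> \<bar>\<zeta>x (t, y)\<bar> \<le> B" using test_bounds by metis
  let ?c = "(e + K * (C / real (N n))) / (2 * \<delta>)"
  let ?H = "\<lambda>t. \<integral>y. f n (t, y) * h (t, y) \<partial>lborel"
  note ps = pairing_slices[OF f_square_int(1), of n]
  have li: "integrable lborel (\<lambda>t. indicator {0..<T} t *\<^sub>R lin n t)" using discrete_identity(2)[of n] by (simp add: set_integrable_def)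
  have fi: "integrable lborel (\<lambda>t. indicator {0..T} t *\<^sub>R force2 n t)" using force2_integral(1)[of n] by (simp add: set_integrable_def)
  have ci: "integrable lborel (\<lambda>t. indicator {0..T} t * ?c)"
    by (intro integrable_mult_left integrable_real_indicator) (auto simp: emeasure_lborel_Icc_eq)
  have "0 \<le> (\<zeta>x (0, a) - \<zeta>x (0, a))\<^sup>2" by simp
  have e0: "0 \<le> e" using e(2)[rule_format, of 0 a a] T aR by simp
  have "0 \<le> K * (C / real (N n))" using e(1) C0 by simp
  then have c0: "0 \<le> ?c" using e0 \<delta> by (intro divide_nonneg_pos add_nonneg_nonneg) auto
  have le: "\<bar>?H t - indicator {0..<T} t *\<^sub>R lin n t\<bar> \<le> \<delta> / 2 * (indicator {0..T} t *\<^sub>R force2 n t) + indicator {0..T} t * ?c" for t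
  proof (cases "t \<in> {0..<T}")
    case False
    then have "h (t, y) = 0" for y by (auto simp: h_def indicator_def)
    then have "?H t = 0" by simp
    moreover have "indicator {0..<T} t *\<^sub>R lin n t = 0" using False by (simp del: atLeastLessThan_iff)
    moreover have "0 \<le> \<delta> / 2 * (indicator {0..T} t *\<^sub>R force2 n t) + indicator {0..T} t * ?c"
      using \<delta> c0 force2_nonneg[of n t] by (intro add_nonneg_nonneg mult_nonneg_nonneg scaleR_nonneg_nonneg) auto
    ultimately show ?thesis by (simp only: diff_zero abs_zero)
  next
    case True
    then have t: "t \<in> {0..T}" by auto
    have "\<bar>lin n t - (\<integral>y. \<zeta>x (t, y) * (B.fieldS t y * indicator {a..b} y) \<partial>lborel)\<bar>
        \<le> \<delta> / 2 * (\<Sum>i\<in>I n. m n i * (B.force t i)\<^sup>2) + (e + K * B.cst t) / (2 * \<delta>)"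
      unfolding lin_def
      by (rule B.slice_error[OF t _ _ aR bR _ _ \<delta>, where B = B])
         (use e(2) True B pos[OF t] borel_measurable_continuous_onI[OF cont_slice[OF cont_\<zeta>(3) True]] in auto)
    also have "(\<integral>y. \<zeta>x (t, y) * (B.fieldS t y * indicator {a..b} y) \<partial>lborel) = ?H t"
      using True by (intro Bochner_Integration.integral_cong refl) (simp add: h_def B.field_eq[OF t] indicator_def)
    finally have "\<bar>lin n t - ?H t\<bar> \<le> \<delta> / 2 * force2 n t + (e + K * B.cst t) / (2 * \<delta>)" by (simp add: force2_def)
    moreover have "(e + K * B.cst t) / (2 * \<delta>) \<le> ?c"
      using cost[OF t, of n] e(1) \<delta> by (intro divide_right_mono add_left_mono mult_left_mono) auto
    ultimately show ?thesis using True t by (simp add: abs_minus_commute)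
  qed
  have "\<bar>(\<integral>z. f n z * h z \<partial>lborel) - (LINT t:{0..<T}|lborel. lin n t)\<bar> = \<bar>\<integral>t. ?H t - indicator {0..<T} t *\<^sub>R lin n t \<partial>lborel\<bar>"
    unfolding set_lebesgue_integral_def ps(2) by (subst Bochner_Integration.integral_diff[OF ps(1) li]) simp
  also have "\<dots> \<le> (\<integral>t. \<bar>?H t - indicator {0..<T} t *\<^sub>R lin n t\<bar> \<partial>lborel)" by (rule integral_abs_bound)
  also have "\<dots> \<le> (\<integral>t. \<delta> / 2 * (indicator {0..T} t *\<^sub>R force2 n t) + indicator {0..T} t * ?c \<partial>lborel)"
    by (intro integral_mono integrable_abs Bochner_Integration.integrable_diff ps(1) li Bochner_Integration.integrable_add integrable_mult_right fi ci le)
  also have "\<dots> = (\<integral>t. \<delta> / 2 * (indicator {0..T} t *\<^sub>R force2 n t) \<partial>lborel) + (\<integral>t. indicator {0..T} t * ?c \<partial>lborel)"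
    by (intro Bochner_Integration.integral_add integrable_mult_right fi ci)
  also have "(\<integral>t. indicator {0..T} t * ?c \<partial>lborel) = T * ?c" using T by simp
  also have "(\<integral>t. \<delta> / 2 * (indicator {0..T} t *\<^sub>R force2 n t) \<partial>lborel) = \<delta> / 2 * (LINT t:{0..T}|lborel. force2 n t)"
    unfolding set_lebesgue_integral_def by (rule integral_mult_right_zero)
  also have "\<dots> + T * ?c \<le> \<delta> / 2 * B1 + T * ?c" using force2_integral(2)[of n] \<delta> by (intro add_right_mono mult_left_mono) auto
  finally show ?thesis .
qed

text \<open>
  The weight \<open>\<delta>\<close> and the error \<open>e\<close> of the modulus are fixed first; then \<open>N\<close> makes the transport cost term small.
\<close>

lemma f_h_tendsto: "(\<lambda>n. \<integral>z. f n z * h z \<partial>lborel) \<longlonglongrightarrow> A1 + A0"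
proof -
  have "(\<lambda>n. (\<integral>z. f n z * h z \<partial>lborel) - (LINT t:{0..<T}|lborel. lin n t)) \<longlonglongrightarrow> 0"
  proof (rule LIMSEQ_I)
    fix r :: real assume r: "0 < r"
    define W0 where "W0 = B1 + 1"
    define \<delta> where "\<delta> = r / (2 * W0)"
    have B1': "0 < W0" using B1_nonneg by (simp add: W0_def)
    have \<delta>: "0 < \<delta>" using r B1' by (simp add: \<delta>_def)
    have d1: "\<delta> / 2 * B1 \<le> r / 4"
    proof -
      have "\<delta> / 2 * B1 \<le> \<delta> / 2 * W0" using \<delta> by (intro mult_left_mono) (auto simp: W0_def)
      also have "\<dots> = r / 4" using B1' by (simp add: \<delta>_def)
      finally show ?thesis .
    qed
    define e where "e = \<delta> * r / (2 * T)"
    have e: "0 < e" using \<delta> r T by (simp add: e_def)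
    have e1: "T * (e / (2 * \<delta>)) = r / 4" using \<delta> T by (simp add: e_def)
    obtain K where K: "0 \<le> K" "\<forall>t\<in>{0..<T}. \<forall>u v. \<bar>u\<bar> \<le> R \<longrightarrow> \<bar>v\<bar> \<le> R \<longrightarrow> (\<zeta>x (t, u) - \<zeta>x (t, v))\<^sup>2 \<le> e + K * (u - v)\<^sup>2"
      using test_bounds e by metis
    define W where "W = T * K * C / (2 * \<delta>)"
    have W: "0 \<le> W" using T K(1) C0 \<delta> by (simp add: W_def)
    obtain n0 :: nat where n0: "4 * W / r < real n0" using reals_Archimedean2 by blast
    show "\<exists>no. \<forall>n\<ge>no. norm ((\<integral>z. f n z * h z \<partial>lborel) - (LINT t:{0..<T}|lborel. lin n t) - 0) < r"
    proof (intro exI allI impI)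
      fix n assume n: "n0 \<le> n"
      have Nr: "4 * W / r < real (N n)" using n n0 Nn[of n] by linarith
      have Np: "0 < real (N n)" using Nn[of n] by simp
      have "T * ((e + K * (C / real (N n))) / (2 * \<delta>)) = T * (e / (2 * \<delta>)) + W / real (N n)"
        by (simp add: W_def add_divide_distrib distrib_left mult_ac)
      moreover have "W / real (N n) < r / 4" using Nr Np r by (simp add: field_simps)
      ultimately have "\<delta> / 2 * B1 + T * ((e + K * (C / real (N n))) / (2 * \<delta>)) < r" using d1 e1 r by linarith
      then show "norm ((\<integral>z. f n z * h z \<partial>lborel) - (LINT t:{0..<T}|lborel. lin n t) - 0) < r"
        using lin_close[OF \<delta> K, of n] by simp
    qed
  qed
  from tendsto_add[OF this lin_tendsto] show ?thesis by simp
qed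

text \<open>
  The pairing of \<open>q\<close> with the test function is \<open>A1 + A0\<close>, the limit of the discrete equations. It has no factor \<open>dens\<close>, but
  \<open>q * dens = q\<close> almost everywhere on the cylinder by \<open>q_saturated\<close>.
\<close>

lemma weak_equation:
  "(LINT t:{0..<T}|lborel. LINT y:{a..b}|lborel. (\<zeta>t (t, y) - \<zeta>x (t, y) * (dV y + q (t, y))) * dens (t, y))
     + (LINT y:{a..b}|\<rho> 0. \<zeta> (0, y)) = 0"
proof -
  have zero: "0 \<in> {0..T}" using T by simp
  have A0: "(LINT y:{a..b}|\<rho> 0. \<zeta> (0, y)) = A0"
    unfolding set_lebesgue_integral_def A0_def
  proof (rule integral_cong_AE)
    have c: "(\<lambda>y. \<zeta> (0, y)) \<in> borel_measurable borel"
      using T by (intro borel_measurable_continuous_onI cont_slice[OF cont_\<zeta>(1)]) auto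
    show "(\<lambda>y. \<zeta> (0, y)) \<in> borel_measurable (\<rho> 0)" "(\<lambda>y. indicator {a..b} y *\<^sub>R \<zeta> (0, y)) \<in> borel_measurable (\<rho> 0)"
      using c by (simp_all add: measurable_cong_sets[OF \<rho>_prob(2)[OF zero] refl])
    show "AE y in \<rho> 0. indicator {a..b} y *\<^sub>R \<zeta> (0, y) = \<zeta> (0, y)"
    proof (rule AE_I)
      show "emeasure (\<rho> 0) (- {a..b}) = 0" using \<rho>_facts(4)[OF zero] by (auto simp: K_set_def P_ac_def)
      show "- {a..b} \<in> sets (\<rho> 0)" using \<rho>_prob(2)[OF zero] by simp
    qed (auto simp: indicator_def)
  qed
  have qh: "(\<integral>z. q z * h z \<partial>lborel) = A1 + A0" by (rule q_limit[OF h_props(2) f_h_tendsto])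
  note ps = pairing_slices[OF q_props(1)]
  let ?Q = "\<lambda>t. \<integral>y. q (t, y) * h (t, y) \<partial>lborel"
  let ?G = "\<lambda>t. LINT y:{a..b}|lborel. (\<zeta>t (t, y) - \<zeta>x (t, y) * (dV y + q (t, y))) * dens (t, y)"
  have Qz: "?Q t = 0" if "t \<notin> {0..<T}" for t
  proof -
    have "h (t, y) = 0" for y using that by (auto simp: h_def indicator_def)
    then show ?thesis by simp
  qed
  have oi: "integrable lborel (\<lambda>t. indicator {0..<T} t *\<^sub>R (\<integral>u. obs t u \<partial>\<rho> t))" using obs_tendsto(2) by (simp add: set_integrable_def)
  have sl: "AE t in lborel. indicator {0..<T} t *\<^sub>R ?G t = indicator {0..<T} t *\<^sub>R (\<integral>u. obs t u \<partial>\<rho> t) - ?Q t"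
    using q_saturated q_slice
  proof eventually_elim
    case (elim t)
    show ?case
    proof (cases "t \<in> {0..<T}")
      case False
      then show ?thesis using Qz by simp
    next
      case True
      then have t: "t \<in> {0..T}" by auto
      obtain B where B: "\<And>t y. t \<in> {0..<T} \<Longrightarrow> \<bar>y\<bar> \<le> R \<Longrightarrow> \<bar>\<zeta>t (t, y)\<bar> \<le> B" "\<And>t y. t \<in> {0..<T} \<Longrightarrow> \<bar>y\<bar> \<le> R \<Longrightarrow> \<bar>\<zeta>x (t, y)\<bar> \<le> B" "0 \<le> B"
        using test_bounds by metis
      have om[measurable]: "obs t \<in> borel_measurable borel" by (rule borel_measurable_continuous_onI[OF obs_cont[OF True]])
      have [measurable]: "(\<lambda>y. dens (t, y)) \<in> borel_measurable borel" "(\<lambda>y. q (t, y)) \<in> borel_measurable borel" "(\<lambda>y. h (t, y)) \<in> borel_measurable borel"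
        by (intro slice_measurable dens_measurable q_measurable h_props(1))+
      have zm[measurable]: "(\<lambda>y. \<zeta>x (t, y)) \<in> borel_measurable borel" "(\<lambda>y. \<zeta>t (t, y)) \<in> borel_measurable borel"
        by (intro borel_measurable_continuous_onI cont_slice[OF _ True] cont_\<zeta>)+
      have [measurable]: "dV \<in> borel_measurable borel" by (rule borel_measurable_continuous_onI[OF block_flow.dVcont[OF flow]])
      have yR: "\<bar>y\<bar> \<le> R" if "y \<in> {a..b}" for y using that aR bR by auto
      have hB: "\<bar>h (t, y)\<bar> \<le> B" for y using B(2)[OF True yR] B(3) by (simp add: h_def indicator_def)
      have i2: "integrable lborel (\<lambda>y. q (t, y) * h (t, y))"
        using elim(2) hB by (intro integrable_times_bounded(1)[of _ _ B]) auto
      have i1: "integrable lborel (\<lambda>y. indicator {a..b} y * (obs t y * dens (t, y)))"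
      proof (rule integrable_on_interval_bounded[where B = "B + B * M"])
        show "\<bar>indicator {a..b} y * (obs t y * dens (t, y))\<bar> \<le> (B + B * M) * indicator {a..b} y" for y
        proof (cases "y \<in> {a..b}")
          case True': True
          have "\<bar>\<zeta>x (t, y) * dV y\<bar> \<le> B * M" unfolding abs_mult by (intro mult_mono B True yR[OF True'] dVM) auto
          moreover have "\<bar>\<zeta>t (t, y)\<bar> \<le> B" by (intro B True yR[OF True'])
          ultimately have o: "\<bar>obs t y\<bar> \<le> B + B * M" unfolding obs_def by linarith
          have "\<bar>obs t y * dens (t, y)\<bar> \<le> \<bar>obs t y\<bar> * 1"
            unfolding abs_mult by (intro mult_left_mono) (use dens_01[of "(t, y)"] in auto)
          then show ?thesis using True' o by simp
        qed simp
      qed measurable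
      have "?G t = (\<integral>y. indicator {a..b} y * (obs t y * dens (t, y)) - q (t, y) * h (t, y) \<partial>lborel)"
        unfolding set_lebesgue_integral_def
      proof (rule integral_cong_AE)
        show "AE y in lborel. indicator {a..b} y *\<^sub>R ((\<zeta>t (t, y) - \<zeta>x (t, y) * (dV y + q (t, y))) * dens (t, y)) = indicator {a..b} y * (obs t y * dens (t, y)) - q (t, y) * h (t, y)"
          using mp[OF elim(1) t]
        proof eventually_elim
          case (elim y)
          show ?case
          proof (cases "y \<in> {a..b}")
            case True': True
            then have qd: "q (t, y) * dens (t, y) = q (t, y)" using elim by blast
            have "(\<zeta>t (t, y) - \<zeta>x (t, y) * (dV y + q (t, y))) * dens (t, y) = obs t y * dens (t, y) - \<zeta>x (t, y) * (q (t, y) * dens (t, y))"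
              by (simp add: obs_def algebra_simps)
            then show ?thesis unfolding qd using True True' by (simp add: h_def)
          qed (simp add: h_def)
        qed
      qed measurable
      also have "\<dots> = (\<integral>u. obs t u \<partial>\<rho> t) - ?Q t"
        unfolding \<rho>_integral[OF t om] by (rule Bochner_Integration.integral_diff[OF i1 i2])
      finally show ?thesis using True by simp
    qed
  qed
  have "(LINT t:{0..<T}|lborel. ?G t) = (\<integral>t. indicator {0..<T} t *\<^sub>R (\<integral>u. obs t u \<partial>\<rho> t) - ?Q t \<partial>lborel)"
    unfolding set_lebesgue_integral_def[of lborel "{0..<T}"]
  proof (rule integral_cong_AE[OF _ _ sl])
    show "(\<lambda>t. indicator {0..<T} t *\<^sub>R (\<integral>u. obs t u \<partial>\<rho> t) - ?Q t) \<in> borel_measurable lborel"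
      by (intro borel_measurable_diff borel_measurable_integrable oi ps(1))
    have tm: "(\<lambda>z. indicator ({0..<T} \<times> UNIV) z *\<^sub>R \<zeta>t z) \<in> borel_measurable borel" "(\<lambda>z. indicator ({0..<T} \<times> UNIV) z *\<^sub>R \<zeta>x z) \<in> borel_measurable borel"
      by (intro borel_measurable_continuous_on_indicator cont_\<zeta>; unfold borel_prod[symmetric]; intro pair_measureI; simp)+
    have dVm[measurable]: "(\<lambda>z. dV (snd z)) \<in> borel_measurable (borel :: (real \<times> real) measure)"
      by (rule borel_measurable_continuous_onI) (intro continuous_on_compose2[OF block_flow.dVcont[OF flow]] continuous_intros, auto)
    have im: "(\<lambda>z. indicator {a..b} (snd z) :: real) \<in> borel_measurable (borel :: (real \<times> real) measure)"
      by (rule borel_measurable_indicator') (auto intro: borel_measurable_continuous_onI continuous_intros)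
    note [measurable] = tm im
    have "(\<lambda>z. indicator {a..b} (snd z) * ((indicator ({0..<T} \<times> UNIV) z *\<^sub>R \<zeta>t z - (indicator ({0..<T} \<times> UNIV) z *\<^sub>R \<zeta>x z) * (dV (snd z) + q z)) * dens z)) \<in> borel_measurable borel" (is "?k \<in> _")
      by measurable
    then have "(\<lambda>(t, y). ?k (t, y)) \<in> borel_measurable (borel \<Otimes>\<^sub>M lborel)" by (simp add: borel_prod[symmetric] split_beta' cong: measurable_cong_sets)
    from lborel.borel_measurable_lebesgue_integral[OF this]
    have "(\<lambda>t. \<integral>y. ?k (t, y) \<partial>lborel) \<in> borel_measurable lborel" by simp
    also have "(\<lambda>t. \<integral>y. ?k (t, y) \<partial>lborel) = (\<lambda>t. indicator {0..<T} t *\<^sub>R ?G t)"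
    proof
      fix t show "(\<integral>y. ?k (t, y) \<partial>lborel) = indicator {0..<T} t *\<^sub>R ?G t"
        by (cases "t \<in> {0..<T}") (simp_all add: set_lebesgue_integral_def)
    qed
    finally show "(\<lambda>t. indicator {0..<T} t *\<^sub>R ?G t) \<in> borel_measurable lborel" .
  qed
  also have "\<dots> = A1 - (\<integral>t. ?Q t \<partial>lborel)"
    unfolding A1_def set_lebesgue_integral_def by (rule Bochner_Integration.integral_diff[OF oi ps(1)])
  also have "\<dots> = A1 - (A1 + A0)" unfolding qh[symmetric] ps(2) ..
  finally show ?thesis unfolding A0 by simp
qed

end

lemma (in flow_limit) limit_weak_solution:
  assumes \<rho>0: "\<rho> 0 = \<rho>0" and dV: "dV = deriv V"
  shows "weak_solution {a..b} V T \<rho>0 \<rho>"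
  unfolding weak_solution_def
proof (intro conjI ballI)
  show "C0_W2 T \<rho>" by (rule C0_\<rho>)
  show "\<rho> t \<in> K_set {a..b}" if "t \<in> {0..T}" for t by (rule \<rho>_facts(4)[OF that])
  show "\<rho> 0 = \<rho>0" by (rule \<rho>0)
  show "\<exists>r p q. r \<in> borel_measurable borel \<and> (\<forall>z. 0 \<le> r z) \<and>
        (AE t in lborel. t \<in> {0..T} \<longrightarrow> \<rho> t = density lborel (\<lambda>x. ennreal (r (t, x)))) \<and>
        in_L2_H1 T {a..b} p q \<and>
        (AE z in lborel. z \<in> {0..T} \<times> {a..b} \<longrightarrow> 0 \<le> p z \<and> p z * (1 - r z) = 0) \<and>
        (\<forall>\<zeta> \<zeta>t \<zeta>x. C1c_test T \<zeta> \<zeta>t \<zeta>x \<longrightarrow>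
           (LINT t:{0..<T}|lborel. LINT x:{a..b}|lborel.
              (\<zeta>t (t, x) - \<zeta>x (t, x) * (deriv V x + q (t, x))) * r (t, x))
           + (LINT x:{a..b}|\<rho>0. \<zeta> (0, x)) = 0)"
  proof (rule exI[of _ dens], rule exI[of _ p], rule exI[of _ q], intro conjI allI impI)
    show "dens \<in> borel_measurable borel" by (rule dens_measurable)
    show "0 \<le> dens z" for z by (rule dens_01)
    show "AE t in lborel. t \<in> {0..T} \<longrightarrow> \<rho> t = density lborel (\<lambda>x. ennreal (dens (t, x)))"
      using \<rho>_facts(3) by blast
    show "in_L2_H1 T {a..b} p q" by (rule pressure_in_L2_H1)
    show "AE z in lborel. z \<in> {0..T} \<times> {a..b} \<longrightarrow> 0 \<le> p z \<and> p z * (1 - dens z) = 0"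
      using p_nonneg p_slack unfolding \<Omega>T_def by eventually_elim blast
    fix \<zeta> \<zeta>t \<zeta>x assume test: "C1c_test T \<zeta> \<zeta>t \<zeta>x"
    interpret L: limit_test N I m x x' l dV a b T R C M G \<zeta> \<zeta>t \<zeta>x by unfold_locales (rule test)
    show "(LINT t:{0..<T}|lborel. LINT x:{a..b}|lborel.
              (\<zeta>t (t, x) - \<zeta>x (t, x) * (deriv V x + q (t, x))) * dens (t, x))
           + (LINT x:{a..b}|\<rho>0. \<zeta> (0, x)) = 0"
      using L.weak_equation unfolding \<rho>0 dV .
  qed
qed

section \<open>The convergence theorem\<close>

theorem theorem2p4:
  fixes V :: "real \<Rightarrow> real" and a b T C :: real and \<Omega> :: "real set"
    and \<rho>0 :: "real measure" and \<mu>0 :: "nat \<Rightarrow> real measure" and \<epsilon> :: "nat \<Rightarrow> real"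
    and X0 :: "nat \<Rightarrow> nat \<Rightarrow> real" and X X' :: "nat \<Rightarrow> real \<Rightarrow> nat \<Rightarrow> real"
    and \<mu> :: "nat \<Rightarrow> real \<Rightarrow> real measure"
  assumes "V C1_differentiable_on UNIV" and "bdd_below (range V)"
    and "\<Omega> = {a..b}" and "b - a \<ge> 1"
    and "T > 0"
    and "\<rho>0 \<in> K_set \<Omega>"
    and "\<And>N. N \<ge> 1 \<Longrightarrow> \<epsilon> N = 1 / real N"
    and "\<And>N. N \<ge> 1 \<Longrightarrow> \<mu>0 N \<in> P_emp N"
    and "\<And>N. N \<ge> 1 \<Longrightarrow> (1 / \<epsilon> N) * (W2 \<rho>0 (\<mu>0 N))\<^sup>2 \<le> C"
    and "\<And>N. N \<ge> 1 \<Longrightarrow> C1_curve T N (X N) (X' N)"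
    and "\<And>N. N \<ge> 1 \<Longrightarrow> solves_gradient_flow \<Omega> V (\<epsilon> N) T N (X N) (X' N) \<or>
           solves_barycenter_ode \<Omega> V (\<epsilon> N) T N (X N) (X' N)"
    and "\<And>N i. N \<ge> 1 \<Longrightarrow> i < N \<Longrightarrow> X N 0 i = X0 N i"
    and "\<And>N. N \<ge> 1 \<Longrightarrow> empirical N (X0 N) = \<mu>0 N"
    and "\<And>N t. N \<ge> 1 \<Longrightarrow> t \<in> {0..T} \<Longrightarrow> \<mu> N t = empirical N (X N t)"
  shows "\<exists>\<rho> s. strict_mono (s :: nat \<Rightarrow> nat) \<and>
           converges_C0_W2 T (\<lambda>n. \<mu> (s n)) \<rho> \<and> weak_solution \<Omega> V T \<rho>0 \<rho>"
proof -
  have T: "0 < T" and ab: "1 \<le> b - a" and K: "\<rho>0 \<in> K_set {a..b}" using assms(3-6) by auto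
  obtain D where D: "\<And>x. (V has_vector_derivative D x) (at x)" and Dc: "continuous_on UNIV D"
    using assms(1) unfolding C1_differentiable_on_def by auto
  have VD: "(V has_real_derivative D x) (at x)" for x using D by (simp add: has_real_derivative_iff_has_vector_derivative)
  have dD: "deriv V = D" using VD by (intro ext DERIV_imp_deriv)
  have V: "(V has_real_derivative deriv V x) (at x)" for x using VD by (simp add: dD)
  have dV: "continuous_on UNIV (deriv V)" using Dc by (simp add: dD)
  have Vc: "continuous_on UNIV V" using V by (intro continuous_at_imp_continuous_on ballI DERIV_isCont)
  obtain v where v: "\<And>y. v \<le> V y" using assms(2) by (auto simp: bdd_below_def)
  have ex: "\<exists>I m l. block_flow (Suc n) I m (X (Suc n)) (X' (Suc n)) l (deriv V) a b T \<and>
      (\<forall>t\<in>{0..T}. empirical (Suc n) (X (Suc n) t) = atomic I m (X (Suc n) t))" for n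
    by (rule flow_block_flow[OF _ T ab V dV assms(10)]) (use assms(3) assms(7)[of "Suc n"] assms(11)[of "Suc n"] in auto)
  then obtain I m l where
    flow: "\<And>n. block_flow (Suc n) (I n) (m n) (X (Suc n)) (X' (Suc n)) (l n) (deriv V) a b T" and
    emp: "\<And>n t. t \<in> {0..T} \<Longrightarrow> empirical (Suc n) (X (Suc n) t) = atomic (I n) (m n) (X (Suc n) t)"
    by metis
  have zero: "0 \<in> {0..T}" using T by simp
  have init: "\<mu>0 (Suc n) = atomic (I n) (m n) (X (Suc n) 0)" for n
  proof -
    have "empirical (Suc n) (X (Suc n) 0) = empirical (Suc n) (X0 (Suc n))"
      unfolding empirical_def by (rule distr_cong) (auto simp: assms(12) space_uniform_count_measure)
    then show ?thesis using emp[OF zero, of n] assms(13)[of "Suc n"] by simp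
  qed
  define cs where "cs = (\<lambda>n. block_flow.cst (I n) (m n) (X (Suc n)) (l n))"
  define sp where "sp = (\<lambda>n. block_flow.speed2 (I n) (m n) (X' (Suc n)))"
  \<comment> \<open>The initial datum is a competitor for the projection of the particles.\<close>
  have cs0: "real (Suc n) * cs n 0 \<le> C" for n
  proof -
    interpret B: block_flow "Suc n" "I n" "m n" "X (Suc n)" "X' (Suc n)" "l n" "deriv V" a b T by (rule flow)
    interpret P: packing "I n" "m n" "X (Suc n) 0" a b "l n 0" by (rule B.pack[OF zero])
    have "cs n 0 \<le> (W2 \<rho>0 (\<mu>0 (Suc n)))\<^sup>2"
      using P.W2_ge[OF K] by (simp add: cs_def B.cst_def init W2_commute)
    then have "real (Suc n) * cs n 0 \<le> real (Suc n) * (W2 \<rho>0 (\<mu>0 (Suc n)))\<^sup>2" by (intro mult_left_mono) auto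
    also have "\<dots> \<le> C" using assms(9)[of "Suc n"] assms(7)[of "Suc n"] by simp
    finally show ?thesis .
  qed
  have cs_nonneg: "0 \<le> cs n t" if t: "t \<in> {0..T}" for n t
  proof -
    interpret B: block_flow "Suc n" "I n" "m n" "X (Suc n)" "X' (Suc n)" "l n" "deriv V" a b T by (rule flow)
    interpret P: packing "I n" "m n" "X (Suc n) t" a b "l n t" by (rule B.pack[OF t])
    show ?thesis using P.cost_nonneg by (simp add: cs_def B.cst_def)
  qed
  have C0: "0 \<le> C" using cs0[of 0] cs_nonneg[OF zero, of 0] by simp
  define L where "L = \<bar>a\<bar> + \<bar>b\<bar>"
  have near: "\<bar>X (Suc n) t i\<bar> \<le> L + sqrt Q" if t: "t \<in> {0..T}" and i: "i \<in> I n" and Q: "real (Suc n) * cs n t \<le> Q" for n t i Q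
  proof -
    interpret B: block_flow "Suc n" "I n" "m n" "X (Suc n)" "X' (Suc n)" "l n" "deriv V" a b T by (rule flow)
    have "(X (Suc n) t i - (l n t i + m n i / 2))\<^sup>2 \<le> Q" using B.position_bound[OF t i] Q by (simp add: cs_def)
    then have "\<bar>X (Suc n) t i - (l n t i + m n i / 2)\<bar> \<le> sqrt Q" using real_sqrt_le_mono by fastforce
    moreover have "a \<le> l n t i + m n i / 2" "l n t i + m n i / 2 \<le> b" using B.center_bounds[OF t i] by auto
    ultimately show ?thesis unfolding L_def by linarith
  qed
  obtain v1 where v1: "\<And>y. \<bar>y\<bar> \<le> L + sqrt C \<Longrightarrow> V y \<le> v1"
  proof -
    have "bounded (V ` {- (L + sqrt C)..L + sqrt C})"
      by (intro compact_imp_bounded compact_continuous_image continuous_on_subset[OF Vc]) auto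
    then obtain B where B: "\<forall>u\<in>V ` {- (L + sqrt C)..L + sqrt C}. norm u \<le> B" unfolding bounded_iff by blast
    show thesis
    proof (rule that[of B])
      fix y assume "\<bar>y\<bar> \<le> L + sqrt C"
      then have "y \<in> {- (L + sqrt C)..L + sqrt C}" by auto
      then have "norm (V y) \<le> B" using B by blast
      then show "V y \<le> B" by simp
    qed
  qed
  \<comment> \<open>The potential is at most \<open>v1\<close> at the initial positions and at least \<open>v\<close> later, so \<open>dissipation\<close> bounds cost and action.\<close>
  define C1 where "C1 = 2 * (v1 - v) + C"
  have est: "real (Suc n) * cs n s \<le> C1 \<and> integral {0..s} (sp n) \<le> C1" if s: "s \<in> {0..T}" for n s
  proof -
    interpret B: block_flow "Suc n" "I n" "m n" "X (Suc n)" "X' (Suc n)" "l n" "deriv V" a b T by (rule flow)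
    have sp: "sp n = B.speed2" and cs: "cs n = B.cst" by (simp_all add: sp_def cs_def)
    have "(\<Sum>i\<in>I n. m n i * v) \<le> (\<Sum>i\<in>I n. m n i * V (X (Suc n) s i))"
      by (intro sum_mono mult_left_mono v B.mnonneg)
    then have lo: "v \<le> (\<Sum>i\<in>I n. m n i * V (X (Suc n) s i))" using B.msum by (simp add: sum_distrib_right[symmetric])
    have "(\<Sum>i\<in>I n. m n i * V (X (Suc n) 0 i)) \<le> (\<Sum>i\<in>I n. m n i * v1)"
      by (intro sum_mono mult_left_mono v1 near[OF zero] cs0 B.mnonneg)
    then have hi: "(\<Sum>i\<in>I n. m n i * V (X (Suc n) 0 i)) \<le> v1" using B.msum by (simp add: sum_distrib_right[symmetric])
    have spn: "0 \<le> integral {0..s} B.speed2"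
      by (intro Henstock_Kurzweil_Integration.integral_nonneg integrable_continuous_real continuous_on_subset[OF B.cont_speed2])
         (use s in \<open>auto simp: B.speed2_def intro!: sum_nonneg mult_nonneg_nonneg B.mnonneg\<close>)
    have half: "real (Suc n) / 2 * r = (real (Suc n) * r) / 2" for r by simp
    note dis = B.dissipation[OF V s, unfolded half]
    have csn: "0 \<le> real (Suc n) * B.cst s" using cs_nonneg[OF s, of n] by (simp add: cs)
    have arith: "c \<le> 2 * (v1 - v) + C" "i \<le> 2 * (v1 - v) + C"
      if "A + c / 2 + i = B + c0 / 2" "v \<le> A" "B \<le> v1" "0 \<le> i" "0 \<le> c" "c0 \<le> C" for A B c i c0 :: real
    proof -
      have c: "c = 2 * (B - A - i) + c0" using that(1) by (simp add: field_simps)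
      then show "c \<le> 2 * (v1 - v) + C" using that(2-) by simp
      show "i \<le> 2 * (v1 - v) + C" using c that(2-) by simp
    qed
    show ?thesis unfolding sp cs C1_def
      by (intro conjI; rule arith[OF dis lo hi spn csn cs0[of n, unfolded cs]])
  qed
  define R where "R = L + sqrt C1"
  obtain M where M: "\<And>y. \<bar>y\<bar> \<le> R \<Longrightarrow> \<bar>deriv V y\<bar> \<le> M"
  proof -
    have "bounded (deriv V ` {- R..R})"
      by (intro compact_imp_bounded compact_continuous_image continuous_on_subset[OF dV]) auto
    then obtain B where B: "\<forall>u\<in>deriv V ` {- R..R}. norm u \<le> B" unfolding bounded_iff by blast
    show thesis
    proof (rule that[of B])
      fix y assume "\<bar>y\<bar> \<le> R"
      then have "y \<in> {- R..R}" by auto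
      then have "norm (deriv V y) \<le> B" using B by blast
      then show "\<bar>deriv V y\<bar> \<le> B" by simp
    qed
  qed
  have C1: "0 \<le> C1"
    using est[OF zero, of 0] cs_nonneg[OF zero, of 0] by simp
  have seq: "flow_sequence (\<lambda>n. Suc (k n)) (\<lambda>n. I (k n)) (\<lambda>n. m (k n)) (\<lambda>n. X (Suc (k n))) (\<lambda>n. X' (Suc (k n))) (\<lambda>n. l (k n)) (deriv V) a b T R C1 M"
    if k: "\<And>n. n \<le> k n" for k
  proof (rule flow_sequence.intro)
    show "block_flow (Suc (k n)) (I (k n)) (m (k n)) (X (Suc (k n))) (X' (Suc (k n))) (l (k n)) (deriv V) a b T" for n by (rule flow)
    show "n < Suc (k n)" for n using k[of n] by simp
    show "\<bar>a\<bar> \<le> R" using C1 by (simp add: R_def L_def)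
    show "\<bar>b\<bar> \<le> R" using C1 by (simp add: R_def L_def)
    show "integral {0..T} (block_flow.speed2 (I (k n)) (m (k n)) (X' (Suc (k n)))) \<le> C1" for n
      using est[of T "k n"] T by (simp add: sp_def)
    show "\<bar>deriv V y\<bar> \<le> M" if "\<bar>y\<bar> \<le> R" for y by (rule M[OF that])
    show "block_flow.cst (I (k n)) (m (k n)) (X (Suc (k n))) (l (k n)) t \<le> C1 / real (Suc (k n))" if t: "t \<in> {0..T}" for n t
      using est[OF t, of "k n"] by (simp add: cs_def pos_le_divide_eq mult.commute)
    show "\<bar>X (Suc (k n)) t i\<bar> \<le> R" if t: "t \<in> {0..T}" and i: "i \<in> I (k n)" for n t i
      unfolding R_def by (rule near[OF t i]) (use est[OF t] in blast)
  qed
  interpret S: flow_sequence Suc I m "\<lambda>n. X (Suc n)" "\<lambda>n. X' (Suc n)" l "deriv V" a b T R C1 M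
    using seq[of "\<lambda>n. n"] by simp
  obtain g k where g: "continuous_on ({0..T} \<times> {a..b}) g" and k: "strict_mono (k :: nat \<Rightarrow> nat)"
    and gk: "\<forall>e>0. \<exists>n0. \<forall>n t y. n0 \<le> n \<longrightarrow> t \<in> {0..T} \<longrightarrow> y \<in> {a..b} \<longrightarrow> \<bar>block_flow.Fc (I (k n)) (m (k n)) (l (k n)) t y - g (t, y)\<bar> < e"
    using S.F_compact by blast
  \<comment> \<open>Outside of the rectangle the limit is extended by its boundary values, which agree with those of distribution functions on \<open>[a, b]\<close>.\<close>
  define G where "G = (\<lambda>t y. g (clampT T t, max a (min b y)))"
  have Gc: "continuous_on UNIV (\<lambda>z. G (fst z) (snd z))"
    unfolding G_def
  proof (rule continuous_on_compose2[OF g])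
    have "continuous_on UNIV (\<lambda>z. clampT T (fst z))"
      by (rule continuous_on_compose2[OF cont_clampT]) (auto intro!: continuous_intros)
    then show "continuous_on UNIV (\<lambda>z. (clampT T (fst z), max a (min b (snd z))))" by (intro continuous_intros)
    show "(\<lambda>z. (clampT T (fst z), max a (min b (snd z)))) ` UNIV \<subseteq> {0..T} \<times> {a..b}"
      using T ab by (auto simp: clampT_def)
  qed
  interpret Sk: flow_sequence "\<lambda>n. Suc (k n)" "\<lambda>n. I (k n)" "\<lambda>n. m (k n)" "\<lambda>n. X (Suc (k n))" "\<lambda>n. X' (Suc (k n))" "\<lambda>n. l (k n)" "deriv V" a b T R C1 M
    by (rule seq) (rule seq_suble[OF k])
  interpret F: flow_limit "\<lambda>n. Suc (k n)" "\<lambda>n. I (k n)" "\<lambda>n. m (k n)" "\<lambda>n. X (Suc (k n))" "\<lambda>n. X' (Suc (k n))" "\<lambda>n. l (k n)" "deriv V" a b T R C1 M G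
  proof
    show "continuous_on UNIV (\<lambda>z. G (fst z) (snd z))" by (rule Gc)
    fix e :: real assume e: "0 < e"
    obtain n0 where n0: "\<And>n t y. n0 \<le> n \<Longrightarrow> t \<in> {0..T} \<Longrightarrow> y \<in> {a..b} \<Longrightarrow> \<bar>block_flow.Fc (I (k n)) (m (k n)) (l (k n)) t y - g (t, y)\<bar> < e"
      using gk e by blast
    show "\<exists>n0. \<forall>n\<ge>n0. \<forall>t\<in>{0..T}. \<forall>y. \<bar>block_flow.Fc (I (k n)) (m (k n)) (l (k n)) t y - G t y\<bar> < e"
    proof (intro exI[of _ n0] allI impI ballI)
      fix n t y assume n: "n0 \<le> n" and t: "t \<in> {0..T}"
      let ?y = "max a (min b y)"
      have "block_flow.Fc (I (k n)) (m (k n)) (l (k n)) t y = block_flow.Fc (I (k n)) (m (k n)) (l (k n)) t ?y"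
        using Sk.F_facts(3)[OF t, of y n] Sk.F_facts(3)[OF t, of a n] Sk.F_facts(4)[OF t, of y n] Sk.F_facts(4)[OF t, of b n] ab
        by (cases "y \<le> a"; cases "b \<le> y") (auto simp: max_def min_def)
      moreover have "?y \<in> {a..b}" using ab by auto
      moreover have "clampT T t = t" using t by (auto simp: clampT_def)
      ultimately show "\<bar>block_flow.Fc (I (k n)) (m (k n)) (l (k n)) t y - G t y\<bar> < e"
        using n0[OF n t, of ?y] by (simp add: G_def)
    qed
  qed
  have rd: "real_distribution \<rho>0" "prob_space \<rho>0" "sets \<rho>0 = sets borel"
    using K by (auto simp: K_set_def P_ac_def real_distribution_def real_distribution_axioms_def)
  have AE0: "AE u in \<rho>0. \<bar>u\<bar> \<le> R"
  proof (rule AE_I)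
    show "{u \<in> space \<rho>0. \<not> \<bar>u\<bar> \<le> R} \<subseteq> - {a..b}" using Sk.aR Sk.bR by auto
    show "emeasure \<rho>0 (- {a..b}) = 0" using K by (auto simp: K_set_def P_ac_def)
    show "- {a..b} \<in> sets \<rho>0" using rd(3) by simp
  qed
  have start: "F.\<rho> 0 = \<rho>0"
  proof (rule real_distribution_eqI_observables[OF F.\<rho>_facts(1)[OF zero] rd(1)])
    fix \<phi> :: "real \<Rightarrow> real" assume \<phi>: "continuous_on UNIV \<phi>"
    define c where "c = (\<lambda>n. C / real (Suc (k n)))"
    have "(\<lambda>n. \<integral>u. \<phi> u \<partial>F.\<mu> n 0) \<longlonglongrightarrow> (\<integral>u. \<phi> u \<partial>\<rho>0)"
    proof (rule observable_tendsto[OF F.\<mu>_prob F.\<mu>_AE[OF zero] rd(2,3) AE0 \<phi>])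
      show "transport_cost (F.\<mu> n 0) \<rho>0 \<le> ennreal (c n)" for n
      proof -
        have fin: "transport_cost (F.\<mu> n 0) \<rho>0 < \<infinity>"
          by (rule transport_cost_finite[OF F.\<mu>_prob F.\<mu>_AE[OF zero] rd(2,3) AE0])
        have "real (Suc (k n)) * (W2 \<rho>0 (\<mu>0 (Suc (k n))))\<^sup>2 \<le> C" using assms(9)[of "Suc (k n)"] assms(7)[of "Suc (k n)"] by simp
        then have "(W2 \<rho>0 (\<mu>0 (Suc (k n))))\<^sup>2 \<le> c n" by (simp add: c_def pos_le_divide_eq mult.commute)
        then have "enn2real (transport_cost (F.\<mu> n 0) \<rho>0) \<le> c n"
          by (simp add: init F.\<mu>_def W2_square W2_commute[of \<rho>0])
        then show ?thesis using fin by (metis ennreal_enn2real ennreal_leI infinity_ennreal_def)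
      qed
      show "0 \<le> c n" for n using C0 by (simp add: c_def)
      have "(\<lambda>n. C / real (Suc n)) \<longlonglongrightarrow> 0" by real_asymp
      from LIMSEQ_subseq_LIMSEQ[OF this k] show "c \<longlonglongrightarrow> 0" by (simp add: c_def o_def)
    qed
    moreover have "(\<lambda>n. \<integral>u. \<phi> u \<partial>F.\<mu> n 0) \<longlonglongrightarrow> (\<integral>u. \<phi> u \<partial>F.\<rho> 0)"
      using F.observable_limit[OF zero \<phi>] by (simp add: F.\<mu>_integral[OF borel_measurable_continuous_onI[OF \<phi>]])
    ultimately show "(\<integral>u. \<phi> u \<partial>F.\<rho> 0) = (\<integral>u. \<phi> u \<partial>\<rho>0)" using LIMSEQ_unique by blast
  qed
  have "\<mu> (Suc (k n)) t = F.\<mu> n t" if t: "t \<in> {0..T}" for n t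
    using assms(14)[of "Suc (k n)" t] emp[OF t, of "k n"] t by (simp add: F.\<mu>_def)
  then have "converges_C0_W2 T (\<lambda>n. \<mu> (Suc (k n))) F.\<rho>"
    using F.converges unfolding converges_C0_W2_def by simp
  moreover have "strict_mono (\<lambda>n. Suc (k n))" using k by (simp add: strict_mono_def)
  moreover have "weak_solution \<Omega> V T \<rho>0 F.\<rho>" unfolding assms(3) by (rule F.limit_weak_solution[OF start refl])
  ultimately show ?thesis by blast
qed

end
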